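(* Let $n\ge 1$ be an integer, let $r>0$ and let $\ell\ge 0$ be an integer. The convolution operator $$\frac{\partial^{\ell}\delta_{S(0,r)}}{\partial r^{\ell}}*\colon \mathcal{C}^{\infty}(\mathbb{R}^{n})\to\mathcal{C}^{\infty}(\mathbb{R}^{n})$$ is surjective.
   Context: For $x\in\mathbb{R}^n$ and $r>0$, $S(x,r)=\{y\in\mathbb{R}^n : |y-x|=r\}$, $dS_{x,r}$ is its surface area measure (for $n=1$, the counting measure on $\{x-r,x+r\}$), and $c_r$ is the reciprocal of the total surface area of $S(x,r)$ (so $c_r=1/2$ for $n=1$). The spherical mean value operator is $M_ru(x)=c_r\int_{S(x,r)}u(y)\,dS_{x,r}(y)$; for $n=1$ this is $\frac12\{u(x-r)+u(x+r)\}$. The compactly supported distribution $\delta_{S(0,r)}\in\mathcal{E}'(\mathbb{R}^n)$ is defined by $u\mapsto M_ru(0)$ for $u\in\mathcal{C}^\infty(\mathbb{R}^n)$. For an integer $\ell\ge0$, $\partial^\ell\delta_{S(0,r)}/\partial r^\ell\in\mathcal{E}'(\mathbb{R}^n)$ is the $\ell$-th derivative with respect to the parameter $r$ of $\delta_{S(0,r)}$, i.e. the distribution $u\mapsto \frac{\partial^\ell}{\partial r^\ell}\big(M_ru(0)\big)=c_1\int_{S(0,1)}\frac{\partial^\ell}{\partial r^\ell}u(r\omega)\,dS_{0,1}(\omega)$ (for $\ell=0$ it is $\delta_{S(0,r)}$). Here $*$ denotes convolution. *)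

theory Defs
  imports "HOL-Analysis.Analysis"
begin

text \<open>
  Surface area on the sphere of radius \<open>r\<close> about \<open>x\<close>, as a Borel measure on the whole space
  concentrated on the sphere. The area of a set \<open>A\<close> is \<open>n / r\<close> times the volume of the solid cone
  with apex \<open>x\<close> over \<open>A\<close>, where \<open>n\<close> is the dimension; this is the surface measure occurring in
  integration in polar coordinates. For \<open>n = 1\<close> it is the counting measure on \<open>{x - r, x + r}\<close>.
  It is meaningful for \<open>r > 0\<close> only.
\<close>

definition sphere_measure :: "'a::euclidean_space \<Rightarrow> real \<Rightarrow> 'a measure" where
  "sphere_measure x r =
     scale_measure (ennreal (real DIM('a) / r))
       (distr (restrict_space lborel (cball x r - {x})) borel
          (\<lambda>z. x + (r / norm (z - x)) *\<^sub>R (z - x)))"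

definition spherical_mean :: "real \<Rightarrow> ('a::euclidean_space \<Rightarrow> complex) \<Rightarrow> 'a \<Rightarrow> complex" where
  "spherical_mean r u x =
     complex_of_real (1 / measure (sphere_measure x r) (sphere x r)) *
     (LINT y:sphere x r|sphere_measure x r. u y)"

primrec times_differentiable ::
    "nat \<Rightarrow> ('a::real_normed_vector \<Rightarrow> 'b::real_normed_vector) \<Rightarrow> bool" where
  "times_differentiable 0 f \<longleftrightarrow> continuous_on UNIV f"
| "times_differentiable (Suc k) f \<longleftrightarrow>
     (\<forall>x. f differentiable (at x)) \<and>
     (\<forall>v. times_differentiable k (\<lambda>x. frechet_derivative f (at x) v))"

definition smooth_functions :: "('a::real_normed_vector \<Rightarrow> complex) set" where
  "smooth_functions = {u. \<forall>k. times_differentiable k u}"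

text \<open>
  Compactly supported distributions are represented by functionals on smooth functions.
  The derivatives in the radius are local, so for \<open>r > 0\<close> only positive radii matter.
\<close>

definition sphere_distribution_deriv ::
    "nat \<Rightarrow> real \<Rightarrow> ('a::euclidean_space \<Rightarrow> complex) \<Rightarrow> complex" where
  "sphere_distribution_deriv l r u =
     ((\<lambda>f s. vector_derivative f (at s)) ^^ l) (\<lambda>s. spherical_mean s u 0) r"

definition convolve ::
    "(('a::real_normed_vector \<Rightarrow> complex) \<Rightarrow> complex) \<Rightarrow> ('a \<Rightarrow> complex) \<Rightarrow> 'a \<Rightarrow> complex" where
  "convolve T u = (\<lambda>x. T (\<lambda>y. u (x - y)))"

text \<open>Consistency checks for the surface measure and the mean value operator.\<close>

lemma sets_sphere_measure [simp, measurable_cong]: "sets (sphere_measure x r) = sets borel"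
  by (simp add: sphere_measure_def)

lemma space_sphere_measure [simp]: "space (sphere_measure x r) = UNIV"
  by (simp add: sphere_measure_def space_scale_measure)

lemma emeasure_sphere_measure:
  fixes x :: "'a::euclidean_space"
  assumes A: "A \<in> sets borel"
  shows "emeasure (sphere_measure x r) A = ennreal (real DIM('a) / r) *
    emeasure lborel {z \<in> cball x r - {x}. x + (r / norm (z - x)) *\<^sub>R (z - x) \<in> A}"
proof -
  define g where "g = (\<lambda>z. x + (r / norm (z - x)) *\<^sub>R (z - x))"
  define M where "M = restrict_space lborel (cball x r - {x})"
  have g: "g \<in> borel_measurable M"
    unfolding g_def M_def by (rule measurable_restrict_space1) measurable
  have "emeasure (distr M borel g) A = emeasure M (g -` A \<inter> space M)"
    using g A by (rule emeasure_distr)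
  also have "\<dots> = emeasure lborel (g -` A \<inter> space M)"
    unfolding M_def by (rule emeasure_restrict_space) (auto simp: space_restrict_space)
  also have "g -` A \<inter> space M = {z \<in> cball x r - {x}. g z \<in> A}"
    unfolding M_def by (auto simp: space_restrict_space)
  finally show ?thesis
    unfolding sphere_measure_def by (simp add: g_def M_def)
qed

lemma sphere_measure_total:
  fixes x :: "'a::euclidean_space"
  assumes "r > 0"
  shows "measure (sphere_measure x r) (sphere x r) =
    real DIM('a) * unit_ball_vol DIM('a) * r ^ (DIM('a) - 1)"
proof -
  have "{z \<in> cball x r - {x}. x + (r / norm (z - x)) *\<^sub>R (z - x) \<in> sphere x r} = cball x r - {x}"
    using assms by (auto simp: dist_norm)
  then have "emeasure (sphere_measure x r) (sphere x r) =
      ennreal (real DIM('a) / r) * emeasure lborel (cball x r - {x})"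
    by (subst emeasure_sphere_measure) auto
  also have "emeasure lborel (cball x r - {x}) = emeasure lborel (cball x r)"
    by (rule emeasure_Diff_null_set) auto
  also have "\<dots> = ennreal (unit_ball_vol DIM('a) * r ^ DIM('a))"
    using assms by (simp add: emeasure_cball)
  also have "ennreal (real DIM('a) / r) * \<dots> =
      ennreal (real DIM('a) / r * (unit_ball_vol DIM('a) * r ^ DIM('a)))"
    using assms by (intro ennreal_mult[symmetric]) auto
  also have "real DIM('a) / r * (unit_ball_vol DIM('a) * r ^ DIM('a)) =
      real DIM('a) * unit_ball_vol DIM('a) * r ^ (DIM('a) - 1)"
    using assms power_minus_mult[of "DIM('a)" r] by (simp add: field_simps)
  finally show ?thesis
    using assms by (simp add: measure_def)
qed

lemma sphere_measure_real:
  fixes x r :: real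
  assumes "r > 0"
  shows "sphere_measure x r = distr (count_space {x - r, x + r}) borel (\<lambda>y. y)"
proof (rule measure_eqI)
  show "sets (sphere_measure x r) = sets (distr (count_space {x - r, x + r}) borel (\<lambda>y. y))"
    by (simp add: sphere_measure_def)
  fix A assume "A \<in> sets (sphere_measure x r)"
  then have A: "A \<in> sets borel" by (simp add: sphere_measure_def)
  define L where "L = (if x - r \<in> A then {x - r..<x} else {})"
  define R where "R = (if x + r \<in> A then {x<..x + r} else {})"
  have LR: "{z \<in> cball x r - {x}. x + (r / norm (z - x)) *\<^sub>R (z - x) \<in> A} = L \<union> R"
  proof -
    have "x + (r / norm (z - x)) *\<^sub>R (z - x) = (if z < x then x - r else x + r)" if "z \<noteq> x" for z
      using that by (auto simp: abs_if field_simps)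
    then have "{z \<in> cball x r - {x}. x + (r / norm (z - x)) *\<^sub>R (z - x) \<in> A} =
        {z \<in> cball x r - {x}. (if z < x then x - r else x + r) \<in> A}"
      by (intro Collect_cong conj_cong refl) (metis DiffE singletonI)
    also have "\<dots> = L \<union> R"
      unfolding L_def R_def using assms
      by (auto simp: dist_real_def split: if_splits)
    finally show ?thesis .
  qed
  have "emeasure lborel (L \<union> R) = emeasure lborel L + emeasure lborel R"
    by (rule plus_emeasure[symmetric]) (auto simp: L_def R_def)
  also have "\<dots> = ennreal r * (\<Sum>y\<in>{x - r, x + r}. indicator A y)"
    using assms by (auto simp: L_def R_def indicator_def mult_2_right)
  finally have "emeasure (sphere_measure x r) A =
      ennreal (1 / r) * (ennreal r * (\<Sum>y\<in>{x - r, x + r}. indicator A y))"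
    using A by (simp add: emeasure_sphere_measure LR[simplified])
  also have "\<dots> = (\<Sum>y\<in>{x - r, x + r}. indicator A y)"
    using assms by (simp add: mult.assoc[symmetric] ennreal_mult[symmetric] del: sum.insert)
  also have "\<dots> = emeasure (distr (count_space {x - r, x + r}) borel (\<lambda>y. y)) A"
    using A assms
    by (subst emeasure_distr)
       (auto simp: emeasure_count_space indicator_def Int_insert_left)
  finally show "emeasure (sphere_measure x r) A =
      emeasure (distr (count_space {x - r, x + r}) borel (\<lambda>y. y)) A" .
qed

lemma spherical_mean_real:
  fixes x r :: real
  assumes "r > 0" and "continuous_on UNIV u"
  shows "spherical_mean r u x = (u (x - r) + u (x + r)) / 2"
proof -
  have [measurable]: "u \<in> borel_measurable borel"
    using assms(2) by (rule borel_measurable_continuous_onI)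
  have [simp]: "{a. (a = x - r \<or> a = x + r) \<and> \<bar>x - a\<bar> = r} = {x - r, x + r}"
    using assms(1) by auto
  have [measurable]: "sphere x r \<in> sets borel"
    by (rule borel_closed) simp
  have "(LINT y:sphere x r|sphere_measure x r. u y) = u (x - r) + u (x + r)"
    unfolding set_lebesgue_integral_def sphere_measure_real[OF assms(1)]
    using assms(1)
    by (subst integral_distr)
       (auto simp: lebesgue_integral_count_space_finite dist_real_def)
  moreover have "measure (sphere_measure x r) (sphere x r) = 2"
    using sphere_measure_total[OF assms(1), of x] by simp
  ultimately show ?thesis
    by (simp add: spherical_mean_def)
qed

lemma sphere_measure_orthogonal:
  fixes f :: "real ^ ('n::{finite,wellorder}) \<Rightarrow> real ^ ('n::{finite,wellorder})"
  assumes f: "orthogonal_transformation f"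
  shows "distr (sphere_measure 0 r) borel f = sphere_measure 0 r"
proof (rule measure_eqI)
  show "sets (distr (sphere_measure 0 r) borel f) = sets (sphere_measure 0 r)"
    by (simp add: sphere_measure_def)
  fix A assume "A \<in> sets (distr (sphere_measure 0 r) borel f)"
  then have A[measurable]: "A \<in> sets borel" by simp
  have lin: "linear f" using f orthogonal_transformation_def by blast
  have m[measurable]: "f \<in> borel_measurable borel"
    by (rule borel_measurable_continuous_onI)
       (use lin linear_continuous_on linear_conv_bounded_linear in blast)
  have nf: "norm (f z) = norm z" for z by (rule orthogonal_transformation_norm[OF f])
  have nz: "f z = 0 \<longleftrightarrow> z = 0" for z using nf[of z] by (metis norm_eq_zero)
  let ?C = "\<lambda>A. {z \<in> cball 0 r - {0}. 0 + (r / norm (z - 0)) *\<^sub>R (z - 0) \<in> A}"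
  have C: "?C B \<in> sets borel \<and> ?C B \<in> lmeasurable"
    if [measurable]: "B \<in> sets borel" for B :: "(real, 'n) vec set"
  proof
    show b: "?C B \<in> sets borel" by measurable
    show "?C B \<in> lmeasurable"
      by (rule fmeasurableI2[of "cball 0 r"]) (use b in auto)
  qed
  have eqC: "f ` ?C (f -` A) = ?C A"
  proof (intro equalityI subsetI)
    fix y assume y: "y \<in> ?C A"
    obtain z where z: "y = f z"
      using orthogonal_transformation_surj[OF f] by (metis surjD)
    with y show "y \<in> f ` ?C (f -` A)"
      by (auto intro!: imageI simp: nf linear_scale[OF lin] linear_0[OF lin])
  qed (auto simp: nf nz linear_scale[OF lin])
  have fA: "f -` A \<in> sets borel" using measurable_sets[OF m A] by simp
  have "emeasure lborel (?C (f -` A)) = emeasure lebesgue (?C (f -` A))"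
    using C[OF fA] by simp
  also have "\<dots> = emeasure lebesgue (f ` ?C (f -` A))"
  proof -
    have "f ` ?C (f -` A) \<in> lmeasurable"
      unfolding eqC using C[OF A] by blast
    note 1 = emeasure_eq_measure2[OF this]
    have 2: "?C (f -` A) \<in> lmeasurable" using C[OF fA] by blast
    show ?thesis
      unfolding 1 emeasure_eq_measure2[OF 2] measure_orthogonal_image[OF f 2] ..
  qed
  also have "\<dots> = emeasure lborel (?C A)"
    unfolding eqC using C[OF A] by simp
  finally have eq: "emeasure lborel (?C (f -` A)) = emeasure lborel (?C A)" .
  have "emeasure (distr (sphere_measure 0 r) borel f) A = emeasure (sphere_measure 0 r) (f -` A)"
    using emeasure_distr[of f "sphere_measure 0 r" borel A] A m by simp
  then show "emeasure (distr (sphere_measure 0 r) borel f) A = emeasure (sphere_measure 0 r) A"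
    unfolding emeasure_sphere_measure[OF fA] emeasure_sphere_measure[OF A] eq .
qed

end

theory Submission
  imports Defs
begin

text \<open>
  The operator multiplies the exponential \<open>exp (i \<zeta> \<cdot> x)\<close>, where \<open>\<zeta> = a - i h\<close> is a complex
  frequency, by the \<open>l\<close>-th derivative in \<open>r\<close> of \<open>j (r \<surd>(\<zeta> \<cdot> \<zeta>))\<close>, where \<open>j\<close> is the normalised Bessel
  function that solves \<open>s y'' + (n - 1) y' + \<zeta> \<cdot> \<zeta> s y = 0\<close>. The differential equation bounds this
  multiplier below by an inverse power of \<open>1 + |\<zeta>|\<close> where \<open>Im \<surd>(\<zeta> \<cdot> \<zeta>)\<close> is large. For real \<open>\<zeta>\<close>
  it bounds the multiplier or its derivative in \<open>r\<close>, so that the multiplier is small only for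
  dilations in a set of small measure, and some dilate of a shifted lattice satisfies the same kind
  of lower bound.

  Let \<open>g\<close> have compact support in the half space \<open>x \<bullet> d > R\<close>. Expand \<open>g\<close> in a Fourier series over
  such a dilated lattice and, along the direction \<open>d\<close>, in a Fourier-Laplace series with frequencies
  shifted by \<open>- i \<eta> d\<close>. Dividing the coefficients by the multipliers gives a solution with datum \<open>g\<close>
  on a large cube. Choosing \<open>\<eta> = 0\<close> for all but finitely many terms of the first series, and \<open>\<eta>\<close> large
  for those, makes the solution and its derivatives arbitrarily small for \<open>x \<bullet> d \<le> R\<close>: the factor
  \<open>exp (\<eta> (x \<bullet> d))\<close> is beaten by the decay of the Laplace transform of a function supported further out.
  A partition of unity over the coordinate directions turns this into solutions for data vanishing on
  a cube that are small on a slightly smaller cube, and a Mittag-Leffler argument on an exhaustion by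
  cubes then solves the equation on the whole space.
\<close>

section \<open>Smooth functions\<close>

text \<open>Two demands conflict. Real multipliers have zeros, and at complex frequencies a lower
  bound is available only when the shift \<eta> exceeds a constant plus the norm of the frequency
  from the first series. Shifting every term would make \<eta> unbounded, and
  \<open>exp (\<eta> (x \<bullet> d))\<close> would defeat the decay of the coefficients; shifting
  none would give no smallness. Hence the mixed choice: the terms with \<eta> = 0 are small as the
  tail of a convergent series, and the finitely many others share one large \<eta>.

  To allow a separate \<eta> for each term, \<open>g\<close> is multiplied by a cutoff \<psi> in the
  variable \<open>x \<bullet> d\<close> that is 1 on its support; the first series expands
  \<open>g\<close>, the second \<psi>. Both use the same scale \<mu>, and \<open>d\<close> is a
  coordinate direction, so the unshifted product frequencies stay in the lattice whose multipliers
  are controlled. The series converge on the whole space but represent \<open>g\<close> only within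
  one period, which is why each step solves the equation on a cube.\<close>

definition dird :: "'a::real_normed_vector \<Rightarrow> ('a \<Rightarrow> complex) \<Rightarrow> 'a \<Rightarrow> complex" where
  "dird v u = (\<lambda>x. frechet_derivative u (at x) v)"

primrec dirds :: "'a::real_normed_vector list \<Rightarrow> ('a \<Rightarrow> complex) \<Rightarrow> 'a \<Rightarrow> complex" where
  "dirds [] u = u"
| "dirds (v # vs) u = dirds vs (dird v u)"

lemma dird_eqI: "(\<And>x. (u has_derivative F x) (at x)) \<Longrightarrow> dird v u = (\<lambda>x. F x v)"
  unfolding dird_def by (metis frechet_derivative_at)

text \<open>Smoothness is a greatest fixed point: a set of differentiable functions that is closed
  under directional derivatives consists of smooth functions. The closure properties below name such
  a set instead of computing iterated derivatives.\<close>

lemma smooth_coinduct: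
  assumes "u \<in> S"
    and "\<And>u. u \<in> S \<Longrightarrow> \<exists>F. (\<forall>x. (u has_derivative F x) (at x)) \<and> (\<forall>v. (\<lambda>x. F x v) \<in> S)"
  shows "u \<in> smooth_functions"
proof -
  have "times_differentiable k u" if "u \<in> S" for k u
    using that
  proof (induction k arbitrary: u)
    case 0
    then obtain F where "\<And>x. (u has_derivative F x) (at x)" using assms(2) by blast
    then show ?case
      by (auto intro!: continuous_at_imp_continuous_on has_derivative_continuous)
  next
    case (Suc k)
    obtain F where F: "\<And>x. (u has_derivative F x) (at x)" "\<And>v. (\<lambda>x. F x v) \<in> S"
      using assms(2)[OF Suc.prems] by blast
    then have "(\<lambda>x. frechet_derivative u (at x) v) = (\<lambda>x. F x v)" for v
      using dird_eqI[of u F v, OF F(1)] by (simp add: dird_def)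
    with F Suc.IH show ?case
      by (auto simp: differentiable_def)
  qed
  with assms(1) show ?thesis by (simp add: smooth_functions_def)
qed

lemma smooth_differentiable:
  assumes "u \<in> smooth_functions" shows "u differentiable (at x)"
proof -
  have "times_differentiable (Suc 0) u" using assms unfolding smooth_functions_def by blast
  then show ?thesis by simp
qed

lemma smooth_dird:
  assumes "u \<in> smooth_functions" shows "dird v u \<in> smooth_functions"
proof -
  have "times_differentiable (Suc k) u" for k using assms unfolding smooth_functions_def by blast
  then show ?thesis by (simp add: smooth_functions_def dird_def)
qed

lemma smooth_dirds: "u \<in> smooth_functions \<Longrightarrow> dirds vs u \<in> smooth_functions"
  by (induction vs arbitrary: u) (auto intro: smooth_dird)

lemma smooth_has_derivative:
  "u \<in> smooth_functions \<Longrightarrow> (u has_derivative (\<lambda>v. dird v u x)) (at x)"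
  using smooth_differentiable[of u x] frechet_derivative_works
  by (auto simp: dird_def)

lemma smooth_continuous: "u \<in> smooth_functions \<Longrightarrow> continuous_on UNIV u"
  by (meson continuous_at_imp_continuous_on has_derivative_continuous smooth_has_derivative)

lemma dird_linear: "u \<in> smooth_functions \<Longrightarrow> linear (\<lambda>v. dird v u x)"
  using smooth_has_derivative has_derivative_linear by blast

lemma dird_basis:
  fixes u :: "'a::euclidean_space \<Rightarrow> complex"
  assumes "u \<in> smooth_functions"
  shows "dird v u x = (\<Sum>b\<in>Basis. of_real (v \<bullet> b) * dird b u x)"
proof -
  have "dird v u x = dird (\<Sum>b\<in>Basis. (v \<bullet> b) *\<^sub>R b) u x" by (simp add: euclidean_representation)
  also have "\<dots> = (\<Sum>b\<in>Basis. of_real (v \<bullet> b) * dird b u x)"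
    using linear_sum[OF dird_linear[OF assms], of "\<lambda>b. (v \<bullet> b) *\<^sub>R b" Basis x]
      linear_scale[OF dird_linear[OF assms], of _ _ x]
    by (simp add: scaleR_conv_of_real)
  finally show ?thesis .
qed

lemma smooth_has_derivative':
  assumes "u \<in> smooth_functions" "(g has_derivative g') (at x)"
  shows "((\<lambda>x. u (g x)) has_derivative (\<lambda>h. dird (g' h) u (g x))) (at x)"
  using diff_chain_at[OF assms(2) smooth_has_derivative[OF assms(1)]] by (simp add: o_def)

section \<open>Closure properties of smooth functions\<close>

lemma smooth_const [intro]: "(\<lambda>x. c) \<in> smooth_functions"
  by (rule smooth_coinduct[of _ "range (\<lambda>c x. c)"]) (auto intro!: exI[of _ "\<lambda>x v. 0"])

lemma smooth_cmult: 
  assumes "u \<in> smooth_functions" shows "(\<lambda>x. c * u x) \<in> smooth_functions"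
proof (rule smooth_coinduct[of _ "(\<lambda>u x. c * u x) ` smooth_functions"])
  fix w assume "w \<in> (\<lambda>u x. c * u x) ` smooth_functions"
  then obtain u where u: "u \<in> smooth_functions" "w = (\<lambda>x. c * u x)" by blast
  then show "\<exists>F. (\<forall>x. (w has_derivative F x) (at x)) \<and> (\<forall>v. (\<lambda>x. F x v) \<in> (\<lambda>u x. c * u x) ` smooth_functions)"
    by (intro exI[of _ "\<lambda>x v. c * dird v u x"])
       (auto intro!: has_derivative_mult_right smooth_has_derivative smooth_dird)
qed (use assms in auto)

lemma dird_cmult:
  assumes "u \<in> smooth_functions" shows "dird v (\<lambda>x. c * u x) = (\<lambda>x. c * dird v u x)"
  by (rule dird_eqI) (auto intro!: has_derivative_mult_right smooth_has_derivative assms)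

lemma smooth_add: 
  assumes "u \<in> smooth_functions" "w \<in> smooth_functions"
  shows "(\<lambda>x. u x + w x) \<in> smooth_functions"
proof -
  define S :: "('a \<Rightarrow> complex) set" where "S = {(\<lambda>x. u x + w x) | u w. u \<in> smooth_functions \<and> w \<in> smooth_functions}"
  show ?thesis
  proof (rule smooth_coinduct[of _ S])
    fix z assume "z \<in> S"
    then obtain u w where uw: "u \<in> smooth_functions" "w \<in> smooth_functions" "z = (\<lambda>x. u x + w x)"
      unfolding S_def by blast
    then show "\<exists>F. (\<forall>x. (z has_derivative F x) (at x)) \<and> (\<forall>v. (\<lambda>x. F x v) \<in> S)"
      by (intro exI[of _ "\<lambda>x v. dird v u x + dird v w x"])
         (auto intro!: has_derivative_add smooth_has_derivative smooth_dird simp: S_def)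
  qed (use assms in \<open>auto simp: S_def\<close>)
qed

lemma dird_add:
  assumes "u \<in> smooth_functions" "w \<in> smooth_functions"
  shows "dird v (\<lambda>x. u x + w x) = (\<lambda>x. dird v u x + dird v w x)"
  by (rule dird_eqI) (auto intro!: has_derivative_add smooth_has_derivative assms)

lemma smooth_diff:
  assumes "u \<in> smooth_functions" "w \<in> smooth_functions"
  shows "(\<lambda>x. u x - w x) \<in> smooth_functions"
  using smooth_add[OF assms(1) smooth_cmult[OF assms(2), of "-1"]] by simp

lemma smooth_sum:
  "(\<And>i. i \<in> A \<Longrightarrow> u i \<in> smooth_functions) \<Longrightarrow> (\<lambda>x. \<Sum>i\<in>A. u i x) \<in> smooth_functions"
  by (induction A rule: infinite_finite_induct) (auto intro: smooth_add)

text \<open>The Leibniz rule turns one product into a sum of two, so the set handed to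
  \<open>smooth_coinduct\<close> has to contain sums of products.\<close>

inductive_set product_sums :: "('a::real_normed_vector \<Rightarrow> complex) set" where
  prodI: "u \<in> smooth_functions \<Longrightarrow> w \<in> smooth_functions \<Longrightarrow> (\<lambda>x. u x * w x) \<in> product_sums"
| addI: "u \<in> product_sums \<Longrightarrow> w \<in> product_sums \<Longrightarrow> (\<lambda>x. u x + w x) \<in> product_sums"

lemma smooth_mult:
  assumes "u \<in> smooth_functions" "w \<in> smooth_functions"
  shows "(\<lambda>x. u x * w x) \<in> smooth_functions"
proof (rule smooth_coinduct[of _ product_sums])
  show "(\<lambda>x. u x * w x) \<in> product_sums" using assms by (rule prodI)
  fix z :: "'a \<Rightarrow> complex" assume "z \<in> product_sums"
  then show "\<exists>F. (\<forall>x. (z has_derivative F x) (at x)) \<and> (\<forall>v. (\<lambda>x. F x v) \<in> product_sums)"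
  proof induction
    case (prodI u w)
    show ?case
      by (rule exI[of _ "\<lambda>x v. u x * dird v w x + dird v u x * w x"])
         (auto intro!: has_derivative_mult smooth_has_derivative product_sums.intros prodI smooth_dird)
  next
    case (addI u w)
    then obtain F G where "\<And>x. (u has_derivative F x) (at x)" "\<And>v. (\<lambda>x. F x v) \<in> product_sums"
      "\<And>x. (w has_derivative G x) (at x)" "\<And>v. (\<lambda>x. G x v) \<in> product_sums" by blast
    then show ?case
      by (intro exI[of _ "\<lambda>x v. F x v + G x v"])
         (auto intro!: has_derivative_add product_sums.intros)
  qed
qed

lemma dird_mult:
  assumes "u \<in> smooth_functions" "w \<in> smooth_functions"
  shows "dird v (\<lambda>x. u x * w x) = (\<lambda>x. u x * dird v w x + dird v u x * w x)"
  by (rule dird_eqI) (auto intro!: has_derivative_mult smooth_has_derivative assms)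

lemma smooth_prod:
  "(\<And>i. i \<in> A \<Longrightarrow> u i \<in> smooth_functions) \<Longrightarrow> (\<lambda>x. \<Prod>i\<in>A. u i x) \<in> smooth_functions"
  by (induction A rule: infinite_finite_induct) (auto intro: smooth_mult)

lemma smooth_divide:
  assumes "u \<in> smooth_functions" "w \<in> smooth_functions" and nz: "\<And>x. w x \<noteq> 0"
  shows "(\<lambda>x. u x / w x) \<in> smooth_functions"
proof -
  define S :: "('a \<Rightarrow> complex) set" where "S = {(\<lambda>x. u x / w x ^ k) | u k. u \<in> smooth_functions}"
  show ?thesis
  proof (rule smooth_coinduct[of _ S])
    show "(\<lambda>x. u x / w x) \<in> S"
      unfolding S_def using assms(1) by (auto intro!: exI[of _ u] exI[of _ 1])
    fix z assume "z \<in> S"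
    then obtain u k where u: "u \<in> smooth_functions" "z = (\<lambda>x. u x / w x ^ k)"
      unfolding S_def by blast
    have "(z has_derivative (\<lambda>v. (dird v u x * w x - of_nat k * dird v w x * u x) / w x ^ Suc k)) (at x)" for x
    proof -
      have 1: "((\<lambda>x. w x ^ k) has_derivative (\<lambda>v. of_nat k * dird v w x * w x ^ (k - 1))) (at x)"
        by (rule has_derivative_power[OF smooth_has_derivative[OF assms(2)]])
      have *: "(\<lambda>v. (dird v u x * w x ^ k - u x * (of_nat k * dird v w x * w x ^ (k - 1))) / (w x ^ k * w x ^ k))
        = (\<lambda>v. (dird v u x * w x - of_nat k * dird v w x * u x) / w x ^ Suc k)"
        using nz[of x] by (cases k) (auto simp: fun_eq_iff field_simps)
      have "w x ^ k \<noteq> 0" using nz[of x] by simp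
      from has_derivative_divide'[OF smooth_has_derivative[OF u(1), of x] 1 this]
      show ?thesis
        unfolding u(2) * .
    qed
    moreover have "(\<lambda>x. (dird v u x * w x - of_nat k * dird v w x * u x) / w x ^ Suc k) \<in> S" for v
      unfolding S_def using u(1) assms(2)
      by (auto intro!: exI[of _ "\<lambda>x. (dird v u x * w x - of_nat k * dird v w x * u x)"] exI[of _ "Suc k"]
          smooth_diff smooth_mult smooth_dird)
    ultimately show "\<exists>F. (\<forall>x. (z has_derivative F x) (at x)) \<and> (\<forall>v. (\<lambda>x. F x v) \<in> S)"
      by (intro exI[of _ "\<lambda>x v. (dird v u x * w x - of_nat k * dird v w x * u x) / w x ^ Suc k"]) blast
  qed
qed

lemma smooth_inner:
  fixes h :: "real \<Rightarrow> complex" and d :: "'a::real_inner"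
  assumes "h \<in> smooth_functions"
  shows "(\<lambda>x. h (x \<bullet> d)) \<in> smooth_functions"
proof -
  define S :: "('a \<Rightarrow> complex) set" where "S = {(\<lambda>x. h (x \<bullet> d)) | h. h \<in> smooth_functions}"
  show ?thesis
  proof (rule smooth_coinduct[of _ S])
    fix z assume "z \<in> S"
    then obtain h where h: "h \<in> smooth_functions" "z = (\<lambda>x. h (x \<bullet> d))" unfolding S_def by blast
    have "(z has_derivative (\<lambda>v. dird (v \<bullet> d) h (x \<bullet> d))) (at x)" for x
      unfolding h by (rule smooth_has_derivative'[OF h(1)]) (auto intro!: derivative_eq_intros)
    moreover have "(\<lambda>x. dird (v \<bullet> d) h (x \<bullet> d)) \<in> S" for v
      unfolding S_def using smooth_dird[OF h(1)] by blast
    ultimately show "\<exists>F. (\<forall>x. (z has_derivative F x) (at x)) \<and> (\<forall>v. (\<lambda>x. F x v) \<in> S)"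
      by (intro exI[of _ "\<lambda>x v. dird (v \<bullet> d) h (x \<bullet> d)"]) blast
  qed (use assms in \<open>auto simp: S_def\<close>)
qed

lemma dird_outside_support:
  assumes "\<And>x. x \<notin> K \<Longrightarrow> u x = 0" "closed K" "x \<notin> K" shows "dird v u x = 0"
proof -
  have "(u has_derivative (\<lambda>v. 0)) (at x)"
    by (rule has_derivative_transform_within_open[where f = "\<lambda>x. 0" and s = "- K"])
      (use assms in auto)
  then have "frechet_derivative u (at x) = (\<lambda>v. 0)" by (metis frechet_derivative_at)
  then show ?thesis by (simp add: dird_def)
qed

text \<open>\<open>expo a h\<close> is the exponential \<open>x \<mapsto> exp (i \<zeta> \<cdot> x)\<close> with complex frequency \<open>\<zeta> = a - i h\<close>.\<close>

definition cinner :: "'a::real_inner \<Rightarrow> 'a \<Rightarrow> 'a \<Rightarrow> complex" where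
  "cinner a h v = Complex (h \<bullet> v) (a \<bullet> v)"

definition expo :: "'a::real_inner \<Rightarrow> 'a \<Rightarrow> 'a \<Rightarrow> complex" where
  "expo a h x = exp (cinner a h x)"

lemma cinner_alt: "cinner a h v = of_real (h \<bullet> v) + \<i> * of_real (a \<bullet> v)"
  by (simp add: cinner_def complex_eq_iff)

lemma cinner_add: "cinner a h (x + y) = cinner a h x + cinner a h y"
  by (simp add: cinner_alt inner_add_right algebra_simps)

lemma cinner_minus: "cinner a h (- x) = - cinner a h x"
  by (simp add: cinner_alt)

lemma cinner_scaleR: "cinner a h (c *\<^sub>R x) = of_real c * cinner a h x"
  by (simp add: cinner_alt algebra_simps)

lemma cinner_scaleR_left: "cinner (c *\<^sub>R a) (c *\<^sub>R h) x = of_real c * cinner a h x"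
  by (simp add: cinner_alt algebra_simps)

lemma norm_cinner: "norm (cinner a h v) \<le> (norm a + norm h) * norm v"
proof -
  have "norm (cinner a h v) \<le> \<bar>h \<bullet> v\<bar> + \<bar>a \<bullet> v\<bar>" using cmod_le[of "cinner a h v"] by (simp add: cinner_def)
  also have "\<dots> \<le> norm h * norm v + norm a * norm v"
    by (intro add_mono Cauchy_Schwarz_ineq2)
  finally show ?thesis by (simp add: algebra_simps)
qed

lemma bounded_linear_cinner: "bounded_linear (cinner a h)"
  by (rule bounded_linear_intro[of _ "norm a + norm h"])
     (auto simp: cinner_add cinner_scaleR scaleR_conv_of_real mult.commute[of "norm _"] intro: norm_cinner)

lemma norm_expo: "norm (expo a h x) = exp (h \<bullet> x)"
  by (simp add: expo_def cinner_def)

lemma expo_add: "expo a h (x + y) = expo a h x * expo a h y"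
  by (simp add: expo_def cinner_add exp_add)

lemma expo_diff: "expo a h (x - y) = expo a h x * expo a h (- y)"
  using expo_add[of a h x "-y"] by simp

lemma expo_freq_add: "expo (a + a') (h + h') x = expo a h x * expo a' h' x"
  by (simp add: expo_def cinner_alt inner_add_left exp_add[symmetric] algebra_simps)

lemma expo_has_derivative: "(expo a h has_derivative (\<lambda>v. cinner a h v * expo a h x)) (at x)"
proof -
  have "((\<lambda>x. exp (cinner a h x)) has_derivative (\<lambda>v. exp (cinner a h x) * cinner a h v)) (at x)"
    using diff_chain_at[OF bounded_linear_imp_has_derivative[OF bounded_linear_cinner]
        DERIV_exp[unfolded has_field_derivative_def]]
    by (simp add: o_def)
  then show ?thesis by (simp add: expo_def[abs_def] mult.commute)
qed

lemma smooth_expo: "expo a h \<in> smooth_functions"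
proof (rule smooth_coinduct[of _ "range (\<lambda>c x. c * expo a h x)"])
  show "expo a h \<in> range (\<lambda>c x. c * expo a h x)" by (rule image_eqI[of _ _ 1]) auto
  fix u assume "u \<in> range (\<lambda>c x. c * expo a h x)"
  then obtain c where u: "u = (\<lambda>x. c * expo a h x)" by blast
  show "\<exists>F. (\<forall>x. (u has_derivative F x) (at x)) \<and> (\<forall>v. (\<lambda>x. F x v) \<in> range (\<lambda>c x. c * expo a h x))"
    unfolding u
    by (rule exI[of _ "\<lambda>x v. c * (cinner a h v * expo a h x)"])
       (intro conjI allI has_derivative_mult_right expo_has_derivative, auto simp: mult.assoc[symmetric])
qed

lemma dird_expo: "dird v (expo a h) = (\<lambda>x. cinner a h v * expo a h x)"
  by (rule dird_eqI) (rule expo_has_derivative)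

lemma dirds_cmult: "u \<in> smooth_functions \<Longrightarrow> dirds vs (\<lambda>x. c * u x) = (\<lambda>x. c * dirds vs u x)"
  by (induction vs arbitrary: u) (auto simp: dird_cmult smooth_dird)

lemma dirds_add:
  "u \<in> smooth_functions \<Longrightarrow> w \<in> smooth_functions \<Longrightarrow>
    dirds vs (\<lambda>x. u x + w x) = (\<lambda>x. dirds vs u x + dirds vs w x)"
  by (induction vs arbitrary: u w) (auto simp: dird_add smooth_dird)

lemma dirds_expo: "dirds vs (expo a h) = (\<lambda>x. prod_list (map (cinner a h) vs) * expo a h x)"
proof (induction vs)
  case (Cons v vs)
  then show ?case
    by (simp add: dird_expo dirds_cmult smooth_expo algebra_simps)
qed simp

lemma norm_dirds_expo:
  "norm (dirds vs (expo a h) x) \<le> (norm a + norm h) ^ length vs * prod_list (map norm vs) * exp (h \<bullet> x)"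
proof -
  have "norm (prod_list (map (cinner a h) vs)) \<le> (norm a + norm h) ^ length vs * prod_list (map norm vs)"
  proof (induction vs)
    case (Cons v vs)
    have "norm (cinner a h v) * norm (prod_list (map (cinner a h) vs))
      \<le> ((norm a + norm h) * norm v) * ((norm a + norm h) ^ length vs * prod_list (map norm vs))"
      by (intro mult_mono norm_cinner Cons.IH) auto
    then show ?case by (simp add: norm_mult algebra_simps)
  qed simp
  then show ?thesis by (simp add: dirds_expo norm_mult norm_expo mult_right_mono)
qed

section \<open>Cutoff functions\<close>

text \<open>The derivatives of \<open>exp (- 1 / t)\<close> are of the form \<open>p (1 / t) * exp (- 1 / t)\<close> with
  polynomials \<open>p\<close>.\<close>

lemma poly_div_exp_tendsto_0: "((\<lambda>x::real. poly p x / exp x) \<longlongrightarrow> 0) at_top"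
proof -
  have "((\<lambda>x. \<Sum>i\<le>degree p. coeff p i * (x ^ i / exp x)) \<longlongrightarrow> (\<Sum>i\<le>degree p. coeff p i * 0)) at_top"
    by (intro tendsto_intros tendsto_power_div_exp_0)
  then show ?thesis by (simp add: poly_altdef sum_divide_distrib)
qed

definition flat :: "real poly \<Rightarrow> real \<Rightarrow> real" where
  "flat p t = (if t > 0 then poly p (1 / t) * exp (- 1 / t) else 0)"

lemma flat_tendsto_0: "((\<lambda>t. flat p t) \<longlongrightarrow> 0) (at 0)"
proof -
  have "((\<lambda>t. poly p (inverse t) / exp (inverse t)) \<longlongrightarrow> 0) (at_right 0)"
    by (rule filterlim_compose[OF poly_div_exp_tendsto_0 filterlim_inverse_at_top_right])
  moreover have "\<forall>\<^sub>F t in at_right (0::real). poly p (inverse t) / exp (inverse t) = flat p t"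
    using eventually_at_right_less[of "0::real"]
    by eventually_elim (auto simp: flat_def exp_minus field_simps)
  ultimately have "((\<lambda>t. flat p t) \<longlongrightarrow> 0) (at_right 0)" by (rule Lim_transform_eventually)
  moreover have "((\<lambda>t. flat p t) \<longlongrightarrow> 0) (at_left 0)"
    by (rule tendsto_eventually) (auto simp: flat_def eventually_at_filter)
  ultimately show ?thesis by (rule filterlim_split_at_real[rotated])
qed

text \<open>With \<open>x = 1 / t\<close>, the chain rule replaces \<open>p\<close> by
  \<open>x ^ 2\<close> times \<open>p - pderiv p\<close>; the two \<open>pCons 0\<close> are the
  factor \<open>x ^ 2\<close>. At 0 the difference quotient is again a flat function, with
  polynomial \<open>pCons 0 p\<close>, and tends to 0.\<close>

lemma flat_has_real_derivative:
  "(flat p has_real_derivative flat (pCons 0 (pCons 0 (p - pderiv p))) t) (at t)"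
proof (cases t "0::real" rule: linorder_cases)
  case less
  have "((\<lambda>t. 0) has_real_derivative 0) (at t)" by simp
  then have "(flat p has_real_derivative 0) (at t)"
    by (rule has_field_derivative_transform_within_open[where S = "{..<0}"])
       (use less in \<open>auto simp: flat_def\<close>)
  then show ?thesis using less by (simp add: flat_def)
next
  case equal
  have "((\<lambda>h. flat (pCons 0 p) h) \<longlongrightarrow> 0) (at 0)" by (rule flat_tendsto_0)
  then have "((\<lambda>h. (flat p (0 + h) - flat p 0) / h) \<longlongrightarrow> 0) (at 0)"
    by (rule Lim_transform_eventually) (auto simp: flat_def eventually_at_filter)
  then show ?thesis using equal by (simp add: has_field_derivative_iff flat_def)
next
  case greater
  have "((\<lambda>t. poly p (1 / t) * exp (- 1 / t)) has_real_derivative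
      poly (pCons 0 (pCons 0 (p - pderiv p))) (1 / t) * exp (- 1 / t)) (at t)"
    using greater
    by (auto intro!: derivative_eq_intros DERIV_chain'[OF _ poly_DERIV] simp: field_simps power2_eq_square)
  then have "(flat p has_real_derivative poly (pCons 0 (pCons 0 (p - pderiv p))) (1 / t) * exp (- 1 / t)) (at t)"
    by (rule has_field_derivative_transform_within_open[where S = "{0<..}"])
       (use greater in \<open>auto simp: flat_def\<close>)
  then show ?thesis using greater by (simp add: flat_def)
qed

lemma smooth_flat: "(\<lambda>t. of_real (flat p (c * t + d))) \<in> smooth_functions"
proof -
  define S where "S = {(\<lambda>t::real. complex_of_real (e * flat p (c * t + d))) | e p. True}"
  show ?thesis
  proof (rule smooth_coinduct[of _ S])
    show "(\<lambda>t. of_real (flat p (c * t + d))) \<in> S" unfolding S_def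
      by (auto intro!: exI[of _ 1] exI[of _ p])
    fix z assume "z \<in> S"
    then obtain e p where z: "z = (\<lambda>t. of_real (e * flat p (c * t + d)))" unfolding S_def by blast
    define p' where "p' = pCons 0 (pCons 0 (p - pderiv p))"
    have "(z has_derivative (\<lambda>v. of_real ((v * c * e) * flat p' (c * t + d)))) (at t)" for t
    proof -
      have "((\<lambda>t. e * flat p (c * t + d)) has_real_derivative c * e * flat p' (c * t + d)) (at t)"
        unfolding p'_def
        by (auto intro!: derivative_eq_intros DERIV_chain'[OF _ flat_has_real_derivative])
      then have "((\<lambda>t. e * flat p (c * t + d)) has_derivative (\<lambda>v. (v * c * e) * flat p' (c * t + d))) (at t)"
        unfolding has_field_derivative_def by (rule has_derivative_eq_rhs) (auto simp: fun_eq_iff)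
      then show ?thesis unfolding z by (rule has_derivative_of_real)
    qed
    moreover have "(\<lambda>t. of_real ((v * c * e) * flat p' (c * t + d))) \<in> S" for v
      unfolding S_def by blast
    ultimately show "\<exists>F. (\<forall>x. (z has_derivative F x) (at x)) \<and> (\<forall>v. (\<lambda>x. F x v) \<in> S)"
      by (intro exI[of _ "\<lambda>t v. of_real ((v * c * e) * flat p' (c * t + d))"]) blast
  qed
qed

lemma smooth_step:
  fixes a b :: real
  assumes "a < b"
  obtains \<theta> :: "real \<Rightarrow> complex" where "\<theta> \<in> smooth_functions"
    "\<And>t. t \<le> a \<Longrightarrow> \<theta> t = 0" "\<And>t. t \<ge> b \<Longrightarrow> \<theta> t = 1"
proof -
  define f where "f = flat 1"
  have f: "f t \<ge> 0" "f t = 0 \<longleftrightarrow> t \<le> 0" for t by (auto simp: f_def flat_def)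
  \<comment> \<open>Since \<open>a < b\<close>, every \<open>t\<close> lies to the right of
    \<open>a\<close> or to the left of \<open>b\<close>, so the denominator of \<theta> never
    vanishes. The form \<open>1 * t + - a\<close> matches the affine arguments in
    \<open>smooth_flat\<close>.\<close>
  have pos: "f (1 * t + - a) + f (- 1 * t + b) > 0" for t
  proof (cases "t > a")
    case True
    then have "f (1 * t + - a) > 0" using f[of "1 * t + -a"] by (simp add: order_less_le)
    then show ?thesis using f(1)[of "-1 * t + b"] by linarith
  next
    case False
    then have "f (-1 * t + b) > 0" using f[of "-1 * t + b"] assms by linarith
    then show ?thesis using f(1)[of "1 * t + -a"] by linarith
  qed
  define \<theta> where "\<theta> t = complex_of_real (f (1 * t + - a)) /
    (complex_of_real (f (1 * t + - a)) + complex_of_real (f (- 1 * t + b)))" for t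
  show thesis
  proof (rule that[of \<theta>])
    show "\<theta> \<in> smooth_functions" unfolding \<theta>_def
    proof (rule smooth_divide)
      show "complex_of_real (f (1 * t + - a)) + complex_of_real (f (- 1 * t + b)) \<noteq> 0" for t
        using pos[of t] by (metis less_numeral_extra(3) of_real_add of_real_eq_0_iff)
      have sm: "(\<lambda>t. complex_of_real (f (c * t + d))) \<in> smooth_functions" for c d
        unfolding f_def by (rule smooth_flat)
      show "(\<lambda>t. complex_of_real (f (1 * t + - a))) \<in> smooth_functions" by (rule sm)
      show "(\<lambda>t. complex_of_real (f (1 * t + - a)) + complex_of_real (f (- 1 * t + b))) \<in> smooth_functions"
        by (rule smooth_add[OF sm sm])
    qed
    show "\<theta> t = 0" if "t \<le> a" for t using that f(2)[of "t - a"] by (simp add: \<theta>_def)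
    show "\<theta> t = 1" if "t \<ge> b" for t using that f(2)[of "b - t"] pos[of t] by (simp add: \<theta>_def)
  qed
qed

lemma smooth_bump:
  fixes a b c d :: real
  assumes "a < b" "c < d"
  obtains \<psi> :: "real \<Rightarrow> complex" where "\<psi> \<in> smooth_functions"
    "\<And>t. t \<le> a \<or> t \<ge> d \<Longrightarrow> \<psi> t = 0" "\<And>t. b \<le> t \<Longrightarrow> t \<le> c \<Longrightarrow> \<psi> t = 1"
proof -
  obtain \<theta> :: "real \<Rightarrow> complex" where t: "\<theta> \<in> smooth_functions"
    "\<And>t. t \<le> a \<Longrightarrow> \<theta> t = 0" "\<And>t. t \<ge> b \<Longrightarrow> \<theta> t = 1" using smooth_step[OF assms(1)] by metis
  obtain \<eta> :: "real \<Rightarrow> complex" where e: "\<eta> \<in> smooth_functions"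
    "\<And>t. t \<le> c \<Longrightarrow> \<eta> t = 0" "\<And>t. t \<ge> d \<Longrightarrow> \<eta> t = 1" using smooth_step[OF assms(2)] by metis
  show thesis
    by (rule that[of "\<lambda>t. \<theta> t * (1 - \<eta> t)"]) (use t e in \<open>auto intro!: smooth_mult smooth_diff\<close>)
qed

section \<open>The normalised surface measure\<close>

text \<open>The measure of linear isometric images is compared with Lebesgue measure by the uniqueness
  argument for Haar measure: Fubini's theorem applied to \<open>1\<^sub>A (f z + y) * 1\<^sub>B (y)\<close> with
  the symmetric set \<open>B = ball 0 1\<close>.\<close>

lemma distr_lborel_isometry:
  fixes f :: "'a::euclidean_space \<Rightarrow> 'a"
  assumes lin: "linear f" and iso: "\<And>x. norm (f x) = norm x"
  shows "distr lborel borel f = lborel"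
proof (rule measure_eqI)
  have bl: "bounded_linear f" using lin by (simp add: linear_conv_bounded_linear)
  have f[measurable]: "f \<in> borel_measurable borel"
    by (rule borel_measurable_continuous_onI) (use bl linear_continuous_on in blast)
  have "inj f" using iso lin by (metis linear_injective_0 norm_eq_zero)
  then have "surj f" using lin linear_injective_imp_surjective by blast
  fix A assume "A \<in> sets (distr lborel borel f)"
  then have A[measurable]: "A \<in> sets borel" by simp
  let ?B = "ball (0::'a) 1"
  have [measurable]: "?B \<in> sets borel" by simp
  have shift: "(\<integral>\<^sup>+z. g (z + c) \<partial>lborel) = (\<integral>\<^sup>+z. g z \<partial>lborel)"
    if [measurable]: "g \<in> borel_measurable borel" for c and g :: "'a \<Rightarrow> ennreal"
  proof -
    have "(\<integral>\<^sup>+z. g z \<partial>lborel) = (\<integral>\<^sup>+z. g z \<partial>distr lborel borel ((+) c))"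
      by (simp add: lborel_distr_plus)
    also have "\<dots> = (\<integral>\<^sup>+z. g (c + z) \<partial>lborel)"
      by (subst nn_integral_distr) auto
    finally show ?thesis by (simp add: add.commute)
  qed
  have fshift: "(\<integral>\<^sup>+z. g (f z + c) \<partial>lborel) = (\<integral>\<^sup>+z. g (f z) \<partial>lborel)"
    if [measurable]: "g \<in> borel_measurable borel" for c and g :: "'a \<Rightarrow> ennreal"
  proof -
    obtain d where d: "c = f d" using \<open>surj f\<close> by (metis surjD)
    have "(\<integral>\<^sup>+z. g (f z + c) \<partial>lborel) = (\<integral>\<^sup>+z. g (f (z + d)) \<partial>lborel)"
      by (simp add: d linear_add[OF lin])
    also have "\<dots> = (\<integral>\<^sup>+z. g (f z) \<partial>lborel)"
      by (rule shift[of "\<lambda>z. g (f z)"]) simp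
    finally show ?thesis .
  qed
  let ?M = "emeasure lborel (f -` A)"
  have vA[measurable]: "f -` A \<in> sets borel" using measurable_sets[OF f A] by simp
  have "?M * emeasure lborel ?B = (\<integral>\<^sup>+y. ?M * indicator ?B y \<partial>lborel)"
    by (simp add: nn_integral_cmult_indicator)
  also have "\<dots> = (\<integral>\<^sup>+y. (\<integral>\<^sup>+z. indicator A (f z + y) * indicator ?B y \<partial>lborel) \<partial>lborel)"
  proof (rule nn_integral_cong)
    fix y
    have "?M = (\<integral>\<^sup>+z. indicator (f -` A) z \<partial>lborel)" by simp
    also have "\<dots> = (\<integral>\<^sup>+z. indicator A (f z) \<partial>lborel)"
      by (simp add: indicator_def)
    also have "\<dots> = (\<integral>\<^sup>+z. indicator A (f z + y) \<partial>lborel)" by (rule fshift[symmetric]) simp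
    finally show "?M * indicator ?B y = (\<integral>\<^sup>+z. indicator A (f z + y) * indicator ?B y \<partial>lborel)"
      by (simp add: nn_integral_multc)
  qed
  also have "\<dots> = (\<integral>\<^sup>+z. (\<integral>\<^sup>+y. indicator A (f z + y) * indicator ?B y \<partial>lborel) \<partial>lborel)"
    by (rule lborel_pair.Fubini') measurable
  also have "\<dots> = (\<integral>\<^sup>+z. (\<integral>\<^sup>+y. indicator A y * indicator ?B (y - f z) \<partial>lborel) \<partial>lborel)"
  proof (rule nn_integral_cong)
    fix z
    show "(\<integral>\<^sup>+y. indicator A (f z + y) * indicator ?B y \<partial>lborel) =
        (\<integral>\<^sup>+y. indicator A y * indicator ?B (y - f z) \<partial>lborel)"
      using shift[of "\<lambda>y. indicator A y * indicator ?B (y - f z)" "f z"] by (simp add: add.commute)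
  qed
  also have "\<dots> = (\<integral>\<^sup>+y. (\<integral>\<^sup>+z. indicator A y * indicator ?B (y - f z) \<partial>lborel) \<partial>lborel)"
    by (rule lborel_pair.Fubini') measurable
  also have "\<dots> = (\<integral>\<^sup>+y. indicator A y * emeasure lborel ?B \<partial>lborel)"
  proof (rule nn_integral_cong)
    fix y
    have "(\<integral>\<^sup>+z. indicator ?B (y - f z) \<partial>lborel) = (\<integral>\<^sup>+z. indicator ?B (f z + (- y)) \<partial>lborel)"
      by (intro nn_integral_cong) (auto simp: indicator_def norm_minus_commute)
    also have "\<dots> = (\<integral>\<^sup>+z. indicator ?B (f z) \<partial>lborel)" by (rule fshift) simp
    also have "\<dots> = (\<integral>\<^sup>+z. indicator ?B z \<partial>lborel)"
      by (intro nn_integral_cong) (auto simp: indicator_def iso)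
    finally show "(\<integral>\<^sup>+z. indicator A y * indicator ?B (y - f z) \<partial>lborel) = indicator A y * emeasure lborel ?B"
      by (simp add: nn_integral_cmult)
  qed
  also have "\<dots> = emeasure lborel A * emeasure lborel ?B"
    by (simp add: nn_integral_multc)
  finally have "?M * emeasure lborel ?B = emeasure lborel A * emeasure lborel ?B" .
  moreover have "emeasure lborel ?B = ennreal (unit_ball_vol DIM('a))"
    by (simp add: emeasure_ball)
  moreover have "unit_ball_vol (real DIM('a)) > 0" by simp
  ultimately have "?M = emeasure lborel A"
    by (metis ennreal_eq_0_iff ennreal_mult_divide_eq ennreal_neq_top not_le)
  then show "emeasure (distr lborel borel f) A = emeasure lborel A"
    by (subst emeasure_distr) auto
qed simp

text \<open>The radial projection of the uniform distribution on the unit ball. One fixed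
  probability measure replaces the surface measures of all radii. \<open>sgn\<close> sends the
  origin to 0, but the origin is a null set, so the measure is concentrated on the unit
  sphere.\<close>

definition sph :: "'a::euclidean_space measure" where
  "sph = distr (density lborel (\<lambda>z. ennreal (indicator (cball 0 1) z / unit_ball_vol DIM('a)))) borel sgn"

lemma sets_sph [simp, measurable_cong]: "sets sph = sets borel"
  and space_sph [simp]: "space sph = UNIV"
  by (simp_all add: sph_def)

lemma emeasure_sph:
  assumes [measurable]: "(A :: 'a::euclidean_space set) \<in> sets borel"
  shows "emeasure sph A = emeasure lborel {z \<in> cball 0 1. sgn z \<in> A} / ennreal (unit_ball_vol DIM('a))"
proof -
  have "emeasure sph A = emeasure (density lborel (\<lambda>z. ennreal (indicator (cball 0 1) z / unit_ball_vol DIM('a)))) (sgn -` A \<inter> UNIV)"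
    unfolding sph_def by (subst emeasure_distr) auto
  also have "\<dots> = (\<integral>\<^sup>+z. indicator {z \<in> cball 0 1. sgn z \<in> A} z / ennreal (unit_ball_vol DIM('a)) \<partial>lborel)"
    using measurable_sets[OF borel_measurable_sgn, of A]
    by (subst emeasure_density)
       (auto intro!: nn_integral_cong simp: indicator_def divide_ennreal[symmetric])
  also have "\<dots> = emeasure lborel {z \<in> cball 0 1. sgn z \<in> A} / ennreal (unit_ball_vol DIM('a))"
    by (subst nn_integral_divide) auto
  finally show ?thesis .
qed

lemma prob_space_sph: "emeasure (sph :: 'a::euclidean_space measure) UNIV = 1"
proof -
  have "emeasure (sph :: 'a measure) UNIV = ennreal (unit_ball_vol DIM('a)) / ennreal (unit_ball_vol DIM('a))"
    using emeasure_cball[of 1 "0::'a"] by (simp add: emeasure_sph cball_def)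
  also have "\<dots> = 1"
  proof (rule ennreal_divide_self)
    have "unit_ball_vol (real DIM('a)) > 0" by simp
    then show "ennreal (unit_ball_vol (real DIM('a))) \<noteq> 0" by (metis ennreal_eq_0_iff not_le)
  qed simp
  finally show ?thesis .
qed

lemma finite_measure_sph: "finite_measure (sph :: 'a::euclidean_space measure)"
  by (rule finite_measureI) (simp add: prob_space_sph)

lemma measure_sph_UNIV: "measure (sph :: 'a::euclidean_space measure) UNIV = 1"
  by (simp add: measure_def prob_space_sph)

lemma AE_sph: "AE w in (sph :: 'a::euclidean_space measure). norm w = 1"
proof -
  have [measurable]: "cball (0::'a) 1 \<in> sets borel" by simp
  have "AE z in lborel. z \<noteq> (0::'a)" by (rule AE_lborel_singleton)
  then have "AE z in density lborel (\<lambda>z. ennreal (indicator (cball 0 1) z / unit_ball_vol DIM('a))). norm (sgn (z::'a)) = 1"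
    by (subst AE_density) (auto simp: norm_sgn elim!: eventually_mono)
  then show ?thesis
    unfolding sph_def by (subst AE_distr_iff) auto
qed

lemma sph_isometry:
  fixes f :: "'a::euclidean_space \<Rightarrow> 'a"
  assumes lin: "linear f" and iso: "\<And>x. norm (f x) = norm x"
  shows "distr sph borel f = sph"
proof (rule measure_eqI)
  have bl: "bounded_linear f" using lin by (simp add: linear_conv_bounded_linear)
  have f[measurable]: "f \<in> borel_measurable borel"
    by (rule borel_measurable_continuous_onI) (use bl linear_continuous_on in blast)
  fix A assume "A \<in> sets (distr sph borel f)"
  then have A[measurable]: "A \<in> sets borel" by simp
  have vA[measurable]: "f -` A \<in> sets borel" using measurable_sets[OF f A] by simp
  have sg: "sgn (f z) = f (sgn z)" for z by (simp add: sgn_div_norm iso linear_scale[OF lin])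
  have "emeasure (distr sph borel f) A = emeasure sph (f -` A)"
    by (subst emeasure_distr) auto
  also have "\<dots> = emeasure lborel {z \<in> cball 0 1. sgn z \<in> f -` A} / ennreal (unit_ball_vol DIM('a))"
    by (rule emeasure_sph) simp
  also have "{z \<in> cball 0 1. sgn z \<in> f -` A} = f -` {z \<in> cball 0 1. sgn z \<in> A}"
    by (auto simp: sg iso)
  also have "emeasure lborel (f -` {z \<in> cball 0 1. sgn z \<in> A}) = emeasure (distr lborel borel f) {z \<in> cball 0 1. sgn z \<in> A}"
    by (subst emeasure_distr) auto
  also have "\<dots> / ennreal (unit_ball_vol DIM('a)) = emeasure sph A"
    unfolding distr_lborel_isometry[OF assms] by (simp add: emeasure_sph)
  finally show "emeasure (distr sph borel f) A = emeasure sph A" .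
qed simp

lemma integral_sph_isometry:
  fixes f :: "'a::euclidean_space \<Rightarrow> 'a" and g :: "'a \<Rightarrow> complex"
  assumes "linear f" and "\<And>x. norm (f x) = norm x" and [measurable]: "g \<in> borel_measurable borel"
  shows "(LINT w|sph. g (f w)) = (LINT w|sph. g w)"
proof -
  have [measurable]: "f \<in> borel_measurable borel"
    by (rule borel_measurable_continuous_onI)
       (use assms(1) linear_continuous_on linear_conv_bounded_linear in blast)
  have "(LINT w|sph. g w) = (LINT w|distr sph borel f. g w)" by (simp add: sph_isometry assms)
  also have "\<dots> = (LINT w|sph. g (f w))" by (subst integral_distr) auto
  finally show ?thesis by simp
qed

lemma emeasure_lborel_scale:
  fixes A :: "'a::euclidean_space set"
  assumes [measurable]: "A \<in> sets borel" and "s > 0"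
  shows "emeasure lborel A = ennreal (s ^ DIM('a)) * emeasure lborel {z. s *\<^sub>R z \<in> A}"
proof -
  have "emeasure lborel A = emeasure (density (distr lborel borel (\<lambda>x::'a. 0 + s *\<^sub>R x)) (\<lambda>_. \<bar>s\<bar>^DIM('a))) A"
    using lborel_affine[of s "0::'a"] assms(2) by simp
  also have "\<dots> = ennreal (s ^ DIM('a)) * emeasure (distr lborel borel (\<lambda>x::'a. 0 + s *\<^sub>R x)) A"
    using assms(2) by (subst emeasure_density_const) auto
  also have "emeasure (distr lborel borel (\<lambda>x::'a. 0 + s *\<^sub>R x)) A = emeasure lborel {z. s *\<^sub>R z \<in> A}"
    by (subst emeasure_distr) (auto simp: vimage_def)
  finally show ?thesis .
qed

text \<open>Both sides come from projecting a ball radially. Scaling the ball by \<open>s\<close>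
  multiplies volumes by \<open>s ^ n\<close> and leaves \<open>sgn\<close> unchanged, and with the
  factor \<open>n / s\<close> this is the total area.\<close>

lemma sphere_measure_eq:
  assumes "s > 0"
  shows "sphere_measure (0::'a::euclidean_space) s =
    density (distr sph borel (\<lambda>w. s *\<^sub>R w)) (\<lambda>_. ennreal (measure (sphere_measure (0::'a) s) (sphere 0 s)))"
    (is "_ = density ?D (\<lambda>_. ennreal ?t)")
proof (rule measure_eqI)
  fix A :: "'a set" assume "A \<in> sets (sphere_measure 0 s)"
  then have [measurable]: "A \<in> sets borel" by simp
  let ?V = "unit_ball_vol DIM('a)"
  have V: "?V > 0" by simp
  have "{z \<in> cball 0 1. s *\<^sub>R sgn z \<in> A} = {z. s *\<^sub>R z \<in> {z \<in> cball 0 s. s *\<^sub>R sgn z \<in> A}}"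
    using assms by (auto simp: sgn_scaleR mult_le_cancel_left1)
  then have eq: "emeasure lborel {z \<in> cball 0 s. s *\<^sub>R sgn z \<in> A}
      = ennreal (s ^ DIM('a)) * emeasure lborel {z \<in> cball 0 1. s *\<^sub>R sgn z \<in> A}"
    by (subst emeasure_lborel_scale[OF _ assms]) (auto simp: sgn_scaleR)
  have [measurable]: "{w. s *\<^sub>R w \<in> A} \<in> sets borel"
    using measurable_sets[of "\<lambda>w. s *\<^sub>R w" borel borel A] by (simp add: vimage_def)
  have "emeasure (sphere_measure 0 s) A = ennreal (real DIM('a) / s) *
      emeasure lborel {z \<in> cball 0 s - {0}. s *\<^sub>R sgn z \<in> A}"
    by (subst emeasure_sphere_measure) (auto simp: sgn_div_norm divide_inverse intro!: arg_cong[of _ _ "emeasure lborel"])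
  also have "emeasure lborel {z \<in> cball 0 s - {0}. s *\<^sub>R sgn z \<in> A} = emeasure lborel {z \<in> cball 0 s. s *\<^sub>R sgn z \<in> A}"
    by (rule emeasure_eq_AE) (use AE_lborel_singleton[of "0::'a"] in auto)
  also have "\<dots> = ennreal (s ^ DIM('a)) * emeasure lborel {z \<in> cball 0 1. sgn z \<in> {w. s *\<^sub>R w \<in> A}}"
    using eq by simp
  also have "emeasure lborel {z \<in> cball 0 1. sgn z \<in> {w. s *\<^sub>R w \<in> A}} = ennreal ?V * emeasure sph {w. s *\<^sub>R w \<in> A}"
  proof -
    have "ennreal ?V * (x / ennreal ?V) = x" for x :: ennreal
      using V by (metis ennreal_eq_0_iff ennreal_mult_divide_eq ennreal_neq_top ennreal_times_divide mult.commute not_le)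
    then show ?thesis by (simp add: emeasure_sph)
  qed
  also have "ennreal (real DIM('a) / s) * (ennreal (s ^ DIM('a)) * (ennreal ?V * emeasure sph {w. s *\<^sub>R w \<in> A}))
     = ennreal ?t * emeasure sph {w. s *\<^sub>R w \<in> A}"
  proof -
    have "ennreal (real DIM('a) / s) * (ennreal (s ^ DIM('a)) * ennreal ?V) = ennreal (real DIM('a) / s * (s ^ DIM('a) * ?V))"
      using assms V by (simp add: ennreal_mult' del: times_divide_eq_left)
    also have "real DIM('a) / s * (s ^ DIM('a) * ?V) = ?t"
      using assms power_minus_mult[of "DIM('a)" s] by (simp add: sphere_measure_total field_simps)
    finally show ?thesis by (simp add: mult.assoc[symmetric])
  qed
  also have "emeasure sph {w. s *\<^sub>R w \<in> A} = emeasure ?D A"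
    by (subst emeasure_distr) (auto simp: vimage_def)
  also have "ennreal ?t * \<dots> = emeasure (density ?D (\<lambda>_. ennreal ?t)) A"
    by (subst emeasure_density_const) auto
  finally show "emeasure (sphere_measure 0 s) A = \<dots>" .
qed simp

text \<open>The total area cancels against the normalisation, and the radius moves from the measure
  into the integrand, where it can be differentiated.\<close>

lemma spherical_mean_eq:
  fixes u :: "'a::euclidean_space \<Rightarrow> complex"
  assumes "s > 0" and [measurable]: "u \<in> borel_measurable borel"
  shows "spherical_mean s u 0 = (LINT w|sph. u (s *\<^sub>R w))"
proof -
  let ?t = "measure (sphere_measure (0::'a) s) (sphere 0 s)"
  have V: "unit_ball_vol DIM('a) > 0" by simp
  have t: "?t > 0" using assms(1) V by (simp add: sphere_measure_total)
  have [measurable]: "sphere (0::'a) s \<in> sets borel" by (rule borel_closed) simp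
  have [measurable]: "(\<lambda>w::'a. s *\<^sub>R w) \<in> borel_measurable borel" by measurable
  have "(LINT y:sphere 0 s|sphere_measure 0 s. u y) =
     (LINT y|density (distr sph borel (\<lambda>w. s *\<^sub>R w)) (\<lambda>_. ennreal ?t). indicator (sphere 0 s) y *\<^sub>R u y)"
    unfolding set_lebesgue_integral_def
    by (rule arg_cong[where f = "\<lambda>M. LINT y|M. indicator (sphere 0 s) y *\<^sub>R u y"]) (rule sphere_measure_eq[OF assms(1)])
  also have "\<dots> = (LINT y|distr sph borel (\<lambda>w. s *\<^sub>R w). ?t *\<^sub>R (indicator (sphere 0 s) y *\<^sub>R u y))"
    using t by (subst integral_density) auto
  also have "\<dots> = (LINT w|sph. ?t *\<^sub>R (indicator (sphere 0 s) (s *\<^sub>R w) *\<^sub>R u (s *\<^sub>R w)))"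
    by (subst integral_distr) auto
  also have "\<dots> = (LINT w|sph. ?t *\<^sub>R u (s *\<^sub>R w))"
    using assms(1) by (intro integral_cong_AE) (auto simp: indicator_def intro: eventually_mono[OF AE_sph])
  finally show ?thesis
    using t by (simp add: spherical_mean_def scaleR_conv_of_real)
qed

section \<open>Differentiation of spherical means\<close>

text \<open>Dominated convergence for the remainder quotients along an arbitrary sequence. The
  parameter may be a vector: the lemma is applied to pairs of radius and centre, to rotation angles
  and to translations.\<close>

lemma has_derivative_integral:
  fixes f :: "'x::real_normed_vector \<Rightarrow> 'b \<Rightarrow> complex"
  assumes fin: "finite_measure M"
    and [measurable]: "\<And>x. (\<lambda>w. f x w) \<in> borel_measurable M" "\<And>h. (\<lambda>w. f' h w) \<in> borel_measurable M"
    and der: "AE w in M. ((\<lambda>x. f x w) has_derivative (\<lambda>h. f' h w)) (at x0)"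
    and lip: "AE w in M. \<forall>x\<in>ball x0 1. norm (f x w - f x0 w) \<le> B * norm (x - x0)"
    and bd: "AE w in M. \<forall>h. norm (f' h w) \<le> B * norm h"
    and int: "\<And>x. integrable M (f x)"
  shows "((\<lambda>x. LINT w|M. f x w) has_derivative (\<lambda>h. LINT w|M. f' h w)) (at x0)"
proof -
  interpret finite_measure M by fact
  have int': "integrable M (f' h)" for h
    by (rule integrable_const_bound[where B = "B * norm h"]) (use bd in auto)
  have lin: "bounded_linear (\<lambda>h. LINT w|M. f' h w)"
  proof (rule bounded_linear_intro[where K = "B * measure M (space M)"])
    have l: "AE w in M. (\<forall>x y. f' (x + y) w = f' x w + f' y w) \<and> (\<forall>r x. f' (r *\<^sub>R x) w = r *\<^sub>R f' x w)"
      using der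
    proof eventually_elim
      case (elim w)
      then show ?case using has_derivative_linear[OF elim] by (simp add: linear_iff)
    qed
    show "(LINT w|M. f' (x + y) w) = (LINT w|M. f' x w) + (LINT w|M. f' y w)" for x y
    proof -
      have "(LINT w|M. f' (x + y) w) = (LINT w|M. f' x w + f' y w)"
        by (rule integral_cong_AE) (auto intro: eventually_mono[OF l])
      then show ?thesis using int' by simp
    qed
    show "(LINT w|M. f' (r *\<^sub>R x) w) = r *\<^sub>R (LINT w|M. f' x w)" for r x
    proof -
      have "(LINT w|M. f' (r *\<^sub>R x) w) = (LINT w|M. r *\<^sub>R f' x w)"
        by (rule integral_cong_AE) (auto intro: eventually_mono[OF l])
      then show ?thesis by simp
    qed
    show "norm (LINT w|M. f' x w) \<le> norm x * (B * measure M (space M))" for x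
    proof -
      have "norm (LINT w|M. f' x w) \<le> (LINT w|M. norm (f' x w))" by (rule integral_norm_bound)
      also have "\<dots> \<le> (LINT w|M. B * norm x)"
        by (rule integral_mono_AE) (use bd int' in auto)
      finally show ?thesis by (simp add: mult_ac)
    qed
  qed
  have "((\<lambda>h. norm ((LINT w|M. f (x0 + h) w) - (LINT w|M. f x0 w) - (LINT w|M. f' h w)) / norm h) \<longlongrightarrow> 0) (at 0)"
    unfolding tendsto_at_iff_sequentially
  proof (intro allI impI)
    fix X :: "nat \<Rightarrow> 'x" assume X: "\<forall>i. X i \<in> UNIV - {0}" "X \<longlonglongrightarrow> 0"
    then obtain N where N: "\<And>i. i \<ge> N \<Longrightarrow> norm (X i) < 1"
      using LIMSEQ_D[OF X(2), of 1] by auto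
    \<comment> \<open>Dropping finitely many terms brings the sequence into the unit ball, where the
      Lipschitz bound is assumed.\<close>
    define Y where "Y i = X (i + N)" for i
    have Y: "Y \<longlonglongrightarrow> 0" "Y i \<noteq> 0" "norm (Y i) < 1" for i
      unfolding Y_def using X N LIMSEQ_ignore_initial_segment[OF X(2), of N] by auto
    define q where "q i w = (f (x0 + Y i) w - f x0 w - f' (Y i) w) /\<^sub>R norm (Y i)" for i w
    have [measurable]: "q i \<in> borel_measurable M" for i unfolding q_def by measurable
    have "(\<lambda>i. LINT w|M. q i w) \<longlonglongrightarrow> (LINT w|M. 0)"
    \<comment> \<open>One \<open>B\<close> bounds the difference quotient, the other the linear
      part.\<close>
    proof (rule integral_dominated_convergence[where w = "\<lambda>_. 2 * B"])
      show "AE w in M. (\<lambda>i. q i w) \<longlonglongrightarrow> 0"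
        using der
      proof eventually_elim
        case (elim w)
        then have "((\<lambda>h. norm (f (x0 + h) w - f x0 w - f' h w) / norm h) \<longlongrightarrow> 0) (at 0)"
          by (simp add: has_derivative_at)
        then have "(\<lambda>i. norm (f (x0 + Y i) w - f x0 w - f' (Y i) w) / norm (Y i)) \<longlonglongrightarrow> 0"
          using Y unfolding tendsto_at_iff_sequentially by (force simp: o_def)
        then show ?case
          by (subst tendsto_norm_zero_iff[symmetric]) (simp add: q_def divide_inverse mult.commute)
      qed
      show "AE w in M. norm (q i w) \<le> 2 * B" for i
        using lip bd
      proof eventually_elim
        case (elim w)
        have "norm (f (x0 + Y i) w - f x0 w) \<le> B * norm (Y i)"
          using elim(1)[rule_format, of "x0 + Y i"] Y(3)[of i] by (simp add: dist_norm)
        moreover have "norm (f' (Y i) w) \<le> B * norm (Y i)" using elim(2) by blast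
        ultimately have "norm (f (x0 + Y i) w - f x0 w - f' (Y i) w) \<le> 2 * B * norm (Y i)"
          using norm_triangle_ineq4[of "f (x0 + Y i) w - f x0 w" "f' (Y i) w"] by linarith
        then show ?case using Y(2)[of i] unfolding q_def norm_scaleR by (simp add: divide_inverse[symmetric] pos_divide_le_eq mult.commute[of "inverse _"])
      qed
    qed auto
    moreover have "(LINT w|M. q i w) = ((LINT w|M. f (x0 + Y i) w) - (LINT w|M. f x0 w) - (LINT w|M. f' (Y i) w)) /\<^sub>R norm (Y i)" for i
      unfolding q_def using int int' by (simp del: scaleR_conv_of_real)
    ultimately have "(\<lambda>i. ((LINT w|M. f (x0 + Y i) w) - (LINT w|M. f x0 w) - (LINT w|M. f' (Y i) w)) /\<^sub>R norm (Y i)) \<longlonglongrightarrow> 0"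
      by simp
    then have "(\<lambda>i. norm (((LINT w|M. f (x0 + Y i) w) - (LINT w|M. f x0 w) - (LINT w|M. f' (Y i) w)) /\<^sub>R norm (Y i))) \<longlonglongrightarrow> 0"
      by (rule tendsto_norm_zero)
    then have "(\<lambda>i. norm ((LINT w|M. f (x0 + Y i) w) - (LINT w|M. f x0 w) - (LINT w|M. f' (Y i) w)) / norm (Y i)) \<longlonglongrightarrow> 0"
      by (simp add: divide_inverse mult.commute)
    then show "((\<lambda>h. norm ((LINT w|M. f (x0 + h) w) - (LINT w|M. f x0 w) - (LINT w|M. f' h w)) / norm h) \<circ> X) \<longlonglongrightarrow> 0"
      unfolding Y_def by (simp add: o_def LIMSEQ_offset)
  qed
  with lin show ?thesis by (simp add: has_derivative_at)
qed

lemma smooth_bounds: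
  fixes u :: "'a::euclidean_space \<Rightarrow> complex"
  assumes "u \<in> smooth_functions"
  obtains B where "B \<ge> 0" "\<And>x. norm x \<le> R \<Longrightarrow> norm (u x) \<le> B"
    "\<And>x v. norm x \<le> R \<Longrightarrow> norm (dird v u x) \<le> B * norm v"
    "\<And>x y. norm x \<le> R \<Longrightarrow> norm y \<le> R \<Longrightarrow> norm (u x - u y) \<le> B * norm (x - y)"
proof -
  have bd: "\<exists>B. \<forall>x. norm x \<le> R \<longrightarrow> norm (u x) \<le> B" if "u \<in> smooth_functions" for u :: "'a \<Rightarrow> complex"
  proof -
    have "compact (u ` cball 0 R)"
      using smooth_continuous[OF that] by (intro compact_continuous_image) (auto intro: continuous_on_subset)
    then have "bounded (u ` cball 0 R)" by (rule compact_imp_bounded)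
    then obtain B where "\<forall>y\<in>u ` cball 0 R. norm y \<le> B" unfolding bounded_iff by blast
    then show ?thesis by (intro exI[of _ B]) auto
  qed
  have "\<forall>b. \<exists>B. \<forall>x. norm x \<le> R \<longrightarrow> norm (dird b u x) \<le> B" using bd[OF smooth_dird[OF assms]] by blast
  then obtain C where C: "\<And>b x. norm x \<le> R \<Longrightarrow> norm (dird b u x) \<le> C b" by metis
  obtain A where A: "\<And>x. norm x \<le> R \<Longrightarrow> norm (u x) \<le> A" using bd[OF assms] by blast
  define B where "B = \<bar>A\<bar> + (\<Sum>b\<in>Basis. \<bar>C b\<bar>)"
  have B0: "B \<ge> 0" unfolding B_def by (intro add_nonneg_nonneg sum_nonneg) auto
  have 2: "norm (dird v u x) \<le> B * norm v" if "norm x \<le> R" for x v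
  proof -
    have "norm (dird v u x) \<le> (\<Sum>b\<in>Basis. norm (of_real (v \<bullet> b) * dird b u x))"
      by (subst dird_basis[OF assms]) (rule norm_sum)
    also have "\<dots> \<le> (\<Sum>b\<in>Basis. norm v * \<bar>C b\<bar>)"
    proof (rule sum_mono)
      fix b :: 'a assume "b \<in> Basis"
      then show "norm (of_real (v \<bullet> b) * dird b u x) \<le> norm v * \<bar>C b\<bar>"
        using C[OF that, of b] Basis_le_norm[of b v] unfolding norm_mult norm_of_real
        by (intro mult_mono) auto
    qed
    also have "\<dots> \<le> B * norm v"
      unfolding B_def sum_distrib_left[symmetric] by (simp add: algebra_simps)
    finally show ?thesis .
  qed
  show thesis
  proof (rule that[of B, OF B0 _ 2])
    show "norm (u x) \<le> B" if "norm x \<le> R" for x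
    proof -
      have "(\<Sum>b\<in>Basis. \<bar>C b\<bar>) \<ge> 0" by (intro sum_nonneg) auto
      then show ?thesis using A[OF that] unfolding B_def by linarith
    qed
    show "norm (u x - u y) \<le> B * norm (x - y)" if "norm x \<le> R" "norm y \<le> R" for x y
    proof (rule differentiable_bound[of "cball 0 R" u "\<lambda>x v. dird v u x"])
      show "onorm (\<lambda>v. dird v u x) \<le> B" if "x \<in> cball 0 R" for x
        by (rule onorm_bound[OF B0]) (use 2 that in auto)
    qed (use that in \<open>auto intro!: has_derivative_at_withinI smooth_has_derivative assms\<close>)
  qed
qed

lemma continuous_bounded_sphere:
  fixes w :: "'a::euclidean_space \<Rightarrow> complex"
  assumes "continuous_on UNIV w"
  obtains W where "W \<ge> 0" "\<And>x. norm x = 1 \<Longrightarrow> norm (w x) \<le> W"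
proof -
  have "compact (w ` sphere 0 1)"
    using assms by (intro compact_continuous_image) (auto intro: continuous_on_subset)
  then have "bounded (w ` sphere 0 1)" by (rule compact_imp_bounded)
  then obtain B where B: "\<forall>y\<in>w ` sphere 0 1. norm y \<le> B" unfolding bounded_iff by blast
  show thesis
    using B by (intro that[of "\<bar>B\<bar>"]) (auto intro: order_trans[OF _ abs_ge_self])
qed

lemma integrable_sph:
  fixes f :: "'a::euclidean_space \<Rightarrow> complex"
  assumes "f \<in> borel_measurable borel" "\<And>w. norm w = 1 \<Longrightarrow> norm (f w) \<le> B"
  shows "integrable sph f"
proof -
  interpret finite_measure "sph :: 'a measure" by (rule finite_measure_sph)
  show ?thesis
    by (rule integrable_const_bound[where B = B])
       (use assms in \<open>auto intro: eventually_mono[OF AE_sph]\<close>)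
qed

lemma integrable_sph_continuous:
  fixes f :: "'a::euclidean_space \<Rightarrow> complex"
  assumes "continuous_on UNIV f"
  shows "integrable sph f"
  by (rule continuous_bounded_sphere[OF assms], rule integrable_sph[OF borel_measurable_continuous_onI[OF assms]])

lemma norm_integral_sph_le:
  fixes f :: "'a::euclidean_space \<Rightarrow> complex"
  assumes f: "continuous_on UNIV f" and "\<And>w. norm w = 1 \<Longrightarrow> norm (f w) \<le> B"
  shows "norm (LINT w|sph. f w) \<le> B"
proof -
  interpret finite_measure "sph :: 'a measure" by (rule finite_measure_sph)
  have "norm (LINT w|sph. f w) \<le> (LINT w|sph. norm (f w))" by (rule integral_norm_bound)
  also have "\<dots> \<le> (LINT w|(sph::'a measure). B)"
    using integrable_sph_continuous[OF f] assms(2)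
    by (intro integral_mono_AE) (auto intro: eventually_mono[OF AE_sph])
  finally show ?thesis using measure_sph_UNIV[where 'a='a] by simp
qed

lemma continuous_smooth_compose:
  assumes "u \<in> smooth_functions" "continuous_on UNIV g"
  shows "continuous_on UNIV (\<lambda>w. u (g w))"
  using continuous_on_compose[OF assms(2), of u] smooth_continuous[OF assms(1)]
  by (auto simp: o_def intro: continuous_on_subset)

text \<open>Joint differentiability in radius and centre yields both the radial and the spatial
  derivative by the chain rule. The weight \<open>w\<close> is carried along because radial
  differentiation creates factors depending on \<open>z\<close>.\<close>

lemma smean_has_derivative:
  fixes u :: "'a::euclidean_space \<Rightarrow> complex"
  assumes w: "continuous_on UNIV w" and u: "u \<in> smooth_functions"
  shows "((\<lambda>p. LINT z|sph. w z * u (snd p - fst p *\<^sub>R z)) has_derivative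
    (\<lambda>q. LINT z|sph. w z * dird (snd q - fst q *\<^sub>R z) u (x - s *\<^sub>R z))) (at (s, x))"
proof -
  obtain W where W: "W \<ge> 0" "\<And>x. norm x = 1 \<Longrightarrow> norm (w x) \<le> W"
    using continuous_bounded_sphere[OF w] by blast
  \<comment> \<open>Moving the parameters by less than 1 moves \<open>x - s *\<^sub>R z\<close> by
    less than 2, so all points concerned stay in this ball.\<close>
  define R where "R = norm x + \<bar>s\<bar> + 2"
  have "\<exists>B\<ge>0. (\<forall>x v. norm x \<le> R \<longrightarrow> norm (dird v u x) \<le> B * norm v) \<and>
      (\<forall>x y. norm x \<le> R \<longrightarrow> norm y \<le> R \<longrightarrow> norm (u x - u y) \<le> B * norm (x - y))"
    by (rule smooth_bounds[OF u, of R], rule exI, intro conjI allI impI) assumption+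
  then obtain B where B: "B \<ge> 0" "\<forall>x v. norm x \<le> R \<longrightarrow> norm (dird v u x) \<le> B * norm v"
      "\<forall>x y. norm x \<le> R \<longrightarrow> norm y \<le> R \<longrightarrow> norm (u x - u y) \<le> B * norm (x - y)"
    by (elim exE conjE)
  have nq: "norm (snd q - fst q *\<^sub>R z) \<le> 2 * norm q" if "norm z = 1" for q :: "real \<times> 'a" and z
  proof -
    have "norm (snd q - fst q *\<^sub>R z) \<le> norm (snd q) + norm (fst q)"
      using norm_triangle_ineq4[of "snd q" "fst q *\<^sub>R z"] that by simp
    moreover have "norm (snd q) \<le> norm q" "norm (fst q) \<le> norm q"
      using norm_snd_le[of "snd q" "fst q"] norm_fst_le[of "fst q" "snd q"] by simp_all
    ultimately show ?thesis by linarith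
  qed
  have cont_diff: "continuous_on UNIV (\<lambda>z. u (snd p - fst p *\<^sub>R z))" for p :: "real \<times> 'a"
    by (rule continuous_smooth_compose[OF u]) (intro continuous_intros)
  have mw [measurable]: "w \<in> borel_measurable borel" using w by (rule borel_measurable_continuous_onI)
  have cd: "continuous_on UNIV (\<lambda>z. dird (snd q - fst q *\<^sub>R z) u (x - s *\<^sub>R z))" for q :: "real \<times> 'a"
    by (subst dird_basis[OF u]) (intro continuous_intros continuous_smooth_compose[OF smooth_dird[OF u]])
  have R0: "norm (x - s *\<^sub>R z) \<le> R" if "norm z = 1" for z
    using norm_triangle_ineq4[of x "s *\<^sub>R z"] that by (simp add: R_def)
  show ?thesis
  proof (rule has_derivative_integral[OF finite_measure_sph, where B = "W * (B * 2)"])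
    show "(\<lambda>z. w z * u (snd p - fst p *\<^sub>R z)) \<in> borel_measurable sph" for p :: "real \<times> 'a"
      using borel_measurable_continuous_onI[OF cont_diff, of p] by measurable
    show "(\<lambda>z. w z * dird (snd q - fst q *\<^sub>R z) u (x - s *\<^sub>R z)) \<in> borel_measurable sph" for q :: "real \<times> 'a"
      using borel_measurable_continuous_onI[OF cd, of q] by measurable
    show "integrable sph (\<lambda>z. w z * u (snd p - fst p *\<^sub>R z))" for p :: "real \<times> 'a"
      by (rule integrable_sph_continuous) (intro continuous_intros w cont_diff)
    have "((\<lambda>p. w z * u (snd p - fst p *\<^sub>R z)) has_derivative
        (\<lambda>h. w z * dird (snd h - fst h *\<^sub>R z) u (snd (s, x) - fst (s, x) *\<^sub>R z))) (at (s, x))" for z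
      by (rule has_derivative_mult_right[OF smooth_has_derivative'[OF u]])
         (auto intro!: derivative_eq_intros)
    then show "AE z in sph. ((\<lambda>p. w z * u (snd p - fst p *\<^sub>R z)) has_derivative
        (\<lambda>h. w z * dird (snd h - fst h *\<^sub>R z) u (x - s *\<^sub>R z))) (at (s, x))"
      by simp
    show "AE z in sph. \<forall>p\<in>ball (s, x) 1. norm (w z * u (snd p - fst p *\<^sub>R z) -
       w z * u (snd (s, x) - fst (s, x) *\<^sub>R z)) \<le> W * (B * 2) * norm (p - (s, x))"
    proof (rule eventually_mono[OF AE_sph], intro ballI)
      fix z p assume z: "norm (z::'a) = 1" and p: "p \<in> ball (s, x) 1"
      have np: "norm (p - (s, x)) < 1" using p by (simp add: dist_norm norm_minus_commute)
      have eq: "snd p - fst p *\<^sub>R z - (x - s *\<^sub>R z) = snd (p - (s,x)) - fst (p - (s,x)) *\<^sub>R z"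
        by (simp add: algebra_simps)
      have d: "norm (snd p - fst p *\<^sub>R z - (x - s *\<^sub>R z)) \<le> 2 * norm (p - (s, x))"
        unfolding eq by (rule nq[OF z])
      have "norm (snd p - fst p *\<^sub>R z) \<le> norm (x - s *\<^sub>R z) + 2"
        using d np norm_triangle_ineq2[of "snd p - fst p *\<^sub>R z" "x - s *\<^sub>R z"] by linarith
      then have "norm (snd p - fst p *\<^sub>R z) \<le> R"
        using norm_triangle_ineq4[of x "s *\<^sub>R z"] z by (simp add: R_def)
      from order_trans[OF B(3)[rule_format, OF this R0[OF z]] mult_left_mono[OF d B(1)]]
      have "norm (u (snd p - fst p *\<^sub>R z) - u (x - s *\<^sub>R z)) \<le> B * (2 * norm (p - (s, x)))" .
      then have "norm (w z) * norm (u (snd p - fst p *\<^sub>R z) - u (x - s *\<^sub>R z)) \<le> W * (B * (2 * norm (p - (s, x))))"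
        using W z by (intro mult_mono) auto
      then show "norm (w z * u (snd p - fst p *\<^sub>R z) -
       w z * u (snd (s, x) - fst (s, x) *\<^sub>R z)) \<le> W * (B * 2) * norm (p - (s, x))"
        by (simp add: right_diff_distrib[symmetric] norm_mult mult_ac)
    qed
    show "AE z in sph. \<forall>h. norm (w z * dird (snd h - fst h *\<^sub>R z) u (x - s *\<^sub>R z)) \<le> W * (B * 2) * norm h"
    proof (rule eventually_mono[OF AE_sph], intro allI)
      fix z h assume z: "norm (z::'a) = 1"
      have "norm (dird (snd h - fst h *\<^sub>R z) u (x - s *\<^sub>R z)) \<le> B * (2 * norm h)"
        by (rule order_trans[OF B(2)[rule_format, OF R0[OF z]] mult_left_mono[OF nq[OF z, of h] B(1)]])
      then have "norm (w z) * norm (dird (snd h - fst h *\<^sub>R z) u (x - s *\<^sub>R z)) \<le> W * (B * (2 * norm h))"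
        using W z by (intro mult_mono) auto
      then show "norm (w z * dird (snd h - fst h *\<^sub>R z) u (x - s *\<^sub>R z)) \<le> W * (B * 2) * norm h"
        by (simp add: norm_mult mult_ac)
    qed
  qed
qed

lemma smean_has_vector_derivative:
  fixes u :: "'a::euclidean_space \<Rightarrow> complex"
  assumes "continuous_on UNIV w" "u \<in> smooth_functions"
  shows "((\<lambda>s. LINT z|sph. w z * u (x - s *\<^sub>R z)) has_vector_derivative
    (LINT z|sph. w z * dird (- z) u (x - s *\<^sub>R z))) (at s)"
proof -
  have g: "((\<lambda>s. (s, x)) has_derivative (\<lambda>h. (h, 0))) (at s)" by (auto intro!: derivative_eq_intros)
  have lin: "dird (- (h *\<^sub>R z)) u y = h *\<^sub>R dird (- z) u y" for h z y
    using linear_scale[OF dird_linear[OF assms(2)], of h "- z"] by simp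
  have "((\<lambda>s. LINT z|sph. w z * u (x - s *\<^sub>R z)) has_derivative
      (\<lambda>h. LINT z|sph. w z * dird (- (h *\<^sub>R z)) u (x - s *\<^sub>R z))) (at s)"
    using diff_chain_at[OF g smean_has_derivative[OF assms, of x s]] by (simp add: o_def)
  moreover have "(LINT z|sph. w z * dird (- (h *\<^sub>R z)) u (x - s *\<^sub>R z)) =
      h *\<^sub>R (LINT z|sph. w z * dird (- z) u (x - s *\<^sub>R z))" for h
    by (simp add: lin)
  ultimately show ?thesis unfolding has_vector_derivative_def by simp
qed

lemma smean_has_derivative_space:
  fixes u :: "'a::euclidean_space \<Rightarrow> complex"
  assumes "continuous_on UNIV w" "u \<in> smooth_functions"
  shows "((\<lambda>x. LINT z|sph. w z * u (x - s *\<^sub>R z)) has_derivative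
    (\<lambda>v. LINT z|sph. w z * dird v u (x - s *\<^sub>R z))) (at x)"
proof -
  have g: "((\<lambda>x. (s, x)) has_derivative (\<lambda>h. (0, h))) (at x)" by (auto intro!: derivative_eq_intros)
  show ?thesis
    using diff_chain_at[OF g smean_has_derivative[OF assms, of x s]] by (simp add: o_def)
qed

text \<open>\<open>rmean l w u s x\<close> is the \<open>l\<close>-th derivative in \<open>s\<close> of the mean of \<open>w (z) * u (x - s z)\<close>,
  with the differentiations carried out on \<open>u\<close>.\<close>

primrec rmean :: "nat \<Rightarrow> ('a::euclidean_space \<Rightarrow> complex) \<Rightarrow> ('a \<Rightarrow> complex) \<Rightarrow> real \<Rightarrow> 'a \<Rightarrow> complex" where
  "rmean 0 w u s x = (LINT z|sph. w z * u (x - s *\<^sub>R z))"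
| "rmean (Suc l) w u s x = (\<Sum>b\<in>Basis. rmean l (\<lambda>z. - of_real (z \<bullet> b) * w z) (dird b u) s x)"

lemma rmean_has_vector_derivative:
  assumes "continuous_on UNIV w" "u \<in> smooth_functions"
  shows "((\<lambda>s. rmean l w u s x) has_vector_derivative rmean (Suc l) w u s x) (at s)"
  using assms
proof (induction l arbitrary: w u)
  case 0
  \<comment> \<open>The chain rule differentiates \<open>u\<close> in direction \<open>- z\<close>;
    expanding this direction over the basis moves the factors \<open>- (z \<bullet> b)\<close> into
    the weight, as in the recursion of \<open>rmean\<close>.\<close>
  have "(LINT z|sph. w z * dird (- z) u (x - s *\<^sub>R z)) =
      (LINT z|sph. (\<Sum>b\<in>Basis. - of_real (z \<bullet> b) * w z * dird b u (x - s *\<^sub>R z)))"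
    by (rule arg_cong[where f = "integral\<^sup>L sph"], rule ext, subst dird_basis[OF 0(2)])
       (simp add: sum_distrib_left algebra_simps)
  also have "\<dots> = rmean (Suc 0) w u s x"
    unfolding rmean.simps
    by (rule Bochner_Integration.integral_sum, rule integrable_sph_continuous)
       (intro continuous_intros 0 continuous_smooth_compose[OF smooth_dird])
  finally show ?case using smean_has_vector_derivative[OF 0, of x s] by simp
next
  case (Suc l)
  show ?case
    unfolding rmean.simps(2)[of l w] rmean.simps(2)[of "Suc l" w]
    by (intro has_vector_derivative_sum Suc.IH smooth_dird Suc.prems continuous_intros)
qed

lemma rmean_smooth:
  assumes "continuous_on UNIV w" "u \<in> smooth_functions"
  shows "rmean l w u s \<in> smooth_functions"
  using assms
proof (induction l arbitrary: w u)
  case 0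
  define S where "S = {rmean 0 w u s | u. u \<in> smooth_functions}"
  show ?case
  proof (rule smooth_coinduct[of _ S])
    fix z assume "z \<in> S"
    then obtain u where "u \<in> smooth_functions" "z = rmean 0 w u s" unfolding S_def by (elim CollectE exE conjE)
    note u = this
    have "(rmean 0 w u s has_derivative (\<lambda>v. rmean 0 w (dird v u) s x)) (at x)" for x
    proof -
      have "rmean 0 w u s = (\<lambda>x. LINT z|sph. w z * u (x - s *\<^sub>R z))"
        by (rule ext) (rule rmean.simps(1))
      then show ?thesis
        using smean_has_derivative_space[OF 0(1) u(1), of s x] by (simp only: rmean.simps(1))
    qed
    then have "(z has_derivative (\<lambda>v. rmean 0 w (dird v u) s x)) (at x)" for x
      by (simp only: u(2))
    moreover have "(\<lambda>x. rmean 0 w (dird v u) s x) \<in> S" for v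
      unfolding S_def
    proof (intro CollectI exI conjI)
      show "(\<lambda>x. rmean 0 w (dird v u) s x) = rmean 0 w (dird v u) s" ..
    qed (rule smooth_dird[OF u(1)])
    ultimately show "\<exists>F. (\<forall>x. (z has_derivative F x) (at x)) \<and> (\<forall>v. (\<lambda>x. F x v) \<in> S)"
      by (intro exI[of _ "\<lambda>x v. rmean 0 w (dird v u) s x"]) (simp only: simp_thms)
  next
    show "rmean 0 w u s \<in> S" unfolding S_def using 0(2) by blast
  qed
next
  case (Suc l)
  have "rmean (Suc l) w u s = (\<lambda>x. \<Sum>b\<in>Basis. rmean l (\<lambda>z. - of_real (z \<bullet> b) * w z) (dird b u) s x)"
    by (rule ext) (rule rmean.simps(2))
  also have "\<dots> \<in> smooth_functions"
  proof (rule smooth_sum)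
    show "rmean l (\<lambda>z. - of_real (z \<bullet> b) * w z) (dird b u) s \<in> smooth_functions" for b
      by (rule Suc.IH) (intro smooth_dird Suc.prems continuous_intros)+
  qed
  finally show ?case .
qed

text \<open>The formula for \<open>g\<close> is available at positive arguments only. A derivative
  at \<open>s > 0\<close> depends on nearby values alone, so the restriction survives the
  iteration.\<close>

lemma iterated_vector_derivative:
  fixes F :: "nat \<Rightarrow> real \<Rightarrow> 'a::real_normed_vector"
  assumes "\<And>s. s > 0 \<Longrightarrow> g s = F 0 s"
    and "\<And>k s. s > 0 \<Longrightarrow> (F k has_vector_derivative F (Suc k) s) (at s)"
    and "s > 0"
  shows "((\<lambda>f s. vector_derivative f (at s)) ^^ k) g s = F k s"
  using assms(3)
proof (induction k arbitrary: s)
  case 0 then show ?case using assms(1) by simp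
next
  case (Suc k)
  have "(((\<lambda>f s. vector_derivative f (at s)) ^^ k) g has_vector_derivative F (Suc k) s) (at s)"
    by (rule has_vector_derivative_transform_within_open[OF assms(2)[OF Suc.prems], of "{0<..}"])
       (use Suc in auto)
  then show ?case by (simp add: vector_derivative_at)
qed

section \<open>The convolution operator on smooth functions\<close>

definition "sphop l r = convolve (sphere_distribution_deriv l r)"

lemma sphop_eq:
  fixes u :: "'a::euclidean_space \<Rightarrow> complex"
  assumes "r > 0" "u \<in> smooth_functions"
  shows "sphop l r u x = rmean l (\<lambda>_. 1) u r x"
  unfolding sphop_def convolve_def sphere_distribution_deriv_def
proof (rule iterated_vector_derivative[where F = "\<lambda>l s. rmean l (\<lambda>_. 1) u s x", OF _ _ assms(1)])
  show "spherical_mean s (\<lambda>y. u (x - y)) 0 = rmean 0 (\<lambda>_. 1) u s x" if "s > 0" for s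
    by (subst spherical_mean_eq[OF that])
       (auto intro!: borel_measurable_continuous_onI continuous_smooth_compose[OF assms(2)] continuous_intros)
  show "((\<lambda>s. rmean k (\<lambda>_. 1) u s x) has_vector_derivative rmean (Suc k) (\<lambda>_. 1) u s x) (at s)" for k s
    by (rule rmean_has_vector_derivative) (use assms in auto)
qed

lemma sphop_smooth:
  fixes u :: "'a::euclidean_space \<Rightarrow> complex"
  assumes "r > 0" "u \<in> smooth_functions"
  shows "sphop l r u \<in> smooth_functions"
proof -
  have "sphop l r u = rmean l (\<lambda>_. 1) u r" using sphop_eq[OF assms] by blast
  also have "\<dots> \<in> smooth_functions" by (rule rmean_smooth) (use assms in auto)
  finally show ?thesis .
qed

lemma rmean_add:
  assumes "continuous_on UNIV w" "u \<in> smooth_functions" "v \<in> smooth_functions"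
  shows "rmean l w (\<lambda>x. u x + v x) s x = rmean l w u s x + rmean l w v s x"
  using assms
proof (induction l arbitrary: w u v)
  case 0
  have "integrable sph (\<lambda>z. w z * u (x - s *\<^sub>R z))" if "u \<in> smooth_functions" for u
    by (intro integrable_sph_continuous continuous_intros 0 continuous_smooth_compose[OF that])
  then show ?case using 0 by (simp add: ring_distribs)
next
  case (Suc l)
  have "rmean l (\<lambda>z. - of_real (z \<bullet> b) * w z) (dird b (\<lambda>x. u x + v x)) s x =
      rmean l (\<lambda>z. - of_real (z \<bullet> b) * w z) (dird b u) s x + rmean l (\<lambda>z. - of_real (z \<bullet> b) * w z) (dird b v) s x" for b
    unfolding dird_add[OF Suc.prems(2,3)]
    by (intro Suc.IH smooth_dird Suc.prems continuous_intros)
  then show ?case by (simp add: sum.distrib)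
qed

lemma sphop_add:
  fixes u v :: "'a::euclidean_space \<Rightarrow> complex"
  assumes "r > 0" "u \<in> smooth_functions" "v \<in> smooth_functions"
  shows "sphop l r (\<lambda>x. u x + v x) x = sphop l r u x + sphop l r v x"
  using assms by (simp add: sphop_eq rmean_add smooth_add)

section \<open>Series of smooth functions\<close>

text \<open>The hypothesis of the Weierstrass test on every ball, required for all iterated
  directional derivatives at once so that it passes to the family of derivatives.\<close>

definition smooth_family :: "(nat \<Rightarrow> 'a::real_normed_vector \<Rightarrow> complex) \<Rightarrow> bool" where
  "smooth_family v \<longleftrightarrow> (\<forall>j. v j \<in> smooth_functions) \<and>
     (\<forall>vs R. \<exists>M. summable M \<and> (\<forall>j x. norm x \<le> R \<longrightarrow> norm (dirds vs (v j) x) \<le> M j))"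

lemma smooth_family_smooth: "smooth_family v \<Longrightarrow> v j \<in> smooth_functions"
  by (simp add: smooth_family_def)

lemma smooth_family_dird: "smooth_family v \<Longrightarrow> smooth_family (\<lambda>j. dird d (v j))"
  unfolding smooth_family_def by (auto intro: smooth_dird simp flip: dirds.simps(2))

lemma smooth_family_bound:
  assumes "smooth_family v"
  obtains M where "summable M" "\<And>j x. norm x \<le> R \<Longrightarrow> norm (v j x) \<le> M j"
proof -
  have "\<exists>M. summable M \<and> (\<forall>j x. norm x \<le> R \<longrightarrow> norm (dirds [] (v j) x) \<le> M j)"
    using assms unfolding smooth_family_def by blast
  then show thesis using that by auto
qed

lemma smooth_family_summable: "smooth_family v \<Longrightarrow> summable (\<lambda>j. norm (v j x))"
  by (rule smooth_family_bound[of v "norm x"], assumption, rule summable_comparison_test'[where N = 0]) auto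

lemma smooth_family_has_derivative:
  fixes v :: "nat \<Rightarrow> 'a::euclidean_space \<Rightarrow> complex"
  assumes v: "smooth_family v"
  shows "((\<lambda>x. \<Sum>j. v j x) has_derivative (\<lambda>h. \<Sum>j. dird h (v j) x)) (at x)"
proof -
  define R where "R = norm x + 1"
  have "\<forall>b. \<exists>M. summable M \<and> (\<forall>j x. norm x \<le> R \<longrightarrow> norm (dird b (v j) x) \<le> M j)"
    using smooth_family_bound[OF smooth_family_dird[OF v]] by metis
  then obtain M where M: "\<And>b. summable (M b)" "\<And>b j x. norm x \<le> R \<Longrightarrow> norm (dird b (v j) x) \<le> M b j"
    by metis
  \<comment> \<open>The majorants for the basis directions add up to one that serves every direction
    \<open>h\<close>, with the factor \<open>norm h\<close>.\<close>
  define N where "N j = (\<Sum>b\<in>Basis. M b j)" for j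
  have N: "summable N" unfolding N_def by (rule summable_sum) (rule M)
  have Nb: "norm (dird h (v j) y) \<le> N j * norm h" if "norm y \<le> R" for h j y
  proof -
    have "norm (dird h (v j) y) \<le> (\<Sum>b\<in>Basis. norm (of_real (h \<bullet> b) * dird b (v j) y))"
      by (subst dird_basis[OF smooth_family_smooth[OF v]]) (rule norm_sum)
    also have "\<dots> \<le> (\<Sum>b\<in>Basis. norm h * M b j)"
    proof (rule sum_mono)
      fix b :: 'a assume "b \<in> Basis"
      then show "norm (of_real (h \<bullet> b) * dird b (v j) y) \<le> norm h * M b j"
        using M(2)[OF that, of b j] Basis_le_norm[of b h] unfolding norm_mult norm_of_real
        by (intro mult_mono) auto
    qed
    finally show ?thesis by (simp add: N_def sum_distrib_left mult.commute)
  qed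
  have sumd: "summable (\<lambda>j. dird h (v j) y)" for h y
    by (rule summable_norm_cancel, rule smooth_family_summable, rule smooth_family_dird, rule v)
  have "\<exists>g. \<forall>y\<in>ball x 1. (\<lambda>n. v n y) sums (g y) \<and> (g has_derivative (\<lambda>h. \<Sum>j. dird h (v j) y)) (at y within ball x 1)"
  proof (rule has_derivative_series[where f' = "\<lambda>n y h. dird h (v n) y"])
    show "(v n has_derivative (\<lambda>h. dird h (v n) y)) (at y within ball x 1)" for n y
      by (rule has_derivative_at_withinI[OF smooth_has_derivative[OF smooth_family_smooth[OF v]]])
    show "x \<in> ball x 1" by simp
    show "(\<lambda>n. v n x) sums (\<Sum>n. v n x)"
      by (rule summable_sums, rule summable_norm_cancel, rule smooth_family_summable, rule v)
    show "\<forall>\<^sub>F n in sequentially. \<forall>y\<in>ball x 1. \<forall>h. norm ((\<Sum>i<n. dird h (v i) y) - (\<Sum>j. dird h (v j) y)) \<le> e * norm h"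
      if "e > 0" for e
    proof -
      obtain K where K: "\<And>n. n \<ge> K \<Longrightarrow> norm (\<Sum>i. N (i + n)) < e"
        using suminf_exist_split[OF \<open>e > 0\<close> N] by auto
      show ?thesis
      proof (rule eventually_sequentiallyI[of K], intro ballI allI)
        fix n and y h :: 'a assume n: "n \<ge> K" and y: "y \<in> ball x 1"
        have yR: "norm y \<le> R"
          using y norm_triangle_ineq2[of y x] by (simp add: R_def dist_norm norm_minus_commute)
        have s1: "summable (\<lambda>i. N (i + n) * norm h)"
          by (intro summable_mult2 summable_ignore_initial_segment N)
        have s2: "summable (\<lambda>i. norm (dird h (v (i + n)) y))"
          using smooth_family_summable[OF smooth_family_dird[OF v]] by (rule summable_ignore_initial_segment)
        have "norm ((\<Sum>i<n. dird h (v i) y) - (\<Sum>j. dird h (v j) y)) = norm (\<Sum>i. dird h (v (i + n)) y)"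
          using suminf_split_initial_segment[OF sumd[of h y], of n] by (simp add: norm_minus_commute)
        also have "\<dots> \<le> (\<Sum>i. norm (dird h (v (i + n)) y))" by (rule summable_norm[OF s2])
        also have "\<dots> \<le> (\<Sum>i. N (i + n) * norm h)" by (rule suminf_le[OF _ s2 s1]) (rule Nb[OF yR])
        also have "\<dots> = (\<Sum>i. N (i + n)) * norm h"
          by (rule suminf_mult2[symmetric]) (intro summable_ignore_initial_segment N)
        also have "\<dots> \<le> e * norm h" using K[OF n] by (intro mult_right_mono) auto
        finally show "norm ((\<Sum>i<n. dird h (v i) y) - (\<Sum>j. dird h (v j) y)) \<le> e * norm h" .
      qed
    qed
  qed simp
  then obtain g where g0: "\<forall>y\<in>ball x 1. (\<lambda>n. v n y) sums (g y) \<and>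
    (g has_derivative (\<lambda>h. \<Sum>j. dird h (v j) y)) (at y within ball x 1)" ..
  have g: "\<And>y. y \<in> ball x 1 \<Longrightarrow> (\<lambda>n. v n y) sums (g y)"
    "(g has_derivative (\<lambda>h. \<Sum>j. dird h (v j) x)) (at x within ball x 1)"
    using g0[rule_format, THEN conjunct1] g0[rule_format, of x, THEN conjunct2] by simp_all
  have "(g has_derivative (\<lambda>h. \<Sum>j. dird h (v j) x)) (at x)"
    using g(2) by (subst (asm) at_within_open) auto
  then show ?thesis
    by (rule has_derivative_transform_within_open[where s = "ball x 1"]) (use g(1) in \<open>auto simp: sums_iff\<close>)
qed

lemma smooth_family_sum:
  fixes v :: "nat \<Rightarrow> 'a::euclidean_space \<Rightarrow> complex"
  assumes "smooth_family v"
  shows "(\<lambda>x. \<Sum>j. v j x) \<in> smooth_functions"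
proof -
  define S where "S = {(\<lambda>x::'a. \<Sum>j. v j x) | v. smooth_family v}"
  show ?thesis
  proof (rule smooth_coinduct[of _ S])
    fix z assume "z \<in> S"
    then obtain v where "smooth_family v" "z = (\<lambda>x. \<Sum>j. v j x)" unfolding S_def by blast
    then show "\<exists>F. (\<forall>x. (z has_derivative F x) (at x)) \<and> (\<forall>d. (\<lambda>x. F x d) \<in> S)"
      by (intro exI[of _ "\<lambda>x h. \<Sum>j. dird h (v j) x"])
         (auto simp: S_def intro!: smooth_family_has_derivative exI[of _ "\<lambda>j. dird _ (v j)"] smooth_family_dird)
  qed (use assms in \<open>auto simp: S_def\<close>)
qed

lemma dird_suminf:
  fixes v :: "nat \<Rightarrow> 'a::euclidean_space \<Rightarrow> complex"
  assumes "smooth_family v"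
  shows "dird h (\<lambda>x. \<Sum>j. v j x) = (\<lambda>x. \<Sum>j. dird h (v j) x)"
  by (rule dird_eqI) (rule smooth_family_has_derivative[OF assms])

lemma dirds_suminf:
  fixes v :: "nat \<Rightarrow> 'a::euclidean_space \<Rightarrow> complex"
  assumes "smooth_family v"
  shows "dirds vs (\<lambda>x. \<Sum>j. v j x) = (\<lambda>x. \<Sum>j. dirds vs (v j) x)"
  using assms by (induction vs arbitrary: v) (auto simp: dird_suminf smooth_family_dird)

lemma smean_sums:
  fixes v :: "nat \<Rightarrow> 'a::euclidean_space \<Rightarrow> complex"
  assumes v: "smooth_family v" and w: "continuous_on UNIV w"
  shows "(\<lambda>j. LINT z|sph. w z * v j (x - s *\<^sub>R z)) sums (LINT z|sph. w z * (\<Sum>j. v j (x - s *\<^sub>R z)))"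
proof -
  obtain W where W: "W \<ge> 0" "\<And>x. norm x = 1 \<Longrightarrow> norm (w x) \<le> W"
    using continuous_bounded_sphere[OF w] by blast
  obtain M where M: "summable M" "\<And>j y. norm y \<le> norm x + \<bar>s\<bar> \<Longrightarrow> norm (v j y) \<le> M j"
    using smooth_family_bound[OF v, of "norm x + \<bar>s\<bar>"] by blast
  have WM: "summable (\<lambda>j. W * M j)" using M(1) by (rule summable_mult)
  have cv: "continuous_on UNIV (\<lambda>z. w z * v j (x - s *\<^sub>R z))" for j
    by (intro continuous_intros w continuous_smooth_compose[OF smooth_family_smooth[OF v]])
  have bd: "norm (w z * v j (x - s *\<^sub>R z)) \<le> W * M j" if "norm z = 1" for z j
    unfolding norm_mult
  proof (rule mult_mono)
    show "norm (v j (x - s *\<^sub>R z)) \<le> M j"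
      using norm_triangle_ineq4[of x "s *\<^sub>R z"] that by (intro M(2)) simp
  qed (use W that in auto)
  have "(\<lambda>j. LINT z|sph. w z * v j (x - s *\<^sub>R z)) sums (LINT z|sph. (\<Sum>j. w z * v j (x - s *\<^sub>R z)))"
  proof (rule sums_integral)
    show "integrable sph (\<lambda>z. w z * v j (x - s *\<^sub>R z))" for j
      by (rule integrable_sph_continuous[OF cv])
    have "summable (\<lambda>j. norm (w z * v j (x - s *\<^sub>R z)))" if "norm z = 1" for z
      by (rule summable_comparison_test'[OF WM, of 0]) (use bd[OF that] in simp)
    then show "AE z in sph. summable (\<lambda>j. norm (w z * v j (x - s *\<^sub>R z)))"
      by (rule eventually_mono[OF AE_sph])
    have "norm (LINT z|sph. norm (w z * v j (x - s *\<^sub>R z))) \<le> W * M j" for j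
    proof -
      have "norm (LINT z|sph. complex_of_real (norm (w z * v j (x - s *\<^sub>R z)))) \<le> W * M j"
      proof (rule norm_integral_sph_le)
        show "continuous_on UNIV (\<lambda>z. complex_of_real (norm (w z * v j (x - s *\<^sub>R z))))"
          by (intro continuous_on_of_real continuous_on_norm cv)
        show "norm (complex_of_real (norm (w z * v j (x - s *\<^sub>R z)))) \<le> W * M j" if "norm z = 1" for z
          using bd[OF that] by (simp only: norm_of_real abs_norm_cancel)
      qed
      then show ?thesis by (simp only: integral_complex_of_real norm_of_real real_norm_def)
    qed
    then show "summable (\<lambda>j. LINT z|sph. norm (w z * v j (x - s *\<^sub>R z)))"
      by (rule summable_comparison_test'[OF WM, of 0])
  qed
  moreover have "(\<Sum>j. w z * v j (x - s *\<^sub>R z)) = w z * (\<Sum>j. v j (x - s *\<^sub>R z))" for z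
    by (rule suminf_mult, rule summable_norm_cancel, rule smooth_family_summable, rule v)
  ultimately show ?thesis by (simp only:)
qed

lemma rmean_sums:
  fixes v :: "nat \<Rightarrow> 'a::euclidean_space \<Rightarrow> complex"
  assumes "smooth_family v" "continuous_on UNIV w"
  shows "(\<lambda>j. rmean l w (v j) s x) sums rmean l w (\<lambda>x. \<Sum>j. v j x) s x"
  using assms
proof (induction l arbitrary: v w)
  case 0
  show ?case unfolding rmean.simps(1) by (rule smean_sums[OF 0])
next
  case (Suc l)
  have "(\<lambda>j. rmean l (\<lambda>z. - of_real (z \<bullet> b) * w z) (dird b (v j)) s x) sums
    rmean l (\<lambda>z. - of_real (z \<bullet> b) * w z) (\<lambda>x. \<Sum>j. dird b (v j) x) s x" for b
    by (intro Suc.IH smooth_family_dird Suc.prems continuous_intros)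
  then show ?case
    unfolding rmean.simps(2) dird_suminf[OF Suc.prems(1)] by (intro sums_sum)
qed

lemma sphop_sums:
  fixes v :: "nat \<Rightarrow> 'a::euclidean_space \<Rightarrow> complex"
  assumes "r > 0" "smooth_family v"
  shows "(\<lambda>j. sphop l r (v j) x) sums sphop l r (\<lambda>x. \<Sum>j. v j x) x"
  using rmean_sums[OF assms(2), of "\<lambda>_. 1" l r x] assms
  by (simp add: sphop_eq smooth_family_smooth smooth_family_sum)

section \<open>Action on exponentials\<close>

text \<open>\<open>bsl a h k s\<close> is the \<open>k\<close>-th derivative of \<open>s \<mapsto> j (s \<surd>(\<zeta> \<cdot> \<zeta>))\<close>, where \<open>j\<close> is the
  normalised Bessel function, that is, the Fourier transform of the normalised surface measure.\<close>

definition bsl :: "'a::euclidean_space \<Rightarrow> 'a \<Rightarrow> nat \<Rightarrow> real \<Rightarrow> complex" where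
  "bsl a h k s = (LINT z|sph. (- cinner a h z) ^ k * expo a h (- (s *\<^sub>R z)))"

lemma continuous_cinner [continuous_intros]: "continuous_on S (cinner a h)"
  by (rule linear_continuous_on) (rule bounded_linear_cinner)

lemma bsl_has_vector_derivative: "(bsl a h k has_vector_derivative bsl a h (Suc k) s) (at s)"
proof -
  have "((\<lambda>s. LINT z|sph. (- cinner a h z) ^ k * expo a h (0 - s *\<^sub>R z)) has_vector_derivative
     (LINT z|sph. (- cinner a h z) ^ k * dird (- z) (expo a h) (0 - s *\<^sub>R z))) (at s)"
    by (rule smean_has_vector_derivative) (auto intro!: smooth_expo continuous_intros)
  then show ?thesis by (simp add: bsl_def[abs_def] dird_expo cinner_minus algebra_simps)
qed

text \<open>Translation of an exponential is multiplication by a constant, so exponentials are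
  eigenfunctions, also for complex frequencies.\<close>

lemma sphop_expo:
  assumes "r > 0"
  shows "sphop l r (expo a h) x = bsl a h l r * expo a h x"
proof -
  have "sphop l r (expo a h) x = (\<lambda>l s. expo a h x * bsl a h l s) l r"
    unfolding sphop_def convolve_def sphere_distribution_deriv_def
  proof (rule iterated_vector_derivative[OF _ _ assms])
    show "spherical_mean s (\<lambda>y. expo a h (x - y)) 0 = expo a h x * bsl a h 0 s" if "s > 0" for s
      by (subst spherical_mean_eq[OF that])
         (auto intro!: borel_measurable_continuous_onI continuous_smooth_compose[OF smooth_expo] continuous_intros
           simp: bsl_def expo_diff)
  qed (intro has_vector_derivative_mult_right bsl_has_vector_derivative)
  then show ?thesis by (simp add: mult.commute)
qed

section \<open>The Bessel equation\<close>

text \<open>Rotation by the angle \<open>t\<close> in the plane of the orthonormal vectors \<open>i\<close> and \<open>j\<close>.\<close>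

definition rot :: "'a::euclidean_space \<Rightarrow> 'a \<Rightarrow> real \<Rightarrow> 'a \<Rightarrow> 'a" where
  "rot i j t z = z + ((cos t - 1) * (z \<bullet> i) - sin t * (z \<bullet> j)) *\<^sub>R i
                   + (sin t * (z \<bullet> i) + (cos t - 1) * (z \<bullet> j)) *\<^sub>R j"

lemma linear_rot: "linear (rot i j t)"
  by (rule linearI) (auto simp: rot_def inner_add_left algebra_simps)

lemma norm_rot:
  assumes "i \<in> Basis" "j \<in> Basis" "i \<noteq> j"
  shows "norm (rot i j t z) = norm z"
proof -
  define \<alpha> \<beta> where "\<alpha> = (cos t - 1) * (z \<bullet> i) - sin t * (z \<bullet> j)"
    and "\<beta> = sin t * (z \<bullet> i) + (cos t - 1) * (z \<bullet> j)"
  have ij: "i \<bullet> i = 1" "j \<bullet> j = 1" "i \<bullet> j = 0" "j \<bullet> i = 0" using assms by (auto simp: inner_Basis)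
  have "rot i j t z = z + \<alpha> *\<^sub>R i + \<beta> *\<^sub>R j" by (simp add: rot_def \<alpha>_def \<beta>_def)
  then have "rot i j t z \<bullet> rot i j t z = z \<bullet> z + 2 * (\<alpha> * (z \<bullet> i) + \<beta> * (z \<bullet> j)) + (\<alpha>\<^sup>2 + \<beta>\<^sup>2)"
    by (simp add: inner_add_left inner_add_right ij inner_commute[of i z] inner_commute[of j z] power2_eq_square algebra_simps)
  also have "\<alpha>\<^sup>2 + \<beta>\<^sup>2 = ((cos t - 1)\<^sup>2 + (sin t)\<^sup>2) * ((z \<bullet> i)\<^sup>2 + (z \<bullet> j)\<^sup>2)"
    unfolding \<alpha>_def \<beta>_def by algebra
  also have "(cos t - 1)\<^sup>2 + (sin t)\<^sup>2 = 2 - 2 * cos t"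
    using sin_cos_squared_add[of t] by (simp add: power2_eq_square algebra_simps)
  also have "z \<bullet> z + 2 * (\<alpha> * (z \<bullet> i) + \<beta> * (z \<bullet> j)) + (2 - 2 * cos t) * ((z \<bullet> i)\<^sup>2 + (z \<bullet> j)\<^sup>2) = z \<bullet> z"
    by (simp add: \<alpha>_def \<beta>_def power2_eq_square algebra_simps)
  finally show ?thesis by (simp add: norm_eq_sqrt_inner)
qed

lemma abs_cos_minus_one_le: "\<bar>cos t - 1\<bar> \<le> \<bar>t\<bar>" for t :: real
proof -
  have "norm (cos t - cos 0) \<le> 1 * norm (t - 0)"
  proof (rule differentiable_bound[of UNIV cos "\<lambda>t h. - sin t * h"])
    show "(cos has_derivative (\<lambda>h. - sin x * h)) (at x within UNIV)" for x :: real
      by (rule has_derivative_eq_rhs[OF DERIV_cos[unfolded has_field_derivative_def]]) auto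
    show "onorm (\<lambda>h. - sin x * h) \<le> 1" for x :: real
      by (rule onorm_bound) (auto simp: abs_mult intro: mult_left_le_one_le)
  qed auto
  then show ?thesis by simp
qed

text \<open>The integral of \<open>f (rot i j t z)\<close> does not depend on \<open>t\<close>, and
  its derivative at \<open>t = 0\<close> is the integral of the generator of the rotation applied to
  \<open>f\<close>. This is integration by parts on the sphere.\<close>

lemma integral_sph_rotation:
  fixes f :: "'a::euclidean_space \<Rightarrow> complex"
  assumes f: "f \<in> smooth_functions" and ij: "i \<in> Basis" "j \<in> Basis" "i \<noteq> j"
  shows "(LINT z|sph. of_real (z \<bullet> i) * dird j f z - of_real (z \<bullet> j) * dird i f z) = 0"
proof -
  have "\<exists>B\<ge>0. (\<forall>x v. norm x \<le> 1 \<longrightarrow> norm (dird v f x) \<le> B * norm v) \<and>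
      (\<forall>x y. norm x \<le> 1 \<longrightarrow> norm y \<le> 1 \<longrightarrow> norm (f x - f y) \<le> B * norm (x - y))"
    by (rule smooth_bounds[OF f, of 1], rule exI, intro conjI allI impI) assumption+
  then obtain B where B: "B \<ge> 0" "\<forall>x v. norm x \<le> 1 \<longrightarrow> norm (dird v f x) \<le> B * norm v"
      "\<forall>x y. norm x \<le> 1 \<longrightarrow> norm y \<le> 1 \<longrightarrow> norm (f x - f y) \<le> B * norm (x - y)"
    by (elim exE conjE)
  have nij: "norm i = 1" "norm j = 1" using ij by auto
  define L where "L z = (z \<bullet> i) *\<^sub>R j - (z \<bullet> j) *\<^sub>R i" for z
  have rot0: "rot i j 0 z = z" for z by (simp add: rot_def)
  have zb: "\<bar>z \<bullet> i\<bar> \<le> 1" "\<bar>z \<bullet> j\<bar> \<le> 1" if "norm z = 1" for z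
    using Basis_le_norm[OF ij(1), of z] Basis_le_norm[OF ij(2), of z] that by auto
  have crot: "continuous_on UNIV (rot i j t)" for t
    unfolding rot_def by (intro continuous_intros)
  have cf: "continuous_on UNIV (\<lambda>z. f (rot i j t z))" for t
    by (rule continuous_smooth_compose[OF f crot])
  have cd: "continuous_on UNIV (\<lambda>z. dird (t *\<^sub>R L z) f z)" for t
    by (subst dird_basis[OF f]) (auto intro!: continuous_intros continuous_smooth_compose[OF smooth_dird[OF f]] simp: L_def)
  have nL: "norm (L z) \<le> 2" if "norm z = 1" for z
    unfolding L_def using norm_triangle_ineq4[of "(z \<bullet> i) *\<^sub>R j" "(z \<bullet> j) *\<^sub>R i"] zb[OF that] nij by simp
  have "((\<lambda>t. LINT z|sph. f (rot i j t z)) has_derivative (\<lambda>h. LINT z|sph. dird (h *\<^sub>R L z) f z)) (at 0)"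
  proof (rule has_derivative_integral[OF finite_measure_sph, where B = "B * 4"])
    show "(\<lambda>z. f (rot i j t z)) \<in> borel_measurable sph" for t
      using borel_measurable_continuous_onI[OF cf[of t]] by simp
    show "(\<lambda>z. dird (t *\<^sub>R L z) f z) \<in> borel_measurable sph" for t
      using borel_measurable_continuous_onI[OF cd[of t]] by simp
    show "integrable sph (\<lambda>z. f (rot i j t z))" for t by (rule integrable_sph_continuous[OF cf])
    have "((\<lambda>t. rot i j t z) has_derivative (\<lambda>h. h *\<^sub>R L z)) (at 0)" for z
      unfolding rot_def L_def by (auto intro!: derivative_eq_intros simp: algebra_simps)
    then have "((\<lambda>t. f (rot i j t z)) has_derivative (\<lambda>h. dird (h *\<^sub>R L z) f (rot i j 0 z))) (at 0)" for z
      by (rule smooth_has_derivative'[OF f])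
    then show "AE z in sph. ((\<lambda>t. f (rot i j t z)) has_derivative (\<lambda>h. dird (h *\<^sub>R L z) f z)) (at 0)"
      by (simp add: rot0)
    show "AE z in sph. \<forall>t\<in>ball 0 1. norm (f (rot i j t z) - f (rot i j 0 z)) \<le> B * 4 * norm (t - 0)"
    proof (rule eventually_mono[OF AE_sph], intro ballI)
      fix z t assume z: "norm (z::'a) = 1"
      have "norm (rot i j t z - z) \<le> norm (((cos t - 1) * (z \<bullet> i) - sin t * (z \<bullet> j)) *\<^sub>R i)
          + norm ((sin t * (z \<bullet> i) + (cos t - 1) * (z \<bullet> j)) *\<^sub>R j)"
        unfolding rot_def by (rule order_trans[OF _ norm_triangle_ineq]) simp
      also have "\<dots> = \<bar>(cos t - 1) * (z \<bullet> i) - sin t * (z \<bullet> j)\<bar> + \<bar>sin t * (z \<bullet> i) + (cos t - 1) * (z \<bullet> j)\<bar>"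
        using nij by simp
      also have "\<dots> \<le> (\<bar>cos t - 1\<bar> * \<bar>z \<bullet> i\<bar> + \<bar>sin t\<bar> * \<bar>z \<bullet> j\<bar>) + (\<bar>sin t\<bar> * \<bar>z \<bullet> i\<bar> + \<bar>cos t - 1\<bar> * \<bar>z \<bullet> j\<bar>)"
        unfolding abs_mult[symmetric] by (intro add_mono abs_triangle_ineq abs_triangle_ineq4)
      also have "\<dots> \<le> (\<bar>t\<bar> * 1 + \<bar>t\<bar> * 1) + (\<bar>t\<bar> * 1 + \<bar>t\<bar> * 1)"
        using abs_cos_minus_one_le[of t] abs_sin_x_le_abs_x[of t] zb[OF z] by (intro add_mono mult_mono) auto
      finally have "norm (rot i j t z - rot i j 0 z) \<le> 4 * \<bar>t\<bar>" by (simp add: rot0)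
      moreover have "norm (rot i j t z) \<le> 1" "norm (rot i j 0 z) \<le> 1" by (simp_all add: norm_rot[OF ij] z)
      ultimately have "norm (f (rot i j t z) - f (rot i j 0 z)) \<le> B * (4 * \<bar>t\<bar>)"
        using order_trans[OF B(3)[rule_format] mult_left_mono[OF _ B(1)]] by blast
      then show "norm (f (rot i j t z) - f (rot i j 0 z)) \<le> B * 4 * norm (t - 0)" by simp
    qed
    show "AE z in sph. \<forall>t. norm (dird (t *\<^sub>R L z) f z) \<le> B * 4 * norm t"
    proof (rule eventually_mono[OF AE_sph], intro allI)
      fix z t assume z: "norm (z::'a) = 1"
      have "norm (t *\<^sub>R L z) \<le> 4 * \<bar>t\<bar>"
        using mult_left_mono[OF nL[OF z], of "\<bar>t\<bar>"] by simp
      from order_trans[OF B(2)[rule_format, of z] mult_left_mono[OF this B(1)]]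
      show "norm (dird (t *\<^sub>R L z) f z) \<le> B * 4 * norm t" using z by simp
    qed
  qed
  moreover have "(LINT z|sph. f (rot i j t z)) = (LINT z|sph. f z)" for t
    by (rule integral_sph_isometry[OF linear_rot])
       (auto intro!: borel_measurable_continuous_onI smooth_continuous f norm_rot[OF ij])
  ultimately have "((\<lambda>t::real. LINT z|sph. f z) has_derivative (\<lambda>h. LINT z|sph. dird (h *\<^sub>R L z) f z)) (at 0)"
    by simp
  moreover have "((\<lambda>t::real. LINT z|sph. f z) has_derivative (\<lambda>h. 0)) (at 0)" by simp
  ultimately have "(\<lambda>h. LINT z|sph. dird (h *\<^sub>R L z) f z) = (\<lambda>h. 0)"
    by (rule has_derivative_unique)
  from fun_cong[OF this, of 1] have "(LINT z|sph. dird (L z) f z) = 0" by simp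
  moreover have "dird (L z) f z = of_real (z \<bullet> i) * dird j f z - of_real (z \<bullet> j) * dird i f z" for z
    using linear_diff[OF dird_linear[OF f, of z], of "(z \<bullet> i) *\<^sub>R j" "(z \<bullet> j) *\<^sub>R i"]
      linear_scale[OF dird_linear[OF f]] by (simp add: L_def scaleR_conv_of_real)
  ultimately show ?thesis by simp
qed

text \<open>\<open>csq a h\<close> is \<open>\<zeta> \<cdot> \<zeta>\<close> for \<open>\<zeta> = a - i h\<close>.\<close>

definition csq :: "'a::real_inner \<Rightarrow> 'a \<Rightarrow> complex" where
  "csq a h = Complex (a \<bullet> a - h \<bullet> h) (- 2 * (a \<bullet> h))"

lemma sum_cinner_squares:
  fixes a h :: "'a::euclidean_space"
  shows "(\<Sum>b\<in>Basis. (cinner a h b)\<^sup>2) = - csq a h"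
proof -
  have "Re (\<Sum>b\<in>Basis. (cinner a h b)\<^sup>2) = (\<Sum>b\<in>Basis. (h \<bullet> b) * (h \<bullet> b)) - (\<Sum>b\<in>Basis. (a \<bullet> b) * (a \<bullet> b))"
    by (simp add: cinner_def power2_eq_square sum_subtractf)
  moreover have "Im (\<Sum>b\<in>Basis. (cinner a h b)\<^sup>2) = 2 * (\<Sum>b\<in>Basis. (a \<bullet> b) * (h \<bullet> b))"
    by (simp add: cinner_def power2_eq_square sum_distrib_left mult_ac sum.distrib[symmetric])
  ultimately show ?thesis
    by (simp add: csq_def complex_eq_iff euclidean_inner[symmetric])
qed

lemma cinner_basis: "cinner a h z = (\<Sum>b\<in>Basis. of_real (z \<bullet> b) * cinner a h b)" for z :: "'a::euclidean_space"
proof -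
  have "cinner a h z = cinner a h (\<Sum>b\<in>Basis. (z \<bullet> b) *\<^sub>R b)" by (simp add: euclidean_representation)
  also have "\<dots> = (\<Sum>b\<in>Basis. cinner a h ((z \<bullet> b) *\<^sub>R b))"
    by (rule linear_sum) (rule bounded_linear.linear[OF bounded_linear_cinner])
  finally show ?thesis by (simp add: cinner_scaleR)
qed

text \<open>The integral over the sphere of the Laplace-Beltrami operator applied to the exponential
  is zero. The operator is a sum of squares of the rotation fields, so
  \<open>integral_sph_rotation\<close> applies to each plane; the sum over all planes is then
  expressed by \<open>z \<bullet> z = 1\<close>, \<open>cinner a h z\<close> and
  \<open>csq a h\<close>.\<close>

lemma bsl_ode_0:
  fixes a h :: "'a::euclidean_space"
  shows "of_real s * bsl a h 2 s + of_nat (DIM('a) - 1) * bsl a h 1 s + csq a h * (of_real s * bsl a h 0 s) = 0"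
proof -
  let ?k = "cinner a h"
  define E where "E z = expo a h (- (s *\<^sub>R z))" for z
  define E' where "E' = expo (- s *\<^sub>R a) (- s *\<^sub>R h)"
  have E': "E' z = E z" for z
    by (simp add: E'_def E_def expo_def cinner_minus cinner_scaleR cinner_alt algebra_simps)
  have dE: "dird v E' z = - of_real s * ?k v * E z" for v z
    using cinner_scaleR_left[of "-s" a h v] by (simp add: E'_def dird_expo flip: E')
  have cE: "continuous_on UNIV E" unfolding E'[symmetric, abs_def] E'_def by (rule smooth_continuous[OF smooth_expo])
  \<comment> \<open>The rotation field of the plane of \<open>i\<close> and \<open>j\<close> applied
    to \<open>g z * E z\<close>, with the linear form \<open>g\<close> introduced below. Applied to
    \<open>E\<close>, that field gives \<open>s * g z * E z\<close>; leaving out this factor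
    \<open>s\<close> avoids a division and includes \<open>s = 0\<close>.\<close>
  define T where "T i j z = (of_real (z \<bullet> i) * ?k i + of_real (z \<bullet> j) * ?k j) * E z
     + of_real s * (of_real (z \<bullet> i) * ?k j - of_real (z \<bullet> j) * ?k i)\<^sup>2 * E z" for i j z
  have cT: "continuous_on UNIV (T i j)" for i j
    unfolding T_def by (intro continuous_intros cE)
  have T0: "(LINT z|sph. T i j z) = 0" if ij: "i \<in> Basis" "j \<in> Basis" "i \<noteq> j" for i j
  proof -
    define g where "g z = (?k i * complex_of_real (z \<bullet> j) - ?k j * complex_of_real (z \<bullet> i))" for z
    have gd: "(g has_derivative (\<lambda>v. g v)) (at z)" for z
      unfolding g_def by (auto intro!: derivative_eq_intros)
    have g: "g \<in> smooth_functions"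
    proof (rule smooth_coinduct[of _ "insert g (range (\<lambda>c x. c))"])
      fix u assume "u \<in> insert g (range (\<lambda>c x. c))"
      then consider "u = g" | c where "u = (\<lambda>x. c)" by blast
      then show "\<exists>F. (\<forall>x. (u has_derivative F x) (at x)) \<and> (\<forall>v. (\<lambda>x. F x v) \<in> insert g (range (\<lambda>c x. c)))"
      proof cases
        case 1 then show ?thesis using gd by (intro exI[of _ "\<lambda>x v. g v"]) auto
      next
        case 2 then show ?thesis by (intro exI[of _ "\<lambda>x v. 0"]) auto
      qed
    qed simp
    have dg: "dird v g = (\<lambda>x. g v)" for v by (rule dird_eqI) (rule gd)
    have E's: "E' \<in> smooth_functions" unfolding E'_def by (rule smooth_expo)
    have gij: "g j = ?k i" "g i = - ?k j" using ij by (auto simp: g_def inner_Basis)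
    have "(LINT z|sph. of_real (z \<bullet> i) * dird j (\<lambda>z. g z * E' z) z - of_real (z \<bullet> j) * dird i (\<lambda>z. g z * E' z) z) = 0"
      by (rule integral_sph_rotation[OF smooth_mult[OF g E's] ij])
    moreover have "of_real (z \<bullet> i) * dird j (\<lambda>z. g z * E' z) z - of_real (z \<bullet> j) * dird i (\<lambda>z. g z * E' z) z = T i j z" for z
      by (simp only: dird_mult[OF g E's] dg gij dE, simp only: E')
         (simp add: T_def g_def power2_eq_square algebra_simps)
    ultimately show ?thesis by simp
  qed
  have S: "(\<Sum>i\<in>Basis. \<Sum>j\<in>Basis - {i}. T i j z) =
     2 * (of_nat (DIM('a) - 1) * ?k z + of_real s * (of_real (z \<bullet> z) * (- csq a h) - (?k z)\<^sup>2)) * E z" for z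
  proof -
    define x where "x b = complex_of_real (z \<bullet> b)" for b
    have k: "?k z = (\<Sum>b\<in>Basis. x b * ?k b)" unfolding x_def by (rule cinner_basis)
    have zz: "complex_of_real (z \<bullet> z) = (\<Sum>b\<in>Basis. (x b)\<^sup>2)"
      by (subst euclidean_inner) (simp add: x_def power2_eq_square)
    have 1: "(\<Sum>i\<in>Basis. \<Sum>j\<in>Basis - {i}. x i * ?k i + x j * ?k j) = 2 * (of_nat (DIM('a) - 1) * ?k z)"
    proof -
      have "(\<Sum>j\<in>Basis - {i}. x i * ?k i + x j * ?k j) = of_nat DIM('a) * (x i * ?k i) + ?k z - 2 * (x i * ?k i)"
        if "i \<in> Basis" for i
        using that by (simp add: sum.distrib sum_diff1 k algebra_simps of_nat_diff)
      then have "(\<Sum>i\<in>Basis. \<Sum>j\<in>Basis - {i}. x i * ?k i + x j * ?k j) =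
         (\<Sum>i\<in>Basis. of_nat DIM('a) * (x i * ?k i) + ?k z - 2 * (x i * ?k i))" by simp
      also have "\<dots> = of_nat DIM('a) * ?k z + of_nat DIM('a) * ?k z - 2 * ?k z"
        unfolding sum_subtractf sum.distrib sum_distrib_left[symmetric] k[symmetric] by simp
      also have "\<dots> = 2 * (of_nat (DIM('a) - 1) * ?k z)"
        by (simp add: of_nat_diff algebra_simps)
      finally show ?thesis .
    qed
    \<comment> \<open>Lagrange's identity for ordered pairs; the diagonal terms vanish.\<close>
    have 2: "(\<Sum>i\<in>Basis. \<Sum>j\<in>Basis - {i}. (x i * ?k j - x j * ?k i)\<^sup>2) = 2 * ((\<Sum>b\<in>Basis. (x b)\<^sup>2) * (- csq a h) - (?k z)\<^sup>2)"
    proof -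
      have "(\<Sum>j\<in>Basis - {i}. (x i * ?k j - x j * ?k i)\<^sup>2) = (\<Sum>j\<in>Basis. (x i * ?k j - x j * ?k i)\<^sup>2)" if "i \<in> Basis" for i
        using that by (simp add: sum_diff1)
      then have "(\<Sum>i\<in>Basis. \<Sum>j\<in>Basis - {i}. (x i * ?k j - x j * ?k i)\<^sup>2) = (\<Sum>i\<in>Basis. \<Sum>j\<in>Basis. (x i * ?k j - x j * ?k i)\<^sup>2)"
        by simp
      also have "\<dots> = (\<Sum>i\<in>Basis. \<Sum>j\<in>Basis. (x i)\<^sup>2 * (?k j)\<^sup>2 + (?k i)\<^sup>2 * (x j)\<^sup>2 - 2 * ((x i * ?k i) * (x j * ?k j)))"
        by (intro sum.cong refl) (simp add: power2_eq_square algebra_simps)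
      also have "\<dots> = (\<Sum>i\<in>Basis. (x i)\<^sup>2) * (\<Sum>j\<in>Basis. (?k j)\<^sup>2) + (\<Sum>i\<in>Basis. (?k i)\<^sup>2) * (\<Sum>j\<in>Basis. (x j)\<^sup>2)
         - 2 * (?k z * ?k z)"
        unfolding sum_subtractf sum.distrib sum_distrib_left[symmetric] sum_distrib_right[symmetric] k by (rule refl)
      finally show ?thesis
        by (rule trans) (simp add: sum_cinner_squares power2_eq_square[of "cinner a h z"] algebra_simps)
    qed
    have "(\<Sum>i\<in>Basis. \<Sum>j\<in>Basis - {i}. T i j z) = ((\<Sum>i\<in>Basis. \<Sum>j\<in>Basis - {i}. x i * ?k i + x j * ?k j)
       + of_real s * (\<Sum>i\<in>Basis. \<Sum>j\<in>Basis - {i}. (x i * ?k j - x j * ?k i)\<^sup>2)) * E z"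
      unfolding T_def x_def by (simp add: sum.distrib sum_distrib_left sum_distrib_right distrib_right mult.assoc)
    then show ?thesis unfolding 1 2 zz by (simp add: algebra_simps)
  qed
  have "0 = (\<Sum>i\<in>Basis. \<Sum>j\<in>Basis - {i}. (LINT z|sph. T i j z))"
    by (rule sym, intro sum.neutral ballI) (use T0 in auto)
  also have "\<dots> = (LINT z|sph. (\<Sum>i\<in>Basis. \<Sum>j\<in>Basis - {i}. T i j z))"
    using integrable_sph_continuous[OF cT] by (simp add: Bochner_Integration.integral_sum Bochner_Integration.integrable_sum)
  \<comment> \<open>Almost everywhere \<open>z \<bullet> z = 1\<close>, which turns the coefficient
    of \<open>csq a h\<close> into a constant.\<close>
  also have "\<dots> = (LINT z|sph. 2 * (of_nat (DIM('a) - 1) * (?k z * E z)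
       + of_real s * ((- csq a h) * E z - (?k z)\<^sup>2 * E z)))"
    unfolding S
  proof (rule integral_cong_AE)
    show "(\<lambda>z. 2 * (of_nat (DIM('a) - 1) * ?k z + of_real s * (of_real (z \<bullet> z) * (- csq a h) - (?k z)\<^sup>2)) * E z)
       \<in> borel_measurable sph"
      using borel_measurable_continuous_onI[of "\<lambda>z. 2 * (of_nat (DIM('a) - 1) * ?k z + of_real s * (of_real (z \<bullet> z) * (- csq a h) - (?k z)\<^sup>2)) * E z"]
      by (simp add: continuous_intros cE)
    show "(\<lambda>z. 2 * (of_nat (DIM('a) - 1) * (?k z * E z) + of_real s * ((- csq a h) * E z - (?k z)\<^sup>2 * E z)))
       \<in> borel_measurable sph"
      using borel_measurable_continuous_onI[of "\<lambda>z. 2 * (of_nat (DIM('a) - 1) * (?k z * E z) + of_real s * ((- csq a h) * E z - (?k z)\<^sup>2 * E z))"]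
      by (simp add: continuous_intros cE)
  qed (rule eventually_mono[OF AE_sph], simp add: dot_square_norm algebra_simps)
  also have "\<dots> = 2 * (of_nat (DIM('a) - 1) * (LINT z|sph. ?k z * E z)
       + of_real s * ((- csq a h) * (LINT z|sph. E z) - (LINT z|sph. (?k z)\<^sup>2 * E z)))"
  proof -
    have i: "integrable sph (\<lambda>z. ?k z * E z)" "integrable sph E" "integrable sph (\<lambda>z. (?k z)\<^sup>2 * E z)"
      by (rule integrable_sph_continuous; intro continuous_intros cE)+
    show ?thesis using i by simp
  qed
  also have "(LINT z|sph. ?k z * E z) = - bsl a h 1 s" by (simp add: bsl_def E_def)
  also have "(LINT z|sph. E z) = bsl a h 0 s" by (simp add: bsl_def E_def)
  also have "(LINT z|sph. (?k z)\<^sup>2 * E z) = bsl a h 2 s" by (simp add: bsl_def E_def)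
  finally have "0 = 2 * (of_nat (DIM('a) - 1) * - bsl a h 1 s
    + of_real s * (- csq a h * bsl a h 0 s - bsl a h 2 s))" .
  then have "of_nat (DIM('a) - 1) * - bsl a h 1 s + of_real s * (- csq a h * bsl a h 0 s - bsl a h 2 s) = 0"
    by (metis mult_eq_0_iff zero_neq_numeral)
  then show ?thesis by algebra
qed

text \<open>The Bessel equation differentiated \<open>k\<close> times. For \<open>k = 0\<close> the
  index \<open>k - 1\<close> is truncated, but its coefficient is zero.\<close>

lemma bsl_ode:
  fixes a h :: "'a::euclidean_space"
  shows "of_real s * bsl a h (k + 2) s + of_nat (k + (DIM('a) - 1)) * bsl a h (k + 1) s
    + csq a h * (of_real s * bsl a h k s + of_nat k * bsl a h (k - 1) s) = 0"
proof (induction k arbitrary: s)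
  case 0
  then show ?case using bsl_ode_0[of s a h] by (simp add: numeral_2_eq_2)
next
  case (Suc k)
  define m where "m = DIM('a) - 1"
  note IH = Suc.IH[folded m_def]
  let ?L = "\<lambda>s. of_real s * bsl a h (k + 2) s + of_nat (k + m) * bsl a h (k + 1) s
    + csq a h * (of_real s * bsl a h k s + of_nat k * bsl a h (k - 1) s)"
  have d: "(bsl a h i has_vector_derivative bsl a h (Suc i) s) (at s)" for i by (rule bsl_has_vector_derivative)
  have m: "((\<lambda>s. of_real s * bsl a h i s) has_vector_derivative (of_real s * bsl a h (Suc i) s + bsl a h i s)) (at s)" for i
    using has_vector_derivative_mult[OF has_vector_derivative_of_real[OF DERIV_ident[unfolded has_real_derivative_iff_has_vector_derivative]] d[of i]]
    by (simp add: add.commute)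
  have "(?L has_vector_derivative (of_real s * bsl a h (Suc (k + 2)) s + bsl a h (k + 2) s)
     + of_nat (k + m) * bsl a h (Suc (k + 1)) s
    + csq a h * ((of_real s * bsl a h (Suc k) s + bsl a h k s) + of_nat k * bsl a h (Suc (k - 1)) s)) (at s)"
    by (intro has_vector_derivative_add has_vector_derivative_mult_right m d)
  moreover have "?L = (\<lambda>s. 0)" using IH by (simp add: fun_eq_iff)
  ultimately have "((\<lambda>s::real. 0::complex) has_vector_derivative (of_real s * bsl a h (Suc (k + 2)) s + bsl a h (k + 2) s)
     + of_nat (k + m) * bsl a h (Suc (k + 1)) s
    + csq a h * ((of_real s * bsl a h (Suc k) s + bsl a h k s) + of_nat k * bsl a h (Suc (k - 1)) s)) (at s)" by simp
  then have "(of_real s * bsl a h (Suc (k + 2)) s + bsl a h (k + 2) s)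
     + of_nat (k + m) * bsl a h (Suc (k + 1)) s
    + csq a h * ((of_real s * bsl a h (Suc k) s + bsl a h k s) + of_nat k * bsl a h (Suc (k - 1)) s) = 0"
    using vector_derivative_unique_at[OF _ has_vector_derivative_const] by blast
  then show ?case unfolding m_def[symmetric] by (cases k) (simp_all add: algebra_simps)
qed

lemma bsl_1_0: "bsl a h 1 0 = 0" for a h :: "'a::euclidean_space"
proof -
  have "(LINT z|sph. - cinner a h (- z)) = (LINT z|sph. - cinner a h z)"
    by (rule integral_sph_isometry[where f = uminus and g = "\<lambda>z. - cinner a h z"])
       (auto intro!: borel_measurable_continuous_onI continuous_intros linear_uminus simp: linear_iff)
  then show ?thesis by (simp add: bsl_def cinner_minus)
qed

lemma norm_bsl_real_le: "norm (bsl a 0 k s) \<le> norm a ^ k" for a :: "'a::euclidean_space"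
  unfolding bsl_def
proof (rule norm_integral_sph_le)
  have cE: "continuous_on UNIV (\<lambda>z. expo a 0 (- (s *\<^sub>R z)))"
    by (rule continuous_smooth_compose[OF smooth_expo]) (intro continuous_intros)
  show "continuous_on UNIV (\<lambda>z. (- cinner a 0 z) ^ k * expo a 0 (- (s *\<^sub>R z)))"
    by (intro continuous_intros cE)
  show "norm ((- cinner a 0 w) ^ k * expo a 0 (- (s *\<^sub>R w))) \<le> norm a ^ k" if "norm w = 1" for w
    using norm_cinner[of a 0 w] that by (simp add: norm_mult norm_power norm_expo power_mono)
qed

text \<open>The integrand is the exponential of a number of modulus at most 1/4, hence within 1/2 of
  1, because \<open>exp (1/4)\<close> is at most 2. This is the value from which the energy estimate
  starts.\<close>

lemma bsl_near_0:
  fixes a h :: "'a::euclidean_space"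
  assumes "s \<ge> 0" "s * (norm a + norm h) \<le> 1/4"
  shows "norm (bsl a h 0 s) \<ge> 1/2"
proof -
  interpret finite_measure "sph :: 'a measure" by (rule finite_measure_sph)
  have cE: "continuous_on UNIV (\<lambda>z. expo a h (- (s *\<^sub>R z)))"
    by (rule continuous_smooth_compose[OF smooth_expo]) (intro continuous_intros)
  have "norm (LINT z|sph. expo a h (- (s *\<^sub>R z)) - 1) \<le> 1/2"
  proof (rule norm_integral_sph_le)
    fix w :: 'a assume w: "norm w = 1"
    let ?y = "cinner a h (- (s *\<^sub>R w))"
    have y: "norm ?y \<le> 1/4"
    proof -
      have "norm ?y \<le> (norm a + norm h) * norm (- (s *\<^sub>R w))" by (rule norm_cinner)
      also have "\<dots> = s * (norm a + norm h)" using assms(1) w by simp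
      finally show ?thesis using assms(2) by linarith
    qed
    have "norm (exp ?y - exp 0) \<le> exp (1/4) * norm (?y - 0)"
    proof (rule differentiable_bound[of "cball 0 (1/4)" exp "\<lambda>x h. h * exp x"])
      show "onorm (\<lambda>h. h * exp x) \<le> exp (1/4)" if "x \<in> cball 0 (1/4)" for x :: complex
      proof (rule onorm_bound)
        have "norm (exp x) \<le> exp (1/4)"
          using that complex_Re_le_cmod[of x] by simp
        then show "norm (h * exp x) \<le> exp (1/4) * norm h" for h
          by (simp only: norm_mult mult.commute[of "norm h"] mult_right_mono norm_ge_zero)
      qed simp
    qed (use y in \<open>auto intro!: derivative_eq_intros\<close>)
    also have "\<dots> \<le> 2 * (1/4)"
      using y exp_bound_half[of "1/4::real"] by (intro mult_mono) (auto intro: order_trans[OF exp_bound])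
    finally show "norm (expo a h (- (s *\<^sub>R w)) - 1) \<le> 1/2" by (simp add: expo_def)
  qed (intro continuous_intros cE)
  moreover have "(LINT z|sph. expo a h (- (s *\<^sub>R z)) - 1) = bsl a h 0 s - 1"
    using integrable_sph_continuous[OF cE] measure_sph_UNIV[where 'a='a] by (simp add: bsl_def)
  ultimately have "norm (bsl a h 0 s - 1) \<le> 1/2" by simp
  then show ?thesis using norm_triangle_ineq2[of 1 "1 - bsl a h 0 s"] by (simp add: norm_minus_commute)
qed

section \<open>Lower bounds for solutions of the Bessel equation\<close>

text \<open>For \<open>j = x0 + i y0\<close>, \<open>q = p + i k\<close> and
  \<open>j'' + v j' + q^2 j = 0\<close>, the energy and the quantity later called \<open>D\<close>
  satisfy \<open>W' = k D - 2 v |j'|^2\<close> and \<open>D' = 4 k W - v D\<close>. In real and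
  imaginary parts these are polynomial identities.\<close>

lemma energy_derivatives:
  fixes x0 y0 x1 y1 :: "real \<Rightarrow> real"
  assumes d: "(x0 has_real_derivative x1 s) (at s)" "(y0 has_real_derivative y1 s) (at s)"
    "(x1 has_real_derivative x2) (at s)" "(y1 has_real_derivative y2) (at s)"
    and e: "x2 = - v * x1 s - ((p\<^sup>2 - k\<^sup>2) * x0 s - 2 * p * k * y0 s)"
    "y2 = - v * y1 s - ((p\<^sup>2 - k\<^sup>2) * y0 s + 2 * p * k * x0 s)"
  shows "((\<lambda>s. (x1 s)\<^sup>2 + (y1 s)\<^sup>2 + (p\<^sup>2 + k\<^sup>2) * ((x0 s)\<^sup>2 + (y0 s)\<^sup>2)) has_real_derivative
     k * (4 * (x1 s * (p * y0 s + k * x0 s) - y1 s * (p * x0 s - k * y0 s))) - 2 * v * ((x1 s)\<^sup>2 + (y1 s)\<^sup>2)) (at s)"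
   "((\<lambda>s. 4 * (x1 s * (p * y0 s + k * x0 s) - y1 s * (p * x0 s - k * y0 s))) has_real_derivative
     4 * k * ((x1 s)\<^sup>2 + (y1 s)\<^sup>2 + (p\<^sup>2 + k\<^sup>2) * ((x0 s)\<^sup>2 + (y0 s)\<^sup>2))
     - v * (4 * (x1 s * (p * y0 s + k * x0 s) - y1 s * (p * x0 s - k * y0 s)))) (at s)"
proof -
  have "((\<lambda>s. (x1 s)\<^sup>2 + (y1 s)\<^sup>2 + (p\<^sup>2 + k\<^sup>2) * ((x0 s)\<^sup>2 + (y0 s)\<^sup>2)) has_real_derivative
     2 * x1 s * x2 + 2 * y1 s * y2 + (p\<^sup>2 + k\<^sup>2) * (2 * x0 s * x1 s + 2 * y0 s * y1 s)) (at s)"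
    by (auto intro!: derivative_eq_intros d)
  then show "((\<lambda>s. (x1 s)\<^sup>2 + (y1 s)\<^sup>2 + (p\<^sup>2 + k\<^sup>2) * ((x0 s)\<^sup>2 + (y0 s)\<^sup>2)) has_real_derivative
     k * (4 * (x1 s * (p * y0 s + k * x0 s) - y1 s * (p * x0 s - k * y0 s))) - 2 * v * ((x1 s)\<^sup>2 + (y1 s)\<^sup>2)) (at s)"
    by (rule DERIV_cong) (unfold e, algebra)
  have "((\<lambda>s. 4 * (x1 s * (p * y0 s + k * x0 s) - y1 s * (p * x0 s - k * y0 s))) has_real_derivative
     4 * ((x2 * (p * y0 s + k * x0 s) + x1 s * (p * y1 s + k * x1 s))
      - (y2 * (p * x0 s - k * y0 s) + y1 s * (p * x1 s - k * y1 s)))) (at s)"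
    by (auto intro!: derivative_eq_intros d simp: algebra_simps)
  then show "((\<lambda>s. 4 * (x1 s * (p * y0 s + k * x0 s) - y1 s * (p * x0 s - k * y0 s))) has_real_derivative
     4 * k * ((x1 s)\<^sup>2 + (y1 s)\<^sup>2 + (p\<^sup>2 + k\<^sup>2) * ((x0 s)\<^sup>2 + (y0 s)\<^sup>2))
     - v * (4 * (x1 s * (p * y0 s + k * x0 s) - y1 s * (p * x0 s - k * y0 s)))) (at s)"
    by (rule DERIV_cong) (unfold e, algebra)
qed

text \<open>The equation is multiplied by \<open>s\<close>, so that it makes sense at the singular
  point 0, where \<open>init\<close> expresses regularity. Of the two square roots of the spectral
  parameter, \<open>q\<close> is one in the closed upper half plane.\<close>

locale bessel_eq =
  fixes j0 j1 j2 :: "real \<Rightarrow> complex" and q :: complex and m :: nat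
  assumes d0: "(j0 has_vector_derivative j1 s) (at s)"
    and d1: "(j1 has_vector_derivative j2 s) (at s)"
    and ode: "of_real s * j2 s + of_nat m * j1 s + q\<^sup>2 * (of_real s * j0 s) = 0"
    and init: "j1 0 = 0"
    and kappa: "Im q \<ge> 0"
begin

definition "W s = (cmod (j1 s))\<^sup>2 + (cmod q)\<^sup>2 * (cmod (j0 s))\<^sup>2"
text \<open>This is \<open>|j1 - i q j0|^2 - |j1 + i q j0|^2\<close>, the energy of the wave
  \<open>exp (- i q s)\<close>, which grows when \<open>Im q > 0\<close>, minus that of the decaying
  wave \<open>exp (i q s)\<close>.\<close>

definition "D s = 4 * (Re (j1 s) * (Re q * Im (j0 s) + Im q * Re (j0 s)) - Im (j1 s) * (Re q * Re (j0 s) - Im q * Im (j0 s)))"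

lemma W_alt: "W s = (Re (j1 s))\<^sup>2 + (Im (j1 s))\<^sup>2 + ((Re q)\<^sup>2 + (Im q)\<^sup>2) * ((Re (j0 s))\<^sup>2 + (Im (j0 s))\<^sup>2)"
  by (simp add: W_def cmod_power2)

lemma W_nonneg: "W s \<ge> 0" by (simp add: W_def)

lemma der:
  "((\<lambda>s. Re (j0 s)) has_real_derivative Re (j1 s)) (at s)" "((\<lambda>s. Im (j0 s)) has_real_derivative Im (j1 s)) (at s)"
  "((\<lambda>s. Re (j1 s)) has_real_derivative Re (j2 s)) (at s)" "((\<lambda>s. Im (j1 s)) has_real_derivative Im (j2 s)) (at s)"
  unfolding has_real_derivative_iff_has_vector_derivative
  using d0[of s] d1[of s]
  by (auto intro: bounded_linear.has_vector_derivative[OF bounded_linear_Re] bounded_linear.has_vector_derivative[OF bounded_linear_Im])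

lemma second:
  assumes "s > 0"
  shows "Re (j2 s) = - (m / s) * Re (j1 s) - (((Re q)\<^sup>2 - (Im q)\<^sup>2) * Re (j0 s) - 2 * Re q * Im q * Im (j0 s))"
    and "Im (j2 s) = - (m / s) * Im (j1 s) - (((Re q)\<^sup>2 - (Im q)\<^sup>2) * Im (j0 s) + 2 * Re q * Im q * Re (j0 s))"
proof -
  have "of_real s * (j2 s + of_real (m / s) * j1 s + q\<^sup>2 * j0 s) = 0"
    using ode[of s] assms by (simp add: algebra_simps)
  then have e: "j2 s + of_real (m / s) * j1 s + q\<^sup>2 * j0 s = 0" using assms by simp
  from arg_cong[OF e, of Re] show "Re (j2 s) = - (m / s) * Re (j1 s) - (((Re q)\<^sup>2 - (Im q)\<^sup>2) * Re (j0 s) - 2 * Re q * Im q * Im (j0 s))"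
    by (simp add: power2_eq_square algebra_simps)
  from arg_cong[OF e, of Im] show "Im (j2 s) = - (m / s) * Im (j1 s) - (((Re q)\<^sup>2 - (Im q)\<^sup>2) * Im (j0 s) + 2 * Re q * Im q * Re (j0 s))"
    by (simp add: power2_eq_square algebra_simps)
qed

lemma W_deriv:
  assumes "s > 0"
  shows "(W has_real_derivative Im q * D s - 2 * (m / s) * (cmod (j1 s))\<^sup>2) (at s)"
  using energy_derivatives(1)[OF der second[OF assms]]
  unfolding W_alt[abs_def] D_def cmod_power2 by simp

lemma D_deriv:
  assumes "s > 0"
  shows "(D has_real_derivative 4 * Im q * W s - (m / s) * D s) (at s)"
  using energy_derivatives(2)[OF der second[OF assms]]
  unfolding W_alt D_def[abs_def] by simp

text \<open>The factor \<open>s ^ m\<close> removes the damping term, so \<open>s ^ m * D s\<close>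
  is nondecreasing, and it vanishes at 0 by regularity. The derivative is known for
  \<open>s > 0\<close> only; continuity gives the comparison with the value at 0.\<close>

lemma D_nonneg:
  assumes "s > 0" shows "D s \<ge> 0"
proof -
  let ?G = "\<lambda>s. s ^ m * D s"
  have dG: "(?G has_real_derivative s ^ m * (4 * Im q * W s)) (at s)" if "s > 0" for s
  proof -
    have "(?G has_real_derivative s ^ m * (4 * Im q * W s - (m / s) * D s) + (real m * s ^ (m - 1)) * D s) (at s)"
      using that by (auto intro!: derivative_eq_intros D_deriv)
    then show ?thesis
    proof (rule DERIV_cong)
      have e: "real m * s ^ (m - 1) = s ^ m * (m / s)" using that by (cases m) auto
      show "s ^ m * (4 * Im q * W s - (m / s) * D s) + (real m * s ^ (m - 1)) * D s = s ^ m * (4 * Im q * W s)"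
        unfolding e by (simp add: algebra_simps)
    qed
  qed
  have cont: "isCont ?G s" for s
    unfolding D_def
    using der[THEN DERIV_isCont] by (intro continuous_intros) auto
  have "?G t \<le> ?G s" if "0 < t" "t \<le> s" for t
  proof (rule DERIV_nonneg_imp_nondecreasing[OF that(2)])
    fix x assume "t \<le> x" "x \<le> s"
    then have x: "x > 0" using that by linarith
    have "0 \<le> x ^ m * (4 * Im q * W x)" using x kappa W_nonneg[of x] by simp
    then show "\<exists>y. (?G has_real_derivative y) (at x) \<and> 0 \<le> y" using dG[OF x] by blast
  qed
  then have "\<forall>\<^sub>F t in at_right 0. ?G t \<le> ?G s"
    using assms by (auto simp: eventually_at_right_field intro!: exI[of _ s])
  moreover have "(?G \<longlongrightarrow> ?G 0) (at_right 0)"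
    using cont[of 0] by (auto simp: isCont_def intro: tendsto_within_subset)
  ultimately have "?G 0 \<le> ?G s"
    by (intro tendsto_upperbound[where F = "at_right 0"]) auto
  moreover have "?G 0 = 0" by (simp add: D_def init)
  ultimately have "0 \<le> s ^ m * D s" by linarith
  then show ?thesis using assms by (metis zero_le_mult_iff zero_less_power not_le)
qed

text \<open>The damping costs at most \<open>2 (m / s) W\<close>, which the factor
  \<open>s ^ (2 * m)\<close> compensates; the remaining term \<open>Im q * D\<close> is
  nonnegative.\<close>

lemma W_mono:
  assumes "0 < t" "t \<le> s"
  shows "t ^ (2 * m) * W t \<le> s ^ (2 * m) * W s"
proof (rule DERIV_nonneg_imp_nondecreasing[OF assms(2)])
  fix x assume x: "t \<le> x" "x \<le> s"
  then have x0: "x > 0" using assms by linarith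
  have "((\<lambda>s. s ^ (2 * m) * W s) has_real_derivative x ^ (2 * m) * (Im q * D x - 2 * (m / x) * (cmod (j1 x))\<^sup>2)
      + (real (2 * m) * x ^ (2 * m - 1)) * W x) (at x)"
    by (auto intro!: derivative_eq_intros W_deriv x0)
  moreover have "x ^ (2 * m) * (Im q * D x - 2 * (m / x) * (cmod (j1 x))\<^sup>2) + (real (2 * m) * x ^ (2 * m - 1)) * W x \<ge> 0"
  proof -
    have e: "real (2 * m) * x ^ (2 * m - 1) = x ^ (2 * m) * (2 * (m / x))" using x0 by (cases m) auto
    have "x ^ (2 * m) * (Im q * D x - 2 * (m / x) * (cmod (j1 x))\<^sup>2) + (real (2 * m) * x ^ (2 * m - 1)) * W x
       = x ^ (2 * m) * (Im q * D x + 2 * (m / x) * ((cmod q)\<^sup>2 * (cmod (j0 x))\<^sup>2))"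
      unfolding e W_def by (simp add: algebra_simps)
    also have "\<dots> \<ge> 0" using x0 D_nonneg[OF x0] kappa by (intro mult_nonneg_nonneg add_nonneg_nonneg) auto
    finally show ?thesis .
  qed
  ultimately show "\<exists>y. ((\<lambda>s. s ^ (2 * m) * W s) has_real_derivative y) (at x) \<and> 0 \<le> y" by blast
qed

text \<open>For large \<open>Im q\<close> the growing wave dominates at \<open>r\<close>. As
  \<open>D\<close> is at most a multiple of \<open>|j1| |q| |j0|\<close>, this bounds function and
  derivative below separately, which the energy alone does not.\<close>

lemma D_ge_W:
  assumes r: "r > 0" and k: "2 * real m / r \<le> 3 * Im q" "exp (- 2 * Im q * r) * 4 ^ m \<le> 1/2"
  shows "D r \<ge> W r / 2"
proof -
  let ?k = "Im q"
  \<comment> \<open>The weight cancels the term \<open>4 * Im q * W\<close> in the derivative of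
    \<open>D\<close>; what is left is nonnegative as soon as \<open>m / x \<le> 3 * Im q\<close>,
    and this holds on the interval from \<open>r / 2\<close> to \<open>r\<close>.\<close>
  let ?F = "\<lambda>s. exp (4 * ?k * s) * (D s - W s)"
  have "?F (r/2) \<le> ?F r"
  proof (rule DERIV_nonneg_imp_nondecreasing[of "r / 2" r ?F])
    fix x assume x: "r / 2 \<le> x" "x \<le> r"
    then have x0: "x > 0" using r by linarith
    let ?X' = "(4 * ?k * W x - (m / x) * D x) - (?k * D x - 2 * (m / x) * (cmod (j1 x))\<^sup>2)"
    have "(?F has_real_derivative exp (4 * ?k * x) * ?X' + exp (4 * ?k * x) * (4 * ?k) * (D x - W x)) (at x)"
      by (auto intro!: derivative_eq_intros W_deriv D_deriv x0)
    then have "(?F has_real_derivative exp (4 * ?k * x) * ((3 * ?k - m / x) * D x + 2 * (m / x) * (cmod (j1 x))\<^sup>2)) (at x)"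
      by (rule DERIV_cong) (simp add: algebra_simps)
    moreover have "m / x \<le> 3 * ?k"
    proof -
      have "real m / x \<le> real m / (r / 2)" using x r by (intro divide_left_mono) auto
      then show ?thesis using k(1) by (simp add: mult.commute)
    qed
    then have "exp (4 * ?k * x) * ((3 * ?k - m / x) * D x + 2 * (m / x) * (cmod (j1 x))\<^sup>2) \<ge> 0"
      using D_nonneg[OF x0] x0 by (intro mult_nonneg_nonneg add_nonneg_nonneg) auto
    ultimately show "\<exists>y. (?F has_real_derivative y) (at x) \<and> 0 \<le> y" by blast
  qed (use r in simp)
  \<comment> \<open>At \<open>r / 2\<close>, \<open>D\<close> is nonnegative and \<open>W\<close> is
    at most \<open>4 ^ m * W r\<close>. This loss carries only \<open>exp (2 * Im q * r)\<close>,
    half the exponent of the weight at \<open>r\<close>.\<close>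
  moreover have "?F (r/2) \<ge> - (exp (2 * ?k * r) * (4 ^ m * W r))"
  proof -
    have "(r / 2) ^ (2 * m) * W (r / 2) \<le> r ^ (2 * m) * W r" by (rule W_mono) (use r in auto)
    also have "r ^ (2 * m) = 4 ^ m * (r / 2) ^ (2 * m)"
      by (simp add: power_divide power_mult)
    finally have "W (r / 2) \<le> 4 ^ m * W r" using r by (simp add: mult_ac)
    then have "D (r/2) - W (r/2) \<ge> - (4 ^ m * W r)" using D_nonneg[of "r/2"] r by linarith
    then show ?thesis using mult_left_mono[of "- (4 ^ m * W r)" "D (r/2) - W (r/2)" "exp (4 * ?k * (r/2))"] by (simp add: mult.commute mult.left_commute)
  qed
  ultimately have "exp (4 * ?k * r) * (D r - W r) \<ge> - (exp (2 * ?k * r) * (4 ^ m * W r))" by linarith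
  then have "exp (- 4 * ?k * r) * (exp (4 * ?k * r) * (D r - W r)) \<ge> exp (- 4 * ?k * r) * (- (exp (2 * ?k * r) * (4 ^ m * W r)))"
    by (intro mult_left_mono) auto
  moreover have "exp (- 4 * ?k * r) * (exp (4 * ?k * r) * (D r - W r)) = D r - W r"
    by (simp add: mult.assoc[symmetric] exp_add[symmetric])
  moreover have "exp (- 4 * ?k * r) * (- (exp (2 * ?k * r) * (4 ^ m * W r))) = - (exp (- 2 * ?k * r) * 4 ^ m * W r)"
    by (simp add: mult.assoc[symmetric] exp_add[symmetric])
  moreover have "exp (- 2 * ?k * r) * 4 ^ m * W r \<le> 1/2 * W r" by (rule mult_right_mono[OF k(2) W_nonneg])
  ultimately show ?thesis by linarith
qed

lemma D_le: "D s \<le> 4 * (cmod (j1 s) * (cmod q * cmod (j0 s)))"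
proof -
  have "D s = - 4 * Re (j1 s * cnj (\<i> * q * j0 s))" by (simp add: D_def algebra_simps)
  also have "\<dots> \<le> 4 * cmod (j1 s * cnj (\<i> * q * j0 s))" using abs_Re_le_cmod[of "j1 s * cnj (\<i> * q * j0 s)"] by simp
  finally show ?thesis by (simp add: norm_mult)
qed

end

lemma bessel_eq_bsl:
  fixes a h :: "'a::euclidean_space"
  assumes "q\<^sup>2 = csq a h" "Im q \<ge> 0"
  shows "bessel_eq (bsl a h 0) (bsl a h 1) (bsl a h 2) q (DIM('a) - 1)"
proof
  show "(bsl a h 0 has_vector_derivative bsl a h 1 s) (at s)" "(bsl a h 1 has_vector_derivative bsl a h 2 s) (at s)" for s
    using bsl_has_vector_derivative[of a h 0 s] bsl_has_vector_derivative[of a h 1 s] by (simp_all add: numeral_2_eq_2)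
qed (use bsl_ode_0[of _ a h] assms bsl_1_0[of a h] in auto)

text \<open>At a radius \<open>t\<close> of order \<open>1 / (1 + norm a + norm h)\<close> the
  solution still has modulus at least 1/2, so its energy is at least \<open>|q|^2 / 4\<close>.
  \<open>W_mono\<close> carries this to \<open>s\<close> with the loss
  \<open>(t / s) ^ (2 * m)\<close>, polynomial in the frequency.\<close>

lemma bsl_energy_bound:
  fixes a h :: "'a::euclidean_space"
  assumes q: "q\<^sup>2 = csq a h" "Im q \<ge> 0" and r: "r > 0" and s: "s \<ge> r" 
  shows "(cmod (bsl a h 1 s))\<^sup>2 + (cmod q)\<^sup>2 * (cmod (bsl a h 0 s))\<^sup>2 \<ge>
     (cmod q / 2 * (min r (1/4) / s / (1 + norm a + norm h)) ^ (DIM('a) - 1))\<^sup>2"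
proof -
  interpret bessel_eq "bsl a h 0" "bsl a h 1" "bsl a h 2" q "DIM('a) - 1" by (rule bessel_eq_bsl[OF q])
  let ?m = "DIM('a) - 1"
  define N where "N = 1 + norm a + norm h"
  have N: "N \<ge> 1" by (simp add: N_def)
  define t where "t = min r (1/4) / N"
  have t: "t > 0" "t \<le> s" "t * (norm a + norm h) \<le> 1/4"
  proof -
    show "t > 0" using r N by (simp add: t_def)
    have "min r (1/4) * 1 \<le> min r (1/4) * N" using N r by (intro mult_left_mono) auto
    then have "t \<le> min r (1/4)" unfolding t_def using N by (subst pos_divide_le_eq) auto
    then show "t \<le> s" using s by simp
    have "min r (1/4) * (norm a + norm h) \<le> 1/4 * N" unfolding N_def using r by (intro mult_mono) auto
    then have "min r (1/4) * (norm a + norm h) / N \<le> 1/4" using N by (subst pos_divide_le_eq) auto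
    then show "t * (norm a + norm h) \<le> 1/4" by (simp add: t_def)
  qed
  have s0: "s > 0" using r s by linarith
  have "1/2 \<le> cmod (bsl a h 0 t)" by (rule bsl_near_0) (use t in auto)
  then have "(1/2)\<^sup>2 \<le> (cmod (bsl a h 0 t))\<^sup>2" by (intro power_mono) auto
  then have "(cmod q)\<^sup>2 * (1/4) \<le> (cmod q)\<^sup>2 * (cmod (bsl a h 0 t))\<^sup>2"
    by (intro mult_left_mono) (auto simp: power2_eq_square)
  then have Wt: "(cmod q)\<^sup>2 / 4 \<le> W t" unfolding W_def using zero_le_power2[of "cmod (bsl a h 1 t)"] by linarith
  have "t ^ (2 * ?m) * ((cmod q)\<^sup>2 / 4) \<le> t ^ (2 * ?m) * W t" using Wt t by (intro mult_left_mono) auto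
  also have "\<dots> \<le> s ^ (2 * ?m) * W s" by (rule W_mono[OF t(1,2)])
  finally have "t ^ (2 * ?m) * ((cmod q)\<^sup>2 / 4) / s ^ (2 * ?m) \<le> W s"
    using s0 by (simp add: pos_divide_le_eq mult.commute mult.left_commute)
  moreover have "t ^ (2 * ?m) * ((cmod q)\<^sup>2 / 4) / s ^ (2 * ?m) = (cmod q / 2 * (t / s) ^ ?m)\<^sup>2"
    by (simp add: power_mult_distrib power_divide power_mult[symmetric] mult.commute)
  ultimately have "(cmod q / 2 * (t / s) ^ ?m)\<^sup>2 \<le> W s" by simp
  moreover have "t / s = min r (1/4) / s / (1 + norm a + norm h)" by (simp add: t_def N_def mult.commute)
  ultimately show ?thesis unfolding W_def by (simp only:)
qed

text \<open>The Bessel equation and its derivatives make the normalised derivatives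
  \<open>y\<^sub>k = bsl a h k s / q ^ k\<close> almost periodic in \<open>k\<close> up to sign, when \<open>1 / |q|\<close> is small.\<close>

definition almost_periodic :: "(nat \<Rightarrow> real) \<Rightarrow> (nat \<Rightarrow> complex) \<Rightarrow> real \<Rightarrow> real \<Rightarrow> bool" where
  "almost_periodic A y w c \<longleftrightarrow> 0 \<le> w \<and> 0 \<le> c \<and> c \<le> 1 \<and> cmod (y 0) \<le> w \<and> cmod (y 1) \<le> w \<and>
     (\<forall>k. cmod (y (k + 2) + y k) \<le> A k * c * (cmod (y (k + 1)) + cmod (y (k - 1))))"

text \<open>The recurrence says that \<open>y (k + 2)\<close> is close to \<open>- y k\<close>, so
  the moduli repeat with period 2 up to an error of order \<open>c * w\<close>. The constant depends
  on \<open>k\<close> and \<open>A\<close> only, hence is uniform in frequency and radius.\<close>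

lemma recurrence_bound:
  assumes A: "\<And>k. A k \<ge> 0"
  shows "\<exists>C\<ge>0. \<forall>y w c. almost_periodic A y w c \<longrightarrow>
     cmod (y k) \<le> C * w \<and> \<bar>cmod (y k) - cmod (y (k mod 2))\<bar> \<le> C * c * w"
proof (induction k rule: less_induct)
  case (less k)
  show ?case
  proof (cases "k < 2")
    case True
    then have "k = 0 \<or> k = 1" by auto
    then show ?thesis by (intro exI[of _ 1]) (auto simp: almost_periodic_def)
  next
    case False
    define l where "l = k - 2"
    have k: "k = l + 2" using False by (simp add: l_def)
    have lt: "l < k" "l + 1 < k" "l - 1 < k" using k by auto
    from less.IH[OF lt(1)] obtain C0 where C0: "C0 \<ge> 0" "\<forall>y w c. almost_periodic A y w c \<longrightarrow>
     cmod (y l) \<le> C0 * w \<and> \<bar>cmod (y l) - cmod (y (l mod 2))\<bar> \<le> C0 * c * w" by (elim exE conjE)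
    from less.IH[OF lt(2)] obtain C1 where C1: "C1 \<ge> 0" "\<forall>y w c. almost_periodic A y w c \<longrightarrow>
     cmod (y (l + 1)) \<le> C1 * w \<and> \<bar>cmod (y (l + 1)) - cmod (y ((l + 1) mod 2))\<bar> \<le> C1 * c * w" by (elim exE conjE)
    from less.IH[OF lt(3)] obtain C2 where C2: "C2 \<ge> 0" "\<forall>y w c. almost_periodic A y w c \<longrightarrow>
     cmod (y (l - 1)) \<le> C2 * w \<and> \<bar>cmod (y (l - 1)) - cmod (y ((l - 1) mod 2))\<bar> \<le> C2 * c * w" by (elim exE conjE)
    define C where "C = C0 + A l * (C1 + C2)"
    have C: "C \<ge> 0" "C0 \<le> C" unfolding C_def using A[of l] C0(1) C1(1) C2(1) by auto
    show ?thesis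
    proof (rule exI[of _ C], intro conjI allI impI C(1))
      fix y w c assume h: "almost_periodic A y w c"
      have w: "0 \<le> w" "0 \<le> c" "c \<le> 1" using h by (simp_all add: almost_periodic_def)
      have b0: "cmod (y l) \<le> C0 * w" "\<bar>cmod (y l) - cmod (y (l mod 2))\<bar> \<le> C0 * c * w" using C0(2) h by blast+
      have b1: "cmod (y (l + 1)) \<le> C1 * w" using C1(2) h by blast
      have b2: "cmod (y (l - 1)) \<le> C2 * w" using C2(2) h by blast
      have "cmod (y (l + 2) + y l) \<le> A l * c * (cmod (y (l + 1)) + cmod (y (l - 1)))"
        using h unfolding almost_periodic_def by blast
      also have "\<dots> \<le> A l * c * (C1 * w + C2 * w)"
        using b1 b2 A[of l] w by (intro mult_left_mono add_mono) auto
      finally have e: "cmod (y (l + 2) + y l) \<le> A l * (C1 + C2) * c * w" by (simp add: algebra_simps)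
      have dif: "\<bar>cmod (y (l + 2)) - cmod (y l)\<bar> \<le> A l * (C1 + C2) * c * w"
        using e norm_triangle_ineq3[of "y (l + 2)" "- y l"] by simp
      have "A l * (C1 + C2) * c * w \<le> A l * (C1 + C2) * 1 * w"
        using A[of l] C1(1) C2(1) w by (intro mult_right_mono mult_left_mono) auto
      then have "cmod (y (l + 2)) \<le> C0 * w + A l * (C1 + C2) * w"
        using dif b0(1) by linarith
      then show "cmod (y k) \<le> C * w"
        unfolding k C_def by (simp add: algebra_simps)
      have "k mod 2 = l mod 2" by (simp add: k)
      moreover have "\<bar>cmod (y (l + 2)) - cmod (y (l mod 2))\<bar> \<le> C0 * c * w + A l * (C1 + C2) * c * w"
        using dif b0(2) by linarith
      ultimately show "\<bar>cmod (y k) - cmod (y (k mod 2))\<bar> \<le> C * c * w"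
        unfolding k C_def by (simp add: algebra_simps)
    qed
  qed
qed

text \<open>Dividing \<open>bsl_ode\<close> by \<open>s * q ^ (k + 2)\<close> leaves
  \<open>y (k + 2) + y k\<close> plus terms of size \<open>1 / (s |q|)\<close>.\<close>

lemma bsl_recurrence:
  fixes a h :: "'a::euclidean_space"
  assumes q: "q\<^sup>2 = csq a h" "q \<noteq> 0" and r: "r > 0" "s \<ge> r"
  defines "y \<equiv> \<lambda>k. bsl a h k s / q ^ k"
  shows "cmod (y (k + 2) + y k) \<le> real (k + DIM('a)) / r * (1 / cmod q) * (cmod (y (k + 1)) + cmod (y (k - 1)))"
proof -
  let ?m = "DIM('a) - 1"
  have s: "s > 0" using r by linarith
  have b: "bsl a h k s = q ^ k * y k" for k using q(2) by (simp add: y_def)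
  have "q ^ (k + 1) * (of_real s * q * (y (k + 2) + y k) + of_nat (k + ?m) * y (k + 1) + of_nat k * y (k - 1)) = 0"
    using bsl_ode[of s a h k] unfolding q(1)[symmetric] b
    by (cases k) (simp_all add: power2_eq_square algebra_simps)
  then have "of_real s * q * (y (k + 2) + y k) = - (of_nat (k + ?m) * y (k + 1) + of_nat k * y (k - 1))"
    using q(2) by (simp only: mult_eq_0_iff power_eq_0_iff eq_neg_iff_add_eq_0 add.assoc) simp
  then have "s * cmod q * cmod (y (k + 2) + y k) = cmod (of_nat (k + ?m) * y (k + 1) + of_nat k * y (k - 1))"
    using s by (metis abs_of_pos norm_minus_cancel norm_mult norm_of_real)
  also have "\<dots> \<le> real (k + ?m) * cmod (y (k + 1)) + real k * cmod (y (k - 1))"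
    by (rule order_trans[OF norm_triangle_ineq]) (simp add: norm_mult)
  also have "\<dots> \<le> real (k + DIM('a)) * cmod (y (k + 1)) + real (k + DIM('a)) * cmod (y (k - 1))"
    by (intro add_mono mult_right_mono) auto
  finally have 1: "s * cmod q * cmod (y (k + 2) + y k) \<le> real (k + DIM('a)) * (cmod (y (k + 1)) + cmod (y (k - 1)))"
    by (simp add: algebra_simps)
  have "r * cmod q * cmod (y (k + 2) + y k) \<le> s * cmod q * cmod (y (k + 2) + y k)"
    using r by (intro mult_right_mono) auto
  then have "r * cmod q * cmod (y (k + 2) + y k) \<le> real (k + DIM('a)) * (cmod (y (k + 1)) + cmod (y (k - 1)))"
    using 1 by linarith
  then show ?thesis using r q(2) by (simp add: field_simps)
qed

text \<open>Reduces the \<open>l\<close>-th derivative to the function or its first derivative,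
  according to the parity of \<open>l\<close>; these two are what the energy controls.\<close>

lemma bsl_almost_periodic:
  assumes r: "r > 0"
  shows "\<exists>C\<ge>0. \<forall>(a::'a::euclidean_space) h q s w. q\<^sup>2 = csq a h \<and> cmod q \<ge> 1 \<and> s \<ge> r \<and> w \<ge> 0 \<and>
      cmod (bsl a h 0 s) \<le> w \<and> cmod (bsl a h 1 s) \<le> cmod q * w \<longrightarrow>
      \<bar>cmod (bsl a h l s) / cmod q ^ l - cmod (bsl a h (l mod 2) s) / cmod q ^ (l mod 2)\<bar> \<le> C * w / cmod q"
proof -
  let ?A = "\<lambda>k. real (k + DIM('a)) / r"
  have "\<exists>C\<ge>0. \<forall>y w c. almost_periodic ?A y w c \<longrightarrow>
     cmod (y l) \<le> C * w \<and> \<bar>cmod (y l) - cmod (y (l mod 2))\<bar> \<le> C * c * w"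
    by (rule recurrence_bound) (use r in auto)
  then obtain C where C: "C \<ge> 0" "\<forall>y w c. almost_periodic ?A y w c \<longrightarrow>
     cmod (y l) \<le> C * w \<and> \<bar>cmod (y l) - cmod (y (l mod 2))\<bar> \<le> C * c * w" by (elim exE conjE)
  show ?thesis
  proof (rule exI[of _ C], intro conjI allI impI C(1))
    fix a h :: 'a and q s w
    assume "q\<^sup>2 = csq a h \<and> cmod q \<ge> 1 \<and> s \<ge> r \<and> w \<ge> 0 \<and> cmod (bsl a h 0 s) \<le> w \<and> cmod (bsl a h 1 s) \<le> cmod q * w"
    then have h: "q\<^sup>2 = csq a h" "cmod q \<ge> 1" "s \<ge> r" "w \<ge> 0" "cmod (bsl a h 0 s) \<le> w" "cmod (bsl a h 1 s) \<le> cmod q * w"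
      by simp_all
    have q0: "q \<noteq> 0" using h(2) by auto
    let ?y = "\<lambda>k. bsl a h k s / q ^ k"
    have y: "cmod (?y 0) \<le> w" "cmod (?y 1) \<le> w"
      using h(5,6) q0 by (simp_all add: norm_divide pos_divide_le_eq mult.commute)
    have q1: "0 \<le> 1 / cmod q" "1 / cmod q \<le> 1" using h(2) by (auto simp: divide_le_eq)
    have "almost_periodic ?A ?y w (1 / cmod q)"
      unfolding almost_periodic_def by (intro conjI allI h(4) y q1 bsl_recurrence[OF h(1) q0 r h(3)])
    with C(2) have "\<bar>cmod (?y l) - cmod (?y (l mod 2))\<bar> \<le> C * (1 / cmod q) * w" by blast
    then show "\<bar>cmod (bsl a h l s) / cmod q ^ l - cmod (bsl a h (l mod 2) s) / cmod q ^ (l mod 2)\<bar> \<le> C * w / cmod q"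
      by (simp add: norm_divide norm_power)
  qed
qed

text \<open>For the moduli \<open>A\<close> and \<open>B\<close> of \<open>j1\<close> and
  \<open>q * j0\<close>, the inequalities \<open>W / 2 \<le> D \<le> 4 A B\<close> give
  \<open>A^2 + B^2 \<le> 8 A B\<close>. Hence both are comparable to the root of the energy, and
  either parity of \<open>l\<close> is covered.\<close>

lemma bsl_lower_bound_complex:
  assumes r: "r > 0"
  obtains K c where "c > 0" "K > 0" "\<And>(a::'a::euclidean_space) h q. q\<^sup>2 = csq a h \<Longrightarrow> Im q \<ge> K \<Longrightarrow>
      cmod (bsl a h l r) \<ge> c / (1 + norm a + norm h) ^ (DIM('a) - 1)"
proof -
  let ?m = "DIM('a) - 1"
  from bsl_almost_periodic[OF r, where 'a='a and l = "l"] obtain C where C0: "C \<ge> 0"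
    and C1: "\<forall>(a::'a) h q s w. q\<^sup>2 = csq a h \<and> cmod q \<ge> 1 \<and> s \<ge> r \<and> w \<ge> 0 \<and>
      cmod (bsl a h 0 s) \<le> w \<and> cmod (bsl a h 1 s) \<le> cmod q * w \<longrightarrow>
      \<bar>cmod (bsl a h l s) / cmod q ^ l - cmod (bsl a h (l mod 2) s) / cmod q ^ (l mod 2)\<bar> \<le> C * w / cmod q"
    by (elim exE conjE)
  \<comment> \<open>1 gives \<open>cmod q \<ge> 1\<close>, \<open>18 * C\<close> keeps the error of
    \<open>bsl_almost_periodic\<close> below \<open>w / 18\<close>, and the last two entries are the
    hypotheses of \<open>D_ge_W\<close>.\<close>
  define K where "K = max (max 1 (18 * C)) (max (2 * real ?m / (3 * r)) (ln (2 * 4 ^ ?m) / (2 * r)))"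
  \<comment> \<open>1/36 is 1/18, left from \<open>w / 9 - w / 18\<close>, times the 1/2 in
    \<open>bsl_energy_bound\<close>.\<close>
  define c where "c = (1/36) * (min r (1/4) / r) ^ ?m"
  show thesis
  proof (rule that[of c K])
    show "c > 0" unfolding c_def using r by auto
    show "K > 0" unfolding K_def by auto
    fix a h :: 'a and q assume q: "q\<^sup>2 = csq a h" "Im q \<ge> K"
    have q1: "Im q \<ge> 1" "Im q \<ge> 18 * C" "Im q \<ge> 2 * real ?m / (3 * r)" "Im q \<ge> ln (2 * 4 ^ ?m) / (2 * r)"
      using q(2) unfolding K_def by simp_all
    have cq: "cmod q \<ge> Im q" using abs_Im_le_cmod[of q] by linarith
    interpret bessel_eq "bsl a h 0" "bsl a h 1" "bsl a h 2" q ?m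
      by (rule bessel_eq_bsl[OF q(1)]) (use q1 in linarith)
    define w where "w = sqrt (W r) / cmod q"
    have q0: "cmod q \<ge> 1" using q1 cq by linarith
    have w0: "w \<ge> 0" using W_nonneg q0 by (auto simp: w_def)
    have W: "W r = (cmod q * w)\<^sup>2" using q0 W_nonneg[of r] by (auto simp: w_def)
    define A B where "A = cmod (bsl a h 1 r)" and "B = cmod q * cmod (bsl a h 0 r)"
    have AB: "A \<ge> 0" "B \<ge> 0" "A\<^sup>2 + B\<^sup>2 = (cmod q * w)\<^sup>2"
      using W unfolding A_def B_def W_def by (simp_all add: power_mult_distrib)
    have Dr: "D r \<ge> W r / 2"
    proof (rule D_ge_W[OF r])
      show "2 * real ?m / r \<le> 3 * Im q" using q1(3) r by (simp add: field_simps)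
      have "ln (2 * 4 ^ ?m) \<le> 2 * Im q * r" using q1(4) r by (simp add: field_simps)
      then have "2 * 4 ^ ?m \<le> exp (2 * Im q * r)"
        using exp_le_cancel_iff[of "ln (2 * 4 ^ ?m)" "2 * Im q * r"] by (simp del: exp_le_cancel_iff)
      then show "exp (- 2 * Im q * r) * 4 ^ ?m \<le> 1/2" by (simp add: exp_minus field_simps)
    qed
    have ab: "A\<^sup>2 + B\<^sup>2 \<le> 8 * (A * B)" using Dr D_le[of r] unfolding W_def A_def B_def by (simp add: power_mult_distrib)
    \<comment> \<open>Two numbers with \<open>x^2 + z^2 \<le> 8 x z\<close> differ at most by a
      factor 8, so \<open>x^2 + z^2 \<le> 65 x^2\<close>, which is below
      \<open>(9 x)^2\<close>.\<close>
    have ge: "x \<ge> cmod q * w / 9" if "x \<ge> 0" "z \<ge> 0" "x\<^sup>2 + z\<^sup>2 = (cmod q * w)\<^sup>2" "x\<^sup>2 + z\<^sup>2 \<le> 8 * (x * z)" for x z :: real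
    proof -
      have "z \<le> 8 * x"
      proof (rule ccontr)
        assume "\<not> z \<le> 8 * x"
        then have "z * (8 * x) < z * z" using that by (intro mult_strict_left_mono) auto
        moreover have "z * (8 * x) = 8 * (x * z)" by simp
        ultimately show False using that(4) zero_le_power2[of x] unfolding power2_eq_square by linarith
      qed
      then have "z\<^sup>2 \<le> (8 * x)\<^sup>2" using that by (intro power_mono) auto
      moreover have "(9 * x)\<^sup>2 = 81 * x\<^sup>2" "(8 * x)\<^sup>2 = 64 * x\<^sup>2" by (simp_all add: power_mult_distrib)
      ultimately have "(cmod q * w)\<^sup>2 \<le> (9 * x)\<^sup>2" using that(3) zero_le_power2[of x] by linarith
      then have "cmod q * w \<le> 9 * x" by (rule power2_le_imp_le) (use that in auto)
      then show ?thesis by simp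
    qed
    have Age: "A \<ge> cmod q * w / 9" using ge[of A B] AB ab by auto
    have Bge: "B \<ge> cmod q * w / 9" using ge[of B A] AB ab by (auto simp: mult.commute add.commute)
    have "l mod 2 = 0 \<or> l mod 2 = 1" by auto
    then have l2: "cmod (bsl a h (l mod 2) r) / cmod q ^ (l mod 2) \<ge> w / 9"
    proof
      have "cmod q * (w / 9) \<le> cmod q * cmod (bsl a h 0 r)" using Bge by (simp add: B_def)
      then have "w / 9 \<le> cmod (bsl a h 0 r)" by (rule mult_left_le_imp_le) (use q0 in linarith)
      then show ?thesis if "l mod 2 = 0" using that by simp
      have "w / 9 \<le> cmod (bsl a h 1 r) / cmod q"
        using Age q0 unfolding A_def by (subst pos_le_divide_eq) (auto simp: mult.commute)
      then show ?thesis if "l mod 2 = 1" unfolding that by simp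
    qed
    have qw: "0 \<le> cmod q * w" using w0 by simp
    have AB2: "A\<^sup>2 \<le> (cmod q * w)\<^sup>2" "B\<^sup>2 \<le> (cmod q * w)\<^sup>2"
      using AB(3) zero_le_power2[of A] zero_le_power2[of B] by linarith+
    note Aq = power2_le_imp_le[OF AB2(1) qw] and Bq = power2_le_imp_le[OF AB2(2) qw]
    have Bw: "cmod (bsl a h 0 r) \<le> w"
      using Bq unfolding B_def by (rule mult_left_le_imp_le) (use q0 in linarith)
    have "\<bar>cmod (bsl a h l r) / cmod q ^ l - cmod (bsl a h (l mod 2) r) / cmod q ^ (l mod 2)\<bar> \<le> C * w / cmod q"
      using q0 w0 q(1) Bw Aq unfolding A_def by (intro C1[rule_format] conjI) simp_all
    moreover have "C * w / cmod q \<le> w / 18"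
    proof -
      have "18 * C * w \<le> cmod q * w" using q1(2) cq w0 by (intro mult_right_mono) auto
      moreover have "cmod q > 0" using q0 by linarith
      ultimately show ?thesis by (simp add: field_simps)
    qed
    ultimately have "cmod (bsl a h l r) / cmod q ^ l \<ge> w / 18" using l2 by linarith
    moreover have "cmod q ^ l > 0" using q0 by (intro zero_less_power) linarith
    ultimately have "cmod (bsl a h l r) \<ge> w / 18 * cmod q ^ l" by (subst (asm) pos_le_divide_eq)
    moreover have "w / 18 * cmod q ^ l \<ge> w / 18 * 1" using q0 w0 by (intro mult_left_mono) auto
    ultimately have 1: "cmod (bsl a h l r) \<ge> w / 18" by linarith
    have "(cmod q / 2 * (min r (1/4) / r / (1 + norm a + norm h)) ^ ?m)\<^sup>2 \<le> (cmod q * w)\<^sup>2"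
      using bsl_energy_bound[OF q(1) _ r order_refl] q1 W unfolding W_def by simp
    then have "cmod q / 2 * (min r (1/4) / r / (1 + norm a + norm h)) ^ ?m \<le> cmod q * w"
      by (rule power2_le_imp_le) (use q0 w0 in auto)
    then have "cmod q * ((1/2) * (min r (1/4) / r / (1 + norm a + norm h)) ^ ?m) \<le> cmod q * w" by simp
    then have "(1/2) * (min r (1/4) / r / (1 + norm a + norm h)) ^ ?m \<le> w"
      by (rule mult_left_le_imp_le) (use q0 in linarith)
    then have "(1/36) * (min r (1/4) / r / (1 + norm a + norm h)) ^ ?m \<le> cmod (bsl a h l r)" using 1 by linarith
    then show "c / (1 + norm a + norm h) ^ ?m \<le> cmod (bsl a h l r)"
      unfolding c_def power_divide[of _ "1 + norm a + norm h"] by simp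
  qed
qed

lemma csq_real: "csq a 0 = of_real ((norm a)\<^sup>2)"
  by (simp add: csq_def complex_eq_iff dot_square_norm)

lemma bsl_energy_bound_real:
  fixes a :: "'a::euclidean_space"
  assumes "r > 0" "s \<in> {r..2*r}"
  defines "w \<equiv> sqrt ((cmod (bsl a 0 1 s))\<^sup>2 + (norm a)\<^sup>2 * (cmod (bsl a 0 0 s))\<^sup>2) / norm a"
  assumes a: "norm a > 0"
  shows "w \<ge> 1/2 * (min r (1/4) / (2 * r) / (1 + norm a)) ^ (DIM('a) - 1)"
proof -
  have "(norm a / 2 * (min r (1/4) / s / (1 + norm a)) ^ (DIM('a) - 1))\<^sup>2 \<le>
     (cmod (bsl a 0 1 s))\<^sup>2 + (norm a)\<^sup>2 * (cmod (bsl a 0 0 s))\<^sup>2"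
    using bsl_energy_bound[of "of_real (norm a)" a 0 r s] assms by (simp add: csq_real)
  from real_sqrt_le_mono[OF this]
  have "norm a / 2 * (min r (1/4) / s / (1 + norm a)) ^ (DIM('a) - 1) \<le> norm a * w"
    using assms by (simp add: w_def real_sqrt_abs)
  then have "norm a * (1 / 2 * (min r (1/4) / s / (1 + norm a)) ^ (DIM('a) - 1)) \<le> norm a * w" by simp
  then have "1 / 2 * (min r (1/4) / s / (1 + norm a)) ^ (DIM('a) - 1) \<le> w"
    by (rule mult_left_le_imp_le[OF _ a])
  moreover have "(min r (1/4) / (2 * r) / (1 + norm a)) ^ (DIM('a) - 1) \<le> (min r (1/4) / s / (1 + norm a)) ^ (DIM('a) - 1)"
    using assms by (intro power_mono divide_right_mono divide_left_mono) auto
  ultimately show ?thesis by linarith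
qed

text \<open>For real frequencies the energy makes only one of \<open>|j0|\<close> and
  \<open>|j1| / |a|\<close> large. The orders \<open>l\<close> and \<open>Suc l\<close> have
  opposite parity, so one of the two derivatives inherits the bound: where the multiplier is small,
  its radial derivative is not.\<close>

lemma bsl_lower_bound_real:
  assumes r: "r > 0"
  obtains K c where "c > 0" "K \<ge> 1" "\<And>(a::'a::euclidean_space) s. norm a \<ge> K \<Longrightarrow> s \<in> {r..2*r} \<Longrightarrow>
      cmod (bsl a 0 l s) \<ge> c / (1 + norm a) ^ (DIM('a) - 1) \<or> cmod (bsl a 0 (Suc l) s) \<ge> c / (1 + norm a) ^ (DIM('a) - 1)"
proof -
  let ?m = "DIM('a) - 1"
  from bsl_almost_periodic[OF r, where 'a='a and l = "l"] obtain C where C0: "C \<ge> 0"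
    and C1: "\<forall>(a::'a) h q s w. q\<^sup>2 = csq a h \<and> cmod q \<ge> 1 \<and> s \<ge> r \<and> w \<ge> 0 \<and>
      cmod (bsl a h 0 s) \<le> w \<and> cmod (bsl a h 1 s) \<le> cmod q * w \<longrightarrow>
      \<bar>cmod (bsl a h l s) / cmod q ^ l - cmod (bsl a h (l mod 2) s) / cmod q ^ (l mod 2)\<bar> \<le> C * w / cmod q"
    by (elim exE conjE)
  from bsl_almost_periodic[OF r, where 'a='a and l = "Suc l"] obtain C' where C'0: "C' \<ge> 0"
    and C'1: "\<forall>(a::'a) h q s w. q\<^sup>2 = csq a h \<and> cmod q \<ge> 1 \<and> s \<ge> r \<and> w \<ge> 0 \<and>
      cmod (bsl a h 0 s) \<le> w \<and> cmod (bsl a h 1 s) \<le> cmod q * w \<longrightarrow>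
      \<bar>cmod (bsl a h (Suc l) s) / cmod q ^ Suc l - cmod (bsl a h (Suc l mod 2) s) / cmod q ^ (Suc l mod 2)\<bar> \<le> C' * w / cmod q"
    by (elim exE conjE)
  \<comment> \<open>With \<open>4 * C\<close> and \<open>4 * C'\<close> both errors are at most
    \<open>w / 4\<close>, half of the lower bound \<open>w / 2\<close>; another factor 1/2 from the
    energy gives 1/8 in \<open>c\<close>.\<close>
  define K where "K = max 1 (max (4 * C) (4 * C'))"
  define c where "c = (1/8) * (min r (1/4) / (2 * r)) ^ ?m"
  show thesis
  proof (rule that[of c K])
    show "c > 0" unfolding c_def using r by auto
    show "K \<ge> 1" unfolding K_def by auto
    fix a :: 'a and s assume a: "norm a \<ge> K" and s: "s \<in> {r..2*r}"
    let ?q = "of_real (norm a) :: complex"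
    have K: "norm a \<ge> 1" "norm a \<ge> 4 * C" "norm a \<ge> 4 * C'" using a unfolding K_def by auto
    have a0: "a \<noteq> 0" using K(1) by auto
    define w where "w = sqrt ((cmod (bsl a 0 1 s))\<^sup>2 + (norm a)\<^sup>2 * (cmod (bsl a 0 0 s))\<^sup>2) / norm a"
    have w0: "w \<ge> 0" by (simp add: w_def)
    have w: "(norm a * w)\<^sup>2 = (cmod (bsl a 0 1 s))\<^sup>2 + (norm a * cmod (bsl a 0 0 s))\<^sup>2"
      using a0 by (simp add: w_def power_mult_distrib power_divide)
    have AB2: "(cmod (bsl a 0 1 s))\<^sup>2 \<le> (norm a * w)\<^sup>2" "(norm a * cmod (bsl a 0 0 s))\<^sup>2 \<le> (norm a * w)\<^sup>2"
      unfolding w by simp_all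
    have nw: "0 \<le> norm a * w" using w0 by simp
    note A = power2_le_imp_le[OF AB2(1) nw]
    from power2_le_imp_le[OF AB2(2) nw] have B: "cmod (bsl a 0 0 s) \<le> w" by (elim mult_left_le_imp_le) (use a0 in auto)
    have or: "cmod (bsl a 0 0 s) \<ge> w / 2 \<or> cmod (bsl a 0 1 s) / norm a \<ge> w / 2"
    proof (rule ccontr)
      assume "\<not> ?thesis"
      then have "cmod (bsl a 0 0 s) < w / 2" "cmod (bsl a 0 1 s) < norm a * w / 2"
        using a0 by (auto simp: not_le pos_divide_less_eq mult.commute)
      then have "(norm a * cmod (bsl a 0 0 s))\<^sup>2 < (norm a * (w / 2))\<^sup>2" "(cmod (bsl a 0 1 s))\<^sup>2 < (norm a * w / 2)\<^sup>2"
        using a0 by (auto intro!: power_strict_mono simp del: times_divide_eq_right)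
      then have "(norm a * w)\<^sup>2 < (norm a * (w / 2))\<^sup>2 + (norm a * w / 2)\<^sup>2" using w by linarith
      moreover have "(norm a * (w / 2))\<^sup>2 = (norm a * w)\<^sup>2 / 4" "(norm a * w / 2)\<^sup>2 = (norm a * w)\<^sup>2 / 4"
        by (simp_all add: power_divide power_mult_distrib)
      ultimately show False using zero_le_power2[of "norm a * w"] by linarith
    qed
    have qs: "?q\<^sup>2 = csq a 0" by (simp add: csq_real)
    have 1: "\<bar>cmod (bsl a 0 l s) / norm a ^ l - cmod (bsl a 0 (l mod 2) s) / norm a ^ (l mod 2)\<bar> \<le> C * w / norm a"
      using C1[rule_format, of ?q a 0 s w] qs w0 B A s K(1) by simp
    have 2: "\<bar>cmod (bsl a 0 (Suc l) s) / norm a ^ Suc l - cmod (bsl a 0 (Suc l mod 2) s) / norm a ^ (Suc l mod 2)\<bar> \<le> C' * w / norm a"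
      using C'1[rule_format, of ?q a 0 s w] qs w0 B A s K(1) by simp
    have 3: "C * w / norm a \<le> w / 4" "C' * w / norm a \<le> w / 4"
      using mult_right_mono[OF K(2) w0] mult_right_mono[OF K(3) w0] a0 by (simp_all add: field_simps)
    have "l mod 2 = 0 \<and> Suc l mod 2 = 1 \<or> l mod 2 = 1 \<and> Suc l mod 2 = 0" by presburger
    then have "cmod (bsl a 0 (l mod 2) s) / norm a ^ (l mod 2) \<ge> w / 2 \<or>
       cmod (bsl a 0 (Suc l mod 2) s) / norm a ^ (Suc l mod 2) \<ge> w / 2" using or by auto
    then have 4: "cmod (bsl a 0 l s) / norm a ^ l \<ge> w / 4 \<or> cmod (bsl a 0 (Suc l) s) / norm a ^ Suc l \<ge> w / 4"
      using 1 2 3 by linarith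
    have wl: "w / 4 \<ge> c / (1 + norm a) ^ ?m"
    proof -
      have "c / (1 + norm a) ^ ?m = 1/8 * (min r (1/4) / (2 * r) / (1 + norm a)) ^ ?m"
        unfolding c_def power_divide[of _ "1 + norm a"] by simp
      moreover have "1/2 * (min r (1/4) / (2 * r) / (1 + norm a)) ^ ?m \<le> w"
        unfolding w_def by (rule bsl_energy_bound_real[OF r s]) (use a0 in simp)
      ultimately show ?thesis by linarith
    qed
    have big: "x \<ge> w / 4" if "x / norm a ^ k \<ge> w / 4" for x :: real and k
    proof -
      have "w / 4 * 1 \<le> w / 4 * norm a ^ k" using K(1) w0 by (intro mult_left_mono) auto
      also have "\<dots> \<le> x" using that a0 by (subst (asm) pos_le_divide_eq) auto
      finally show ?thesis by simp
    qed
    from 4 big wl show "cmod (bsl a 0 l s) \<ge> c / (1 + norm a) ^ ?m \<or> cmod (bsl a 0 (Suc l) s) \<ge> c / (1 + norm a) ^ ?m"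
      by (meson order_trans)
  qed
qed

section \<open>Lattices avoiding the zeros\<close>

text \<open>While \<open>g\<close> stays within \<open>d / 2\<close> of \<open>g s\<close>, the
  function \<open>f\<close> moves from \<open>f s\<close> with speed at least \<open>d / 2\<close>
  and leaves the disc of radius \<open>e\<close> soon. Complex values admit no mean value equality,
  so \<open>f\<close> is compared with its linearisation at \<open>s\<close>.\<close>

lemma sublevel_diameter:
  fixes f g :: "real \<Rightarrow> complex"
  assumes f: "\<And>s. (f has_vector_derivative g s) (at s)"
    and C: "\<And>x. x \<in> {a..b} \<Longrightarrow> norm (g x - g s) \<le> d / 2"
    and st: "s \<in> {a..b}" "t \<in> {a..b}"
    and g: "norm (g s) \<ge> d" "d > 0" and e: "norm (f s) < e" "norm (f t) < e"
  shows "\<bar>t - s\<bar> \<le> 4 * e / d"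
proof -
  have "norm ((f t - t *\<^sub>R g s) - (f s - s *\<^sub>R g s)) \<le> d / 2 * norm (t - s)"
  proof (rule differentiable_bound[of "{a..b}" "\<lambda>x. f x - x *\<^sub>R g s" "\<lambda>x h. h *\<^sub>R g x - h *\<^sub>R g s"])
    show "((\<lambda>x. f x - x *\<^sub>R g s) has_derivative (\<lambda>h. h *\<^sub>R g x - h *\<^sub>R g s)) (at x within {a..b})" for x
      by (rule has_derivative_at_withinI, rule has_derivative_diff[OF f[unfolded has_vector_derivative_def]
            has_derivative_scaleR_left[OF has_derivative_ident]])
    show "onorm (\<lambda>h. h *\<^sub>R g x - h *\<^sub>R g s) \<le> d / 2" if "x \<in> {a..b}" for x
    proof (rule onorm_bound)
      show "norm (h *\<^sub>R g x - h *\<^sub>R g s) \<le> d / 2 * norm h" for h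
        using mult_left_mono[OF C[OF that], of "\<bar>h\<bar>"] by (simp add: scaleR_diff_right[symmetric] mult.commute)
    qed (use g(2) in simp)
  qed (use st in auto)
  moreover have "norm ((t - s) *\<^sub>R g s) \<le> norm ((f t - t *\<^sub>R g s) - (f s - s *\<^sub>R g s)) + (norm (f t) + norm (f s))"
  proof -
    have "(t - s) *\<^sub>R g s = - ((f t - t *\<^sub>R g s) - (f s - s *\<^sub>R g s)) + (f t - f s)"
      by (simp add: scaleR_diff_left)
    then have "norm ((t - s) *\<^sub>R g s) \<le> norm (- ((f t - t *\<^sub>R g s) - (f s - s *\<^sub>R g s))) + norm (f t - f s)"
      using norm_triangle_ineq[of "- ((f t - t *\<^sub>R g s) - (f s - s *\<^sub>R g s))" "f t - f s"] by (simp only:)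
    then show ?thesis using norm_triangle_ineq4[of "f t" "f s"] by (simp only: norm_minus_cancel)
  qed
  moreover have "\<bar>t - s\<bar> * d \<le> norm ((t - s) *\<^sub>R g s)"
    using g by (simp add: mult_left_mono)
  ultimately have "\<bar>t - s\<bar> * d \<le> d / 2 * \<bar>t - s\<bar> + 2 * e" using e by simp
  then have "\<bar>t - s\<bar> * d \<le> 4 * e" by (simp add: algebra_simps)
  then show ?thesis using g(2) by (simp add: pos_le_divide_eq)
qed

text \<open>On each of \<open>N\<close> short intervals the sublevel set lies in a ball of radius
  \<open>4 * e / d\<close> by \<open>sublevel_diameter\<close>; the intervals are so short that
  \<open>g\<close> varies by at most \<open>d / 2\<close> on each.\<close>

lemma sublevel_measure:
  fixes f g :: "real \<Rightarrow> complex"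
  assumes f: "\<And>s. (f has_vector_derivative g s) (at s)"
    and C: "\<And>s t. s \<in> {a..b} \<Longrightarrow> t \<in> {a..b} \<Longrightarrow> norm (g s - g t) \<le> C * \<bar>s - t\<bar>" "C > 0"
    and ab: "a < b" and d: "d > 0" "\<And>s. s \<in> {a..b} \<Longrightarrow> d \<le> norm (f s) \<or> d \<le> norm (g s)"
    and e: "0 < e" "e \<le> d"
  shows "measure lborel {s \<in> {a..b}. norm (f s) < e} \<le> (2 * C * (b - a) / d + 2) * (8 * e / d)"
proof -
  define N where "N = nat \<lceil>2 * C * (b - a) / d\<rceil> + 1"
  have pos: "0 \<le> 2 * C * (b - a) / d" using C ab d by simp
  have N0: "N > 0" by (simp add: N_def)
  have N1: "real N \<ge> 2 * C * (b - a) / d" "real N \<le> 2 * C * (b - a) / d + 2"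
    unfolding N_def using pos by linarith+
  define \<delta> where "\<delta> = (b - a) / real N"
  have \<delta>: "\<delta> > 0" "C * \<delta> \<le> d / 2"
  proof -
    show "\<delta> > 0" using ab N0 by (simp add: \<delta>_def)
    have "2 * C * (b - a) \<le> real N * d" using N1(1) d(1) by (simp add: pos_divide_le_eq)
    then show "C * \<delta> \<le> d / 2" using N0 by (simp add: \<delta>_def field_simps)
  qed
  define P where "P i = {a + real i * \<delta>..a + real (Suc i) * \<delta>} \<inter> {a..b}" for i
  have cov: "\<exists>i<N. s \<in> P i" if "s \<in> {a..b}" for s
  proof (cases "s = b")
    case True
    have "a + real (Suc (N - 1)) * \<delta> = b" using N0 by (simp add: \<delta>_def)
    moreover have "a + real (N - 1) * \<delta> \<le> a + real (Suc (N - 1)) * \<delta>" using \<delta>(1) by simp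
    ultimately show ?thesis unfolding P_def True using that ab N0
      by (intro exI[of _ "N - 1"]) auto
  next
    case False
    define i where "i = nat \<lfloor>(s - a) / \<delta>\<rfloor>"
    have nn: "(s - a) / \<delta> \<ge> 0" using that \<delta> by auto
    have i: "real i \<le> (s - a) / \<delta>" "(s - a) / \<delta> < real i + 1" unfolding i_def using nn by linarith+
    have "(s - a) / \<delta> < real N" using that False \<delta> N0 by (auto simp: \<delta>_def field_simps)
    then have "i < N" using i by linarith
    moreover have "s \<in> P i" using i \<delta> that by (auto simp: P_def field_simps)
    ultimately show ?thesis by blast
  qed
  have "\<exists>c. {s \<in> P i. norm (f s) < e} \<subseteq> cball c (4 * e / d)" for i
  proof (cases "{s \<in> P i. norm (f s) < e} = {}")
    case False
    then obtain s where s: "s \<in> P i" "norm (f s) < e" by blast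
    have "dist s t \<le> 4 * e / d" if t: "t \<in> P i" "norm (f t) < e" for t
    proof -
      have "\<bar>t - s\<bar> \<le> 4 * e / d"
      proof (rule sublevel_diameter[OF f, of "max (a + real i * \<delta>) a" "min (a + real (Suc i) * \<delta>) b"])
        \<comment> \<open>As \<open>norm (f s) < e \<le> d\<close>, the first alternative of the
          hypothesis is excluded.\<close>
        show "norm (g s) \<ge> d" using d(2)[of s] s e(2) by (auto simp: P_def)
        fix x assume x: "x \<in> {max (a + real i * \<delta>) a..min (a + real (Suc i) * \<delta>) b}"
        have "norm (g x - g s) \<le> C * \<bar>x - s\<bar>" by (rule C) (use x s in \<open>auto simp: P_def\<close>)
        also have "\<dots> \<le> C * \<delta>" using x s C(2) by (intro mult_left_mono) (auto simp: P_def algebra_simps)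
        finally show "norm (g x - g s) \<le> d / 2" using \<delta>(2) by linarith
      qed (use s t d in \<open>auto simp: P_def\<close>)
      then show ?thesis by (simp add: dist_real_def abs_minus_commute)
    qed
    then show ?thesis by (intro exI[of _ s]) auto
  qed auto
  then obtain c where c: "\<And>i. {s \<in> P i. norm (f s) < e} \<subseteq> cball (c i) (4 * e / d)" by metis
  have rho: "4 * e / d \<ge> 0" using e d by simp
  have "measure lborel {s \<in> {a..b}. norm (f s) < e} \<le> measure lborel (\<Union>i<N. cball (c i) (4 * e / d))"
  proof (rule measure_mono_fmeasurable)
    show "{s \<in> {a..b}. norm (f s) < e} \<subseteq> (\<Union>i<N. cball (c i) (4 * e / d))" using cov c by blast
    have "continuous_on UNIV f"
      by (meson f continuous_at_imp_continuous_on has_vector_derivative_continuous)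
    then have [measurable]: "f \<in> borel_measurable borel" by (rule borel_measurable_continuous_onI)
    show "{s \<in> {a..b}. norm (f s) < e} \<in> sets lborel" by measurable
    show "(\<Union>i<N. cball (c i) (4 * e / d)) \<in> fmeasurable lborel"
      by (rule fmeasurable.finite_UN) (auto intro!: fmeasurableI simp: cball_eq_atLeastAtMost emeasure_lborel_Icc_eq)
  qed
  also have "\<dots> \<le> (\<Sum>i<N. measure lborel (cball (c i) (4 * e / d)))"
    by (rule measure_UNION_le) auto
  also have "\<dots> = real N * (8 * e / d)"
    using rho by (simp add: cball_eq_atLeastAtMost)
  also have "\<dots> \<le> (2 * C * (b - a) / d + 2) * (8 * e / d)"
    using N1(2) e d by (intro mult_right_mono) auto
  finally show ?thesis .
qed

text \<open>By Rolle's theorem zeros accumulating at \<open>x\<close> force zeros of the derivative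
  to accumulate there, and so on for all orders.\<close>

lemma islimpt_zeros_derivative:
  fixes \<phi> :: "nat \<Rightarrow> real \<Rightarrow> real"
  assumes "\<And>k s. (\<phi> k has_real_derivative \<phi> (Suc k) s) (at s)" and "x islimpt {s. \<phi> 0 s = 0}"
  shows "\<phi> k x = 0"
  using assms
proof (induction k arbitrary: \<phi>)
  case 0
  have "continuous_on UNIV (\<phi> 0)"
    using 0(1)[of 0] by (meson continuous_at_imp_continuous_on DERIV_isCont)
  then have "closed {s. \<phi> 0 s = 0}"
    using closed_Collect_eq[of "\<phi> 0" "\<lambda>_. 0"] by auto
  then have "x \<in> {s. \<phi> 0 s = 0}" using 0(2) by (rule closed_limpt[THEN iffD1, rule_format])
  then show ?case by simp
next
  case (Suc k)
  note d = Suc.prems(1)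
  have cont: "continuous_on S (\<phi> 0)" for S
    using d[of 0] by (meson continuous_at_imp_continuous_on DERIV_isCont)
  have "closed {s. \<phi> 0 s = 0}"
    using closed_Collect_eq[of "\<phi> 0" "\<lambda>_. 0"] cont by auto
  then have "x \<in> {s. \<phi> 0 s = 0}" using Suc.prems(2) by (rule closed_limpt[THEN iffD1, rule_format])
  then have x0: "\<phi> 0 x = 0" by simp
  have "x islimpt {s. \<phi> (Suc 0) s = 0}"
    unfolding islimpt_approachable
  proof (intro allI impI)
    fix e :: real assume "e > 0"
    then obtain y where y: "\<phi> 0 y = 0" "y \<noteq> x" "dist y x < e"
      using Suc.prems(2) unfolding islimpt_approachable by blast
    have "\<exists>z. min x y < z \<and> z < max x y \<and> DERIV (\<phi> 0) z :> 0"
    proof (rule Rolle)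
      show "min x y < max x y" using y by auto
      show "\<phi> 0 (min x y) = \<phi> 0 (max x y)" using x0 y by (simp add: min_def max_def)
      show "continuous_on {min x y..max x y} (\<phi> 0)" by (rule cont)
      show "\<phi> 0 differentiable (at z)" for z using d[of 0 z] unfolding real_differentiable_def by blast
    qed
    then obtain z where z: "min x y < z" "z < max x y" "DERIV (\<phi> 0) z :> 0" by blast
    then have "\<phi> (Suc 0) z = 0" using DERIV_unique[OF d[of 0 z]] by blast
    moreover have "z \<noteq> x" "dist z x < e" using z y by (auto simp: dist_real_def)
    ultimately show "\<exists>x'\<in>{s. \<phi> (Suc 0) s = 0}. x' \<noteq> x \<and> dist x' x < e" by blast
  qed
  then show ?case using Suc.IH[of "\<lambda>k. \<phi> (Suc k)"] d by blast
qed

text \<open>At an accumulation point of zeros all derivatives of order at least \<open>l\<close>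
  vanish. The differentiated equation then forces the lower orders to vanish too, against the
  positive energy.\<close>

lemma bsl_zeros_finite:
  fixes a :: "'a::euclidean_space"
  assumes r: "r > 0" and a: "a \<noteq> 0"
  shows "finite {s \<in> {r..2*r}. bsl a 0 l s = 0}"
proof (rule ccontr)
  let ?Z = "{s \<in> {r..2*r}. bsl a 0 l s = 0}"
  assume "infinite ?Z"
  then have "\<exists>x\<in>{r..2*r}. x islimpt ?Z"
    by (rule Heine_Borel_imp_Bolzano_Weierstrass[OF compact_Icc]) auto
  then obtain x where x: "x \<in> {r..2*r}" "x islimpt ?Z" ..
  have z: "bsl a 0 (l + k) x = 0" for k
  proof -
    have d: "(bsl a 0 (l + k) has_vector_derivative bsl a 0 (l + Suc k) s) (at s)" for k s
      using bsl_has_vector_derivative[of a 0 "l + k" s] by simp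
    have "Re (bsl a 0 (l + k) x) = 0"
    proof (rule islimpt_zeros_derivative[of "\<lambda>k s. Re (bsl a 0 (l + k) s)"])
      show "((\<lambda>s. Re (bsl a 0 (l + k) s)) has_real_derivative Re (bsl a 0 (l + Suc k) s)) (at s)" for k s
        unfolding has_real_derivative_iff_has_vector_derivative
        by (rule bounded_linear.has_vector_derivative[OF bounded_linear_Re d])
      show "x islimpt {s. Re (bsl a 0 (l + 0) s) = 0}" by (rule islimpt_subset[OF x(2)]) auto
    qed
    moreover have "Im (bsl a 0 (l + k) x) = 0"
    proof (rule islimpt_zeros_derivative[of "\<lambda>k s. Im (bsl a 0 (l + k) s)"])
      show "((\<lambda>s. Im (bsl a 0 (l + k) s)) has_real_derivative Im (bsl a 0 (l + Suc k) s)) (at s)" for k s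
        unfolding has_real_derivative_iff_has_vector_derivative
        by (rule bounded_linear.has_vector_derivative[OF bounded_linear_Im d])
      show "x islimpt {s. Im (bsl a 0 (l + 0) s) = 0}" by (rule islimpt_subset[OF x(2)]) auto
    qed
    ultimately show ?thesis by (simp add: complex_eq_iff)
  qed
  have "\<forall>k. bsl a 0 (j + k) x = 0" if "\<forall>k. bsl a 0 (l + k) x = 0" for j
    using that
  proof (induction l)
    case 0
    then show ?case by simp
  next
    case (Suc l)
    have Z: "bsl a 0 k x = 0" if "k \<ge> Suc l" for k
      using Suc.prems[rule_format, of "k - Suc l"] that by simp
    \<comment> \<open>In the equation of order \<open>Suc l\<close> only the term with index
      \<open>l\<close> survives, and its coefficient is nonzero.\<close>
    have "csq a 0 * (of_nat (Suc l) * bsl a 0 (Suc l - 1) x) = 0"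
      using bsl_ode[of x a 0 "Suc l"] Z[of "Suc l + 2"] Z[of "Suc l + 1"] Z[of "Suc l"] by simp
    then have "bsl a 0 l x = 0" using a by (auto simp: csq_real simp del: of_nat_Suc)
    then have "bsl a 0 (l + k) x = 0" for k using Z[of "l + k"] by (cases k) auto
    then show ?case using Suc.IH by blast
  qed
  from this[of 0] z have all: "bsl a 0 k x = 0" for k by simp
  have "0 < 1/2 * (min r (1/4) / (2 * r) / (1 + norm a)) ^ (DIM('a) - 1)"
    using r by (intro mult_pos_pos zero_less_power divide_pos_pos) (auto intro: add_pos_nonneg)
  then show False using bsl_energy_bound_real[OF r x(1), of a] a all by simp
qed

text \<open>Dilating the frequency amounts to dilating the radius, so a good dilation can be found
  as a good radius between \<open>r\<close> and \<open>2 * r\<close>.\<close>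

lemma bsl_scale:
  "bsl (t *\<^sub>R a) 0 l r = of_real (t ^ l) * bsl a 0 l (t * r)" for a :: "'a::euclidean_space"
proof -
  have c: "cinner (t *\<^sub>R a) 0 z = of_real t * cinner a 0 z" for z
    using cinner_scaleR_left[of t a 0 z] by simp
  have "(- cinner (t *\<^sub>R a) 0 z) ^ l * expo (t *\<^sub>R a) 0 (- (r *\<^sub>R z)) =
      of_real (t ^ l) * ((- cinner a 0 z) ^ l * expo a 0 (- ((t * r) *\<^sub>R z)))" for z
  proof -
    have "(- cinner (t *\<^sub>R a) 0 z) ^ l = of_real (t ^ l) * (- cinner a 0 z) ^ l"
    proof -
      have "- (of_real t * cinner a 0 z) = of_real t * (- cinner a 0 z)" by simp
      then show ?thesis unfolding c by (simp only: power_mult_distrib of_real_power)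
    qed
    moreover have "expo (t *\<^sub>R a) 0 (- (r *\<^sub>R z)) = expo a 0 (- ((t * r) *\<^sub>R z))"
      by (simp add: expo_def c cinner_minus cinner_scaleR mult.assoc mult.left_commute)
    ultimately show ?thesis by simp
  qed
  then show ?thesis by (simp add: bsl_def)
qed

lemma bsl_lipschitz:
  fixes a :: "'a::euclidean_space"
  shows "norm (bsl a 0 k s - bsl a 0 k t) \<le> norm a ^ Suc k * \<bar>s - t\<bar>"
proof -
  have "norm (bsl a 0 k s - bsl a 0 k t) \<le> norm a ^ Suc k * norm (s - t)"
  proof (rule differentiable_bound[of UNIV _ "\<lambda>x h. h *\<^sub>R bsl a 0 (Suc k) x"])
    show "(bsl a 0 k has_derivative (\<lambda>h. h *\<^sub>R bsl a 0 (Suc k) x)) (at x within UNIV)" for x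
      using bsl_has_vector_derivative[of a 0 k x] by (simp add: has_vector_derivative_def)
    show "onorm (\<lambda>h. h *\<^sub>R bsl a 0 (Suc k) x) \<le> norm a ^ Suc k" for x
    proof (rule onorm_bound)
      show "norm (h *\<^sub>R bsl a 0 (Suc k) x) \<le> norm a ^ Suc k * norm h" for h
        using mult_left_mono[OF norm_bsl_real_le[of a "Suc k" x], of "\<bar>h\<bar>"] by (simp add: mult.commute)
    qed simp
  qed auto
  then show ?thesis by simp
qed

text \<open>Borel-Cantelli: the radii that are bad for \<open>p i\<close> have summable measure, so
  almost every radius is bad for finitely many \<open>i\<close> only. Almost every radius also
  avoids all exact zeros, which takes care of these remaining indices.\<close>

lemma generic_scale:
  fixes p :: "nat \<Rightarrow> 'a::euclidean_space"
  assumes r: "r > 0" and p: "\<And>i. p i \<noteq> 0" and sum: "summable (\<lambda>i. 1 / (1 + norm (p i)) ^ N)"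
  shows "\<exists>t\<in>{1..2}. \<exists>c>0. \<exists>M. \<forall>i. norm (bsl (t *\<^sub>R p i) 0 l r) \<ge> c / (1 + norm (p i)) ^ M"
proof -
  let ?m = "DIM('a) - 1"
  obtain K c where c: "c > 0" and K: "K \<ge> 1" and lb: "\<And>(a::'a) s. norm a \<ge> K \<Longrightarrow> s \<in> {r..2*r} \<Longrightarrow>
      cmod (bsl a 0 l s) \<ge> c / (1 + norm a) ^ ?m \<or> cmod (bsl a 0 (Suc l) s) \<ge> c / (1 + norm a) ^ ?m"
    by (rule bsl_lower_bound_real[OF r, where 'a='a and l=l]) (rule that; simp)
  define P where "P i = 1 + norm (p i)" for i
  have P: "P i \<ge> 1" for i by (simp add: P_def)
  have P0: "P i > 0" for i using P[of i] by linarith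
  \<comment> \<open>In \<open>sublevel_measure\<close>, \<open>l + 2\<close> powers come from the
    Lipschitz constant of the derivative of order \<open>l + 1\<close> and
    \<open>DIM('a) - 1\<close> from each of the two divisions by \<open>d\<close>; \<open>N\<close>
    powers are left for summability.\<close>
  define M where "M = l + 2 + 2 * ?m + N"
  define e where "e i = c / P i ^ M" for i
  \<comment> \<open>For frequencies below \<open>K\<close> no lower bound is available. There are
    finitely many of them, and they enter through the minimum \<open>c'\<close>.\<close>
  define B where "B i = (if norm (p i) \<ge> K then {s \<in> {r..2*r}. norm (bsl (p i) 0 l s) < e i} else {})" for i
  have cont: "continuous_on UNIV (bsl a 0 l)" for a :: 'a
    by (meson bsl_has_vector_derivative continuous_at_imp_continuous_on has_vector_derivative_continuous)
  have Bm: "B i \<in> sets lborel" for i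
  proof -
    have [measurable]: "bsl (p i) 0 l \<in> borel_measurable borel" by (rule borel_measurable_continuous_onI[OF cont])
    have "{s \<in> {r..2*r}. norm (bsl (p i) 0 l s) < e i} \<in> sets borel" by measurable
    then show ?thesis by (simp add: B_def)
  qed
  have Bsub: "B i \<subseteq> {r..2*r}" for i by (auto simp: B_def)
  have Bfin: "emeasure lborel (B i) < \<infinity>" for i
    using emeasure_mono[OF Bsub[of i], of lborel] r by (auto intro: le_less_trans)
  have Bmeas: "measure lborel (B i) \<le> (2 * r / c + 2) * 8 * (1 / P i ^ N)" for i
  proof (cases "norm (p i) \<ge> K")
    case True
    define d where "d = c / P i ^ ?m"
    have pp: "p i \<noteq> 0" by (rule p)
    have Pm: "P i ^ k > 0" for k using P[of i] by (intro zero_less_power) linarith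
    have ed: "e i \<le> d"
      unfolding e_def d_def M_def using c P[of i] by (intro divide_left_mono power_increasing) auto
    have nP: "norm (p i) ^ k \<le> P i ^ k" for k by (rule power_mono) (auto simp: P_def)
    have "measure lborel (B i) \<le> (2 * P i ^ (l + 2) * (2 * r - r) / d + 2) * (8 * e i / d)"
      unfolding B_def using True
    proof (simp only: if_True, intro sublevel_measure[of "bsl (p i) 0 l" "bsl (p i) 0 (Suc l)"])
      show "(bsl (p i) 0 l has_vector_derivative bsl (p i) 0 (Suc l) s) (at s)" for s by (rule bsl_has_vector_derivative)
      show "cmod (bsl (p i) 0 (Suc l) s - bsl (p i) 0 (Suc l) t) \<le> P i ^ (l + 2) * \<bar>s - t\<bar>" for s t
        using order_trans[OF bsl_lipschitz[of "p i" "Suc l" s t] mult_right_mono[OF nP[of "Suc (Suc l)"], of "\<bar>s - t\<bar>"]] by simp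
      show "d \<le> cmod (bsl (p i) 0 l s) \<or> d \<le> cmod (bsl (p i) 0 (Suc l) s)" if "s \<in> {r..2 * r}" for s
        using lb[OF True that] by (simp add: d_def P_def)
    qed (use r c Pm ed P0[of i] in \<open>auto simp: d_def e_def\<close>)
    also have "\<dots> = (2 * r / c * P i ^ (l + 2 + ?m) + 2) * (8 / P i ^ (l + 2 + ?m + N))"
    proof -
      have "2 * P i ^ (l + 2) * (2 * r - r) / d = 2 * r / c * P i ^ (l + 2 + ?m)"
      proof -
        have "2 * X * (2 * r - r) / (c / Y) = 2 * r / c * (X * Y)" for X Y :: real
          by simp
        then show ?thesis unfolding d_def power_add[of "P i" "l + 2" ?m] .
      qed
      moreover have "8 * e i / d = 8 / P i ^ (l + 2 + ?m + N)"
      proof -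
        have "P i ^ M = P i ^ (l + 2 + ?m + N) * P i ^ ?m" 
          unfolding M_def power_add[symmetric] by (rule arg_cong[where f = "\<lambda>k. P i ^ k"]) (simp only: mult_2 add_ac)
        then show ?thesis using c Pm[of ?m] by (simp add: d_def e_def)
      qed
      ultimately show ?thesis by simp
    qed
    also have "\<dots> \<le> ((2 * r / c + 2) * P i ^ (l + 2 + ?m)) * (8 / P i ^ (l + 2 + ?m + N))"
    proof (rule mult_right_mono)
      have "1 \<le> P i ^ (l + 2 + ?m)" using P[of i] by (rule one_le_power)
      then show "2 * r / c * P i ^ (l + 2 + ?m) + 2 \<le> (2 * r / c + 2) * P i ^ (l + 2 + ?m)"
        unfolding distrib_right by linarith
    qed (use Pm[of "l + 2 + ?m + N"] in simp)
    also have "\<dots> = (2 * r / c + 2) * 8 * (1 / P i ^ N)"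
    proof -
      have gen: "(A * X) * (8 / (X * Y)) = A * 8 * (1 / Y)" if "X > 0" for A X Y :: real
        using that by simp
      show ?thesis unfolding power_add[of "P i" "l + 2 + ?m" N] by (rule gen[OF Pm])
    qed
    finally show ?thesis .
  next
    case False
    then show ?thesis using r c P[of i] by (simp add: B_def)
  qed
  have "summable (\<lambda>i. (2 * r / c + 2) * 8 * (1 / P i ^ N))"
    using sum unfolding P_def by (rule summable_mult)
  then have "summable (\<lambda>i. measure lborel (B i))"
    by (rule summable_comparison_test'[where N = 0]) (use Bmeas in simp)
  from borel_cantelli_AE1[OF Bm Bfin this]
  have ae1: "AE s in lborel. eventually (\<lambda>i. s \<notin> B i) sequentially"
    by (rule eventually_mono) (auto elim: eventually_mono)
  have "{s \<in> {r..2*r}. bsl (p i) 0 l s = 0} \<in> null_sets lborel" for i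
    using bsl_zeros_finite[OF r p, of i l] by (rule finite_imp_null_set_lborel)
  then have "AE s in lborel. s \<notin> {s \<in> {r..2*r}. bsl (p i) 0 l s = 0}" for i by (rule AE_not_in)
  then have ae2: "AE s in lborel. \<forall>i. s \<notin> {s \<in> {r..2*r}. bsl (p i) 0 l s = 0}" unfolding AE_all_countable ..
  have "\<exists>s\<in>{r..2*r}. eventually (\<lambda>i. s \<notin> B i) sequentially \<and> (\<forall>i. s \<notin> {s \<in> {r..2*r}. bsl (p i) 0 l s = 0})"
  proof (rule ccontr)
    assume contra: "\<not> ?thesis"
    have "AE s in lborel. s \<notin> {r..2*r}"
      using ae1 ae2
    proof eventually_elim
      case (elim s)
      then show ?case using contra by blast
    qed
    then have "{r..2*r} \<in> null_sets lborel" by (subst (asm) AE_iff_null_sets[symmetric]) auto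
    then show False using r by (auto simp: null_sets_def)
  qed
  then obtain s where s: "s \<in> {r..2*r}" "eventually (\<lambda>i. s \<notin> B i) sequentially"
    "\<And>i. bsl (p i) 0 l s \<noteq> 0" by auto
  \<comment> \<open>Summability forces the norms of \<open>p i\<close> to infinity, so eventually
    they exceed \<open>K\<close>.\<close>
  have "(\<lambda>i. 1 / P i ^ N) \<longlonglongrightarrow> 0" using summable_LIMSEQ_zero[OF sum] by (simp add: P_def)
  then have "eventually (\<lambda>i. 1 / P i ^ N < 1 / (1 + K) ^ N) sequentially"
    by (rule order_tendstoD) (use K in auto)
  then have "eventually (\<lambda>i. norm (p i) \<ge> K) sequentially"
  proof eventually_elim
    case (elim i)
    show ?case
    proof (rule ccontr)
      assume "\<not> norm (p i) \<ge> K"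
      then have "P i ^ N \<le> (1 + K) ^ N" by (intro power_mono) (auto simp: P_def)
      moreover have "P i ^ N > 0" using P[of i] by (intro zero_less_power) linarith
      ultimately have "1 / (1 + K) ^ N \<le> 1 / P i ^ N" by (intro divide_left_mono) auto
      then show False using elim by linarith
    qed
  qed
  with s(2) have "eventually (\<lambda>i. norm (bsl (p i) 0 l s) \<ge> e i) sequentially"
    by eventually_elim (use s(1) in \<open>auto simp: B_def not_less\<close>)
  then obtain n where n: "\<And>i. i \<ge> n \<Longrightarrow> norm (bsl (p i) 0 l s) \<ge> e i"
    unfolding eventually_sequentially by blast
  define c' where "c' = Min (insert c ((\<lambda>i. norm (bsl (p i) 0 l s)) ` {..<n}))"
  have c'0: "c' > 0" unfolding c'_def using c s(3) by (subst Min_gr_iff) auto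
  have c'1: "c' \<le> c" unfolding c'_def by (rule Min_le) auto
  have c'2: "c' \<le> norm (bsl (p i) 0 l s)" if "i < n" for i
    unfolding c'_def by (rule Min_le) (use that in auto)
  have main: "c' / P i ^ M \<le> norm (bsl (p i) 0 l s)" for i
  proof (cases "i < n")
    case True
    have "1 \<le> P i ^ M" using P[of i] by (rule one_le_power)
    then have "c' / P i ^ M \<le> c' / 1" using c'0 by (intro divide_left_mono) auto
    then show ?thesis using c'2[OF True] by simp
  next
    case False
    have "c' / P i ^ M \<le> e i" unfolding e_def using c'1 P[of i] by (intro divide_right_mono) auto
    then show ?thesis using n[of i] False by simp
  qed
  show ?thesis
  proof (rule bexI[of _ "s / r"], rule exI[of _ c'], intro conjI exI[of _ M] allI c'0)
    show "s / r \<in> {1..2}" using s(1) r by (auto simp: field_simps)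
    then have "1 \<le> s / r" by simp
    then have "1 \<le> (s / r) ^ l" by (rule one_le_power)
    then show "c' / (1 + norm (p i)) ^ M \<le> norm (bsl ((s / r) *\<^sub>R p i) 0 l r)" for i
      using order_trans[OF main[of i] mult_right_mono[OF \<open>1 \<le> (s / r) ^ l\<close> norm_ge_zero, of "bsl (p i) 0 l s", simplified]]
        s(1) r by (simp add: bsl_scale norm_mult norm_power norm_divide P_def del: of_real_power)
  qed
qed

section \<open>Fourier series\<close>

lemma integrable_compact_support:
  fixes f :: "'a::euclidean_space \<Rightarrow> complex"
  assumes "continuous_on UNIV f" "\<And>x. norm x > R \<Longrightarrow> f x = 0"
  shows "integrable lborel f"
proof -
  have "integrable lborel (\<lambda>x. indicator (cball 0 R) x *\<^sub>R f x)"
    using assms(1) by (intro borel_integrable_compact) (auto intro: continuous_on_subset)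
  moreover have "(\<lambda>x. indicator (cball 0 R) x *\<^sub>R f x) = f"
    using assms(2) by (auto simp: indicator_def fun_eq_iff)
  ultimately show ?thesis by simp
qed

lemma integral_translate:
  fixes f :: "'a::euclidean_space \<Rightarrow> complex"
  assumes "f \<in> borel_measurable borel"
  shows "(LINT x|lborel. f (c + x)) = (LINT x|lborel. f x)"
proof -
  have "(LINT x|lborel. f x) = (LINT x|distr lborel borel ((+) c). f x)" by (simp add: lborel_distr_plus)
  also have "\<dots> = (LINT x|lborel. f (c + x))" by (subst integral_distr) (use assms in auto)
  finally show ?thesis by simp
qed

text \<open>The integral of the translates of \<open>f\<close> is constant; its derivative is the
  integral of \<open>dird b f\<close>. A ball of radius \<open>R + 1\<close> contains the supports
  of all translates used and has finite measure.\<close>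

lemma integral_dird_zero:
  fixes f :: "'a::euclidean_space \<Rightarrow> complex"
  assumes f: "f \<in> smooth_functions" and supp: "\<And>x. norm x > R \<Longrightarrow> f x = 0" and b: "norm b \<le> 1"
  shows "(LINT x|lborel. dird b f x) = 0"
proof -
  let ?M = "restrict_space lborel (cball 0 (R + 1)) :: 'a measure"
  have fin: "finite_measure ?M"
    by (rule finite_measureI)
       (use emeasure_lborel_cball_finite[of "0::'a" "R + 1"] in \<open>simp add: emeasure_restrict_space space_restrict_space less_top\<close>)
  have "\<exists>B\<ge>0. (\<forall>x v. norm x \<le> R + 2 \<longrightarrow> norm (dird v f x) \<le> B * norm v) \<and>
      (\<forall>x y. norm x \<le> R + 2 \<longrightarrow> norm y \<le> R + 2 \<longrightarrow> norm (f x - f y) \<le> B * norm (x - y))"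
    by (rule smooth_bounds[OF f, of "R + 2"], rule exI, intro conjI allI impI) assumption+
  then obtain B where B: "B \<ge> 0" "\<forall>x v. norm x \<le> R + 2 \<longrightarrow> norm (dird v f x) \<le> B * norm v"
      "\<forall>x y. norm x \<le> R + 2 \<longrightarrow> norm y \<le> R + 2 \<longrightarrow> norm (f x - f y) \<le> B * norm (x - y)"
    by (elim exE conjE)
  have cf: "continuous_on UNIV (\<lambda>x. f (t *\<^sub>R b + x))" for t
    by (rule continuous_smooth_compose[OF f]) (intro continuous_intros)
  have ds: "dird b f \<in> smooth_functions" by (rule smooth_dird[OF f])
  have lin: "dird (t *\<^sub>R b) f x = of_real t * dird b f x" for t x
    using linear_scale[OF dird_linear[OF f]] by (simp add: scaleR_conv_of_real)
  have AEM: "AE x in ?M. norm x \<le> R + 1"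
    by (rule AE_I2) (simp add: space_restrict_space)
  have restr: "(LINT x|?M. g x) = (LINT x|lborel. g x)" if "\<And>x. norm x > R + 1 \<Longrightarrow> g x = 0" for g :: "'a \<Rightarrow> complex"
    using that by (subst integral_restrict_space) (auto intro!: Bochner_Integration.integral_cong simp: indicator_def)
  have "((\<lambda>t. LINT x|?M. f (t *\<^sub>R b + x)) has_derivative (\<lambda>t. LINT x|?M. of_real t * dird b f x)) (at 0)"
  proof (rule has_derivative_integral[OF fin, where B = B])
    show "(\<lambda>x. f (t *\<^sub>R b + x)) \<in> borel_measurable ?M" for t
      using borel_measurable_continuous_onI[OF cf[of t]] by (intro measurable_restrict_space1) simp
    show "(\<lambda>x. of_real t * dird b f x) \<in> borel_measurable ?M" for t
      using borel_measurable_continuous_onI[OF smooth_continuous[OF ds]] by (intro measurable_restrict_space1) simp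
    show "integrable ?M (\<lambda>x. f (t *\<^sub>R b + x))" for t
      by (subst integrable_restrict_space) (auto intro!: borel_integrable_compact continuous_on_subset[OF cf])
    have "((\<lambda>t. f (t *\<^sub>R b + x)) has_derivative (\<lambda>h. dird (h *\<^sub>R b) f (0 *\<^sub>R b + x))) (at 0)" for x
      by (rule smooth_has_derivative'[OF f]) (auto intro!: derivative_eq_intros)
    then show "AE x in ?M. ((\<lambda>t. f (t *\<^sub>R b + x)) has_derivative (\<lambda>t. of_real t * dird b f x)) (at 0)"
      by (simp add: lin)
    show "AE x in ?M. \<forall>t\<in>ball 0 1. norm (f (t *\<^sub>R b + x) - f (0 *\<^sub>R b + x)) \<le> B * norm (t - 0)"
    proof (rule eventually_mono[OF AEM], intro ballI)
      fix x :: 'a and t :: real assume x: "norm x \<le> R + 1" and t: "t \<in> ball 0 1"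
      have tb: "norm (t *\<^sub>R b) \<le> \<bar>t\<bar>" using mult_left_mono[OF b, of "\<bar>t\<bar>"] by simp
      have "norm (t *\<^sub>R b + x) \<le> R + 2" using norm_triangle_ineq[of "t *\<^sub>R b" x] tb t x by simp
      then have "norm (f (t *\<^sub>R b + x) - f x) \<le> B * norm (t *\<^sub>R b + x - x)" using B(3)[rule_format, of "t *\<^sub>R b + x" x] x by linarith
      also have "\<dots> \<le> B * \<bar>t\<bar>" using tb B(1) by (intro mult_left_mono) auto
      finally show "norm (f (t *\<^sub>R b + x) - f (0 *\<^sub>R b + x)) \<le> B * norm (t - 0)" by simp
    qed
    show "AE x in ?M. \<forall>t. norm (of_real t * dird b f x) \<le> B * norm t"
    proof (rule eventually_mono[OF AEM], intro allI)
      fix x :: 'a and t :: real assume x: "norm x \<le> R + 1"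
      have "norm (dird b f x) \<le> B * norm b" using B(2) x by simp
      also have "\<dots> \<le> B * 1" using b B(1) by (rule mult_left_mono)
      finally show "norm (of_real t * dird b f x) \<le> B * norm t" by (simp add: norm_mult mult.commute[of B] mult_left_mono)
    qed
  qed
  moreover have "(LINT x|?M. f (t *\<^sub>R b + x)) = (LINT x|lborel. f x)" if "t \<in> ball 0 1" for t
  proof -
    have "(LINT x|?M. f (t *\<^sub>R b + x)) = (LINT x|lborel. f (t *\<^sub>R b + x))"
    proof (rule restr)
      fix x :: 'a assume x: "norm x > R + 1"
      have "norm (t *\<^sub>R b) \<le> 1" using mult_left_mono[OF b, of "\<bar>t\<bar>"] that by simp
      then have "norm (t *\<^sub>R b + x) > R" using norm_triangle_ineq4[of "t *\<^sub>R b + x" "t *\<^sub>R b"] x by simp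
      then show "f (t *\<^sub>R b + x) = 0" by (rule supp)
    qed
    also have "\<dots> = (LINT x|lborel. f x)"
      by (rule integral_translate) (intro borel_measurable_continuous_onI smooth_continuous f)
    finally show ?thesis .
  qed
  then have "((\<lambda>t. LINT x|?M. f (t *\<^sub>R b + x)) has_derivative (\<lambda>t. 0)) (at 0)"
    by (intro has_derivative_transform_within_open[OF has_derivative_const, of "ball 0 1" 0 "LINT x|lborel. f x"]) auto
  ultimately have "(\<lambda>t::real. LINT x|?M. of_real t * dird b f x) = (\<lambda>t. 0)" by (rule has_derivative_unique)
  from fun_cong[OF this, of 1] have "(LINT x|?M. dird b f x) = 0" by simp
  moreover have "(LINT x|?M. dird b f x) = (LINT x|lborel. dird b f x)"
    by (rule restr, rule dird_outside_support[where K = "cball 0 R"]) (use supp in auto)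
  ultimately show ?thesis by simp
qed

text \<open>The Fourier-Laplace transform at the frequency \<open>a - i h\<close>.\<close>

definition fl :: "('a::euclidean_space \<Rightarrow> complex) \<Rightarrow> 'a \<Rightarrow> 'a \<Rightarrow> complex" where
  "fl f a h = (LINT x|lborel. f x * expo (- a) (- h) x)"

lemma cinner_minus_left: "cinner (- a) (- h) x = - cinner a h x"
  by (simp add: cinner_alt)

lemma fl_dird:
  fixes f :: "'a::euclidean_space \<Rightarrow> complex"
  assumes f: "f \<in> smooth_functions" and supp: "\<And>x. norm x > R \<Longrightarrow> f x = 0" and b: "norm b \<le> 1"
  shows "fl (dird b f) a h = cinner a h b * fl f a h"
proof -
  let ?e = "expo (- a) (- h)"
  have e: "?e \<in> smooth_functions" by (rule smooth_expo)
  have i: "integrable lborel (\<lambda>x. f x * ?e x)"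
    by (rule integrable_compact_support[of _ R]) (auto simp: supp intro!: smooth_continuous smooth_mult f e)
  have "dird b f x = 0" if "norm x > R" for x
    by (rule dird_outside_support[where K = "cball 0 R"]) (use supp that in auto)
  then have i': "integrable lborel (\<lambda>x. dird b f x * ?e x)"
    by (intro integrable_compact_support[of _ R]) (auto intro!: smooth_continuous smooth_mult smooth_dird f e)
  have "0 = (LINT x|lborel. dird b (\<lambda>x. f x * ?e x) x)"
    by (rule integral_dird_zero[symmetric, of _ R]) (auto simp: supp b intro!: smooth_mult f e)
  also have "\<dots> = (LINT x|lborel. dird b f x * ?e x - cinner a h b * (f x * ?e x))"
    by (rule Bochner_Integration.integral_cong) (auto simp: dird_mult[OF f e] dird_expo cinner_minus_left algebra_simps)
  also have "\<dots> = fl (dird b f) a h - cinner a h b * fl f a h"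
    unfolding fl_def using i i' by simp
  finally show ?thesis by simp
qed

lemma dird_power_smooth: "f \<in> smooth_functions \<Longrightarrow> (dird b ^^ N) f \<in> smooth_functions"
  by (induction N) (auto intro: smooth_dird)

lemma dird_power_support:
  assumes "\<And>x. x \<notin> K \<Longrightarrow> f x = 0" "closed K" "x \<notin> K" shows "(dird b ^^ N) f x = 0"
  using assms(3) by (induction N arbitrary: x) (auto intro: assms dird_outside_support[where K = K])

text \<open>Each derivative of \<open>f\<close> produces a factor \<open>cinner a h b\<close>, and
  the exponential is at most \<open>exp (- s)\<close> where \<open>f\<close> does not vanish. The
  constant is uniform in \<open>a\<close>, \<open>h\<close> and \<open>s\<close>; this is the decay
  that later beats the growth of the exponentials.\<close>

lemma fl_decay:
  fixes f :: "'a::euclidean_space \<Rightarrow> complex"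
  assumes f: "f \<in> smooth_functions" and supp: "\<And>x. norm x > R \<Longrightarrow> f x = 0" and b: "norm b \<le> 1"
  shows "\<exists>C\<ge>0. \<forall>a h s. (\<forall>x. f x \<noteq> 0 \<longrightarrow> h \<bullet> x \<ge> s) \<longrightarrow> norm (cinner a h b) ^ N * norm (fl f a h) \<le> C * exp (- s)"
proof -
  let ?g = "(dird b ^^ N) f"
  have g: "?g \<in> smooth_functions" by (rule dird_power_smooth[OF f])
  have suppN: "(dird b ^^ k) f x = 0" if "norm x > R" for x k
    by (rule dird_power_support[where K = "cball 0 R"]) (use supp that in auto)
  have ig: "integrable lborel ?g"
    by (rule integrable_compact_support[OF smooth_continuous[OF g] suppN])
  show ?thesis
  proof (rule exI[of _ "LINT x|lborel. norm (?g x)"], intro conjI allI impI)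
    show "(LINT x|lborel. norm (?g x)) \<ge> 0" by simp
    fix a h :: 'a and s assume s: "\<forall>x. f x \<noteq> 0 \<longrightarrow> h \<bullet> x \<ge> s"
    have eq: "fl ((dird b ^^ k) f) a h = cinner a h b ^ k * fl f a h" for k
    proof (induction k)
      case (Suc k)
      have "fl (dird b ((dird b ^^ k) f)) a h = cinner a h b * fl ((dird b ^^ k) f) a h"
        by (rule fl_dird[OF dird_power_smooth[OF f] suppN b])
      then show ?case using Suc by simp
    qed simp
    have gs: "?g x = 0" if "h \<bullet> x < s" for x
    proof (rule dird_power_support[where K = "{x. s \<le> h \<bullet> x}"])
      show "f x = 0" if "x \<notin> {x. s \<le> h \<bullet> x}" for x using s that by auto
      show "closed {x. s \<le> h \<bullet> x}" by (rule closed_halfspace_ge)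
    qed (use that in auto)
    have "norm (cinner a h b) ^ N * norm (fl f a h) = norm (fl ?g a h)"
      by (simp add: eq norm_mult norm_power)
    also have "\<dots> \<le> (LINT x|lborel. norm (?g x * expo (- a) (- h) x))"
      unfolding fl_def by (rule integral_norm_bound)
    also have "\<dots> \<le> (LINT x|lborel. norm (?g x) * exp (- s))"
    proof (rule integral_mono)
      show "integrable lborel (\<lambda>x. norm (?g x * expo (- a) (- h) x))"
        by (intro integrable_norm integrable_compact_support[of _ R])
           (auto simp: suppN intro!: smooth_continuous smooth_mult g smooth_expo)
      show "integrable lborel (\<lambda>x. norm (?g x) * exp (- s))" using ig by simp
      show "norm (?g x * expo (- a) (- h) x) \<le> norm (?g x) * exp (- s)" for x
        using gs[of x] by (cases "h \<bullet> x < s") (auto simp: norm_mult norm_expo intro: mult_left_mono)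
    qed
    finally show "norm (cinner a h b) ^ N * norm (fl f a h) \<le> (LINT x|lborel. norm (?g x)) * exp (- s)" by simp
  qed
qed

section \<open>Lattices, cubes and orthogonality of exponentials\<close>

definition lattice :: "'a::euclidean_space set" where
  "lattice = {x. \<forall>b\<in>Basis. x \<bullet> b \<in> \<int>}"

definition cube :: "real \<Rightarrow> 'a::euclidean_space set" where
  "cube L = {x. \<forall>b\<in>Basis. \<bar>x \<bullet> b\<bar> \<le> L}"

lemma abs_le_interval: "\<bar>y\<bar> \<le> L \<longleftrightarrow> - L \<le> y \<and> y \<le> L" for y L :: real
  by auto

lemma cube_cbox: "cube L = cbox (- (L *\<^sub>R One)) (L *\<^sub>R One)"
  by (auto simp: cube_def mem_box abs_le_interval)

lemma compact_cube: "compact (cube L)" and closed_cube: "closed (cube L)"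
  by (simp_all add: cube_cbox compact_cbox closed_cbox)

lemma sets_cube [measurable]: "cube L \<in> sets borel"
  using closed_cube by (rule borel_closed)

lemma norm_le_cube: "x \<in> cube L \<Longrightarrow> norm x \<le> real DIM('a) * L" for x :: "'a::euclidean_space"
proof -
  assume "x \<in> cube L"
  then have "(\<Sum>b\<in>Basis. \<bar>x \<bullet> b\<bar>) \<le> (\<Sum>b\<in>(Basis::'a set). L)" by (intro sum_mono) (auto simp: cube_def)
  then show ?thesis using norm_le_l1[of x] by simp
qed

lemma integral_lborel_prod:
  fixes f :: "'a::euclidean_space \<Rightarrow> real \<Rightarrow> complex"
  assumes i: "\<And>b. b \<in> Basis \<Longrightarrow> integrable lborel (f b)"
  shows "(LINT x|lborel. (\<Prod>b\<in>Basis. f b (x \<bullet> b))) = (\<Prod>b\<in>Basis. (LINT t|lborel. f b t))"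
proof -
  interpret product_sigma_finite "\<lambda>_::'a. lborel :: real measure" ..
  have [measurable]: "b \<in> Basis \<Longrightarrow> f b \<in> borel_measurable borel" for b
    using borel_measurable_integrable[OF i] by simp
  have "(LINT x|lborel. (\<Prod>b\<in>Basis. f b (x \<bullet> b))) =
      (LINT x|distr (\<Pi>\<^sub>M b\<in>Basis. lborel) borel (\<lambda>f. \<Sum>b\<in>Basis. f b *\<^sub>R b). (\<Prod>b\<in>Basis. f b (x \<bullet> (b::'a))))"
    by (subst lborel_eq) simp
  also have "\<dots> = (LINT y|(\<Pi>\<^sub>M b\<in>(Basis::'a set). lborel). (\<Prod>b\<in>Basis. f b ((\<Sum>c\<in>Basis. y c *\<^sub>R c) \<bullet> b)))"
    by (subst integral_distr) auto
  also have "\<dots> = (LINT y|(\<Pi>\<^sub>M b\<in>(Basis::'a set). lborel). (\<Prod>b\<in>Basis. f b (y b)))"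
    by (intro Bochner_Integration.integral_cong refl prod.cong) (simp add: inner_sum_left_Basis)
  also have "\<dots> = (\<Prod>b\<in>Basis. (LINT t|lborel. f b t))"
    by (rule product_integral_prod) (use i in auto)
  finally show ?thesis .
qed

lemma integral_exp_interval:
  assumes \<mu>: "\<mu> > 0" and k: "k \<in> \<int>"
  shows "(LINT t|lborel. indicator {-(pi/\<mu>)..pi/\<mu>} t *\<^sub>R exp (\<i> * of_real (\<mu> * k * t))) = (if k = 0 then of_real (2 * (pi / \<mu>)) else 0)"
proof (cases "k = 0")
  case True
  have "(LINT t|lborel. indicator {-(pi/\<mu>)..pi/\<mu>} t *\<^sub>R (1::complex)) = of_real (measure lborel {-(pi/\<mu>)..pi/\<mu>})"
    by (simp add: scaleR_conv_of_real)
  then show ?thesis using True \<mu> by simp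
next
  case False
  define F where "F t = exp (\<i> * of_real (\<mu> * k * t)) / (\<i> * of_real (\<mu> * k))" for t
  have nz: "\<mu> * k \<noteq> 0" using False \<mu> by simp
  have "(LINT t|lborel. indicator {-(pi/\<mu>)..pi/\<mu>} t *\<^sub>R exp (\<i> * of_real (\<mu> * k * t))) = F (pi/\<mu>) - F (-(pi/\<mu>))"
  proof (rule integral_FTC_Icc)
    show "- (pi / \<mu>) \<le> pi / \<mu>" using \<mu> by simp
    show "(F has_vector_derivative exp (\<i> * of_real (\<mu> * k * x))) (at x within {- (pi / \<mu>)..pi / \<mu>})" for x
    proof -
      have "((\<lambda>t. exp (\<i> * of_real (\<mu> * k) * t) / (\<i> * of_real (\<mu> * k))) has_field_derivative exp (\<i> * of_real (\<mu> * k) * of_real x)) (at (of_real x))"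
        using nz by (auto intro!: derivative_eq_intros)
      from has_vector_derivative_real_field[OF this] have "((\<lambda>t. exp (\<i> * of_real (\<mu> * k) * of_real t) / (\<i> * of_real (\<mu> * k))) has_vector_derivative exp (\<i> * of_real (\<mu> * k) * of_real x)) (at x within {- (pi / \<mu>)..pi / \<mu>})" .
      then show ?thesis unfolding F_def by (simp add: mult.assoc)
    qed
    show "continuous_on {- (pi / \<mu>)..pi / \<mu>} (\<lambda>t. exp (\<i> * of_real (\<mu> * k * t)))" by (intro continuous_intros)
  qed
  moreover have "exp (\<i> * of_real (\<mu> * k * (pi/\<mu>))) = exp (\<i> * of_real (\<mu> * k * (-(pi/\<mu>))))"
  proof -
    obtain n where n: "k = of_int n" using k Ints_cases by blast
    have "\<i> * of_real (\<mu> * k * (pi/\<mu>)) = \<i> * of_real (\<mu> * k * (-(pi/\<mu>))) + \<i> * (of_int n * (of_real pi * 2))"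
      using \<mu> by (simp add: n)
    then show ?thesis by (simp only: exp_plus_2pin)
  qed
  ultimately show ?thesis using False by (simp add: F_def)
qed

lemma indicator_cube: "indicator (cube L) x = (\<Prod>b\<in>Basis. indicator {-L..L} (x \<bullet> b) :: real)" for x :: "'a::euclidean_space"
proof (cases "x \<in> cube L")
  case True
  then have "(\<Prod>b\<in>Basis. indicator {-L..L} (x \<bullet> b) :: real) = (\<Prod>b\<in>(Basis::'a set). 1)"
    by (intro prod.cong refl) (auto simp: cube_def abs_le_interval)
  then show ?thesis using True by simp
next
  case False
  then obtain b where b: "b \<in> Basis" "x \<bullet> b \<notin> {-L..L}" by (auto simp: cube_def abs_le_interval)
  have "(\<Prod>b\<in>Basis. indicator {-L..L} (x \<bullet> b) :: real) = 0"
    by (rule prod_zero) (use b in \<open>auto intro!: bexI[of _ b]\<close>)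
  then show ?thesis using False by simp
qed

lemma expo_real_prod: "expo a 0 x = (\<Prod>b\<in>Basis. exp (\<i> * of_real ((a \<bullet> b) * (x \<bullet> b))))" for x :: "'a::euclidean_space"
proof -
  have "cinner a 0 x = (\<Sum>b\<in>Basis. \<i> * of_real ((a \<bullet> b) * (x \<bullet> b)))"
    by (subst cinner_alt, subst euclidean_inner) (simp add: sum_distrib_left)
  then show ?thesis by (simp add: expo_def exp_sum)
qed

lemma integral_cube_expo:
  fixes k :: "'a::euclidean_space"
  assumes \<mu>: "\<mu> > 0" and k: "k \<in> lattice"
  shows "(LINT x:cube (pi/\<mu>)|lborel. expo (\<mu> *\<^sub>R k) 0 x) = (if k = 0 then of_real ((2 * (pi/\<mu>)) ^ DIM('a)) else 0)"
proof -
  let ?L = "pi / \<mu>"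
  have "(LINT x:cube ?L|lborel. expo (\<mu> *\<^sub>R k) 0 x) =
     (LINT x|lborel. (\<Prod>b\<in>Basis. indicator {-?L..?L} (x \<bullet> b) *\<^sub>R exp (\<i> * of_real (\<mu> * (k \<bullet> b) * (x \<bullet> b)))))"
    unfolding set_lebesgue_integral_def indicator_cube expo_real_prod
    by (simp add: scaleR_conv_of_real prod.distrib)
  also have "\<dots> = (\<Prod>b\<in>Basis. (LINT t|lborel. indicator {-?L..?L} t *\<^sub>R exp (\<i> * of_real (\<mu> * (k \<bullet> b) * t))))"
    by (rule integral_lborel_prod, rule borel_integrable_compact) (auto intro!: continuous_intros)
  also have "\<dots> = (\<Prod>b\<in>Basis. if k \<bullet> b = 0 then of_real (2 * ?L) else 0)"
    by (intro prod.cong refl integral_exp_interval \<mu>) (use k in \<open>auto simp: lattice_def\<close>)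
  also have "\<dots> = (if k = 0 then of_real ((2 * ?L) ^ DIM('a)) else 0)"
  proof (cases "k = 0")
    case False
    then obtain b where "b \<in> Basis" "k \<bullet> b \<noteq> 0" using euclidean_all_zero_iff by blast
    then show ?thesis using False by (auto simp: prod_zero_iff)
  qed simp
  finally show ?thesis .
qed

text \<open>A nonnegative trigonometric polynomial \<open>p\<close> with its only maximum over the
  cube at \<open>x0\<close> has powers that concentrate there. They too are orthogonal to
  \<open>h\<close>, which is impossible if \<open>h x0\<close> is nonzero. \<open>x0\<close> has to
  be interior because opposite faces of the cube are identified by periodicity.\<close>

lemma trig_uniqueness:
  fixes h :: "'a::euclidean_space \<Rightarrow> complex"
  assumes \<mu>: "\<mu> > 0" and h: "continuous_on UNIV h"
    and orth: "\<And>m. m \<in> lattice \<Longrightarrow> (LINT x:cube (pi/\<mu>)|lborel. h x * expo (\<mu> *\<^sub>R m) 0 x) = 0"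
    and x0: "\<And>b. b \<in> Basis \<Longrightarrow> \<bar>x0 \<bullet> b\<bar> < pi / \<mu>"
  shows "h x0 = 0"
proof (rule ccontr)
  assume nz: "h x0 \<noteq> 0"
  define L where "L = pi / \<mu>"
  have L: "L > 0" using \<mu> by (simp add: L_def)
  let ?Q = "cube L :: 'a set"
  \<comment> \<open>The factors \<phi> that may be inserted without destroying the orthogonality.
    Multiplication by \<open>F b\<close> preserves this property because it only mixes neighbouring
    frequencies.\<close>
  define V where "V \<phi> \<longleftrightarrow> continuous_on UNIV \<phi> \<and> (\<forall>m\<in>lattice. (LINT x:?Q|lborel. h x * \<phi> x * expo (\<mu> *\<^sub>R m) 0 x) = 0)" for \<phi>
  define F where "F b x = (1 + cos (\<mu> * (x \<bullet> b - x0 \<bullet> b))) / 2" for b x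
  have cF: "continuous_on UNIV (F b)" for b unfolding F_def by (intro continuous_intros) auto
  have ce: "continuous_on UNIV (expo a 0)" for a :: 'a by (rule smooth_continuous[OF smooth_expo])
  have si: "set_integrable lborel ?Q g" if "continuous_on UNIV g" for g :: "'a \<Rightarrow> complex"
    unfolding set_integrable_def using that compact_cube[of L]
    by (intro borel_integrable_compact) (auto intro: continuous_on_subset)
  have Ff: "of_real (F b x) = 1/2 + exp (- (\<i> * of_real (\<mu> * (x0 \<bullet> b)))) / 4 * expo (\<mu> *\<^sub>R b) 0 x
     + exp (\<i> * of_real (\<mu> * (x0 \<bullet> b))) / 4 * expo (\<mu> *\<^sub>R (- b)) 0 x" for b x
  proof -
    have "complex_of_real (cos t) = (exp (\<i> * of_real t) + exp (- (\<i> * of_real t))) / 2" for t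
      by (simp add: cos_of_real[symmetric] cos_exp_eq)
    then have "of_real (F b x) = 1/2 + exp (\<i> * of_real (\<mu> * (x \<bullet> b - x0 \<bullet> b))) / 4 + exp (- (\<i> * of_real (\<mu> * (x \<bullet> b - x0 \<bullet> b)))) / 4"
      unfolding F_def by (simp add: add_divide_distrib)
    moreover have "exp (\<i> * of_real (\<mu> * (x \<bullet> b - x0 \<bullet> b))) = exp (- (\<i> * of_real (\<mu> * (x0 \<bullet> b)))) * expo (\<mu> *\<^sub>R b) 0 x"
      unfolding expo_def exp_add[symmetric] by (rule arg_cong[where f = exp]) (simp add: cinner_alt inner_commute algebra_simps)
    moreover have "exp (- (\<i> * of_real (\<mu> * (x \<bullet> b - x0 \<bullet> b)))) = exp (\<i> * of_real (\<mu> * (x0 \<bullet> b))) * expo (\<mu> *\<^sub>R (- b)) 0 x"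
      unfolding expo_def exp_add[symmetric] by (rule arg_cong[where f = exp]) (simp add: cinner_alt inner_commute algebra_simps)
    ultimately show ?thesis by simp
  qed
  have lat: "b \<in> Basis \<Longrightarrow> b \<in> lattice" "m \<in> lattice \<Longrightarrow> - m \<in> lattice" "m \<in> lattice \<Longrightarrow> k \<in> lattice \<Longrightarrow> m + k \<in> lattice"
      "m \<in> lattice \<Longrightarrow> k \<in> lattice \<Longrightarrow> m - k \<in> lattice" for b m k :: 'a
    by (auto simp: lattice_def inner_Basis inner_add_left inner_diff_left)
  have step: "V (\<lambda>x. \<phi> x * of_real (F b x))" if "V \<phi>" "b \<in> Basis" for \<phi> b
    unfolding V_def
  proof (intro conjI ballI)
    have c: "continuous_on UNIV \<phi>" using that V_def by blast
    show "continuous_on UNIV (\<lambda>x. \<phi> x * of_real (F b x))" by (intro continuous_intros c cF)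
    fix m :: 'a assume m: "m \<in> lattice"
    let ?c1 = "exp (- (\<i> * of_real (\<mu> * (x0 \<bullet> b)))) / 4" and ?c2 = "exp (\<i> * of_real (\<mu> * (x0 \<bullet> b))) / 4"
    let ?I = "\<lambda>m x. h x * \<phi> x * expo (\<mu> *\<^sub>R m) 0 x"
    have z: "(LINT x:?Q|lborel. ?I m x) = 0" if "m \<in> lattice" for m using \<open>V \<phi>\<close> that unfolding V_def by blast
    have eq: "h x * (\<phi> x * of_real (F b x)) * expo (\<mu> *\<^sub>R m) 0 x =
      1/2 * ?I m x + (?c1 * ?I (b + m) x + ?c2 * ?I (- b + m) x)" for x
      unfolding Ff scaleR_add_right expo_freq_add[of _ _ 0 0, simplified] by (simp add: algebra_simps)
    have ci: "set_integrable lborel ?Q (?I m)" for m by (rule si) (intro continuous_intros h c ce)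
    show "(LINT x:?Q|lborel. h x * (\<phi> x * of_real (F b x)) * expo (\<mu> *\<^sub>R m) 0 x) = 0"
      unfolding eq using ci z lat that(2) m
      by (simp add: set_integral_add set_integrable_mult_right)
  qed
  have step2: "V (\<lambda>x. \<phi> x * of_real (\<Prod>b\<in>A. F b x))" if "V \<phi>" "finite A" "A \<subseteq> Basis" for \<phi> A
    using that(2,3)
  proof (induction A rule: finite_induct)
    case empty then show ?case using that(1) by simp
  next
    case (insert b A)
    then have "V (\<lambda>x. (\<phi> x * of_real (\<Prod>b\<in>A. F b x)) * of_real (F b x))" by (intro step) auto
    then show ?case using insert by (simp add: mult_ac)
  qed
  define p where "p x = (\<Prod>b\<in>Basis. F b x)" for x
  have V1: "V (\<lambda>x. 1)" unfolding V_def using orth by (simp add: L_def)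
  have VN: "V (\<lambda>x. of_real (p x) ^ N)" for N
  proof (induction N)
    case (Suc N)
    have "V (\<lambda>x. of_real (p x) ^ N * of_real (p x))" unfolding p_def[of "_"] using step2[OF Suc[unfolded p_def], of Basis] by simp
    then show ?case by (simp add: mult.commute)
  qed (use V1 in simp)
  have zero: "(LINT x:?Q|lborel. h x * of_real (p x) ^ N) = 0" for N
  proof -
    have "(0::'a) \<in> lattice" by (simp add: lattice_def)
    from VN[of N, unfolded V_def, THEN conjunct2, rule_format, OF this]
    show ?thesis by (simp add: expo_def cinner_alt)
  qed
  have F01: "0 \<le> F b x" "F b x \<le> 1" for b x
  proof -
    have "0 \<le> 1 + cos t" for t :: real using cos_ge_minus_one[of t] by linarith
    then show "0 \<le> F b x" by (simp add: F_def)
    show "F b x \<le> 1" by (simp add: F_def)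
  qed
  have p01: "0 \<le> p x" "p x \<le> 1" for x unfolding p_def using F01 by (auto intro: prod_nonneg prod_le_1)
  have cp: "continuous_on UNIV p" unfolding p_def by (intro continuous_intros cF)
  have p0: "p x0 = 1" by (simp add: p_def F_def)
  have plt: "p x < 1" if "x \<in> ?Q" "x \<noteq> x0" for x
  proof -
    obtain b where b: "b \<in> Basis" "x \<bullet> b \<noteq> x0 \<bullet> b" using \<open>x \<noteq> x0\<close> euclidean_eqI by blast
    \<comment> \<open>Strict because \<open>x0\<close> is interior; hence the cosine equals 1 only
      where the coordinates agree.\<close>
    have "\<bar>x \<bullet> b - x0 \<bullet> b\<bar> < 2 * (pi / \<mu>)" using that(1) x0[OF b(1)] b(1) by (auto simp: cube_def L_def)
    then have lt: "\<bar>\<mu> * (x \<bullet> b - x0 \<bullet> b)\<bar> < 2 * pi" 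
    proof -
      have "\<mu> * \<bar>x \<bullet> b - x0 \<bullet> b\<bar> < \<mu> * (2 * (pi / \<mu>))"
        using \<open>\<bar>x \<bullet> b - x0 \<bullet> b\<bar> < 2 * (pi / \<mu>)\<close> \<mu> by (rule mult_strict_left_mono)
      then show ?thesis using \<mu> by (simp only: abs_mult abs_of_pos) simp
    qed
    have "cos (\<mu> * (x \<bullet> b - x0 \<bullet> b)) \<noteq> 1"
    proof
      assume "cos (\<mu> * (x \<bullet> b - x0 \<bullet> b)) = 1"
      then obtain n :: int where n: "\<mu> * (x \<bullet> b - x0 \<bullet> b) = of_int n * 2 * pi" using cos_one_2pi_int by auto
      then have "\<bar>of_int n\<bar> * (2 * pi) < 1 * (2 * pi)" using lt by (simp add: abs_mult)
      then have "\<bar>real_of_int n\<bar> < 1" by (simp only: mult_less_cancel_right) auto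
      then have "n = 0" by linarith
      then show False using n \<mu> b by simp
    qed
    then have "cos (\<mu> * (x \<bullet> b - x0 \<bullet> b)) < 1" by (simp add: order_less_le)
    then have "F b x < 1" by (simp add: F_def)
    moreover have "p x = F b x * (\<Prod>b\<in>Basis - {b}. F b x)" unfolding p_def by (rule prod.remove) (use b in auto)
    moreover have "(\<Prod>b\<in>Basis - {b}. F b x) \<le> 1" using F01 by (intro prod_le_1) auto
    then have "F b x * (\<Prod>b\<in>Basis - {b}. F b x) \<le> F b x * 1" using F01 by (intro mult_left_mono)
    ultimately show ?thesis by linarith
  qed
  \<comment> \<open>Rotating the values of \<open>h\<close> makes the one at \<open>x0\<close>
    positive, so real inequalities apply.\<close>
  define u where "u x = Re (h x * cnj (h x0))" for x
  define u0 where "u0 = u x0"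
  have u0: "u0 > 0" using nz unfolding u0_def u_def complex_norm_square[symmetric] by simp
  have cu: "continuous_on UNIV u" unfolding u_def by (intro continuous_intros h)
  have "open {x. u x > u0 / 2}" using cu by (intro open_Collect_less) (auto intro: continuous_intros)
  moreover have "open {x::'a. \<forall>b\<in>Basis. \<bar>x \<bullet> b\<bar> < L}"
  proof -
    have "{x::'a. \<forall>b\<in>Basis. \<bar>x \<bullet> b\<bar> < L} = (\<Inter>b\<in>Basis. {x. \<bar>x \<bullet> b\<bar> < L})" by auto
    moreover have "open (\<Inter>b\<in>(Basis::'a set). {x. \<bar>x \<bullet> b\<bar> < L})"
      by (intro open_INT ballI open_Collect_less continuous_intros) auto
    ultimately show ?thesis by simp
  qed
  ultimately have "open ({x. u x > u0 / 2} \<inter> {x::'a. \<forall>b\<in>Basis. \<bar>x \<bullet> b\<bar> < L})" by (rule open_Int)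
  moreover have "x0 \<in> {x. u x > u0 / 2} \<inter> {x. \<forall>b\<in>Basis. \<bar>x \<bullet> b\<bar> < L}" using u0 x0 by (simp add: L_def u0_def)
  ultimately obtain \<delta> where \<delta>: "\<delta> > 0" "ball x0 \<delta> \<subseteq> {x. u x > u0 / 2} \<inter> {x. \<forall>b\<in>Basis. \<bar>x \<bullet> b\<bar> < L}"
    by (rule openE)
  have ballQ: "ball x0 \<delta> \<subseteq> ?Q" using \<delta>(2) by (fastforce simp: cube_def)
  let ?K = "?Q - ball x0 \<delta>"
  have "\<exists>q. 0 < q \<and> q < 1 \<and> (\<forall>x\<in>?K. p x \<le> q)"
  proof (cases "?K = {}")
    case False
    have "compact ?K" by (intro compact_diff compact_cube) simp
    then have "\<exists>y\<in>?K. \<forall>x\<in>?K. p x \<le> p y"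
      by (rule continuous_attains_sup[OF _ False]) (rule continuous_on_subset[OF cp], simp)
    then obtain y where y: "y \<in> ?K" "\<forall>x\<in>?K. p x \<le> p y" ..
    have "p y < 1" using y(1) \<delta>(1) by (intro plt) auto
    then show ?thesis using y(2) by (intro exI[of _ "max (p y) (1/2)"]) (auto intro: max.coboundedI1)
  qed (auto intro: exI[of _ "1/2"])
  then obtain q where q: "0 < q" "q < 1" "\<And>x. x \<in> ?K \<Longrightarrow> p x \<le> q" by blast
  \<comment> \<open>Strictly between the bound \<open>q\<close> for \<open>p\<close> away from
    \<open>x0\<close> and the maximum 1: near \<open>x0\<close> the powers exceed
    \<open>q' ^ N\<close>, which outgrows \<open>q ^ N\<close>.\<close>
  define q' where "q' = (1 + q) / 2"
  have q': "q < q'" "q' < 1" using q by (simp_all add: q'_def)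
  have "open {x. p x > q'}" using cp by (intro open_Collect_less) auto
  moreover have "x0 \<in> {x. p x > q'}" using p0 q' by simp
  ultimately obtain \<delta>' where \<delta>': "\<delta>' > 0" "ball x0 \<delta>' \<subseteq> {x. p x > q'}" by (rule openE)
  define B where "B = ball x0 (min \<delta> \<delta>')"
  have Bsub: "B \<subseteq> ball x0 \<delta>" "B \<subseteq> ball x0 \<delta>'" by (auto simp: B_def)
  have Bm[measurable]: "B \<in> sets borel" by (simp add: B_def)
  have "compact (u ` ?Q)" using compact_cube continuous_on_subset[OF cu] by (intro compact_continuous_image) auto
  then have "bounded (u ` ?Q)" by (rule compact_imp_bounded)
  then obtain M where "\<forall>y\<in>u ` ?Q. norm y \<le> M" unfolding bounded_iff ..
  then have M: "\<And>x. x \<in> ?Q \<Longrightarrow> \<bar>u x\<bar> \<le> M" by simp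
  have M0: "M \<ge> 0" 
  proof -
    have "x0 \<in> ?Q" using ballQ \<delta>(1) centre_in_ball by blast
    from M[OF this] show ?thesis by linarith
  qed
  have vB: "measure lborel B > 0" using \<delta>(1) \<delta>'(1) content_ball_pos[of "min \<delta> \<delta>'" x0] by (simp add: B_def)
  have Bfin: "emeasure lborel B < \<infinity>" unfolding B_def by (rule emeasure_lborel_ball_finite)
  have Qfin: "emeasure lborel ?Q < \<infinity>" unfolding cube_cbox by (rule emeasure_lborel_cbox_finite)
  \<comment> \<open>Compare the integral, which is 0, with contributions of three regions: at least
    \<open>u0 / 2 * q' ^ N\<close> on \<open>B\<close>, nonnegative on the rest of the ball, and at
    least \<open>- M * q ^ N\<close> elsewhere in the cube.\<close>
  have key: "u0 / 2 * q' ^ N * measure lborel B \<le> M * q ^ N * measure lborel ?Q" for N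
  proof -
    have low: "u0 / 2 * q' ^ N * indicator B x - M * q ^ N * indicator ?Q x \<le> indicator ?Q x * (u x * p x ^ N)" for x
    proof (cases "x \<in> ?Q")
      case False
      then have "x \<notin> B" using Bsub ballQ by blast
      then show ?thesis using False by simp
    next
      case True
      consider "x \<in> B" | "x \<in> ball x0 \<delta>" "x \<notin> B" | "x \<in> ?K" using True by blast
      then show ?thesis
      proof cases
        case 1
        have "u x > u0 / 2" "p x > q'" using 1 \<delta>(2) \<delta>'(2) Bsub by blast+
        then have "u0 / 2 * q' ^ N \<le> u x * p x ^ N" using u0 q q' by (intro mult_mono power_mono) auto
        moreover have "0 \<le> M * q ^ N" using M0 q by simp
        ultimately show ?thesis using 1 True by simp
      next
        case 2
        have "u x > u0 / 2" using 2 \<delta>(2) by blast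
        then have "0 \<le> u x * p x ^ N" using u0 p01 by (intro mult_nonneg_nonneg) auto
        moreover have "0 \<le> M * q ^ N" using M0 q by simp
        ultimately show ?thesis using 2 True by simp
      next
        case 3
        have pq: "p x ^ N \<le> q ^ N" by (rule power_mono[OF q(3)[OF 3] p01(1)])
        have pN: "0 \<le> p x ^ N" using p01(1) by simp
        have "\<bar>u x\<bar> * p x ^ N \<le> M * q ^ N" by (rule mult_mono[OF M[OF True] pq M0 pN])
        then have "\<bar>u x * p x ^ N\<bar> \<le> M * q ^ N" using pN by (simp add: abs_mult)
        moreover have "x \<notin> B" using 3 Bsub by blast
        ultimately show ?thesis using True by simp
      qed
    qed
    have i1: "integrable lborel (\<lambda>x. indicator ?Q x * (u x * p x ^ N))"
    proof -
      have "integrable lborel (\<lambda>x. indicator ?Q x *\<^sub>R (u x * p x ^ N))"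
        using compact_cube by (intro borel_integrable_compact continuous_intros continuous_on_subset[OF cu] continuous_on_subset[OF cp]) auto
      then show ?thesis by simp
    qed
    have i2: "integrable lborel (\<lambda>x. u0 / 2 * q' ^ N * indicator B x - M * q ^ N * indicator ?Q x)"
      using Bfin Qfin by (intro Bochner_Integration.integrable_diff integrable_mult_right integrable_real_indicator) auto
    have "u0 / 2 * q' ^ N * measure lborel B - M * q ^ N * measure lborel ?Q
       = (LINT x|lborel. u0 / 2 * q' ^ N * indicator B x - M * q ^ N * indicator ?Q x)"
      using Bfin Qfin by (subst Bochner_Integration.integral_diff) auto
    also have "\<dots> \<le> (LINT x|lborel. indicator ?Q x * (u x * p x ^ N))"
      by (rule integral_mono[OF i2 i1 low])
    also have "\<dots> = (LINT x|lborel. Re (cnj (h x0) * (indicator ?Q x *\<^sub>R (h x * of_real (p x) ^ N))))"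
      by (intro Bochner_Integration.integral_cong refl) (simp add: u_def algebra_simps flip: of_real_power)
    also have "\<dots> = Re (LINT x|lborel. cnj (h x0) * (indicator ?Q x *\<^sub>R (h x * of_real (p x) ^ N)))"
    proof (rule integral_Re)
      have "set_integrable lborel ?Q (\<lambda>x. h x * of_real (p x) ^ N)" by (rule si) (intro continuous_intros h cp)
      then show "integrable lborel (\<lambda>x. cnj (h x0) * (indicator ?Q x *\<^sub>R (h x * of_real (p x) ^ N)))"
        unfolding set_integrable_def by (rule integrable_mult_right)
    qed
    also have "\<dots> = Re (cnj (h x0) * (LINT x:?Q|lborel. h x * of_real (p x) ^ N))"
      unfolding set_lebesgue_integral_def by (simp only: integral_mult_right_zero)
    also have "\<dots> = 0" by (simp add: zero)
    finally show ?thesis by simp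
  qed
  have "(q' / q) ^ N \<le> M * measure lborel ?Q / (u0 / 2 * measure lborel B)" for N
    using key[of N] q u0 vB by (simp add: power_divide field_simps)
  moreover obtain N where "(q' / q) ^ N > M * measure lborel ?Q / (u0 / 2 * measure lborel B)"
    using real_arch_pow[of "q' / q"] q q' by auto
  ultimately show False using not_le by blast
qed

section \<open>Fourier-Laplace series\<close>

lemma countable_lattice: "countable (lattice :: 'a::euclidean_space set)"
proof -
  have "countable (\<int> :: real set)" by (simp add: Ints_def)
  then have "countable (Pi\<^sub>E (Basis :: 'a set) (\<lambda>_. \<int> :: real set))" by (intro countable_PiE) auto
  then have "countable ((\<lambda>f. \<Sum>b\<in>Basis. f b *\<^sub>R b) ` Pi\<^sub>E (Basis :: 'a set) (\<lambda>_. \<int>))" by (rule countable_image)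
  moreover have "(lattice :: 'a set) \<subseteq> (\<lambda>f. \<Sum>b\<in>Basis. f b *\<^sub>R b) ` Pi\<^sub>E (Basis :: 'a set) (\<lambda>_. \<int>)"
  proof
    fix x :: 'a assume x: "x \<in> lattice"
    have "x = (\<Sum>b\<in>Basis. (restrict (\<lambda>b. x \<bullet> b) Basis) b *\<^sub>R b)" by (simp add: euclidean_representation)
    moreover have "restrict (\<lambda>b. x \<bullet> b) Basis \<in> Pi\<^sub>E (Basis :: 'a set) (\<lambda>_. \<int>)" using x by (auto simp: lattice_def)
    ultimately show "x \<in> (\<lambda>f. \<Sum>b\<in>Basis. f b *\<^sub>R b) ` Pi\<^sub>E (Basis :: 'a set) (\<lambda>_. \<int>)" by blast
  qed
  ultimately show ?thesis by (rule countable_subset[rotated])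
qed

lemma infinite_lattice: "infinite (lattice :: 'a::euclidean_space set)"
proof -
  obtain b :: 'a where b: "b \<in> Basis" using nonempty_Basis by blast
  have "inj (\<lambda>n::nat. real n *\<^sub>R b)" using b by (auto simp: inj_on_def)
  then have "infinite (range (\<lambda>n::nat. real n *\<^sub>R b))" by (rule range_inj_infinite)
  moreover have "range (\<lambda>n::nat. real n *\<^sub>R b) \<subseteq> lattice" using b by (auto simp: lattice_def inner_Basis)
  ultimately show ?thesis by (meson finite_subset)
qed

text \<open>Enumerates the lattice, so that lattice sums become series over the naturals. At type
  \<open>real\<close> it enumerates the integers, used for the expansion along
  \<open>d\<close>.\<close>

definition lat :: "nat \<Rightarrow> 'a::euclidean_space" where "lat = from_nat_into lattice"

lemma bij_lat: "bij_betw lat UNIV lattice"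
  unfolding lat_def by (rule bij_betw_from_nat_into[OF countable_lattice infinite_lattice])

lemma lat_in: "lat i \<in> lattice" using bij_lat bij_betwE by blast

text \<open>The absolute value is injective on the nonnegative and on the negative integers, and
  each half is dominated by the series over the naturals.\<close>

lemma sum_Ints_le:
  fixes T :: "real set"
  assumes "finite T" "T \<subseteq> \<int>"
  shows "(\<Sum>t\<in>T. 1 / (1 + \<bar>t\<bar>)\<^sup>2) \<le> 2 * (\<Sum>n. 1 / (1 + real n)\<^sup>2)"
proof -
  let ?g = "\<lambda>n::nat. 1 / (1 + real n)\<^sup>2"
  have sg: "summable ?g"
  proof -
    have "summable (\<lambda>n. inverse (real (Suc n) ^ 2))"
      by (subst summable_Suc_iff[of "\<lambda>n. inverse (real n ^ 2)"]) (rule inverse_power_summable, simp)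
    then show ?thesis by (simp add: divide_inverse)
  qed
  have half: "(\<Sum>t\<in>S. 1 / (1 + \<bar>t\<bar>)\<^sup>2) \<le> (\<Sum>n. ?g n)"
    if "finite S" "S \<subseteq> \<int>" "\<And>s t. s \<in> S \<Longrightarrow> t \<in> S \<Longrightarrow> \<bar>s\<bar> = \<bar>t\<bar> \<Longrightarrow> s = t" for S :: "real set"
  proof -
    let ?f = "\<lambda>t::real. nat \<lfloor>\<bar>t\<bar>\<rfloor>"
    have f: "real (?f t) = \<bar>t\<bar>" if t: "t \<in> S" for t
    proof -
      have "t \<in> \<int>" using \<open>S \<subseteq> \<int>\<close> t by blast
      then show ?thesis by (elim Ints_cases) simp
    qed
    have inj: "inj_on ?f S"
    proof (rule inj_onI)
      fix s t assume s: "s \<in> S" and t: "t \<in> S" and e: "?f s = ?f t"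
      have "\<bar>s\<bar> = \<bar>t\<bar>" using f[OF s] f[OF t] e by metis
      then show "s = t" using that(3) s t by blast
    qed
    have "(\<Sum>t\<in>S. 1 / (1 + \<bar>t\<bar>)\<^sup>2) = (\<Sum>t\<in>S. ?g (?f t))" by (rule sum.cong) (simp_all only: f)
    also have "\<dots> = (\<Sum>n\<in>?f ` S. ?g n)" using sum.reindex[OF inj, of ?g] by (simp only: o_def)
    also have "\<dots> \<le> (\<Sum>n. ?g n)" by (rule sum_le_suminf[OF sg]) (use that(1) in auto)
    finally show ?thesis .
  qed
  have "(\<Sum>t\<in>T. 1 / (1 + \<bar>t\<bar>)\<^sup>2) = (\<Sum>t\<in>{t\<in>T. t \<ge> 0}. 1 / (1 + \<bar>t\<bar>)\<^sup>2) + (\<Sum>t\<in>{t\<in>T. t < 0}. 1 / (1 + \<bar>t\<bar>)\<^sup>2)"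
    by (subst sum.union_disjoint[symmetric]) (use assms(1) in \<open>auto intro!: sum.cong\<close>)
  also have "\<dots> \<le> (\<Sum>n. ?g n) + (\<Sum>n. ?g n)"
    by (rule add_mono; rule half) (use assms in auto)
  finally show ?thesis by simp
qed

text \<open>As \<open>(1 + norm x) ^ (2 * n)\<close> dominates the product of the squares
  \<open>(1 + \<bar>x \<bullet> b\<bar>)^2\<close>, and a finite set of lattice points lies in a box
  of coordinates, partial sums are bounded by a power of a one-dimensional sum.\<close>

lemma summable_lat: "summable (\<lambda>i. 1 / (1 + norm (lat i :: 'a::euclidean_space)) ^ (2 * DIM('a)))"
proof (rule summableI_nonneg_bounded)
  define C where "C = 2 * (\<Sum>n. 1 / (1 + real n)\<^sup>2)"
  fix n :: nat
  let ?F = "lat ` {..<n} :: 'a set"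
  have inj: "inj_on (lat :: nat \<Rightarrow> 'a) {..<n}" using bij_lat[where 'a='a] by (meson bij_betw_imp_inj_on inj_on_subset subset_UNIV)
  define T where "T = (\<Union>b\<in>Basis. (\<lambda>x::'a. x \<bullet> b) ` ?F)"
  have T: "finite T" "T \<subseteq> \<int>" using lat_in by (auto simp: T_def lattice_def)
  have inj2: "inj_on (\<lambda>x::'a. restrict (\<lambda>b. x \<bullet> b) Basis) ?F"
  proof (rule inj_onI)
    fix x y :: 'a assume "restrict (\<lambda>b. x \<bullet> b) Basis = restrict (\<lambda>b. y \<bullet> b) Basis"
    then have "x \<bullet> b = y \<bullet> b" if "b \<in> Basis" for b using that by (metis restrict_apply)
    then show "x = y" by (rule euclidean_eqI)
  qed
  have le: "1 / (1 + norm x) ^ (2 * DIM('a)) \<le> (\<Prod>b\<in>Basis. 1 / (1 + \<bar>x \<bullet> b\<bar>)\<^sup>2)" for x :: 'a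
  proof -
    have "(\<Prod>b\<in>Basis. (1 + \<bar>x \<bullet> b\<bar>)\<^sup>2) \<le> (\<Prod>b\<in>(Basis::'a set). (1 + norm x)\<^sup>2)"
      by (intro prod_mono conjI power_mono) (auto simp: Basis_le_norm)
    also have "\<dots> = (1 + norm x) ^ (2 * DIM('a))" by (simp add: power_mult)
    finally have "1 / (1 + norm x) ^ (2 * DIM('a)) \<le> 1 / (\<Prod>b\<in>Basis. (1 + \<bar>x \<bullet> b\<bar>)\<^sup>2)"
      by (intro divide_left_mono) (auto intro!: mult_pos_pos prod_pos zero_less_power add_pos_nonneg)
    then show ?thesis by (simp add: prod_dividef)
  qed
  have "(\<Sum>i<n. 1 / (1 + norm (lat i :: 'a)) ^ (2 * DIM('a))) = (\<Sum>x\<in>?F. 1 / (1 + norm x) ^ (2 * DIM('a)))"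
    by (simp add: sum.reindex[OF inj])
  also have "\<dots> \<le> (\<Sum>x\<in>?F. (\<Prod>b\<in>Basis. 1 / (1 + \<bar>x \<bullet> b\<bar>)\<^sup>2))" by (rule sum_mono) (rule le)
  also have "\<dots> = (\<Sum>x\<in>?F. (\<Prod>b\<in>Basis. 1 / (1 + \<bar>restrict (\<lambda>b. x \<bullet> b) Basis b\<bar>)\<^sup>2))"
    by (intro sum.cong prod.cong refl) simp
  also have "\<dots> = (\<Sum>g\<in>(\<lambda>x. restrict (\<lambda>b. x \<bullet> b) Basis) ` ?F. (\<Prod>b\<in>Basis. 1 / (1 + \<bar>g b\<bar>)\<^sup>2))"
    by (subst sum.reindex[OF inj2]) simp
  also have "\<dots> \<le> (\<Sum>g\<in>Pi\<^sub>E (Basis::'a set) (\<lambda>_. T). (\<Prod>b\<in>Basis. 1 / (1 + \<bar>g b\<bar>)\<^sup>2))"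
    by (rule sum_mono2) (use T in \<open>auto intro!: finite_PiE prod_nonneg simp: T_def\<close>)
  also have "\<dots> = (\<Prod>b\<in>(Basis::'a set). \<Sum>t\<in>T. 1 / (1 + \<bar>t\<bar>)\<^sup>2)"
    by (rule prod_sum_PiE[symmetric]) (use T in auto)
  also have "\<dots> \<le> (\<Prod>b\<in>(Basis::'a set). C)"
    unfolding C_def by (intro prod_mono conjI sum_nonneg sum_Ints_le T) auto
  finally show "(\<Sum>i<n. 1 / (1 + norm (lat i :: 'a)) ^ (2 * DIM('a))) \<le> C ^ DIM('a)" by simp
qed simp

text \<open>The largest coordinate of \<open>a\<close> carries the decay, and
  \<open>fl_decay\<close> in that direction applies because \<open>\<bar>a \<bullet> b\<bar>\<close>
  is at most the modulus of \<open>cinner a h b\<close>. Order 0 covers small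
  \<open>a\<close>.\<close>

lemma fl_rapid_decay:
  fixes f :: "'a::euclidean_space \<Rightarrow> complex"
  assumes f: "f \<in> smooth_functions" and supp: "\<And>x. norm x > R \<Longrightarrow> f x = 0"
  shows "\<exists>C\<ge>0. \<forall>a h s. (\<forall>x. f x \<noteq> 0 \<longrightarrow> h \<bullet> x \<ge> s) \<longrightarrow> (1 + norm a) ^ N * norm (fl f a h) \<le> C * exp (- s)"
proof -
  have ex: "\<forall>b\<in>Basis. \<exists>C\<ge>0. \<forall>a h s. (\<forall>x. f x \<noteq> 0 \<longrightarrow> h \<bullet> x \<ge> s) \<longrightarrow> norm (cinner a h b) ^ N * norm (fl f a h) \<le> C * exp (- s)"
  proof
    fix b :: 'a assume "b \<in> Basis"
    then have nb: "norm b \<le> 1" by simp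
    show "\<exists>C\<ge>0. \<forall>a h s. (\<forall>x. f x \<noteq> 0 \<longrightarrow> h \<bullet> x \<ge> s) \<longrightarrow> norm (cinner a h b) ^ N * norm (fl f a h) \<le> C * exp (- s)"
      by (rule fl_decay[OF f supp nb])
  qed
  from bchoice[OF ex] obtain C where C: "\<forall>b\<in>Basis. C b \<ge> 0 \<and> (\<forall>a h s. (\<forall>x. f x \<noteq> 0 \<longrightarrow> h \<bullet> x \<ge> s) \<longrightarrow> norm (cinner a h b) ^ N * norm (fl f a h) \<le> C b * exp (- s))" ..
  have "\<exists>C\<ge>0. \<forall>a h s. (\<forall>x. f x \<noteq> 0 \<longrightarrow> h \<bullet> x \<ge> s) \<longrightarrow> norm (cinner a h 0) ^ 0 * norm (fl f a h) \<le> C * exp (- s)"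
    by (rule fl_decay[OF f supp]) simp_all
  then obtain C0 where C0: "C0 \<ge> 0" "\<forall>a h s. (\<forall>x. f x \<noteq> 0 \<longrightarrow> h \<bullet> x \<ge> s) \<longrightarrow> norm (cinner a h 0) ^ 0 * norm (fl f a h) \<le> C0 * exp (- s)"
    by (elim exE conjE)
  define K where "K = real (DIM('a) + 1) ^ N"
  have K: "K \<ge> 0" by (simp add: K_def)
  show ?thesis
  proof (rule exI[of _ "K * (C0 + (\<Sum>b\<in>Basis. C b))"], intro conjI allI impI)
    show "0 \<le> K * (C0 + (\<Sum>b\<in>Basis. C b))"
      using C C0(1) K by (intro mult_nonneg_nonneg add_nonneg_nonneg sum_nonneg) auto
    fix a h :: 'a and s assume s: "\<forall>x. f x \<noteq> 0 \<longrightarrow> h \<bullet> x \<ge> s"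
    let ?n = "norm (fl f a h)"
    have 0: "?n \<le> C0 * exp (- s)" using C0(2) s by simp
    have b: "\<bar>a \<bullet> b\<bar> ^ N * ?n \<le> C b * exp (- s)" if "b \<in> Basis" for b
    proof -
      have "\<bar>a \<bullet> b\<bar> ^ N \<le> norm (cinner a h b) ^ N"
        using abs_Im_le_cmod[of "cinner a h b"] by (intro power_mono) (auto simp: cinner_def)
      then have "\<bar>a \<bullet> b\<bar> ^ N * ?n \<le> norm (cinner a h b) ^ N * ?n" by (rule mult_right_mono) simp
      also have "\<dots> \<le> C b * exp (- s)" using C that s by blast
      finally show ?thesis .
    qed
    define m where "m = Max (insert 1 ((\<lambda>b. \<bar>a \<bullet> b\<bar>) ` Basis))"
    have m: "1 \<le> m" "\<And>b. b \<in> Basis \<Longrightarrow> \<bar>a \<bullet> b\<bar> \<le> m"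
      unfolding m_def by (intro Max_ge finite.insertI finite_imageI finite_Basis; blast)+
    have "m \<in> insert 1 ((\<lambda>b. \<bar>a \<bullet> b\<bar>) ` Basis)" unfolding m_def by (rule Max_in) auto
    then have mN: "m ^ N * ?n \<le> (C0 + (\<Sum>b\<in>Basis. C b)) * exp (- s)"
    proof (elim insertE imageE)
      assume "m = 1"
      have "0 \<le> (\<Sum>b\<in>Basis. C b) * exp (- s)" using C by (intro mult_nonneg_nonneg sum_nonneg) auto
      then show ?thesis using 0 \<open>m = 1\<close> by (simp add: distrib_right)
    next
      fix b assume mb: "m = \<bar>a \<bullet> b\<bar>" "b \<in> Basis"
      have "C b \<le> (\<Sum>b\<in>Basis. C b)" by (rule member_le_sum) (use mb C in auto)
      then have "C b * exp (- s) \<le> (C0 + (\<Sum>b\<in>Basis. C b)) * exp (- s)" using C0(1) by (intro mult_right_mono) auto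
      then show ?thesis using b[OF mb(2)] unfolding mb(1) by (rule order_trans[rotated])
    qed
    have "norm a \<le> (\<Sum>b\<in>Basis. \<bar>a \<bullet> b\<bar>)" by (rule norm_le_l1)
    also have "\<dots> \<le> (\<Sum>b\<in>(Basis::'a set). m)" by (rule sum_mono) (rule m)
    finally have "1 + norm a \<le> real (DIM('a) + 1) * m" using m(1) by (simp add: algebra_simps)
    then have "(1 + norm a) ^ N \<le> K * m ^ N" unfolding K_def power_mult_distrib[symmetric] by (intro power_mono) auto
    then have "(1 + norm a) ^ N * ?n \<le> K * m ^ N * ?n" by (rule mult_right_mono) simp
    also have "\<dots> \<le> K * ((C0 + (\<Sum>b\<in>Basis. C b)) * exp (- s))"
      unfolding mult.assoc using mN K by (rule mult_left_mono)
    finally show "(1 + norm a) ^ N * ?n \<le> K * (C0 + (\<Sum>b\<in>Basis. C b)) * exp (- s)" by (simp add: mult.assoc)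
  qed
qed

lemma smooth_family_expo:
  fixes a h :: "nat \<Rightarrow> 'a::euclidean_space"
  assumes "\<And>N R. summable (\<lambda>j. norm (c j) * (norm (a j) + norm (h j)) ^ N * exp (norm (h j) * R))"
  shows "smooth_family (\<lambda>j x. c j * expo (a j) (h j) x)"
  unfolding smooth_family_def
proof (intro conjI allI)
  show "(\<lambda>x. c j * expo (a j) (h j) x) \<in> smooth_functions" for j by (rule smooth_cmult[OF smooth_expo])
  fix vs :: "'a list" and R :: real
  let ?M = "\<lambda>j. prod_list (map norm vs) * (norm (c j) * (norm (a j) + norm (h j)) ^ length vs * exp (norm (h j) * R))"
  have P: "0 \<le> prod_list (map norm vs)" by (induction vs) auto
  show "\<exists>M. summable M \<and> (\<forall>j x. norm x \<le> R \<longrightarrow> norm (dirds vs (\<lambda>x. c j * expo (a j) (h j) x) x) \<le> M j)"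
  proof (rule exI[of _ ?M], intro conjI allI impI)
    show "summable ?M" by (rule summable_mult) (rule assms)
    fix j and x :: 'a assume x: "norm x \<le> R"
    have "h j \<bullet> x \<le> norm (h j) * norm x" by (rule norm_cauchy_schwarz)
    also have "\<dots> \<le> norm (h j) * R" using x by (rule mult_left_mono) simp
    finally have e: "exp (h j \<bullet> x) \<le> exp (norm (h j) * R)" by simp
    have "norm (dirds vs (\<lambda>x. c j * expo (a j) (h j) x) x) = norm (c j) * norm (dirds vs (expo (a j) (h j)) x)"
      by (simp add: dirds_cmult[OF smooth_expo] norm_mult)
    also have "\<dots> \<le> norm (c j) * ((norm (a j) + norm (h j)) ^ length vs * prod_list (map norm vs) * exp (h j \<bullet> x))"
      by (rule mult_left_mono[OF norm_dirds_expo]) simp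
    also have "\<dots> \<le> norm (c j) * ((norm (a j) + norm (h j)) ^ length vs * prod_list (map norm vs) * exp (norm (h j) * R))"
      using e P by (intro mult_left_mono) auto
    also have "\<dots> = ?M j" by (simp add: mult_ac)
    finally show "norm (dirds vs (\<lambda>x. c j * expo (a j) (h j) x) x) \<le> ?M j" .
  qed
qed

text \<open>Rapid decay makes the sum \<open>g\<close> of the series smooth. Orthogonality gives
  \<open>g\<close> and \<open>f\<close> the same Fourier coefficients, so
  \<open>trig_uniqueness\<close> applies to \<open>g - f\<close>.\<close>

lemma fourier_series:
  fixes f :: "'a::euclidean_space \<Rightarrow> complex"
  assumes \<mu>: "\<mu> > 0" and f: "f \<in> smooth_functions" and supp: "\<And>x. f x \<noteq> 0 \<Longrightarrow> x \<in> cube (pi / \<mu>)"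
    and x0: "\<And>b. b \<in> Basis \<Longrightarrow> \<bar>x0 \<bullet> b\<bar> < pi / \<mu>"
  shows "(\<lambda>j. fl f (\<mu> *\<^sub>R lat j) 0 / of_real ((2 * (pi/\<mu>)) ^ DIM('a)) * expo (\<mu> *\<^sub>R lat j) 0 x0) sums f x0"
proof -
  define L where "L = pi / \<mu>"
  define V where "V = (2 * L) ^ DIM('a)"
  have V: "V > 0" using \<mu> by (simp add: V_def L_def)
  define c where "c j = fl f (\<mu> *\<^sub>R lat j) 0 / of_real V" for j
  let ?v = "\<lambda>j (x::'a). c j * expo (\<mu> *\<^sub>R lat j) 0 x"
  let ?Q = "cube L :: 'a set"
  have suppR: "f x = 0" if "norm x > real DIM('a) * L" for x
    using supp[of x] norm_le_cube[of x L] that by (auto simp: L_def)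
  have cdec: "\<exists>C. \<forall>j. norm (c j) \<le> C / (1 + norm (lat j :: 'a)) ^ N" for N
  proof -
    have "\<exists>C\<ge>0. \<forall>a h s. (\<forall>x. f x \<noteq> 0 \<longrightarrow> h \<bullet> x \<ge> s) \<longrightarrow> (1 + norm a) ^ N * norm (fl f a h) \<le> C * exp (- s)"
      by (rule fl_rapid_decay[OF f suppR])
    then obtain C where C: "C \<ge> 0" "\<forall>a h s. (\<forall>x. f x \<noteq> 0 \<longrightarrow> h \<bullet> x \<ge> s) \<longrightarrow> (1 + norm a) ^ N * norm (fl f a h) \<le> C * exp (- s)"
      by (elim exE conjE)
    define m where "m = min 1 \<mu>"
    have m: "0 < m" "m \<le> 1" "m \<le> \<mu>" using \<mu> by (auto simp: m_def)
    show ?thesis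
    proof (intro exI allI)
      fix j
      let ?p = "lat j :: 'a"
      have "m * (1 + norm ?p) \<le> 1 + norm (\<mu> *\<^sub>R ?p)"
        using m mult_right_mono[of m \<mu> "norm ?p"] \<mu> by (simp add: algebra_simps)
      then have "(m * (1 + norm ?p)) ^ N \<le> (1 + norm (\<mu> *\<^sub>R ?p)) ^ N" using m by (intro power_mono) auto
      then have "(m * (1 + norm ?p)) ^ N * norm (fl f (\<mu> *\<^sub>R ?p) 0) \<le> (1 + norm (\<mu> *\<^sub>R ?p)) ^ N * norm (fl f (\<mu> *\<^sub>R ?p) 0)"
        by (rule mult_right_mono) simp
      also have "\<dots> \<le> C * exp (- 0)" using C(2)[rule_format, of 0 0 "\<mu> *\<^sub>R ?p"] by simp
      finally have "(1 + norm ?p) ^ N * norm (fl f (\<mu> *\<^sub>R ?p) 0) \<le> C / m ^ N"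
        using m by (simp add: power_mult_distrib pos_le_divide_eq mult_ac)
      moreover have "(1 + norm ?p) ^ N > 0" by (intro zero_less_power add_pos_nonneg) auto
      ultimately have "norm (fl f (\<mu> *\<^sub>R ?p) 0) \<le> C / m ^ N / (1 + norm ?p) ^ N"
        by (simp only: pos_le_divide_eq mult.commute)
      then have "norm (fl f (\<mu> *\<^sub>R ?p) 0) / V \<le> C / m ^ N / (1 + norm ?p) ^ N / V" using V by (intro divide_right_mono) auto
      then show "norm (c j) \<le> (C / m ^ N / V) / (1 + norm ?p) ^ N" using V by (simp add: c_def norm_divide mult.commute)
    qed
  qed
  have sumc: "summable (\<lambda>j. norm (c j) * (norm (\<mu> *\<^sub>R lat j :: 'a) + norm (0::'a)) ^ N * exp (norm (0::'a) * R))" for N R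
  proof -
    obtain C where C: "\<And>j. norm (c j) \<le> C / (1 + norm (lat j :: 'a)) ^ (N + 2 * DIM('a))" using cdec by blast
    show ?thesis
    proof (rule summable_comparison_test'[where N = 0])
      show "summable (\<lambda>j. C * \<mu> ^ N * (1 / (1 + norm (lat j :: 'a)) ^ (2 * DIM('a))))"
        by (rule summable_mult) (rule summable_lat)
      fix j
      let ?p = "1 + norm (lat j :: 'a)"
      have p: "?p > 0" by (simp add: add_pos_nonneg)
      have "norm (c j) * (\<mu> * norm (lat j :: 'a)) ^ N \<le> C / ?p ^ (N + 2 * DIM('a)) * (\<mu> * ?p) ^ N"
        using C[of j] \<mu> by (intro mult_mono power_mono order_trans[OF norm_ge_zero C[of j]]) auto
      also have "\<dots> = C * \<mu> ^ N * (1 / ?p ^ (2 * DIM('a)))"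
        using p by (simp add: power_add power_mult_distrib)
      finally show "norm (norm (c j) * (norm (\<mu> *\<^sub>R lat j :: 'a) + norm (0::'a)) ^ N * exp (norm (0::'a) * R))
        \<le> C * \<mu> ^ N * (1 / ?p ^ (2 * DIM('a)))" using \<mu> by simp
    qed
  qed
  have fam: "smooth_family ?v" using smooth_family_expo[of c "\<lambda>j. \<mu> *\<^sub>R lat j" "\<lambda>_. 0", OF sumc] .
  have sumn: "summable (\<lambda>j. norm (c j))" using sumc[of 0 0] by simp
  define g where "g x = (\<Sum>j. ?v j x)" for x
  have gs: "g \<in> smooth_functions" unfolding g_def by (rule smooth_family_sum[OF fam])
  have "(\<lambda>x. g x - f x) x0 = 0"
  proof (rule trig_uniqueness[OF \<mu> _ _ x0])
    show "continuous_on UNIV (\<lambda>x. g x - f x)" by (intro smooth_continuous smooth_diff gs f)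
    fix m :: 'a assume m: "m \<in> lattice"
    let ?e = "\<lambda>x. expo (\<mu> *\<^sub>R m) 0 x"
    have ne: "norm (expo a 0 x) = 1" for a x :: 'a by (simp add: norm_expo)
    have ce: "continuous_on UNIV (expo a 0)" for a :: 'a by (rule smooth_continuous[OF smooth_expo])
    have si: "set_integrable lborel ?Q u" if "continuous_on UNIV u" for u :: "'a \<Rightarrow> complex"
      unfolding set_integrable_def using that compact_cube[of L]
      by (intro borel_integrable_compact) (auto intro: continuous_on_subset)
    \<comment> \<open>Testing against the exponential of frequency \<open>\<mu> *\<^sub>R m\<close>
      selects the coefficient at the opposite lattice point.\<close>
    have "- m \<in> lattice" using m by (auto simp: lattice_def)
    then obtain j0 where j0: "lat j0 = - m" using bij_lat unfolding bij_betw_def by (metis imageE)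
    have prod: "expo (\<mu> *\<^sub>R lat j) 0 x * ?e x = expo (\<mu> *\<^sub>R (lat j + m)) 0 x" for j x
      using expo_freq_add[of "\<mu> *\<^sub>R lat j" "\<mu> *\<^sub>R m" 0 0 x] by (simp add: scaleR_add_right)
    have int_v: "(LINT x|lborel. indicator ?Q x *\<^sub>R (?v j x * ?e x)) = (if j = j0 then c j0 * of_real V else 0)" for j
    proof -
      have "lat j + m \<in> lattice" using lat_in[of j, where 'a='a] m by (auto simp: lattice_def inner_add_left)
      then have "(LINT x:?Q|lborel. expo (\<mu> *\<^sub>R (lat j + m)) 0 x) = (if lat j + m = 0 then of_real V else 0)"
        using integral_cube_expo[OF \<mu>, of "lat j + m"] by (simp add: L_def V_def)
      moreover have "lat j + m = 0 \<longleftrightarrow> j = j0"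
        using j0 bij_lat[where 'a='a] unfolding bij_betw_def inj_on_def by (metis UNIV_I add_eq_0_iff add.commute)
      moreover have "(LINT x|lborel. indicator ?Q x *\<^sub>R (?v j x * ?e x)) = c j * (LINT x:?Q|lborel. expo (\<mu> *\<^sub>R (lat j + m)) 0 x)"
        unfolding mult.assoc prod set_lebesgue_integral_def mult_scaleR_right[symmetric] by (rule integral_mult_right_zero)
      ultimately show ?thesis by simp
    qed
    have bd: "norm (indicator ?Q x *\<^sub>R (?v j x * ?e x)) = norm (c j) * indicator ?Q x" for j x
      by (simp add: norm_mult ne indicator_def)
    have "(\<lambda>j. LINT x|lborel. indicator ?Q x *\<^sub>R (?v j x * ?e x)) sums (LINT x|lborel. (\<Sum>j. indicator ?Q x *\<^sub>R (?v j x * ?e x)))"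
    proof (rule sums_integral)
      show "integrable lborel (\<lambda>x. indicator ?Q x *\<^sub>R (?v j x * ?e x))" for j
        using si[of "\<lambda>x. ?v j x * ?e x"] unfolding set_integrable_def by (simp add: continuous_intros ce)
      show "AE x in lborel. summable (\<lambda>j. norm (indicator ?Q x *\<^sub>R (?v j x * ?e x)))"
        unfolding bd using sumn by (intro AE_I2 summable_mult2)
      show "summable (\<lambda>j. LINT x|lborel. norm (indicator ?Q x *\<^sub>R (?v j x * ?e x)))"
        unfolding bd using sumn by (simp add: summable_mult2)
    qed
    moreover have "(\<lambda>j. if j = j0 then c j0 * of_real V else 0) sums (c j0 * of_real V)"
      using sums_single[of j0 "\<lambda>j. c j0 * of_real V"] by simp
    ultimately have "(LINT x|lborel. (\<Sum>j. indicator ?Q x *\<^sub>R (?v j x * ?e x))) = c j0 * of_real V"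
      unfolding int_v using sums_unique2 by blast
    moreover have "(\<Sum>j. indicator ?Q x *\<^sub>R (?v j x * ?e x)) = indicator ?Q x *\<^sub>R (g x * ?e x)" for x
    proof -
      have s: "summable (\<lambda>j. ?v j x)" by (rule summable_norm_cancel, rule smooth_family_summable[OF fam])
      show ?thesis unfolding g_def suminf_mult2[OF s] by (rule suminf_scaleR_right[symmetric]) (rule summable_mult2[OF s])
    qed
    ultimately have G: "(LINT x:?Q|lborel. g x * ?e x) = c j0 * of_real V" by (simp add: set_lebesgue_integral_def)
    have "(LINT x:?Q|lborel. f x * ?e x) = fl f (\<mu> *\<^sub>R lat j0) 0"
      unfolding set_lebesgue_integral_def fl_def j0
      by (rule Bochner_Integration.integral_cong) (use supp in \<open>auto simp: indicator_def L_def\<close>)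
    also have "\<dots> = c j0 * of_real V" using V by (simp add: c_def)
    finally have Fi: "(LINT x:?Q|lborel. f x * ?e x) = c j0 * of_real V" .
    have "(LINT x:?Q|lborel. (g x - f x) * ?e x) = (LINT x:?Q|lborel. g x * ?e x) - (LINT x:?Q|lborel. f x * ?e x)"
      unfolding left_diff_distrib
      by (rule set_integral_diff(2)) (rule si, intro continuous_intros smooth_continuous gs f smooth_expo)+
    then show "(LINT x:cube (pi / \<mu>)|lborel. (g x - f x) * ?e x) = 0" using G Fi by (simp add: L_def)
  qed
  then have "g x0 = f x0" by simp
  moreover have "(\<lambda>j. ?v j x0) sums g x0"
    unfolding g_def by (rule summable_sums, rule summable_norm_cancel, rule smooth_family_summable[OF fam])
  ultimately show ?thesis by (simp add: c_def V_def L_def)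
qed

text \<open>Conjugation with an exponential: expand \<open>f x * expo (- a) (- h) x\<close> in an
  ordinary Fourier series and multiply back.\<close>

lemma fourier_laplace_series:
  fixes f :: "'a::euclidean_space \<Rightarrow> complex"
  assumes \<mu>: "\<mu> > 0" and f: "f \<in> smooth_functions" and supp: "\<And>x. f x \<noteq> 0 \<Longrightarrow> x \<in> cube (pi / \<mu>)"
    and x0: "\<And>b. b \<in> Basis \<Longrightarrow> \<bar>x0 \<bullet> b\<bar> < pi / \<mu>"
  shows "(\<lambda>j. fl f (a + \<mu> *\<^sub>R lat j) h / of_real ((2 * (pi/\<mu>)) ^ DIM('a)) * expo (a + \<mu> *\<^sub>R lat j) h x0) sums f x0"
proof -
  let ?g = "\<lambda>x. f x * expo (- a) (- h) x"
  have e1: "expo (- a) (- h) x * expo a h x = 1" for x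
    using expo_freq_add[of "- a" a "- h" h x] by (simp add: expo_def cinner_def Complex_eq)
  have flg: "fl ?g m 0 = fl f (a + m) h" for m
    unfolding fl_def using expo_freq_add[of "- a" "- m" "- h" 0] by (simp add: mult.assoc)
  have "(\<lambda>j. fl ?g (\<mu> *\<^sub>R lat j) 0 / of_real ((2 * (pi/\<mu>)) ^ DIM('a)) * expo (\<mu> *\<^sub>R lat j) 0 x0) sums ?g x0"
    by (rule fourier_series[OF \<mu> _ _ x0]) (use supp in \<open>auto intro!: smooth_mult f smooth_expo\<close>)
  then have "(\<lambda>j. fl ?g (\<mu> *\<^sub>R lat j) 0 / of_real ((2 * (pi/\<mu>)) ^ DIM('a)) * expo (\<mu> *\<^sub>R lat j) 0 x0 * expo a h x0) sums (?g x0 * expo a h x0)"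
    by (rule sums_mult2)
  moreover have "expo (\<mu> *\<^sub>R lat j) 0 x0 * expo a h x0 = expo (a + \<mu> *\<^sub>R lat j) h x0" for j
    using expo_freq_add[of "\<mu> *\<^sub>R lat j" a 0 h x0] by (simp add: add.commute)
  ultimately show ?thesis by (simp only: flg mult.assoc e1 mult_1_right)
qed

lemma rmean_cmult:
  assumes "u \<in> smooth_functions"
  shows "rmean l w (\<lambda>x. c * u x) s x = c * rmean l w u s x"
  using assms
proof (induction l arbitrary: w u)
  case 0
  have "(LINT z|sph. w z * (c * u (x - s *\<^sub>R z))) = (LINT z|sph. c * (w z * u (x - s *\<^sub>R z)))"
    by (simp only: mult.left_commute)
  then show ?case by simp
next
  case (Suc l)
  show ?case
    by (simp only: rmean.simps dird_cmult[OF Suc.prems] Suc.IH[OF smooth_dird[OF Suc.prems]] sum_distrib_left)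
qed

lemma sphop_cmult:
  fixes u :: "'a::euclidean_space \<Rightarrow> complex"
  assumes "r > 0" "u \<in> smooth_functions"
  shows "sphop l r (\<lambda>x. c * u x) x = c * sphop l r u x"
  using assms by (simp add: sphop_eq smooth_cmult rmean_cmult)

lemma sphop_zero: "r > 0 \<Longrightarrow> sphop l r (\<lambda>_. 0) x = 0" for x :: "'a::euclidean_space"
  using sphop_cmult[of r "\<lambda>_. 0" l 0 x] by (simp add: smooth_const)

section \<open>Double series and the choice of the shifts\<close>

lemma summable_prod_decode:
  fixes P Q :: "nat \<Rightarrow> real"
  assumes P: "\<And>i. P i \<ge> 0" "summable P" and Q: "\<And>k. Q k \<ge> 0" "summable Q"
  shows "(\<lambda>j. P (fst (prod_decode j)) * Q (snd (prod_decode j))) sums (suminf P * suminf Q)"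
proof -
  have hP: "(P has_sum suminf P) UNIV" and hQ: "(Q has_sum suminf Q) UNIV"
    using P Q by (auto intro!: norm_summable_imp_has_sum summable_sums)
  have inner: "((\<lambda>k. (\<lambda>z. P (fst z) * Q (snd z)) (i, k)) has_sum (P i * suminf Q)) UNIV" for i
    using has_sum_cmult_right[OF hQ, of "P i"] by simp
  have outer: "((\<lambda>i. P i * suminf Q) has_sum (suminf P * suminf Q)) UNIV"
    by (rule has_sum_cmult_left[OF hP])
  have "(\<lambda>z. P (fst z) * Q (snd z)) summable_on Sigma UNIV (\<lambda>_. UNIV)"
    by (rule summable_on_SigmaI[OF inner]) (use outer P Q in \<open>auto simp: summable_on_def\<close>)
  then have "((\<lambda>z. P (fst z) * Q (snd z)) has_sum (suminf P * suminf Q)) (Sigma UNIV (\<lambda>_. UNIV))"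
    by (intro has_sum_SigmaI[OF inner outer])
  then have "((\<lambda>j. P (fst (prod_decode j)) * Q (snd (prod_decode j))) has_sum (suminf P * suminf Q)) UNIV"
    using has_sum_reindex_bij_betw[OF bij_prod_decode, of "\<lambda>z. P (fst z) * Q (snd z)"] by simp
  then show ?thesis by (rule has_sum_imp_sums)
qed

text \<open>A product majorant makes the double series absolutely summable, so it may be rearranged
  into a single series, the form required by \<open>smooth_family\<close>.\<close>

lemma sums_prod_decode:
  fixes f :: "nat \<Rightarrow> nat \<Rightarrow> complex"
  assumes P: "\<And>i. P i \<ge> 0" "summable P" and Q: "\<And>k. Q k \<ge> 0" "summable Q"
    and f: "\<And>i k. norm (f i k) \<le> P i * Q k" and S: "\<And>i. f i sums S i" "S sums T"
  shows "(\<lambda>j. f (fst (prod_decode j)) (snd (prod_decode j))) sums T"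
proof -
  let ?g = "\<lambda>z. f (fst z) (snd z)"
  have "summable (\<lambda>j. norm (f (fst (prod_decode j)) (snd (prod_decode j))))"
    by (rule summable_comparison_test'[where N = 0, OF sums_summable[OF summable_prod_decode[OF P Q]]]) (simp add: f)
  then have "(\<lambda>j. ?g (prod_decode j)) summable_on UNIV" by (rule norm_summable_imp_summable_on)
  then have "?g summable_on UNIV" using summable_on_reindex_bij_betw[OF bij_prod_decode, of ?g] by simp
  then have gs: "?g summable_on Sigma UNIV (\<lambda>_. UNIV)" by simp
  have sf: "summable (\<lambda>k. norm (f i k))" for i
    by (rule summable_comparison_test'[where N = 0, OF summable_mult[OF Q(2), of "P i"]]) (simp add: f)
  have inner: "((\<lambda>k. ?g (i, k)) has_sum S i) UNIV" for i
    using norm_summable_imp_has_sum[OF sf S(1)] by simp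
  have nS: "norm (S i) \<le> P i * suminf Q" for i
  proof -
    have "norm (S i) \<le> (\<Sum>k. norm (f i k))" using summable_norm[OF sf, of i] S(1)[of i] by (simp add: sums_iff)
    also have "\<dots> \<le> (\<Sum>k. P i * Q k)" by (rule suminf_le[OF f sf summable_mult[OF Q(2)]])
    also have "\<dots> = P i * suminf Q" by (rule suminf_mult[OF Q(2)])
    finally show ?thesis .
  qed
  have "summable (\<lambda>i. norm (S i))"
    by (rule summable_comparison_test'[where N = 0, OF summable_mult2[OF P(2), of "suminf Q"]]) (simp add: nS)
  then have outer: "(S has_sum T) UNIV" using S(2) by (rule norm_summable_imp_has_sum)
  have "(?g has_sum T) (Sigma UNIV (\<lambda>_. UNIV))" by (rule has_sum_SigmaI[OF inner outer gs])
  then have "((\<lambda>j. ?g (prod_decode j)) has_sum T) UNIV"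
    using has_sum_reindex_bij_betw[OF bij_prod_decode, of ?g] by simp
  then show ?thesis by (rule has_sum_imp_sums)
qed

text \<open>First cut off a tail of sum below \<delta>/2 and leave it unshifted, using
  \<open>w 0 \<le> 1\<close>; then choose one \<eta> above the finitely many thresholds
  \<open>H i\<close> that makes the weighted head at most \<delta>/2. Hence the shifts have a common
  bound.\<close>

lemma choose_shifts:
  fixes P H :: "nat \<Rightarrow> real" and w :: "real \<Rightarrow> real"
  assumes P: "\<And>i. P i \<ge> 0" "summable P" and w: "\<And>e. w e \<ge> 0" "(w \<longlongrightarrow> 0) at_top" "w 0 \<le> 1" and \<delta>: "\<delta> > 0"
  shows "\<exists>e B. (\<forall>i. (e i = 0 \<or> e i \<ge> H i) \<and> 0 \<le> e i \<and> e i \<le> B) \<and>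
    summable (\<lambda>i. w (e i) * P i) \<and> (\<Sum>i. w (e i) * P i) \<le> (\<delta>::real)"
proof -
  have "(\<lambda>n. \<Sum>i. P (i + n)) \<longlonglongrightarrow> 0" by (rule suminf_exist_split2[OF P(2)])
  then have "\<forall>\<^sub>F n in sequentially. (\<Sum>i. P (i + n)) < \<delta> / 2" using \<delta> by (intro order_tendstoD(2)[of _ 0]) auto
  then obtain M where M: "(\<Sum>i. P (i + M)) < \<delta> / 2" by (auto simp: eventually_sequentially)
  define S where "S = (\<Sum>i<M. P i) + 1"
  have S: "S > 0" using P by (simp add: S_def sum_nonneg add_nonneg_pos)
  have "\<forall>\<^sub>F e in at_top. w e < \<delta> / (2 * S)" using w(2) \<delta> S by (intro order_tendstoD(2)[of _ 0]) auto
  moreover have "\<forall>\<^sub>F e in at_top. Max (insert 0 (H ` {..<M})) \<le> e" by (rule eventually_ge_at_top)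
  ultimately have "\<forall>\<^sub>F e in at_top. w e < \<delta> / (2 * S) \<and> Max (insert 0 (H ` {..<M})) \<le> e" by (rule eventually_conj)
  then obtain \<eta> where \<eta>: "w \<eta> < \<delta> / (2 * S)" "Max (insert 0 (H ` {..<M})) \<le> \<eta>"
    by (auto simp: eventually_at_top_linorder)
  define e where "e i = (if i < M then \<eta> else 0)" for i
  have \<eta>0: "0 \<le> \<eta>" and \<eta>H: "\<And>i. i < M \<Longrightarrow> H i \<le> \<eta>" using \<eta>(2) by auto
  have tail: "summable (\<lambda>i. w (e (i + M)) * P (i + M))"
  proof (rule summable_comparison_test'[where N = 0])
    show "summable (\<lambda>i. P (i + M))" using P(2) by (simp add: summable_iff_shift)
    show "norm (w (e (i + M)) * P (i + M)) \<le> P (i + M)" for i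
      using w P(1)[of "i + M"] by (simp add: e_def mult_left_le_one_le)
  qed
  then have sm: "summable (\<lambda>i. w (e i) * P i)" using summable_iff_shift[of "\<lambda>i. w (e i) * P i" M] by simp
  have "(\<Sum>i. w (e i) * P i) = (\<Sum>i. w (e (i + M)) * P (i + M)) + (\<Sum>i<M. w (e i) * P i)"
    by (rule suminf_split_initial_segment[OF sm])
  also have "(\<Sum>i. w (e (i + M)) * P (i + M)) \<le> (\<Sum>i. P (i + M))"
    using P w by (intro suminf_le tail) (auto simp: e_def mult_left_le_one_le summable_iff_shift)
  also have "(\<Sum>i<M. w (e i) * P i) = w \<eta> * (\<Sum>i<M. P i)"
    unfolding sum_distrib_left by (rule sum.cong) (auto simp: e_def)
  also have "w \<eta> * (\<Sum>i<M. P i) \<le> w \<eta> * S" using w(1) by (intro mult_left_mono) (auto simp: S_def)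
  also have "\<dots> \<le> \<delta> / (2 * S) * S" using \<eta>(1) S by (intro mult_right_mono) auto
  also have "\<dots> = \<delta> / 2" using S by simp
  finally have "(\<Sum>i. w (e i) * P i) \<le> \<delta>" using M by linarith
  then show ?thesis using sm \<eta>0 \<eta>H by (intro exI[of _ e] exI[of _ \<eta>]) (auto simp: e_def)
qed

text \<open>With \<open>t = a0 \<bullet> d + \<tau>\<close> and \<beta> the squared norm of the part
  of \<open>a0\<close> orthogonal to \<open>d\<close>, the number is
  \<open>(t - i \<eta>)^2 + \<beta>\<close>. If \<open>(Im q)^2\<close> were below
  \<open>\<eta>^2 - \<beta>\<close>, then \<open>(Re q)^2\<close> would be below \<open>t^2\<close>,
  contradicting \<open>Re q * Im q = - \<eta> t\<close>. The threshold for \<eta> is the same for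
  all \<tau>, so one shift serves a whole line of frequencies.\<close>

lemma shifted_frequency_root:
  fixes a0 d :: "'a::euclidean_space"
  assumes d: "norm d = 1" and \<eta>: "\<eta> \<ge> K + norm a0" and K: "K > 0"
  shows "\<exists>q. q\<^sup>2 = csq (a0 + \<tau> *\<^sub>R d) (\<eta> *\<^sub>R d) \<and> Im q \<ge> K"
proof -
  define t where "t = a0 \<bullet> d + \<tau>"
  define \<beta> where "\<beta> = a0 \<bullet> a0 - (a0 \<bullet> d)\<^sup>2"
  have dd: "d \<bullet> d = 1" using d by (simp add: dot_square_norm)
  have aa: "(a0 + \<tau> *\<^sub>R d) \<bullet> (a0 + \<tau> *\<^sub>R d) = t\<^sup>2 + \<beta>"
    by (simp add: t_def \<beta>_def inner_add_left inner_add_right dd inner_commute[of d a0] power2_eq_square algebra_simps)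
  have ad: "(a0 + \<tau> *\<^sub>R d) \<bullet> d = t" by (simp add: t_def inner_add_left dd)
  define q where "q = csqrt (csq (a0 + \<tau> *\<^sub>R d) (\<eta> *\<^sub>R d))"
  have q2: "q\<^sup>2 = csq (a0 + \<tau> *\<^sub>R d) (\<eta> *\<^sub>R d)" unfolding q_def by (rule power2_csqrt)
  have re: "(Re q)\<^sup>2 - (Im q)\<^sup>2 = t\<^sup>2 + \<beta> - \<eta>\<^sup>2"
    using arg_cong[OF q2, of Re] by (simp add: csq_def aa dd Re_power2 power2_eq_square[of \<eta>])
  have "2 * Re q * Im q = - 2 * (\<eta> * t)"
    using arg_cong[OF q2, of Im] by (simp add: csq_def ad Im_power2)
  then have "Re q * Im q = - (\<eta> * t)" by linarith
  then have "(Re q * Im q)\<^sup>2 = (\<eta> * t)\<^sup>2" by simp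
  then have im: "(Re q)\<^sup>2 * (Im q)\<^sup>2 = t\<^sup>2 * \<eta>\<^sup>2" by (simp add: power_mult_distrib mult.commute)
  have "(a0 \<bullet> d)\<^sup>2 \<le> (norm a0)\<^sup>2"
    using Cauchy_Schwarz_ineq2[of a0 d] d by (simp add: abs_le_square_iff[symmetric])
  then have \<beta>: "0 \<le> \<beta>" "\<beta> \<le> (norm a0)\<^sup>2" by (simp_all add: \<beta>_def dot_square_norm)
  have "\<eta>\<^sup>2 - \<beta> \<le> (Im q)\<^sup>2"
  proof (rule ccontr)
    assume n: "\<not> ?thesis"
    then have x: "(Re q)\<^sup>2 < t\<^sup>2" and y: "(Im q)\<^sup>2 < \<eta>\<^sup>2" using re \<beta> by auto
    have "(Re q)\<^sup>2 * (Im q)\<^sup>2 < t\<^sup>2 * \<eta>\<^sup>2" by (rule mult_strict_mono'[OF x y]) auto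
    then show False using im by simp
  qed
  moreover have "(K + norm a0)\<^sup>2 \<le> \<eta>\<^sup>2" using \<eta> K by (intro power_mono) auto
  moreover have "K\<^sup>2 + (norm a0)\<^sup>2 \<le> (K + norm a0)\<^sup>2" using K by (simp add: power2_sum)
  ultimately have "K\<^sup>2 \<le> (Im q)\<^sup>2" using \<beta> by linarith
  then have "K \<le> \<bar>Im q\<bar>" using K by (simp add: abs_le_square_iff[symmetric])
  then consider "Im q \<ge> K" | "Im (- q) \<ge> K" by fastforce
  then show ?thesis
  proof cases
    case 2
    have "(- q)\<^sup>2 = csq (a0 + \<tau> *\<^sub>R d) (\<eta> *\<^sub>R d)" using q2 by simp
    then show ?thesis using 2 by blast
  qed (use q2 in blast)
qed

lemma bsl_shift_lower_bound:
  assumes r: "r > 0"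
  shows "\<exists>K c. c > 0 \<and> K > 0 \<and> (\<forall>(a0::'a::euclidean_space) d \<tau> \<eta>. norm d = 1 \<longrightarrow> \<eta> \<ge> K + norm a0 \<longrightarrow>
      cmod (bsl (a0 + \<tau> *\<^sub>R d) (\<eta> *\<^sub>R d) l r) \<ge> c / (1 + norm (a0 + \<tau> *\<^sub>R d) + \<eta>) ^ (DIM('a) - 1))"
proof -
  obtain K c where c: "c > 0" and K: "K > 0" and b: "\<forall>(a::'a) h q. q\<^sup>2 = csq a h \<longrightarrow> Im q \<ge> K \<longrightarrow>
      cmod (bsl a h l r) \<ge> c / (1 + norm a + norm h) ^ (DIM('a) - 1)"
    by (rule bsl_lower_bound_complex[OF r, where 'a = 'a and l = l]) (rule that, assumption, assumption, simp)
  show ?thesis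
  proof (rule exI[of _ K], rule exI[of _ c], intro conjI c K allI impI)
    fix a0 d :: 'a and \<tau> \<eta> :: real
    assume d: "norm d = 1" and \<eta>: "\<eta> \<ge> K + norm a0"
    have "\<eta> \<ge> 0" using \<eta> K norm_ge_zero[of a0] by linarith
    then have nh: "norm (\<eta> *\<^sub>R d) = \<eta>" using d by simp
    from shifted_frequency_root[OF d \<eta> K, of \<tau>] obtain q where q: "q\<^sup>2 = csq (a0 + \<tau> *\<^sub>R d) (\<eta> *\<^sub>R d)" "Im q \<ge> K" by blast
    have "c / (1 + norm (a0 + \<tau> *\<^sub>R d) + norm (\<eta> *\<^sub>R d)) ^ (DIM('a) - 1) \<le> cmod (bsl (a0 + \<tau> *\<^sub>R d) (\<eta> *\<^sub>R d) l r)"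
      using b q by blast
    then show "c / (1 + norm (a0 + \<tau> *\<^sub>R d) + \<eta>) ^ (DIM('a) - 1) \<le> cmod (bsl (a0 + \<tau> *\<^sub>R d) (\<eta> *\<^sub>R d) l r)"
      unfolding nh .
  qed
qed

section \<open>Small solutions in half spaces\<close>

text \<open>Here \<open>d\<close> has to be a signed coordinate vector: the unshifted frequencies of
  the double series then stay in the lattice.\<close>

lemma lattice_line:
  fixes p d :: "'a::euclidean_space" and k :: real
  assumes d: "d \<in> Basis \<union> uminus ` Basis" and p: "p \<in> lattice" and k: "k \<in> lattice"
  shows "p + k *\<^sub>R d \<in> lattice"
  unfolding lattice_def
proof (intro CollectI ballI)
  fix b :: 'a assume b: "b \<in> Basis"
  have "d \<bullet> b \<in> \<int>" using d b by (auto simp: inner_Basis)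
  moreover have "k \<in> \<int>" "p \<bullet> b \<in> \<int>" using p k b by (auto simp: lattice_def)
  ultimately show "(p + k *\<^sub>R d) \<bullet> b \<in> \<int>" by (simp add: inner_add_left)
qed

text \<open>The shift keeps the frequencies away from \<open>0\<close>, where the multiplier vanishes for \<open>l \<ge> 1\<close>.\<close>

definition half_shift :: "'a::euclidean_space" where "half_shift = (1/2) *\<^sub>R (\<Sum>b\<in>Basis. b)"

lemma half_shift_off_lattice:
  assumes "p \<in> lattice" shows "p + half_shift \<noteq> (0::'a::euclidean_space)"
proof
  obtain b :: 'a where b: "b \<in> Basis" using nonempty_Basis by blast
  assume "p + half_shift = 0"
  then have "(p + half_shift) \<bullet> b = 0" by simp
  then have "p \<bullet> b + 1/2 = 0" using b by (simp add: half_shift_def inner_add_left inner_sum_left inner_Basis sum.delta')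
  moreover have "p \<bullet> b \<in> \<int>" using assms b by (auto simp: lattice_def)
  then obtain n where "p \<bullet> b = of_int n" by (elim Ints_cases)
  ultimately have "real_of_int (2 * n + 1) = 0" by simp
  then have "2 * n + 1 = 0" by (simp only: of_int_eq_0_iff)
  then show False by presburger
qed

text \<open>Confining \<mu> to the range from \<sigma> to 2\<sigma> keeps the period as large as the
  caller wants. The constants \<open>A\<close> and \<open>A'\<close> only translate between the norm
  of a lattice point and that of its shifted dilate.\<close>

lemma generic_lattice_scale:
  assumes r: "r > 0" and \<sigma>: "\<sigma> > 0"
  shows "\<exists>\<mu> c M. \<sigma> \<le> \<mu> \<and> \<mu> \<le> 2 * \<sigma> \<and> c > 0 \<and>
    (\<forall>p\<in>lattice. c / (1 + norm p) ^ M \<le> norm (bsl (\<mu> *\<^sub>R (p + half_shift :: 'a::euclidean_space)) 0 l r))"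
proof -
  let ?sh = "half_shift :: 'a"
  define p where "p i = \<sigma> *\<^sub>R (lat i + ?sh)" for i
  have np: "norm (p i) = \<sigma> * norm (lat i + ?sh)" for i using \<sigma> by (simp add: p_def)
  define A where "A = 1 + norm ?sh + 1 / \<sigma>"
  have A: "A \<ge> 1" "A * \<sigma> \<ge> 1" using \<sigma> by (auto simp: A_def field_simps)
  have "summable (\<lambda>i. 1 / (1 + norm (p i)) ^ (2 * DIM('a)))"
  proof (rule summable_comparison_test'[where N = 0])
    show "summable (\<lambda>i. A ^ (2 * DIM('a)) * (1 / (1 + norm (lat i :: 'a)) ^ (2 * DIM('a))))"
      by (rule summable_mult[OF summable_lat])
    fix i
    have "norm (lat i :: 'a) \<le> norm (lat i + ?sh) + norm ?sh" using norm_triangle_ineq4[of "lat i + ?sh" ?sh] by simp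
    moreover have "1 * norm (lat i + ?sh) \<le> A * \<sigma> * norm (lat i + ?sh)" using A by (intro mult_right_mono) auto
    moreover have "1 + norm ?sh \<le> A" using \<sigma> by (simp add: A_def)
    ultimately have "1 + norm (lat i :: 'a) \<le> A * (1 + norm (p i))" unfolding np by (simp add: distrib_left mult.assoc)
    then have "(1 + norm (lat i :: 'a)) ^ (2 * DIM('a)) \<le> A ^ (2 * DIM('a)) * (1 + norm (p i)) ^ (2 * DIM('a))"
      unfolding power_mult_distrib[symmetric] by (intro power_mono) auto
    moreover have "(1 + norm (lat i :: 'a)) ^ (2 * DIM('a)) > 0" "(1 + norm (p i)) ^ (2 * DIM('a)) > 0"
      by (intro zero_less_power add_pos_nonneg; simp)+
    ultimately show "norm (1 / (1 + norm (p i)) ^ (2 * DIM('a))) \<le> A ^ (2 * DIM('a)) * (1 / (1 + norm (lat i :: 'a)) ^ (2 * DIM('a)))"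
      by (simp add: pos_le_divide_eq pos_divide_le_eq mult.commute)
  qed
  moreover have p0: "\<forall>i. p i \<noteq> 0" using half_shift_off_lattice lat_in \<sigma> by (auto simp: p_def)
  ultimately have "\<exists>t\<in>{1..2}. \<exists>c>0. \<exists>M. \<forall>i. norm (bsl (t *\<^sub>R p i) 0 l r) \<ge> c / (1 + norm (p i)) ^ M"
    using r by (intro generic_scale) auto
  then obtain t c M where t: "1 \<le> t" "t \<le> 2" and c: "c > 0" and b: "\<forall>i. norm (bsl (t *\<^sub>R p i) 0 l r) \<ge> c / (1 + norm (p i)) ^ M"
    by auto
  define A' where "A' = 1 + \<sigma> + \<sigma> * norm ?sh"
  have A': "A' > 0" using \<sigma> by (auto simp: A'_def intro!: add_pos_nonneg)
  show ?thesis
  proof (rule exI[of _ "t * \<sigma>"], rule exI[of _ "c / A' ^ M"], rule exI[of _ M], intro conjI ballI)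
    show "\<sigma> \<le> t * \<sigma>" "t * \<sigma> \<le> 2 * \<sigma>" "0 < c / A' ^ M" using t \<sigma> c A' by auto
    fix x :: 'a assume "x \<in> lattice"
    then obtain i where i: "x = lat i" using bij_lat[where 'a='a] unfolding bij_betw_def by (metis imageE)
    have "\<sigma> * norm (x + ?sh) \<le> \<sigma> * (norm x + norm ?sh)" using \<sigma> by (intro mult_left_mono norm_triangle_ineq) auto
    moreover have "0 \<le> norm x * (1 + \<sigma> * norm ?sh)" using \<sigma> by simp
    ultimately have "1 + norm (p i) \<le> A' * (1 + norm x)" 
    proof -
      have "A' * (1 + norm x) = 1 + \<sigma> + \<sigma> * norm ?sh + \<sigma> * norm x + norm x * (1 + \<sigma> * norm ?sh)"
        by (simp add: A'_def algebra_simps)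
      moreover have "norm (p i) = \<sigma> * norm (x + ?sh)" by (simp only: np i)
      ultimately show ?thesis using \<open>\<sigma> * norm (x + ?sh) \<le> _\<close> \<open>0 \<le> norm x * _\<close> \<sigma> by (simp only: distrib_left)
    qed
    then have "(1 + norm (p i)) ^ M \<le> A' ^ M * (1 + norm x) ^ M"
      unfolding power_mult_distrib[symmetric] by (intro power_mono) auto
    then have "c / (A' ^ M * (1 + norm x) ^ M) \<le> c / (1 + norm (p i)) ^ M"
      using c A' by (intro divide_left_mono mult_pos_pos zero_less_power add_pos_nonneg) auto
    also have "\<dots> \<le> norm (bsl (t *\<^sub>R p i) 0 l r)" using b by blast
    finally show "c / A' ^ M / (1 + norm x) ^ M \<le> norm (bsl ((t * \<sigma>) *\<^sub>R (x + ?sh)) 0 l r)" by (simp add: p_def i)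
  qed
qed

lemma fl_lattice_decay:
  fixes f :: "'a::euclidean_space \<Rightarrow> complex"
  assumes f: "f \<in> smooth_functions" and supp: "\<And>x. norm x > R \<Longrightarrow> f x = 0" and \<mu>: "\<mu> > 0"
  shows "\<exists>C\<ge>0. \<forall>p h s. (\<forall>x. f x \<noteq> 0 \<longrightarrow> h \<bullet> x \<ge> s) \<longrightarrow> norm (fl f (b + \<mu> *\<^sub>R p) h) \<le> C * exp (- s) / (1 + norm p) ^ N"
proof -
  have "\<exists>C\<ge>0. \<forall>a h s. (\<forall>x. f x \<noteq> 0 \<longrightarrow> h \<bullet> x \<ge> s) \<longrightarrow> (1 + norm a) ^ N * norm (fl f a h) \<le> C * exp (- s)"
    by (rule fl_rapid_decay[OF f supp])
  then obtain C where C: "C \<ge> 0" "\<forall>a h s. (\<forall>x. f x \<noteq> 0 \<longrightarrow> h \<bullet> x \<ge> s) \<longrightarrow> (1 + norm a) ^ N * norm (fl f a h) \<le> C * exp (- s)"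
    by (elim exE conjE)
  \<comment> \<open>Chosen so that \<open>1 + norm p\<close> is at most \<open>A\<close> times
    \<open>1 + norm (b + \<mu> *\<^sub>R p)\<close>.\<close>
  define A where "A = 1 + (1 + norm b) / \<mu>"
  have A: "A > 0" "\<mu> * A \<ge> \<mu>" "\<mu> * A \<ge> 1" using \<mu> by (auto simp: A_def field_simps intro!: add_pos_nonneg)
  show ?thesis
  proof (rule exI[of _ "A ^ N * C"], intro conjI allI impI)
    show "0 \<le> A ^ N * C" using A C by simp
    fix p h s assume s: "\<forall>x. f x \<noteq> 0 \<longrightarrow> h \<bullet> x \<ge> s"
    let ?a = "b + \<mu> *\<^sub>R p"
    have "\<mu> * norm p \<le> norm ?a + norm b" using norm_triangle_ineq4[of ?a b] \<mu> by simp
    moreover have "1 * norm ?a \<le> \<mu> * A * norm ?a" using A by (intro mult_right_mono) auto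
    moreover have "\<mu> * A = \<mu> + 1 + norm b" using \<mu> by (simp add: A_def field_simps)
    ultimately have "\<mu> * (1 + norm p) \<le> \<mu> * (A * (1 + norm ?a))" by (simp add: distrib_left mult.assoc[symmetric])
    then have "1 + norm p \<le> A * (1 + norm ?a)" using \<mu> by simp
    then have "(1 + norm p) ^ N \<le> A ^ N * (1 + norm ?a) ^ N"
      unfolding power_mult_distrib[symmetric] by (intro power_mono) auto
    then have "(1 + norm p) ^ N * norm (fl f ?a h) \<le> A ^ N * (1 + norm ?a) ^ N * norm (fl f ?a h)"
      by (rule mult_right_mono) simp
    also have "\<dots> \<le> A ^ N * (C * exp (- s))"
      unfolding mult.assoc using C(2) s A by (intro mult_left_mono) auto
    finally have "norm (fl f ?a h) * (1 + norm p) ^ N \<le> A ^ N * C * exp (- s)" by (simp only: mult_ac)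
    moreover have "(1 + norm p) ^ N > 0" by (intro zero_less_power add_pos_nonneg) auto
    ultimately show "norm (fl f ?a h) \<le> A ^ N * C * exp (- s) / (1 + norm p) ^ N" by (simp only: pos_le_divide_eq)
  qed
qed

text \<open>The weight for \<open>choose_shifts\<close>; the absolute value keeps it nonnegative at
  all real arguments.\<close>

lemma power_exp_tendsto_0: "((\<lambda>e. \<bar>1 + e\<bar> ^ k * exp (- (e / 4))) \<longlongrightarrow> 0) (at_top :: real filter)"
proof -
  have f: "filterlim (\<lambda>e::real. (1 + e) / 4) at_top at_top"
    by (rule filterlim_at_top_mono[where f = "\<lambda>e. (1/4) * e", OF filterlim_tendsto_pos_mult_at_top[OF tendsto_const _ filterlim_ident]]) auto
  have "((\<lambda>e::real. 4 ^ k * exp (1/4) * (((1 + e) / 4) ^ k / exp ((1 + e) / 4))) \<longlongrightarrow> 4 ^ k * exp (1/4) * 0) at_top"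
    by (intro tendsto_mult tendsto_const filterlim_compose[OF tendsto_power_div_exp_0 f])
  then have "((\<lambda>e::real. 4 ^ k * exp (1/4) * (((1 + e) / 4) ^ k / exp ((1 + e) / 4))) \<longlongrightarrow> 0) at_top" by simp
  moreover have "\<forall>\<^sub>F e::real in at_top. 4 ^ k * exp (1/4) * (((1 + e) / 4) ^ k / exp ((1 + e) / 4)) = \<bar>1 + e\<bar> ^ k * exp (- (e / 4))"
    using eventually_ge_at_top[of "0::real"]
  proof eventually_elim
    case (elim e)
    have "exp ((1 + e) / 4) = exp (1/4) * exp (e / 4)" by (simp add: exp_add[symmetric] add_divide_distrib)
    then show ?case using elim by (simp add: power_divide exp_minus field_simps)
  qed
  ultimately show ?thesis by (rule Lim_transform_eventually)
qed

text \<open>The products of terms of the two expansions are again exponentials, hence eigenfunctions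
  of the operator.\<close>

lemma expo_inner:
  fixes x d b :: "'a::euclidean_space" and t \<eta> :: real
  shows "expo b 0 x * expo t \<eta> (x \<bullet> d) = expo (b + t *\<^sub>R d) (\<eta> *\<^sub>R d) x"
proof -
  have "expo t \<eta> (x \<bullet> d) = expo (t *\<^sub>R d) (\<eta> *\<^sub>R d) x" by (simp add: expo_def cinner_def inner_commute)
  then show ?thesis using expo_freq_add[of b "t *\<^sub>R d" 0 "\<eta> *\<^sub>R d" x] by simp
qed

lemma mono_divide_power:
  fixes c c' Y Z :: real
  assumes "c \<le> c'" "0 \<le> c'" "0 < Z" "Z \<le> Y" "1 \<le> Y" "j \<le> m"
  shows "c / Y ^ m \<le> c' / Z ^ j"
proof -
  have "Z ^ j \<le> Y ^ j" using assms by (intro power_mono) auto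
  also have "\<dots> \<le> Y ^ m" using assms by (intro power_increasing) auto
  finally show ?thesis using assms by (intro frac_le) auto
qed

text \<open>The cutoff \<psi> is supported in \<open>x \<bullet> d \<ge> R + 1/4\<close>, so a shift
  \<open>e\<close> makes its coefficients of size \<open>exp (- e (R + 1/4))\<close>, while the
  exponentials are at most \<open>exp (e R)\<close> where \<open>x \<bullet> d \<le> R\<close>. The
  net gain \<open>exp (- e / 4)\<close> beats every power of \<open>1 + e\<close> lost by dividing
  and differentiating.\<close>

lemma directional_step:
  fixes g :: "'a::euclidean_space \<Rightarrow> complex"
  assumes r: "r > 0" and R: "- 2 \<le> R" and d: "d \<in> Basis \<union> uminus ` Basis" and g: "g \<in> smooth_functions"
    and supp: "\<And>x. g x \<noteq> 0 \<Longrightarrow> x \<in> cube (R + 3) \<and> R + 1/2 \<le> x \<bullet> d" and \<epsilon>: "\<epsilon> > 0"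
  shows "\<exists>v\<in>smooth_functions. (\<forall>x\<in>cube (R + 3). sphop l r v x = g x) \<and>
    (\<forall>x vs. x \<bullet> d \<le> R \<longrightarrow> length vs \<le> n \<longrightarrow> norm (dirds vs v x) \<le> \<epsilon> * prod_list (map norm vs))"
proof -
  have nd: "norm d = 1" using d by auto
  \<comment> \<open>Every scale up to 2\<sigma> gives \<open>pi / \<mu> \<ge> R + 4\<close>, so the
    open period cube contains \<open>cube (R + 3)\<close> and the interval of half-length
    \<open>pi / \<mu>\<close> contains the support of \<psi>.\<close>
  define \<sigma> where "\<sigma> = pi / (2 * (R + 4))"
  have \<sigma>: "\<sigma> > 0" using R by (simp add: \<sigma>_def)
  obtain \<mu> c0 m0 where \<mu>12: "\<sigma> \<le> \<mu>" "\<mu> \<le> 2 * \<sigma>" and c0: "c0 > 0"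
    and gen: "\<forall>p\<in>lattice. c0 / (1 + norm p) ^ m0 \<le> norm (bsl (\<mu> *\<^sub>R (p + half_shift :: 'a)) 0 l r)"
    using generic_lattice_scale[OF r \<sigma>, of l, where 'a = 'a] by (elim exE conjE)
  have \<mu>: "\<mu> > 0" using \<mu>12 \<sigma> by linarith
  have "R + 4 = pi / (2 * \<sigma>)" using R by (simp add: \<sigma>_def)
  also have "\<dots> \<le> pi / \<mu>" using \<mu> \<mu>12 by (intro divide_left_mono) auto
  finally have L: "R + 4 \<le> pi / \<mu>" .
  have lt: "R + 1/4 < R + 1/2" "R + 3 < R + 4" by simp_all
  obtain \<psi> :: "real \<Rightarrow> complex" where \<psi>: "\<psi> \<in> smooth_functions"
    and \<psi>0: "\<And>t. t \<le> R + 1/4 \<or> t \<ge> R + 4 \<Longrightarrow> \<psi> t = 0" and \<psi>1: "\<And>t. R + 1/2 \<le> t \<Longrightarrow> t \<le> R + 3 \<Longrightarrow> \<psi> t = 1"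
    by (rule smooth_bump[OF lt]) (rule that)
  have \<psi>s: "R + 1/4 \<le> t \<and> t \<le> R + 4" if "\<psi> t \<noteq> 0" for t using \<psi>0[of t] that by linarith
  define s where "s = R + 1/4"
  obtain K c1 where c1: "c1 > 0" and K: "K > 0" and cpx: "\<forall>(a0::'a) d \<tau> \<eta>. norm d = 1 \<longrightarrow> \<eta> \<ge> K + norm a0 \<longrightarrow>
      cmod (bsl (a0 + \<tau> *\<^sub>R d) (\<eta> *\<^sub>R d) l r) \<ge> c1 / (1 + norm (a0 + \<tau> *\<^sub>R d) + \<eta>) ^ (DIM('a) - 1)"
    using bsl_shift_lower_bound[OF r, of l, where 'a = 'a] by (elim exE conjE)
  let ?sh = "half_shift :: 'a"
  define p where "p i = 1 + norm (lat i :: 'a)" for i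
  define q where "q k = 1 + norm (lat k :: real)" for k
  have p1: "1 \<le> p i" and q1: "1 \<le> q i" for i by (simp_all add: p_def q_def)
  have p0: "0 < p i" and q0: "0 < q i" for i using p1[of i] q1[of i] by linarith+
  define V where "V = (2 * (pi / \<mu>)) ^ DIM('a)"
  define W where "W = (2 * (pi / \<mu>)) ^ DIM(real)"
  have V: "V > 0" and W: "W > 0" using \<mu> by (simp_all add: V_def W_def)
  define c where "c i = fl g (\<mu> *\<^sub>R ?sh + \<mu> *\<^sub>R lat i) 0 / of_real V" for i
  define D where "D \<eta> k = fl \<psi> (0 + \<mu> *\<^sub>R lat k) \<eta> / of_real W" for \<eta> k
  define a0 where "a0 i = \<mu> *\<^sub>R ?sh + \<mu> *\<^sub>R lat i" for i
  define a where "a i k = a0 i + (\<mu> *\<^sub>R lat k) *\<^sub>R d" for i k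
  define B where "B e i k = bsl (a i k) (e *\<^sub>R d) l r" for e i k
  define H where "H i = K + norm (a0 i)" for i
  define A where "A = 1 + \<mu> * norm ?sh + 2 * \<mu>"
  have A1: "1 \<le> A" using \<mu> by (simp add: A_def)
  \<comment> \<open>A majorant of \<open>1 + norm (a i k) + e\<close> that is a product in
    \<open>i\<close>, \<open>k\<close> and \<open>e\<close>, so that the final estimate separates
    into \<open>P i\<close>, \<open>Q k\<close> and a function of \<open>e\<close>. The summands of
    \<open>A\<close> account for \<open>1 + e\<close>, the half shift and the two lattice
    contributions.\<close>
  define Y where "Y e i k = A * (p i * q k * (1 + e))" for e i k
  have X: "1 \<le> p i * q k" "p i \<le> p i * q k" "q k \<le> p i * q k" for i k
    using p1[of i] q1[of k] mult_mono[of 1 "p i" 1 "q k"] mult_left_mono[of 1 "q k" "p i"] mult_right_mono[of 1 "p i" "q k"] by auto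
  have XY: "p i * q k \<le> Y e i k" "1 \<le> Y e i k" "0 < Y e i k" "1 + norm (a i k) + e \<le> Y e i k" if e: "0 \<le> e" for e i k
  proof -
    let ?X = "p i * q k * (1 + e)"
    have x: "p i * q k \<le> ?X" using X(1)[of i k] e mult_left_mono[of 1 "1 + e" "p i * q k"] by simp
    have x1: "1 + e \<le> ?X" using X(1)[of i k] e mult_right_mono[of 1 "p i * q k" "1 + e"] by simp
    have X0: "1 \<le> ?X" "0 \<le> ?X" using x X(1)[of i k] by linarith+
    have y: "?X \<le> Y e i k" unfolding Y_def using A1 X0 mult_right_mono[of 1 A ?X] by simp
    show "p i * q k \<le> Y e i k" "1 \<le> Y e i k" "0 < Y e i k" using x y X0 by linarith+
    have "norm (a i k) \<le> norm (a0 i) + \<mu> * norm (lat k :: real)"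
      unfolding a_def using norm_triangle_ineq[of "a0 i" "(\<mu> *\<^sub>R lat k) *\<^sub>R d"] nd \<mu> by (simp add: abs_mult)
    moreover have "norm (a0 i) \<le> \<mu> * norm ?sh + \<mu> * norm (lat i :: 'a)"
      unfolding a0_def using norm_triangle_ineq[of "\<mu> *\<^sub>R ?sh" "\<mu> *\<^sub>R lat i"] \<mu> by simp
    moreover have "\<mu> * norm ?sh * 1 \<le> \<mu> * norm ?sh * ?X" using X0 \<mu> by (intro mult_left_mono) auto
    moreover have "\<mu> * norm (lat i :: 'a) \<le> \<mu> * ?X" using x X(2)[of i k] \<mu> unfolding p_def by (intro mult_left_mono) auto
    moreover have "\<mu> * norm (lat k :: real) \<le> \<mu> * ?X" using x X(3)[of k i] \<mu> unfolding q_def by (intro mult_left_mono) auto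
    ultimately have "1 + norm (a i k) + e \<le> ?X + \<mu> * norm ?sh * ?X + \<mu> * ?X + \<mu> * ?X" using x1 by linarith
    then show "1 + norm (a i k) + e \<le> Y e i k" by (simp add: Y_def A_def distrib_right mult.assoc)
  qed
  \<comment> \<open>One exponent large enough for both the real and the complex lower bound.\<close>
  define m where "m = m0 + (DIM('a) - 1)"
  have mj: "m0 \<le> m" "DIM('a) - 1 \<le> m" unfolding m_def by (rule le_add1, rule le_add2)
  define cc where "cc = min c0 c1"
  have cc: "cc > 0" "cc \<le> c0" "cc \<le> c1" using c0 c1 by (auto simp: cc_def)
  \<comment> \<open>An unshifted frequency is a dilated lattice point with the half shift, a shifted
    one satisfies the threshold \<open>H i\<close>; each case has its own lower bound.\<close>
  have Bb: "cc / Y e i k ^ m \<le> norm (B e i k)" if e: "0 \<le> e" "e = 0 \<or> H i \<le> e" for e i k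
    using e(2)
  proof
    assume e0: "e = 0"
    let ?p = "lat i + (lat k :: real) *\<^sub>R d"
    have pl: "?p \<in> lattice" by (rule lattice_line[OF d lat_in lat_in])
    have "norm ?p \<le> norm (lat i :: 'a) + norm (lat k :: real)"
      using norm_triangle_ineq[of "lat i" "(lat k :: real) *\<^sub>R d"] nd by simp
    also have "\<dots> \<le> p i * q k - 1" by (simp add: p_def q_def algebra_simps)
    finally have np: "1 + norm ?p \<le> Y e i k" using XY(1)[OF e(1), of i k] by simp
    have "cc / Y e i k ^ m \<le> c0 / (1 + norm ?p) ^ m0"
      by (rule mono_divide_power[OF cc(2) _ _ np XY(2)[OF e(1)]]) (use c0 mj in \<open>auto simp: add_pos_nonneg\<close>)
    also have "\<dots> \<le> norm (bsl (\<mu> *\<^sub>R (?p + ?sh)) 0 l r)" using gen pl by blast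
    also have "\<mu> *\<^sub>R (?p + ?sh) = a i k" by (simp add: a_def a0_def algebra_simps)
    finally show ?thesis by (simp add: B_def e0)
  next
    assume He: "H i \<le> e"
    have "cc / Y e i k ^ m \<le> c1 / (1 + norm (a i k) + e) ^ (DIM('a) - 1)"
      by (rule mono_divide_power[OF cc(3) _ _ XY(4)[OF e(1)] XY(2)[OF e(1)]]) (use c1 e(1) mj in \<open>auto simp: add_pos_nonneg\<close>)
    also have "\<dots> \<le> norm (B e i k)" using cpx nd He unfolding B_def a_def H_def by blast
    finally show ?thesis .
  qed
  have B0: "B e i k \<noteq> 0" if "0 \<le> e" "e = 0 \<or> H i \<le> e" for e i k
  proof -
    have "0 < cc / Y e i k ^ m" using cc XY(3)[OF that(1)] by (intro divide_pos_pos zero_less_power)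
    then show ?thesis using Bb[OF that, of k] by auto
  qed
  have cb: "\<exists>C\<ge>0. \<forall>i. norm (c i) \<le> C / p i ^ N" for N
  proof -
    have g0: "g x = 0" if "norm x > real DIM('a) * (R + 3)" for x
      using supp[of x] norm_le_cube[of x "R + 3"] that by force
    have "\<exists>C\<ge>0. \<forall>p h s. (\<forall>x. g x \<noteq> 0 \<longrightarrow> h \<bullet> x \<ge> s) \<longrightarrow> norm (fl g (\<mu> *\<^sub>R ?sh + \<mu> *\<^sub>R p) h) \<le> C * exp (- s) / (1 + norm p) ^ N"
      by (rule fl_lattice_decay[OF g g0 \<mu>])
    then obtain C where C: "C \<ge> 0" "\<forall>p h s. (\<forall>x. g x \<noteq> 0 \<longrightarrow> h \<bullet> x \<ge> s) \<longrightarrow> norm (fl g (\<mu> *\<^sub>R ?sh + \<mu> *\<^sub>R p) h) \<le> C * exp (- s) / (1 + norm p) ^ N"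
      by (elim exE conjE)
    show ?thesis
    proof (rule exI[of _ "C / V"], intro conjI allI)
      show "0 \<le> C / V" using C V by simp
      fix i
      have "norm (fl g (\<mu> *\<^sub>R ?sh + \<mu> *\<^sub>R lat i) 0) \<le> C * exp (- 0) / (1 + norm (lat i :: 'a)) ^ N"
        using C(2)[rule_format, of 0 0 "lat i"] by simp
      then have "norm (fl g (\<mu> *\<^sub>R ?sh + \<mu> *\<^sub>R lat i) 0) / V \<le> C / p i ^ N / V"
        using V by (intro divide_right_mono) (auto simp: p_def)
      then show "norm (c i) \<le> C / V / p i ^ N" using V by (simp add: c_def norm_divide mult.commute)
    qed
  qed
  have Db: "\<exists>C\<ge>0. \<forall>k e. 0 \<le> e \<longrightarrow> norm (D e k) \<le> C * exp (- (e * s)) / q k ^ N" for N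
  proof -
    have g0: "\<psi> x = 0" if "norm x > R + 4" for x
      using \<psi>s[of x] R that by (auto simp: abs_if split: if_splits)
    have "\<exists>C\<ge>0. \<forall>p h s. (\<forall>x. \<psi> x \<noteq> 0 \<longrightarrow> h \<bullet> x \<ge> s) \<longrightarrow> norm (fl \<psi> (0 + \<mu> *\<^sub>R p) h) \<le> C * exp (- s) / (1 + norm p) ^ N"
      by (rule fl_lattice_decay[OF \<psi> g0 \<mu>])
    then obtain C where C: "C \<ge> 0" "\<forall>p h s. (\<forall>x. \<psi> x \<noteq> 0 \<longrightarrow> h \<bullet> x \<ge> s) \<longrightarrow> norm (fl \<psi> (0 + \<mu> *\<^sub>R p) h) \<le> C * exp (- s) / (1 + norm p) ^ N"
      by (elim exE conjE)
    show ?thesis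
    proof (rule exI[of _ "C / W"], intro conjI allI impI)
      show "0 \<le> C / W" using C W by simp
      fix k and e :: real assume e: "0 \<le> e"
      have "\<forall>x. \<psi> x \<noteq> 0 \<longrightarrow> e \<bullet> x \<ge> e * s" using \<psi>s e by (auto simp: s_def intro!: mult_left_mono)
      then have "norm (fl \<psi> (0 + \<mu> *\<^sub>R lat k) e) \<le> C * exp (- (e * s)) / (1 + norm (lat k :: real)) ^ N"
        using C(2) by blast
      then have "norm (fl \<psi> (0 + \<mu> *\<^sub>R lat k) e) / W \<le> C * exp (- (e * s)) / q k ^ N / W"
        using W unfolding q_def by (intro divide_right_mono) auto
      then show "norm (D e k) \<le> C / W * exp (- (e * s)) / q k ^ N" using W by (simp add: D_def norm_divide mult.commute)
    qed
  qed
  define P where "P i = 1 / p i ^ (2 * DIM('a))" for i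
  define Q where "Q k = 1 / q k ^ (2 * DIM(real))" for k
  have P: "P i \<ge> 0" "summable P" and Q: "Q k \<ge> 0" "summable Q" for i k
  proof -
    show "P i \<ge> 0" "Q k \<ge> 0" using p0[of i] q0[of k] by (simp_all add: P_def Q_def less_imp_le)
    show "summable P" unfolding P_def[abs_def] p_def by (rule summable_lat)
    show "summable Q" unfolding Q_def[abs_def] q_def by (rule summable_lat)
  qed
  \<comment> \<open>The rapid decay of \<open>c\<close> and \<open>D\<close> pays for
    \<open>m\<close> powers of \<open>Y\<close> from the division and \<open>N\<close> from
    differentiation, and leaves the summable factors \<open>P i\<close> and
    \<open>Q k\<close>.\<close>
  have est: "\<exists>E\<ge>0. \<forall>i k e. 0 \<le> e \<longrightarrow> e = 0 \<or> H i \<le> e \<longrightarrow>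
      norm (c i * D e k / B e i k) * (1 + norm (a i k) + e) ^ N \<le> E * ((1 + e) ^ (m + N) * exp (- (e * s))) * (P i * Q k)" for N
  proof -
    define J where "J = m + N"
    obtain C1 where C1: "C1 \<ge> 0" "\<forall>i. norm (c i) \<le> C1 / p i ^ (J + 2 * DIM('a))" using cb by blast
    obtain C2 where C2: "C2 \<ge> 0" "\<forall>k e. 0 \<le> e \<longrightarrow> norm (D e k) \<le> C2 * exp (- (e * s)) / q k ^ (J + 2 * DIM(real))" using Db by blast
    show ?thesis
    proof (rule exI[of _ "C1 * C2 * A ^ J / cc"], intro conjI allI impI)
      show "0 \<le> C1 * C2 * A ^ J / cc" using C1 C2 A1 cc by simp
      fix i k and e :: real assume e: "0 \<le> e" and He: "e = 0 \<or> H i \<le> e"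
      have y0: "0 < Y e i k ^ m" using XY(3)[OF e] by (rule zero_less_power)
      have ib: "1 / norm (B e i k) \<le> Y e i k ^ m / cc"
      proof -
        have "1 / norm (B e i k) \<le> 1 / (cc / Y e i k ^ m)" using Bb[OF e He] cc y0 by (intro frac_le) auto
        then show ?thesis by simp
      qed
      have "norm (c i * D e k / B e i k) * (1 + norm (a i k) + e) ^ N
        = norm (c i) * norm (D e k) * (1 / norm (B e i k)) * (1 + norm (a i k) + e) ^ N"
        by (simp add: norm_mult norm_divide)
      also have "\<dots> \<le> (C1 / p i ^ (J + 2 * DIM('a))) * (C2 * exp (- (e * s)) / q k ^ (J + 2 * DIM(real))) * (Y e i k ^ m / cc) * Y e i k ^ N"
        using C1 C2 e ib XY(3,4)[OF e, of i k] cc p0[of i] q0[of k]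
        by (intro mult_mono power_mono mult_nonneg_nonneg) (auto simp: less_imp_le)
      also have "\<dots> = (C1 / p i ^ (J + 2 * DIM('a))) * (C2 * exp (- (e * s)) / q k ^ (J + 2 * DIM(real))) * (A ^ J * p i ^ J * q k ^ J * (1 + e) ^ J / cc)"
        by (simp add: Y_def J_def power_add power_mult_distrib)
      also have "\<dots> = C1 * C2 * A ^ J / cc * ((1 + e) ^ J * exp (- (e * s))) * (P i * Q k)"
        using p0[of i] q0[of k] cc by (simp add: P_def Q_def power_add power2_eq_square mult_ac)
      finally show "norm (c i * D e k / B e i k) * (1 + norm (a i k) + e) ^ N
        \<le> C1 * C2 * A ^ J / cc * ((1 + e) ^ (m + N) * exp (- (e * s))) * (P i * Q k)" unfolding J_def .
    qed
  qed
  obtain E where E: "E \<ge> 0" and En: "\<forall>i k e. 0 \<le> e \<longrightarrow> e = 0 \<or> H i \<le> e \<longrightarrow>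
      norm (c i * D e k / B e i k) * (1 + norm (a i k) + e) ^ n \<le> E * ((1 + e) ^ (m + n) * exp (- (e * s))) * (P i * Q k)"
    using est[of n] by (elim exE conjE)
  define w where "w e = \<bar>1 + e\<bar> ^ (m + n) * exp (- (e / 4))" for e :: real
  have sQ: "0 \<le> suminf Q" using Q by (intro suminf_nonneg)
  \<comment> \<open>Adding 1 keeps the denominator positive even if \<open>E\<close> is 0.\<close>
  define \<delta> where "\<delta> = \<epsilon> / (E * suminf Q + 1)"
  have EQ: "0 < E * suminf Q + 1" using E sQ by (simp add: add_nonneg_pos)
  have \<delta>: "\<delta> > 0" unfolding \<delta>_def using \<epsilon> EQ by (rule divide_pos_pos)
  have "\<exists>e B. (\<forall>i. (e i = 0 \<or> e i \<ge> H i) \<and> 0 \<le> e i \<and> e i \<le> B) \<and>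
    summable (\<lambda>i. w (e i) * P i) \<and> (\<Sum>i. w (e i) * P i) \<le> \<delta>"
    by (rule choose_shifts[OF P _ _ _ \<delta>]) (auto simp: w_def power_exp_tendsto_0)
  then obtain e Bd where e: "\<And>i. e i = 0 \<or> H i \<le> e i" "\<And>i. 0 \<le> e i" "\<And>i. e i \<le> Bd"
    and sw: "summable (\<lambda>i. w (e i) * P i)" "(\<Sum>i. w (e i) * P i) \<le> \<delta>" by blast
  have Bd: "0 \<le> Bd" using e(2,3)[of 0] by linarith
  define I where "I j = fst (prod_decode j)" for j
  define k where "k j = snd (prod_decode j)" for j
  define co where "co j = c (I j) * D (e (I j)) (k j) / B (e (I j)) (I j) (k j)" for j
  define aa where "aa j = a (I j) (k j)" for j
  define hh where "hh j = e (I j) *\<^sub>R d" for j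
  have nhh: "norm (hh j) = e (I j)" for j using e(2) nd by (simp add: hh_def)
  have sPQ: "(\<lambda>j. P (I j) * Q (k j)) sums (suminf P * suminf Q)"
    unfolding I_def k_def by (rule summable_prod_decode[OF P Q])
  have ex1: "exp (- (e i * s)) \<le> exp (Bd * \<bar>s\<bar>)" for i
  proof -
    have "- (e i * s) \<le> e i * \<bar>s\<bar>" using mult_left_mono[of "- s" "\<bar>s\<bar>" "e i"] e(2)[of i] by simp
    also have "\<dots> \<le> Bd * \<bar>s\<bar>" using e(3) by (intro mult_right_mono) auto
    finally show ?thesis by simp
  qed
  have ex2: "exp (e i * t) \<le> exp (Bd * \<bar>t\<bar>)" for i t
  proof -
    have "e i * t \<le> e i * \<bar>t\<bar>" using e(2)[of i] by (intro mult_left_mono) auto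
    also have "\<dots> \<le> Bd * \<bar>t\<bar>" using e(3) by (intro mult_right_mono) auto
    finally show ?thesis by simp
  qed
  \<comment> \<open>The shifts are bounded by \<open>Bd\<close>, so on each ball the exponential
    factors are bounded uniformly in \<open>j\<close>.\<close>
  have fam: "smooth_family (\<lambda>j x. co j * expo (aa j) (hh j) x)"
  proof (rule smooth_family_expo)
    fix N R'
    obtain F where F: "F \<ge> 0" and Fn: "\<forall>i k e. 0 \<le> e \<longrightarrow> e = 0 \<or> H i \<le> e \<longrightarrow>
      norm (c i * D e k / B e i k) * (1 + norm (a i k) + e) ^ N \<le> F * ((1 + e) ^ (m + N) * exp (- (e * s))) * (P i * Q k)"
      using est[of N] by (elim exE conjE)
    define G where "G = F * ((1 + Bd) ^ (m + N) * exp (Bd * \<bar>s\<bar>)) * exp (Bd * \<bar>R'\<bar>)"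
    show "summable (\<lambda>j. norm (co j) * (norm (aa j) + norm (hh j)) ^ N * exp (norm (hh j) * R'))"
    proof (rule summable_comparison_test'[where N = 0])
      show "summable (\<lambda>j. G * (P (I j) * Q (k j)))" by (rule summable_mult[OF sums_summable[OF sPQ]])
      fix j
      let ?e = "e (I j)"
      have "norm (co j) * (norm (aa j) + norm (hh j)) ^ N \<le> norm (co j) * (1 + norm (aa j) + ?e) ^ N"
        unfolding nhh using e(2) by (intro mult_left_mono power_mono) auto
      also have "\<dots> \<le> F * ((1 + ?e) ^ (m + N) * exp (- (?e * s))) * (P (I j) * Q (k j))"
        unfolding co_def aa_def using Fn e(1,2) by blast
      also have "\<dots> \<le> F * ((1 + Bd) ^ (m + N) * exp (Bd * \<bar>s\<bar>)) * (P (I j) * Q (k j))"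
        using F e(2,3) ex1 P(1) Q(1) Bd by (intro mult_right_mono mult_left_mono mult_mono power_mono mult_nonneg_nonneg) auto
      finally have x1: "norm (co j) * (norm (aa j) + norm (hh j)) ^ N \<le> F * ((1 + Bd) ^ (m + N) * exp (Bd * \<bar>s\<bar>)) * (P (I j) * Q (k j))" .
      have "norm (co j) * (norm (aa j) + norm (hh j)) ^ N * exp (?e * R') \<le>
        F * ((1 + Bd) ^ (m + N) * exp (Bd * \<bar>s\<bar>)) * (P (I j) * Q (k j)) * exp (Bd * \<bar>R'\<bar>)"
        by (rule mult_mono[OF x1 ex2]) (use F P(1) Q(1) Bd in simp_all)
      then show "norm (norm (co j) * (norm (aa j) + norm (hh j)) ^ N * exp (norm (hh j) * R')) \<le> G * (P (I j) * Q (k j))"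
        unfolding nhh G_def using e(2) by (simp add: mult_ac)
    qed
  qed
  define v where "v x = (\<Sum>j. co j * expo (aa j) (hh j) x)" for x
  have vs: "v \<in> smooth_functions" unfolding v_def by (rule smooth_family_sum[OF fam])
  \<comment> \<open>The operator acts termwise and cancels each division by \<open>B\<close>. The
    double series that remains is the product of the expansions of \<open>g\<close> and \<psi>, both
    valid inside the period, and \<psi> is 1 where \<open>g\<close> does not vanish.\<close>
  have val: "sphop l r v x = g x" if x: "x \<in> cube (R + 3)" for x
  proof -
    define f where "f i k = c i * D (e i) k * expo (a i k) (e i *\<^sub>R d) x" for i k
    have xd: "\<bar>x \<bullet> d\<bar> \<le> R + 3" using x d by (auto simp: cube_def)
    have trm: "sphop l r (\<lambda>x. co j * expo (aa j) (hh j) x) x = f (I j) (k j)" for j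
    proof -
      have "sphop l r (\<lambda>x. co j * expo (aa j) (hh j) x) x = co j * (B (e (I j)) (I j) (k j) * expo (aa j) (hh j) x)"
        unfolding sphop_cmult[OF r smooth_expo] sphop_expo[OF r] B_def aa_def hh_def ..
      also have "\<dots> = f (I j) (k j)" using B0[OF e(2,1), of "I j" "k j"] by (simp add: co_def f_def aa_def hh_def)
      finally show ?thesis .
    qed
    have s1: "(\<lambda>j. f (I j) (k j)) sums sphop l r v x"
      using sphop_sums[OF r fam, of l x] unfolding trm v_def[symmetric] .
    have inner: "f i sums (c i * expo (a0 i) 0 x * \<psi> (x \<bullet> d))" for i
    proof -
      have "(\<lambda>j. fl \<psi> (0 + \<mu> *\<^sub>R lat j) (e i) / of_real ((2 * (pi/\<mu>)) ^ DIM(real)) * expo (0 + \<mu> *\<^sub>R lat j) (e i) (x \<bullet> d)) sums \<psi> (x \<bullet> d)"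
      proof (rule fourier_laplace_series[OF \<mu> \<psi>])
        show "t \<in> cube (pi / \<mu>)" if "\<psi> t \<noteq> 0" for t using \<psi>s[OF that] L R by (auto simp: cube_def abs_le_iff)
        show "\<bar>(x \<bullet> d) \<bullet> b\<bar> < pi / \<mu>" if "b \<in> Basis" for b using that xd L by auto
      qed
      from sums_mult[OF this, of "c i * expo (a0 i) 0 x"]
      have "(\<lambda>j. c i * expo (a0 i) 0 x * (D (e i) j * expo (\<mu> *\<^sub>R lat j) (e i) (x \<bullet> d))) sums (c i * expo (a0 i) 0 x * \<psi> (x \<bullet> d))"
        by (simp add: D_def W_def)
      moreover have "c i * expo (a0 i) 0 x * (D (e i) j * expo (\<mu> *\<^sub>R lat j) (e i) (x \<bullet> d)) = f i j" for j
        unfolding f_def a_def expo_inner[symmetric] by (simp only: mult_ac)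
      ultimately show ?thesis by simp
    qed
    have outer: "(\<lambda>i. c i * expo (a0 i) 0 x * \<psi> (x \<bullet> d)) sums g x"
    proof -
      have "(\<lambda>j. fl g (\<mu> *\<^sub>R ?sh + \<mu> *\<^sub>R lat j) 0 / of_real ((2 * (pi/\<mu>)) ^ DIM('a)) * expo (\<mu> *\<^sub>R ?sh + \<mu> *\<^sub>R lat j) 0 x) sums g x"
      proof (rule fourier_laplace_series[OF \<mu> g])
        show "y \<in> cube (pi / \<mu>)" if "g y \<noteq> 0" for y using supp[OF that] L by (force simp: cube_def)
        show "\<bar>x \<bullet> b\<bar> < pi / \<mu>" if "b \<in> Basis" for b using that x L by (force simp: cube_def)
      qed
      then have "(\<lambda>i. c i * expo (a0 i) 0 x) sums g x" by (simp add: c_def V_def a0_def)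
      from sums_mult2[OF this, of "\<psi> (x \<bullet> d)"]
      have "(\<lambda>i. c i * expo (a0 i) 0 x * \<psi> (x \<bullet> d)) sums (g x * \<psi> (x \<bullet> d))" .
      moreover have "g x * \<psi> (x \<bullet> d) = g x"
      proof (cases "g x = 0")
        case False
        then show ?thesis using supp[of x] \<psi>1[of "x \<bullet> d"] xd by simp
      qed simp
      ultimately show ?thesis by simp
    qed
    obtain C1 where C1: "C1 \<ge> 0" "\<forall>i. norm (c i) \<le> C1 / p i ^ (2 * DIM('a))" using cb by blast
    obtain C2 where C2: "C2 \<ge> 0" "\<forall>k e. 0 \<le> e \<longrightarrow> norm (D e k) \<le> C2 * exp (- (e * s)) / q k ^ (2 * DIM(real))" using Db by blast
    define G where "G = C1 * C2 * exp (Bd * \<bar>s\<bar>) * exp (Bd * \<bar>x \<bullet> d\<bar>)"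
    have "(\<lambda>j. f (fst (prod_decode j)) (snd (prod_decode j))) sums g x"
    proof (rule sums_prod_decode[OF _ _ Q _ inner outer])
      show "0 \<le> G * P i" for i using C1 C2 P(1) by (simp add: G_def)
      show "summable (\<lambda>i. G * P i)" by (rule summable_mult[OF P(2)])
      fix i k
      have "norm (D (e i) k) \<le> C2 * exp (- (e i * s)) / q k ^ (2 * DIM(real))" using C2(2) e(2) by blast
      also have "\<dots> = C2 * exp (- (e i * s)) * Q k" by (simp add: Q_def)
      also have "\<dots> \<le> C2 * exp (Bd * \<bar>s\<bar>) * Q k" using C2 Q(1) ex1 by (intro mult_right_mono mult_left_mono)
      finally have 2: "norm (D (e i) k) \<le> C2 * exp (Bd * \<bar>s\<bar>) * Q k" .
      have 1: "norm (c i) \<le> C1 * P i" using C1(2) by (simp add: P_def)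
      have "norm (expo (a i k) (e i *\<^sub>R d) x) = exp (e i * (x \<bullet> d))" by (simp add: norm_expo inner_commute)
      then have 3: "norm (expo (a i k) (e i *\<^sub>R d) x) \<le> exp (Bd * \<bar>x \<bullet> d\<bar>)" using ex2 by simp
      have "norm (f i k) \<le> C1 * P i * (C2 * exp (Bd * \<bar>s\<bar>) * Q k) * exp (Bd * \<bar>x \<bullet> d\<bar>)"
        unfolding f_def norm_mult using 1 2 3 C1 C2 P(1) Q(1) by (intro mult_mono mult_nonneg_nonneg) auto
      then show "norm (f i k) \<le> G * P i * Q k" by (simp add: G_def mult_ac)
    qed
    then have "(\<lambda>j. f (I j) (k j)) sums g x" unfolding I_def k_def .
    with s1 show ?thesis by (rule sums_unique2)
  qed
  have small: "norm (dirds vs v x) \<le> \<epsilon> * prod_list (map norm vs)" if x: "x \<bullet> d \<le> R" and len: "length vs \<le> n" for x vs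
  proof -
    let ?\<Pi> = "prod_list (map norm vs)"
    have \<Pi>: "0 \<le> ?\<Pi>" by (induction vs) auto
    have eq: "dirds vs v x = (\<Sum>j. dirds vs (\<lambda>x. co j * expo (aa j) (hh j) x) x)"
      using dirds_suminf[OF fam, of vs] unfolding v_def by (rule fun_cong)
    have wP: "\<And>i. 0 \<le> w (e i) * P i" using P(1) by (simp add: w_def)
    have sM: "(\<lambda>j. w (e (I j)) * P (I j) * Q (k j)) sums ((\<Sum>i. w (e i) * P i) * suminf Q)"
      using summable_prod_decode[OF wP sw(1) Q] unfolding I_def k_def .
    have bd: "norm (dirds vs (\<lambda>x. co j * expo (aa j) (hh j) x) x) \<le> ?\<Pi> * E * (w (e (I j)) * P (I j) * Q (k j))" for j
    proof -
      let ?e = "e (I j)"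
      have "(norm (aa j) + norm (hh j)) ^ length vs \<le> (1 + norm (aa j) + ?e) ^ length vs"
        unfolding nhh using e(2) by (intro power_mono) auto
      also have "\<dots> \<le> (1 + norm (aa j) + ?e) ^ n" using e(2) len by (intro power_increasing) auto
      finally have pw: "(norm (aa j) + norm (hh j)) ^ length vs \<le> (1 + norm (aa j) + ?e) ^ n" .
      have "hh j \<bullet> x \<le> ?e * R" using x e(2) by (simp add: hh_def inner_commute mult_left_mono)
      then have ee: "exp (hh j \<bullet> x) \<le> exp (?e * R)" by simp
      have "norm (dirds vs (\<lambda>x. co j * expo (aa j) (hh j) x) x) = norm (co j) * norm (dirds vs (expo (aa j) (hh j)) x)"
        by (simp add: dirds_cmult[OF smooth_expo] norm_mult)
      also have "\<dots> \<le> norm (co j) * ((norm (aa j) + norm (hh j)) ^ length vs * ?\<Pi> * exp (hh j \<bullet> x))"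
        by (rule mult_left_mono[OF norm_dirds_expo]) simp
      also have "\<dots> \<le> norm (co j) * ((1 + norm (aa j) + ?e) ^ n * ?\<Pi> * exp (?e * R))"
        using pw ee \<Pi> e(2) by (intro mult_left_mono mult_mono mult_right_mono mult_nonneg_nonneg) auto
      also have "\<dots> = (norm (co j) * (1 + norm (aa j) + ?e) ^ n) * (?\<Pi> * exp (?e * R))" by (simp only: mult_ac)
      also have "\<dots> \<le> (E * ((1 + ?e) ^ (m + n) * exp (- (?e * s))) * (P (I j) * Q (k j))) * (?\<Pi> * exp (?e * R))"
      proof (rule mult_right_mono)
        show "norm (co j) * (1 + norm (aa j) + ?e) ^ n \<le> E * ((1 + ?e) ^ (m + n) * exp (- (?e * s))) * (P (I j) * Q (k j))"
          unfolding co_def aa_def using En e(1,2) by blast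
      qed (simp add: \<Pi>)
      also have "\<dots> = ?\<Pi> * E * (((1 + ?e) ^ (m + n) * (exp (- (?e * s)) * exp (?e * R))) * P (I j) * Q (k j))" by (simp only: mult_ac)
      also have "exp (- (?e * s)) * exp (?e * R) = exp (- (?e / 4))"
        unfolding exp_add[symmetric] by (simp add: s_def algebra_simps)
      also have "(1 + ?e) ^ (m + n) * exp (- (?e / 4)) = w ?e" using e(2)[of "I j"] by (simp add: w_def)
      finally show ?thesis .
    qed
    have sb: "summable (\<lambda>j. ?\<Pi> * E * (w (e (I j)) * P (I j) * Q (k j)))" by (rule summable_mult[OF sums_summable[OF sM]])
    have "norm (dirds vs v x) \<le> (\<Sum>j. ?\<Pi> * E * (w (e (I j)) * P (I j) * Q (k j)))"
      unfolding eq by (rule norm_suminf_le[OF bd sb])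
    also have "\<dots> = ?\<Pi> * E * ((\<Sum>i. w (e i) * P i) * suminf Q)"
      using sums_mult[OF sM, of "?\<Pi> * E"] by (simp add: sums_iff)
    also have "\<dots> \<le> ?\<Pi> * E * (\<delta> * suminf Q)" using sw(2) sQ E \<Pi> by (intro mult_left_mono mult_right_mono) auto
    also have "\<dots> = ?\<Pi> * (\<delta> * (E * suminf Q))" by (simp only: mult_ac)
    also have "\<dots> \<le> ?\<Pi> * (\<delta> * (E * suminf Q + 1))" using \<delta> \<Pi> by (intro mult_left_mono) auto
    also have "\<dots> = ?\<Pi> * \<epsilon>" unfolding \<delta>_def using EQ by simp
    finally show ?thesis by (simp only: mult.commute)
  qed
  show ?thesis using vs val small by blast
qed

section \<open>Surjectivity\<close>

lemma prod_list_norm_nonneg: "0 \<le> prod_list (map norm vs)"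
  by (induction vs) auto

lemma dirds_zero: "dirds vs (\<lambda>_. 0) = (\<lambda>_. 0)"
  using dirds_cmult[of "\<lambda>_. 0" vs 0] by (simp add: smooth_const)

text \<open>One direction is split off at a time: \<theta> cuts out the part of \<open>f\<close> in
  \<open>x \<bullet> d \<ge> R + 1/2\<close>, which \<open>directional_step\<close> solves, and the
  rest vanishes where \<open>x \<bullet> d \<ge> R + 1\<close>, so it is supported over the other
  directions. Each half gets \<epsilon>/2.\<close>

lemma halfspace_union_step:
  fixes f :: "'a::euclidean_space \<Rightarrow> complex"
  assumes r: "r > 0" and R: "- 2 \<le> R" and "finite S" "S \<subseteq> Basis \<union> uminus ` Basis"
    and "f \<in> smooth_functions" and "\<epsilon> > 0"
    and "\<And>x. f x \<noteq> 0 \<Longrightarrow> x \<in> cube (R + 3) \<and> (\<exists>d\<in>S. R + 1 < x \<bullet> d)"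
  shows "\<exists>v\<in>smooth_functions. (\<forall>x\<in>cube (R + 3). sphop l r v x = f x) \<and>
    (\<forall>x vs. (\<forall>d\<in>S. x \<bullet> d \<le> R) \<longrightarrow> length vs \<le> n \<longrightarrow> norm (dirds vs v x) \<le> \<epsilon> * prod_list (map norm vs))"
  using assms(3-)
proof (induction S arbitrary: f \<epsilon> rule: finite_induct)
  case empty
  then have f0: "f = (\<lambda>_. 0)" by auto
  show ?case
    by (rule bexI[of _ "\<lambda>_. 0"])
       (use \<open>\<epsilon> > 0\<close> in \<open>simp_all add: f0 sphop_zero[OF r] dirds_zero smooth_const prod_list_norm_nonneg\<close>)
next
  case (insert d S)
  have d: "d \<in> Basis \<union> uminus ` Basis" and S: "S \<subseteq> Basis \<union> uminus ` Basis" using insert.prems(1) by auto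
  note f = \<open>f \<in> smooth_functions\<close>
  have lt: "R + 1/2 < R + 1" by simp
  obtain \<theta> :: "real \<Rightarrow> complex" where \<theta>: "\<theta> \<in> smooth_functions"
    and \<theta>0: "\<And>t. t \<le> R + 1/2 \<Longrightarrow> \<theta> t = 0" and \<theta>1: "\<And>t. t \<ge> R + 1 \<Longrightarrow> \<theta> t = 1"
    by (rule smooth_step[OF lt]) (rule that)
  define g where "g x = f x * \<theta> (x \<bullet> d)" for x
  define h where "h x = f x - g x" for x
  have g: "g \<in> smooth_functions" unfolding g_def by (rule smooth_mult[OF f smooth_inner[OF \<theta>]])
  have h: "h \<in> smooth_functions" unfolding h_def by (rule smooth_diff[OF f g])
  have e2: "\<epsilon> / 2 > 0" using insert.prems by simp
  have gs: "x \<in> cube (R + 3) \<and> R + 1/2 \<le> x \<bullet> d" if "g x \<noteq> 0" for x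
    using that insert.prems(4)[of x] \<theta>0[of "x \<bullet> d"] unfolding g_def by force
  have hs: "x \<in> cube (R + 3) \<and> (\<exists>d\<in>S. R + 1 < x \<bullet> d)" if "h x \<noteq> 0" for x
  proof -
    have "f x \<noteq> 0" "\<theta> (x \<bullet> d) \<noteq> 1" using that by (auto simp: h_def g_def)
    then show ?thesis using insert.prems(4)[of x] \<theta>1[of "x \<bullet> d"] by force
  qed
  have "\<exists>v\<in>smooth_functions. (\<forall>x\<in>cube (R + 3). sphop l r v x = g x) \<and>
    (\<forall>x vs. x \<bullet> d \<le> R \<longrightarrow> length vs \<le> n \<longrightarrow> norm (dirds vs v x) \<le> \<epsilon> / 2 * prod_list (map norm vs))"
    by (rule directional_step[OF r R d g gs e2])
  then obtain v1 where v1: "v1 \<in> smooth_functions" "\<forall>x\<in>cube (R + 3). sphop l r v1 x = g x"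
      "\<forall>x vs. x \<bullet> d \<le> R \<longrightarrow> length vs \<le> n \<longrightarrow> norm (dirds vs v1 x) \<le> \<epsilon> / 2 * prod_list (map norm vs)"
    by (elim bexE conjE)
  have "\<exists>v\<in>smooth_functions. (\<forall>x\<in>cube (R + 3). sphop l r v x = h x) \<and>
    (\<forall>x vs. (\<forall>d\<in>S. x \<bullet> d \<le> R) \<longrightarrow> length vs \<le> n \<longrightarrow> norm (dirds vs v x) \<le> \<epsilon> / 2 * prod_list (map norm vs))"
    by (rule insert.IH[OF S h e2 hs])
  then obtain v2 where v2: "v2 \<in> smooth_functions" "\<forall>x\<in>cube (R + 3). sphop l r v2 x = h x"
      "\<forall>x vs. (\<forall>d\<in>S. x \<bullet> d \<le> R) \<longrightarrow> length vs \<le> n \<longrightarrow> norm (dirds vs v2 x) \<le> \<epsilon> / 2 * prod_list (map norm vs)"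
    by (elim bexE conjE)
  show ?case
  proof (rule bexI[of _ "\<lambda>x. v1 x + v2 x"], intro conjI ballI allI impI)
    show "(\<lambda>x. v1 x + v2 x) \<in> smooth_functions" by (rule smooth_add[OF v1(1) v2(1)])
    show "sphop l r (\<lambda>x. v1 x + v2 x) x = f x" if "x \<in> cube (R + 3)" for x
      using v1(2) v2(2) that by (simp add: sphop_add[OF r v1(1) v2(1)] h_def)
    show "norm (dirds vs (\<lambda>x. v1 x + v2 x) x) \<le> \<epsilon> * prod_list (map norm vs)"
      if "\<forall>d\<in>insert d S. x \<bullet> d \<le> R" "length vs \<le> n" for x vs
    proof -
      have 1: "norm (dirds vs v1 x) \<le> \<epsilon> / 2 * prod_list (map norm vs)" using v1(3) that by blast
      have 2: "norm (dirds vs v2 x) \<le> \<epsilon> / 2 * prod_list (map norm vs)" using v2(3) that by blast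
      have "norm (dirds vs (\<lambda>x. v1 x + v2 x) x) \<le> norm (dirds vs v1 x) + norm (dirds vs v2 x)"
        unfolding dirds_add[OF v1(1) v2(1)] by (rule norm_triangle_ineq)
      then show ?thesis using 1 2 by simp
    qed
  qed
qed

text \<open>The complement of \<open>cube (R + 1)\<close> is a union of half spaces for the signed
  coordinate directions. The cutoff equals 1 on \<open>cube (R + 2)\<close> and is supported in
  \<open>cube (R + 3)\<close>; it makes the datum compactly supported without changing the equation
  on the cube of interest.\<close>

lemma cube_step:
  fixes f :: "'a::euclidean_space \<Rightarrow> complex"
  assumes r: "r > 0" and R: "- 2 \<le> R" and f: "f \<in> smooth_functions" and \<epsilon>: "\<epsilon> > 0"
    and f0: "\<And>x. x \<in> cube (R + 1) \<Longrightarrow> f x = 0"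
  shows "\<exists>v\<in>smooth_functions. (\<forall>x\<in>cube (R + 2). sphop l r v x = f x) \<and>
    (\<forall>x vs. x \<in> cube R \<longrightarrow> length vs \<le> n \<longrightarrow> norm (dirds vs v x) \<le> \<epsilon> * prod_list (map norm vs))"
proof -
  have lt: "- (R + 3) < - (R + 2)" "R + 2 < R + 3" by simp_all
  obtain \<psi> :: "real \<Rightarrow> complex" where \<psi>: "\<psi> \<in> smooth_functions"
    and \<psi>0: "\<And>t. t \<le> - (R + 3) \<or> t \<ge> R + 3 \<Longrightarrow> \<psi> t = 0" and \<psi>1: "\<And>t. - (R + 2) \<le> t \<Longrightarrow> t \<le> R + 2 \<Longrightarrow> \<psi> t = 1"
    by (rule smooth_bump[OF lt]) (rule that)
  define cut where "cut x = (\<Prod>b\<in>Basis. \<psi> (x \<bullet> b))" for x :: 'a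
  have cut: "cut \<in> smooth_functions" unfolding cut_def by (intro smooth_prod smooth_inner \<psi>)
  define g where "g x = f x * cut x" for x
  have g: "g \<in> smooth_functions" unfolding g_def by (rule smooth_mult[OF f cut])
  let ?S = "Basis \<union> uminus ` Basis :: 'a set"
  have gs: "x \<in> cube (R + 3) \<and> (\<exists>d\<in>?S. R + 1 < x \<bullet> d)" if "g x \<noteq> 0" for x
  proof
    have "cut x \<noteq> 0" "f x \<noteq> 0" using that by (auto simp: g_def)
    then have nz: "\<psi> (x \<bullet> b) \<noteq> 0" if "b \<in> Basis" for b using that by (auto simp: cut_def)
    show "x \<in> cube (R + 3)" unfolding cube_def
    proof (intro CollectI ballI)
      fix b :: 'a assume "b \<in> Basis"
      then have "\<not> (x \<bullet> b \<le> - (R + 3) \<or> x \<bullet> b \<ge> R + 3)" using nz[of b] \<psi>0[of "x \<bullet> b"] by blast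
      then show "\<bar>x \<bullet> b\<bar> \<le> R + 3" by linarith
    qed
    have "x \<notin> cube (R + 1)" using f0[of x] \<open>f x \<noteq> 0\<close> by blast
    then obtain b where b: "b \<in> Basis" "R + 1 < \<bar>x \<bullet> b\<bar>" by (auto simp: cube_def not_le)
    then have "R + 1 < x \<bullet> b \<or> R + 1 < x \<bullet> (- b)" by (auto simp: abs_if split: if_splits)
    then show "\<exists>d\<in>?S. R + 1 < x \<bullet> d" using b by blast
  qed
  have fS: "finite ?S" by simp
  have "\<exists>v\<in>smooth_functions. (\<forall>x\<in>cube (R + 3). sphop l r v x = g x) \<and>
    (\<forall>x vs. (\<forall>d\<in>?S. x \<bullet> d \<le> R) \<longrightarrow> length vs \<le> n \<longrightarrow> norm (dirds vs v x) \<le> \<epsilon> * prod_list (map norm vs))"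
    by (rule halfspace_union_step[OF r R fS order_refl g \<epsilon> gs])
  then obtain v where v: "v \<in> smooth_functions" "\<forall>x\<in>cube (R + 3). sphop l r v x = g x"
      "\<forall>x vs. (\<forall>d\<in>?S. x \<bullet> d \<le> R) \<longrightarrow> length vs \<le> n \<longrightarrow> norm (dirds vs v x) \<le> \<epsilon> * prod_list (map norm vs)"
    by (elim bexE conjE)
  show ?thesis
  proof (rule bexI[OF _ v(1)], intro conjI ballI allI impI)
    fix x :: 'a assume x: "x \<in> cube (R + 2)"
    then have "\<psi> (x \<bullet> b) = 1" if "b \<in> Basis" for b
      using that \<psi>1[of "x \<bullet> b"] by (fastforce simp: cube_def abs_le_iff)
    then have "g x = f x" by (simp add: g_def cut_def)
    moreover have "x \<in> cube (R + 3)" using x by (force simp: cube_def)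
    ultimately show "sphop l r v x = f x" using v(2) by simp
  next
    fix x :: 'a and vs :: "'a list" assume x: "x \<in> cube R" and len: "length vs \<le> n"
    have "x \<bullet> b \<le> R" "- R \<le> x \<bullet> b" if "b \<in> Basis" for b
      using x that by (auto simp: cube_def abs_le_iff dest!: bspec[OF _ that])
    then have "\<forall>d\<in>?S. x \<bullet> d \<le> R" by force
    then show "norm (dirds vs v x) \<le> \<epsilon> * prod_list (map norm vs)" using v(3) len by blast
  qed
qed

text \<open>The approximations solve the equation on growing cubes, and each correction solves for
  the current error, which vanishes on the previous cube. By \<open>cube_step\<close> it can be
  taken small in \<open>j\<close> derivatives on a slightly smaller cube, so the corrections form a
  \<open>smooth_family\<close>.\<close>

lemma sphop_surj:
  fixes u :: "'a::euclidean_space \<Rightarrow> complex"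
  assumes r: "r > 0" and u: "u \<in> smooth_functions"
  shows "\<exists>v\<in>smooth_functions. sphop l r v = u"
proof -
  have diff: "sphop l r (\<lambda>x. w x - w' x) x = sphop l r w x - sphop l r w' x"
    if "w \<in> smooth_functions" "w' \<in> smooth_functions" for w w' :: "'a \<Rightarrow> complex" and x
    using sphop_add[OF r smooth_diff[OF that] that(2), of l x] by simp
  \<comment> \<open>The cube of half-side -1 is empty, so the construction starts from any smooth
    function. The next correction is controlled on \<open>cube (real j - 2)\<close>, which explains
    the hypothesis \<open>- 2 \<le> R\<close> above.\<close>
  define ok where "ok j W \<longleftrightarrow> W \<in> smooth_functions \<and> (\<forall>x\<in>cube (real j - 1). sphop l r W x = u x)" for j and W :: "'a \<Rightarrow> complex"
  define close where "close j W W' \<longleftrightarrow> (\<forall>x vs. x \<in> cube (real j - 2) \<longrightarrow> length vs \<le> j \<longrightarrow>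
    norm (dirds vs (\<lambda>x. W' x - W x) x) \<le> (1/2) ^ j * prod_list (map norm vs))" for j and W W' :: "'a \<Rightarrow> complex"
  have "\<exists>V. \<forall>j. ok j (V j) \<and> close j (V j) (V (Suc j))"
  proof (rule dependent_nat_choice)
    have "x \<notin> cube (- 1)" for x :: 'a
    proof
      obtain b :: 'a where b: "b \<in> Basis" using nonempty_Basis by blast
      assume "x \<in> cube (- 1)"
      then have "\<bar>x \<bullet> b\<bar> \<le> - 1" using b by (simp add: cube_def)
      then show False by simp
    qed
    then show "\<exists>W. ok 0 W" by (intro exI[of _ "\<lambda>_. 0"]) (auto simp: ok_def smooth_const)
  next
    fix W j assume W: "ok j W"
    let ?f = "\<lambda>x. u x - sphop l r W x"
    have Ws: "W \<in> smooth_functions" using W by (simp add: ok_def)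
    have f: "?f \<in> smooth_functions" by (intro smooth_diff u sphop_smooth r Ws)
    have f0: "?f x = 0" if "x \<in> cube ((real j - 2) + 1)" for x using W that by (simp add: ok_def)
    have j: "- 2 \<le> real j - 2" and e: "(0::real) < (1/2) ^ j" by simp_all
    have "\<exists>v\<in>smooth_functions. (\<forall>x\<in>cube (real j - 2 + 2). sphop l r v x = ?f x) \<and>
      (\<forall>x vs. x \<in> cube (real j - 2) \<longrightarrow> length vs \<le> j \<longrightarrow> norm (dirds vs v x) \<le> (1/2) ^ j * prod_list (map norm vs))"
      by (rule cube_step[OF r j f e f0])
    then obtain v where v: "v \<in> smooth_functions" "\<forall>x\<in>cube (real j - 2 + 2). sphop l r v x = ?f x"
      "\<forall>x vs. x \<in> cube (real j - 2) \<longrightarrow> length vs \<le> j \<longrightarrow> norm (dirds vs v x) \<le> (1/2) ^ j * prod_list (map norm vs)"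
      by (elim bexE conjE)
    show "\<exists>W'. ok (Suc j) W' \<and> close j W W'"
    proof (rule exI[of _ "\<lambda>x. W x + v x"], intro conjI)
      show "ok (Suc j) (\<lambda>x. W x + v x)"
        using v(2) by (simp add: ok_def smooth_add Ws v(1) sphop_add[OF r Ws v(1)])
      show "close j W (\<lambda>x. W x + v x)" using v(3) by (simp add: close_def)
    qed
  qed
  then obtain V where V: "\<And>j. ok j (V j)" "\<And>j. close j (V j) (V (Suc j))" by blast
  have Vs: "V j \<in> smooth_functions" for j using V(1) by (simp add: ok_def)
  define v where "v j x = V (Suc j) x - V j x" for j x
  have vj: "v j \<in> smooth_functions" for j unfolding v_def by (rule smooth_diff[OF Vs Vs])
  have fam: "smooth_family v"
    unfolding smooth_family_def
  proof (intro conjI allI vj)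
    fix vs :: "'a list" and R :: real
    let ?\<Pi> = "prod_list (map norm vs)"
    have "\<forall>j. \<exists>B. \<forall>x. norm x \<le> R \<longrightarrow> norm (dirds vs (v j) x) \<le> B"
    proof
      fix j
      obtain B where "B \<ge> 0" "\<And>x. norm x \<le> R \<Longrightarrow> norm (dirds vs (v j) x) \<le> B"
        by (rule smooth_bounds[OF smooth_dirds[OF vj], of R vs j]) (rule that)
      then show "\<exists>B. \<forall>x. norm x \<le> R \<longrightarrow> norm (dirds vs (v j) x) \<le> B" by blast
    qed
    then obtain B where B: "\<forall>j x. norm x \<le> R \<longrightarrow> norm (dirds vs (v j) x) \<le> B j" by metis
    \<comment> \<open>From index \<open>J\<close> on, the list is short enough and the ball of
      radius \<open>R\<close> lies in the cube of control; the finitely many earlier terms are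
      bounded by compactness.\<close>
    define J where "J = max (length vs) (nat \<lceil>R + 2\<rceil>)"
    define M where "M j = (if j < J then B j else (1/2) ^ j * ?\<Pi>)" for j
    show "\<exists>M. summable M \<and> (\<forall>j x. norm x \<le> R \<longrightarrow> norm (dirds vs (v j) x) \<le> M j)"
    proof (rule exI[of _ M], intro conjI allI impI)
      have "summable (\<lambda>j. (1/2::real) ^ j * ?\<Pi>)" by (intro summable_mult2 summable_geometric) simp
      moreover have "\<forall>\<^sub>F j in sequentially. (1/2) ^ j * ?\<Pi> = M j"
        unfolding eventually_sequentially by (rule exI[of _ J]) (simp add: M_def)
      ultimately show "summable M" by (rule summable_cong[THEN iffD1, rotated])
      fix j and x :: 'a assume x: "norm x \<le> R"
      show "norm (dirds vs (v j) x) \<le> M j"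
      proof (cases "j < J")
        case True
        then show ?thesis using B x by (simp add: M_def)
      next
        case False
        then have len: "length vs \<le> j" and "R + 2 \<le> real j" unfolding J_def by linarith+
        then have "x \<in> cube (real j - 2)" using x Basis_le_norm[of _ x] by (force simp: cube_def)
        then have "norm (dirds vs (v j) x) \<le> (1/2) ^ j * ?\<Pi>"
          using V(2)[of j] len unfolding close_def v_def by blast
        then show ?thesis using False by (simp add: M_def)
      qed
    qed
  qed
  define w where "w x = (\<Sum>j. v j x)" for x
  have ws: "w \<in> smooth_functions" unfolding w_def by (rule smooth_family_sum[OF fam])
  have "sphop l r (\<lambda>x. w x + V 0 x) x = u x" for x
  proof -
    have s: "(\<lambda>j. sphop l r (v j) x) sums sphop l r w x" unfolding w_def by (rule sphop_sums[OF r fam])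
    have "sphop l r (v j) x = sphop l r (V (Suc j)) x - sphop l r (V j) x" for j
      unfolding v_def by (rule diff[OF Vs Vs])
    then have ps: "(\<Sum>j<n. sphop l r (v j) x) = sphop l r (V n) x - sphop l r (V 0) x" for n
      using sum_lessThan_telescope[of "\<lambda>j. sphop l r (V j) x" n] by simp
    \<comment> \<open>The partial sums telescope, and at a fixed point the equation holds exactly
      from some index on.\<close>
    have "\<forall>\<^sub>F n in sequentially. (\<Sum>j<n. sphop l r (v j) x) = u x - sphop l r (V 0) x"
      unfolding eventually_sequentially
    proof (rule exI[of _ "nat \<lceil>norm x + 1\<rceil>"], intro allI impI)
      fix n assume "nat \<lceil>norm x + 1\<rceil> \<le> n"
      then have "norm x \<le> real n - 1" by linarith
      then have "x \<in> cube (real n - 1)" using Basis_le_norm[of _ x] by (force simp: cube_def)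
      then have "sphop l r (V n) x = u x" using V(1)[of n] by (simp add: ok_def)
      then show "(\<Sum>j<n. sphop l r (v j) x) = u x - sphop l r (V 0) x" using ps by simp
    qed
    then have "(\<lambda>j. sphop l r (v j) x) sums (u x - sphop l r (V 0) x)"
      unfolding sums_def by (rule tendsto_eventually)
    with s have "sphop l r w x = u x - sphop l r (V 0) x" by (rule sums_unique2)
    then show ?thesis by (simp add: sphop_add[OF r ws Vs])
  qed
  then have "sphop l r (\<lambda>x. w x + V 0 x) = u" by (rule ext)
  then show ?thesis using smooth_add[OF ws Vs] by blast
qed

theorem theorem14:
  fixes r :: real and l :: nat
  assumes "r > 0"
  shows "convolve (sphere_distribution_deriv l r) ` smooth_functions
           = (smooth_functions :: (real ^ 'n \<Rightarrow> complex) set)"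
proof
  show "convolve (sphere_distribution_deriv l r) ` smooth_functions \<subseteq> (smooth_functions :: (real ^ 'n \<Rightarrow> complex) set)"
    using sphop_smooth[OF assms, where l = l] unfolding sphop_def by blast
  show "smooth_functions \<subseteq> convolve (sphere_distribution_deriv l r) ` (smooth_functions :: (real ^ 'n \<Rightarrow> complex) set)"
  proof
    fix u :: "real ^ 'n \<Rightarrow> complex" assume "u \<in> smooth_functions"
    from sphop_surj[OF assms this, of l] show "u \<in> convolve (sphere_distribution_deriv l r) ` smooth_functions"
      unfolding sphop_def by blast
  qed
qed

end
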